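(* Let $q=2^n$ with $n\ge 2$ and $G=\mathrm{SL}_2(q)$. Then: $\mathrm{d}_{\pm}(\psi)=(q+1)(\mathbb{Q}^\times)^2$; for $1\le i\le\frac{q-2}{2}$ and $n$ odd, $\mathfrak{c}(\chi_i)=1\in\mathrm{Br}(\mathbb{Q}(\chi_i))$; for $1\le j\le \frac q2$, $\mathfrak{c}(\theta_j)=(-1,-1)\in\mathrm{Br}(\mathbb{Q}(\sqrt5))$ if $q=4$ and $\mathfrak{c}(\theta_j)=1\in\mathrm{Br}(\mathbb{Q}(\theta_j))$ if $q\ge 8$.
   Context: Characters of $\mathrm{SL}_2(2^n)$: let $\nu$ generate $\mathbb{F}_q^\times$, $c=\begin{pmatrix}1&0\\1&1\end{pmatrix}$, $a=\mathrm{diag}(\nu,\nu^{-1})$, $b$ an element of order $q+1$; $\zeta_r=e^{2\pi i/r}$. The irreducible characters, with values on $1,c,a^\ell,b^m$ ($1\le\ell\le\frac{q-2}2$, $1\le m\le \frac q2$), are $\mathbf 1$; $\psi$: $q,0,1,-1$; $\chi_i$ ($1\le i\le \frac{q-2}2$): $q+1,1,\zeta_{q-1}^{i\ell}+\zeta_{q-1}^{-i\ell},0$; $\theta_j$ ($1\le j\le\frac q2$): $q-1,-1,0,-\zeta_{q+1}^{jm}-\zeta_{q+1}^{-jm}$. All have totally real character field and Schur index 1, so for each such $\chi$ with $K=\mathbb{Q}(\chi)$ there is an absolutely irreducible $KG$-module $W$ affording $\chi$, whose nonzero $G$-invariant symmetric bilinear forms $F$ are unique up to scalars. Invariants: for $F$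 non-degenerate symmetric on an $m$-dimensional $K$-space $W$, $\mathrm{d}_{\pm}(W,F)=(-1)^{m(m-1)/2}\det(\text{Gram matrix})\in K^\times/(K^\times)^2$; the Clifford algebra $\mathcal{C}(W,F)$ is the tensor algebra modulo $w\otimes w-\frac12F(w,w)$; for $m$ odd $\mathfrak{c}(W,F)\in \mathrm{Br}(K)$ is the Brauer class of its even part $\mathcal{C}_0(W,F)$. Then $\mathrm{d}_{\pm}(\chi):=\mathrm{d}_{\pm}(W,F)$ when $\chi(1)$ is even and $\mathfrak{c}(\chi):=\mathfrak{c}(W,F)$ when $\chi(1)$ is odd (independent of $F$). $(a,b)$ denotes the Brauer class of the quaternion algebra $\langle i,j\mid i^2=a,j^2=b,ij=-ji\rangle$. *)

theory Defs
  imports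
    "HOL-Library.Cardinality"
    "HOL-Algebra.Generated_Fields"
    "HOL-Algebra.Algebraic_Closure_Type"
    "Jordan_Normal_Form.Determinant"
begin

section \<open>Subfields of the complex numbers\<close>

definition rat_adjoin :: "complex set \<Rightarrow> complex set" where
  "rat_adjoin S = generate_field ring_of_type_algebra S"

definition subfield_ring :: "complex set \<Rightarrow> complex ring" where
  "subfield_ring K = ring_of_type_algebra\<lparr>carrier := K\<rparr>"

definition square_class :: "complex set \<Rightarrow> complex \<Rightarrow> complex set" where
  "square_class K d = {d * y\<^sup>2 | y. y \<in> K \<and> y \<noteq> 0}"

definition zeta :: "nat \<Rightarrow> complex" where
  "zeta r = exp (2 * of_real pi * \<i> / of_nat r)"


section \<open>The group and its characters\<close>

definition SL2 :: "'f::field mat monoid" where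
  "SL2 = \<lparr>carrier = {g \<in> carrier_mat 2 2. det g = 1}, monoid.mult = (*), one = 1\<^sub>m 2\<rparr>"

definition SL2_c :: "'f::field mat" where
  "SL2_c = mat_of_rows_list 2 [[1, 0], [1, 1]]"

definition SL2_a :: "'f::field \<Rightarrow> 'f mat" where
  "SL2_a \<nu> = mat_of_rows_list 2 [[\<nu>, 0], [0, inverse \<nu>]]"

definition generates_units :: "'f::field \<Rightarrow> bool" where
  "generates_units \<nu> \<longleftrightarrow> \<nu> \<noteq> 0 \<and> (\<forall>x. x \<noteq> 0 \<longrightarrow> (\<exists>k::nat. x = \<nu> ^ k))"

text \<open>The elements \<open>1\<close>, \<open>c\<close>, \<open>a\<^sup>l\<close>, \<open>b\<^sup>m\<close> below represent all conjugacy classes,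
  so a class function is determined on the group by these values.\<close>

definition class_function_with_values ::
  "'f::{field,finite} \<Rightarrow> 'f mat \<Rightarrow> ('f mat \<Rightarrow> complex) \<Rightarrow>
     complex \<Rightarrow> complex \<Rightarrow> (nat \<Rightarrow> complex) \<Rightarrow> (nat \<Rightarrow> complex) \<Rightarrow> bool" where
  "class_function_with_values \<nu> b \<chi> v1 vc va vb \<longleftrightarrow>
     (\<forall>g\<in>carrier SL2. \<forall>h\<in>carrier SL2.
        \<chi> (h \<otimes>\<^bsub>SL2\<^esub> g \<otimes>\<^bsub>SL2\<^esub> inv\<^bsub>SL2\<^esub> h) = \<chi> g) \<and>
     \<chi> \<one>\<^bsub>SL2\<^esub> = v1 \<and>
     \<chi> SL2_c = vc \<and>
     (\<forall>l\<in>{1..(CARD('f) - 2) div 2}. \<chi> (SL2_a \<nu> [^]\<^bsub>SL2\<^esub> l) = va l) \<and>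
     (\<forall>m\<in>{1..CARD('f) div 2}. \<chi> (b [^]\<^bsub>SL2\<^esub> m) = vb m)"

definition is_psi :: "'f::{field,finite} \<Rightarrow> 'f mat \<Rightarrow> ('f mat \<Rightarrow> complex) \<Rightarrow> bool" where
  "is_psi \<nu> b \<chi> \<longleftrightarrow>
     class_function_with_values \<nu> b \<chi> (of_nat CARD('f)) 0 (\<lambda>l. 1) (\<lambda>m. - 1)"

definition is_chi :: "'f::{field,finite} \<Rightarrow> 'f mat \<Rightarrow> nat \<Rightarrow> ('f mat \<Rightarrow> complex) \<Rightarrow> bool" where
  "is_chi \<nu> b i \<chi> \<longleftrightarrow>
     class_function_with_values \<nu> b \<chi> (of_nat CARD('f) + 1) 1
       (\<lambda>l. zeta (CARD('f) - 1) powi (int (i * l)) + zeta (CARD('f) - 1) powi (- int (i * l)))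
       (\<lambda>m. 0)"

definition is_theta :: "'f::{field,finite} \<Rightarrow> 'f mat \<Rightarrow> nat \<Rightarrow> ('f mat \<Rightarrow> complex) \<Rightarrow> bool" where
  "is_theta \<nu> b j \<chi> \<longleftrightarrow>
     class_function_with_values \<nu> b \<chi> (of_nat CARD('f) - 1) (- 1)
       (\<lambda>l. 0)
       (\<lambda>m. - (zeta (CARD('f) + 1) powi (int (j * m))) - zeta (CARD('f) + 1) powi (- int (j * m)))"

definition char_field :: "('f::field mat \<Rightarrow> complex) \<Rightarrow> complex set" where
  "char_field \<chi> = rat_adjoin (\<chi> ` carrier SL2)"


section \<open>Orthogonal representations\<close>

text \<open>The \<open>m\<close>-dimensional \<open>KG\<close>-module is taken with a basis, as \<open>K\<^sup>m\<close> with a matrix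
  representation \<open>\<rho>\<close>; a bilinear form is given by its Gram matrix.\<close>

definition matrix_rep :: "complex set \<Rightarrow> nat \<Rightarrow> ('f::field mat \<Rightarrow> complex mat) \<Rightarrow> bool" where
  "matrix_rep K m \<rho> \<longleftrightarrow>
     (\<forall>g\<in>carrier SL2. \<rho> g \<in> carrier_mat m m \<and> elements_mat (\<rho> g) \<subseteq> K) \<and>
     \<rho> \<one>\<^bsub>SL2\<^esub> = 1\<^sub>m m \<and>
     (\<forall>g\<in>carrier SL2. \<forall>h\<in>carrier SL2. \<rho> (g \<otimes>\<^bsub>SL2\<^esub> h) = \<rho> g * \<rho> h)"

text \<open>For a subfield \<open>K\<close> of the algebraically closed field of complex numbers, absolute
  irreducibility means irreducibility of the scalar extension to the complex numbers.\<close>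

definition absolutely_irreducible :: "nat \<Rightarrow> ('f::field mat \<Rightarrow> complex mat) \<Rightarrow> bool" where
  "absolutely_irreducible m \<rho> \<longleftrightarrow> m > 0 \<and>
     (\<forall>U \<subseteq> carrier_vec m.
        0\<^sub>v m \<in> U \<and> (\<forall>u\<in>U. \<forall>v\<in>U. u + v \<in> U) \<and> (\<forall>z. \<forall>u\<in>U. z \<cdot>\<^sub>v u \<in> U) \<and>
        (\<forall>g\<in>carrier SL2. \<forall>u\<in>U. \<rho> g *\<^sub>v u \<in> U)
        \<longrightarrow> U = {0\<^sub>v m} \<or> U = carrier_vec m)"

definition affords :: "('f::field mat \<Rightarrow> complex mat) \<Rightarrow> ('f mat \<Rightarrow> complex) \<Rightarrow> bool" where
  "affords \<rho> \<chi> \<longleftrightarrow> (\<forall>g\<in>carrier SL2. sum_list (diag_mat (\<rho> g)) = \<chi> g)"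

definition invariant_symmetric_form ::
  "complex set \<Rightarrow> nat \<Rightarrow> ('f::field mat \<Rightarrow> complex mat) \<Rightarrow> complex mat \<Rightarrow> bool" where
  "invariant_symmetric_form K m \<rho> F \<longleftrightarrow>
     F \<in> carrier_mat m m \<and> elements_mat F \<subseteq> K \<and> F\<^sup>T = F \<and>
     (\<forall>g\<in>carrier SL2. (\<rho> g)\<^sup>T * F * \<rho> g = F)"

definition orthogonal_module_of ::
  "('f::field mat \<Rightarrow> complex) \<Rightarrow> nat \<Rightarrow> ('f mat \<Rightarrow> complex mat) \<Rightarrow> complex mat \<Rightarrow> bool" where
  "orthogonal_module_of \<chi> m \<rho> F \<longleftrightarrow>
     matrix_rep (char_field \<chi>) m \<rho> \<and> absolutely_irreducible m \<rho> \<and> affords \<rho> \<chi> \<and>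
     invariant_symmetric_form (char_field \<chi>) m \<rho> F \<and> F \<noteq> 0\<^sub>m m m"

definition disc_pm :: "complex set \<Rightarrow> nat \<Rightarrow> complex mat \<Rightarrow> complex set" where
  "disc_pm K m F = square_class K ((- 1) ^ (m * (m - 1) div 2) * det F)"


section \<open>Associative algebras and Brauer equivalence\<close>

text \<open>An associative unital algebra over \<open>R\<close> is represented by a \<open>module\<close> record. The library
  locale \<open>algebra\<close> is not applicable, since it requires commutativity.\<close>

definition assoc_algebra :: "'a ring \<Rightarrow> ('a, 'b) module \<Rightarrow> bool" where
  "assoc_algebra R A \<longleftrightarrow> module R A \<and> ring A \<and>
     (\<forall>c\<in>carrier R. \<forall>x\<in>carrier A. \<forall>y\<in>carrier A.
        (c \<odot>\<^bsub>A\<^esub> x) \<otimes>\<^bsub>A\<^esub> y = c \<odot>\<^bsub>A\<^esub> (x \<otimes>\<^bsub>A\<^esub> y) \<and>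
        x \<otimes>\<^bsub>A\<^esub> (c \<odot>\<^bsub>A\<^esub> y) = c \<odot>\<^bsub>A\<^esub> (x \<otimes>\<^bsub>A\<^esub> y))"

definition finite_dimensional :: "'a ring \<Rightarrow> ('a, 'b) module \<Rightarrow> bool" where
  "finite_dimensional R A \<longleftrightarrow>
     (\<exists>S \<subseteq> carrier A. finite S \<and>
        (\<forall>x\<in>carrier A. \<exists>f \<in> S \<rightarrow> carrier R. x = (\<Oplus>\<^bsub>A\<^esub>s\<in>S. f s \<odot>\<^bsub>A\<^esub> s)))"

definition central_simple :: "'a ring \<Rightarrow> ('a, 'b) module \<Rightarrow> bool" where
  "central_simple R A \<longleftrightarrow> assoc_algebra R A \<and> finite_dimensional R A \<and>
     {z \<in> carrier A. \<forall>x\<in>carrier A. z \<otimes>\<^bsub>A\<^esub> x = x \<otimes>\<^bsub>A\<^esub> z} = {c \<odot>\<^bsub>A\<^esub> \<one>\<^bsub>A\<^esub> | c. c \<in> carrier R} \<and>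
     \<one>\<^bsub>A\<^esub> \<noteq> \<zero>\<^bsub>A\<^esub> \<and> (\<forall>I. ideal I A \<longrightarrow> I = {\<zero>\<^bsub>A\<^esub>} \<or> I = carrier A)"

definition algebra_isomorphic :: "'a ring \<Rightarrow> ('a, 'b) module \<Rightarrow> ('a, 'c) module \<Rightarrow> bool" where
  "algebra_isomorphic R A B \<longleftrightarrow>
     (\<exists>h \<in> ring_iso A B. \<forall>c\<in>carrier R. \<forall>x\<in>carrier A. h (c \<odot>\<^bsub>A\<^esub> x) = c \<odot>\<^bsub>B\<^esub> h x)"

definition matrix_algebra :: "nat \<Rightarrow> ('a, 'b) module \<Rightarrow> ('a, nat \<times> nat \<Rightarrow> 'b) module" where
  "matrix_algebra r A = (let D = {..<r} \<times> {..<r} in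
     \<lparr>carrier = D \<rightarrow>\<^sub>E carrier A,
      monoid.mult = (\<lambda>M N. restrict (\<lambda>(i, j). \<Oplus>\<^bsub>A\<^esub>k\<in>{..<r}. M (i, k) \<otimes>\<^bsub>A\<^esub> N (k, j)) D),
      one = restrict (\<lambda>(i, j). if i = j then \<one>\<^bsub>A\<^esub> else \<zero>\<^bsub>A\<^esub>) D,
      ring.zero = restrict (\<lambda>_. \<zero>\<^bsub>A\<^esub>) D,
      add = (\<lambda>M N. restrict (\<lambda>p. M p \<oplus>\<^bsub>A\<^esub> N p) D),
      module.smult = (\<lambda>c M. restrict (\<lambda>p. c \<odot>\<^bsub>A\<^esub> M p) D)\<rparr>)"

text \<open>Equality of the classes of \<open>A\<close> and \<open>B\<close> in the Brauer group of \<open>R\<close>.\<close>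

definition same_brauer_class :: "'a ring \<Rightarrow> ('a, 'b) module \<Rightarrow> ('a, 'c) module \<Rightarrow> bool" where
  "same_brauer_class R A B \<longleftrightarrow> central_simple R A \<and> central_simple R B \<and>
     (\<exists>r s. r > 0 \<and> s > 0 \<and> algebra_isomorphic R (matrix_algebra r A) (matrix_algebra s B))"

text \<open>The base field as an algebra over itself; it represents the neutral element of the
  Brauer group.\<close>

definition base_algebra :: "complex set \<Rightarrow> (complex, complex) module" where
  "base_algebra K =
     \<lparr>carrier = K, monoid.mult = (*), one = 1, ring.zero = 0, add = (+), module.smult = (*)\<rparr>"


section \<open>Clifford and quaternion algebras\<close>

text \<open>The tensor algebra of \<open>K\<^sup>m\<close>: the word \<open>[i\<^sub>1, \<dots>, i\<^sub>k]\<close> stands for the basis tensor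
  \<open>e\<close>-\<open>i\<^sub>1\<close> \<open>\<otimes> \<dots> \<otimes>\<close> \<open>e\<close>-\<open>i\<^sub>k\<close>, and an element is its finitely supported coefficient function.
  Equivalently, this is the free associative algebra on \<open>m\<close> generators.\<close>

definition tensor_algebra :: "complex set \<Rightarrow> nat \<Rightarrow> (complex, nat list \<Rightarrow> complex) module" where
  "tensor_algebra K m =
     \<lparr>carrier = {f. finite {w. f w \<noteq> 0} \<and> range f \<subseteq> K \<and> (\<forall>w. f w \<noteq> 0 \<longrightarrow> set w \<subseteq> {..<m})},
      monoid.mult = (\<lambda>f g w. \<Sum>k\<le>length w. f (take k w) * g (drop k w)),
      one = (\<lambda>w. if w = [] then 1 else 0),
      ring.zero = (\<lambda>w. 0),
      add = (\<lambda>f g w. f w + g w),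
      module.smult = (\<lambda>c f w. c * f w)\<rparr>"

definition vec_tensor :: "complex vec \<Rightarrow> nat list \<Rightarrow> complex" where
  "vec_tensor v w = (if length w = 1 \<and> hd w < dim_vec v then v $ hd w else 0)"

definition quotient_algebra :: "('a, 'b) module \<Rightarrow> 'b set \<Rightarrow> ('a, 'b set) module" where
  "quotient_algebra A I =
     \<lparr>carrier = carrier (A Quot I), monoid.mult = monoid.mult (A Quot I), one = \<one>\<^bsub>A Quot I\<^esub>,
      ring.zero = \<zero>\<^bsub>A Quot I\<^esub>, add = add (A Quot I),
      module.smult = (\<lambda>c C. \<Union>x\<in>C. I +>\<^bsub>A\<^esub> (c \<odot>\<^bsub>A\<^esub> x))\<rparr>"

definition clifford_ideal :: "complex set \<Rightarrow> nat \<Rightarrow> complex mat \<Rightarrow> (nat list \<Rightarrow> complex) set" where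
  "clifford_ideal K m F = (let T = tensor_algebra K m in
     Idl\<^bsub>T\<^esub> {(vec_tensor v \<otimes>\<^bsub>T\<^esub> vec_tensor v) \<ominus>\<^bsub>T\<^esub> ((1 / 2 * (v \<bullet> (F *\<^sub>v v))) \<odot>\<^bsub>T\<^esub> \<one>\<^bsub>T\<^esub>) | v.
        v \<in> carrier_vec m \<and> set\<^sub>v v \<subseteq> K})"

definition clifford_algebra ::
  "complex set \<Rightarrow> nat \<Rightarrow> complex mat \<Rightarrow> (complex, (nat list \<Rightarrow> complex) set) module" where
  "clifford_algebra K m F = quotient_algebra (tensor_algebra K m) (clifford_ideal K m F)"

definition even_clifford_algebra ::
  "complex set \<Rightarrow> nat \<Rightarrow> complex mat \<Rightarrow> (complex, (nat list \<Rightarrow> complex) set) module" where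
  "even_clifford_algebra K m F =
     (clifford_algebra K m F)\<lparr>carrier :=
        {clifford_ideal K m F +>\<^bsub>tensor_algebra K m\<^esub> x | x.
           x \<in> carrier (tensor_algebra K m) \<and> (\<forall>w. x w \<noteq> 0 \<longrightarrow> even (length w))}\<rparr>"

text \<open>The generators \<open>i\<close> and \<open>j\<close> are the words \<open>[0]\<close> and \<open>[1]\<close>.\<close>

definition quaternion_algebra ::
  "complex set \<Rightarrow> complex \<Rightarrow> complex \<Rightarrow> (complex, (nat list \<Rightarrow> complex) set) module" where
  "quaternion_algebra K a b = (let T = tensor_algebra K 2;
       i = (\<lambda>w. if w = [0] then 1 else 0);
       j = (\<lambda>w. if w = [1] then 1 else 0)
     in quotient_algebra T
       (Idl\<^bsub>T\<^esub> {(i \<otimes>\<^bsub>T\<^esub> i) \<ominus>\<^bsub>T\<^esub> (a \<odot>\<^bsub>T\<^esub> \<one>\<^bsub>T\<^esub>), (j \<otimes>\<^bsub>T\<^esub> j) \<ominus>\<^bsub>T\<^esub> (b \<odot>\<^bsub>T\<^esub> \<one>\<^bsub>T\<^esub>),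
               (i \<otimes>\<^bsub>T\<^esub> j) \<oplus>\<^bsub>T\<^esub> (j \<otimes>\<^bsub>T\<^esub> i)}))"

end

theory Submission
  imports Defs "HOL-Library.Function_Algebras" "HOL-Number_Theory.Residues"
begin

text \<open>
  Let U be the group of lower unitriangular matrices, D(x) the diagonal torus and w the Weyl
  element. An eigenvector of U for a nontrivial sign character of U has q - 1 translates under the
  torus; they are defined over the character field K, mutually orthogonal, and of equal norm a.
  For theta these vectors form a basis. For psi one adds a vector f fixed by the Borel subgroup,
  for chi a Borel eigenvector f and its complex conjugate. Averaging the translates of w f over U
  in two ways, by the expansion in the basis and by the Bruhat decomposition, determines the norms
  of the additional vectors in terms of a: up to squares of K this is (q + 1) a for psi, and for
  chi, with n odd, the added plane has an orthogonal K-basis of norms a and a d.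

  The Clifford invariants are then read off from explicit matrix models. The even Clifford algebra
  of an orthogonal basis is generated by anticommuting elements, so it is spanned by the 4^p words
  in 2p generators, which are independent because averaging over conjugation by the generators
  separates them; anticommuting matrices of the right size over K give the splitting.
\<close>

section \<open>Subfields of the complex numbers\<close>

text \<open>Additive characters of a field of characteristic 2 take only the values 1 and -1; this
  is why the torus translates are already defined over K. For chi the Borel eigenvectors exist only
  over a quadratic extension of K, and complex conjugation, available because K is real, brings them
  back. Odd n makes 2q = 2^(n+1) a rational square, which removes the factor 2q from the norms of
  the added plane.

  The relations of a Clifford algebra do not show by themselves that the quotient is nonzero; a
  matrix model does. A single anticommuting generator may need square roots outside K, so models are
  complex. The even algebra sees only products of two generators, where these roots pair up and a
  common factor of the form cancels. Equal norms a may thus be replaced by -1, and norms ad, a, ...,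
  a by d^2, d, ..., d. For q at least 8 the dimensions q - 1 and q + 1 are 7 and 1 modulo 8, where
  periodicity gives a split algebra; q = 4 leaves three equal norms, whose even algebra is (-1,-1).

  The conjugacy classes serve to find K: rational for psi, real for chi, generated by the square
  root of 5 for theta and q = 4.\<close>

locale csubfield =
  fixes K :: "complex set"
  assumes one_mem [simp, intro]: "1 \<in> K"
    and add_mem [simp, intro]: "\<And>x y. x \<in> K \<Longrightarrow> y \<in> K \<Longrightarrow> x + y \<in> K"
    and mult_mem [simp, intro]: "\<And>x y. x \<in> K \<Longrightarrow> y \<in> K \<Longrightarrow> x * y \<in> K"
    and uminus_mem [simp, intro]: "\<And>x. x \<in> K \<Longrightarrow> - x \<in> K"
    and inverse_mem [simp, intro]: "\<And>x. x \<in> K \<Longrightarrow> inverse x \<in> K"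
begin

lemma zero_mem [simp, intro]: "0 \<in> K"
  using add_mem[OF one_mem uminus_mem[OF one_mem]] by simp

lemma diff_mem [simp, intro]: "x \<in> K \<Longrightarrow> y \<in> K \<Longrightarrow> x - y \<in> K"
  using add_mem[of x "- y"] by simp

lemma divide_mem [simp, intro]: "x \<in> K \<Longrightarrow> y \<in> K \<Longrightarrow> x / y \<in> K"
  by (simp add: divide_inverse)

lemma power_mem [simp, intro]: "x \<in> K \<Longrightarrow> x ^ k \<in> K"
  by (induction k) auto

lemma sum_mem [intro]: "(\<And>i. i \<in> A \<Longrightarrow> f i \<in> K) \<Longrightarrow> sum f A \<in> K"
  by (induction A rule: infinite_finite_induct) auto

lemma of_nat_mem [simp, intro]: "of_nat k \<in> K"
  by (induction k) auto

lemma numeral_mem [simp, intro]: "numeral k \<in> K"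
  using of_nat_mem[of "numeral k"] by simp

lemma Rats_subset: "\<rat> \<subseteq> K"
proof
  fix x :: complex assume "x \<in> \<rat>"
  have "of_int c \<in> K" for c :: int
    by (cases c rule: int_cases2) auto
  with \<open>x \<in> \<rat>\<close> show "x \<in> K" by (cases x rule: Rats_cases') auto
qed

end

lemma csubfield_rat_adjoin: "csubfield (rat_adjoin S)"
proof -
  define R :: "complex ring" where "R = ring_of_type_algebra"
  interpret R: field R unfolding R_def by (rule field_from_type_algebra)
  have c [simp]: "carrier R = UNIV" "monoid.mult R = (*)" "one R = 1" "zero R = 0" "add R = (+)"
    by (auto simp: R_def ring_of_type_algebra_def)
  have neg: "\<ominus>\<^bsub>R\<^esub> x = - x" for x
    by (rule R.minus_equality) auto
  have inv: "inv\<^bsub>R\<^esub> x = inverse x" if "x \<noteq> 0" for x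
    by (rule R.comm_inv_char) (use that in auto)
  let ?G = "generate_field R S"
  have "csubfield ?G"
  proof
    show "1 \<in> ?G" using generate_field.one[of R S] by simp
    fix x assume x: "x \<in> ?G"
    show "- x \<in> ?G" using generate_field.a_inv[OF x] by (simp add: neg)
    show "inverse x \<in> ?G"
    proof (cases "x = 0")
      case True then show ?thesis using x by simp
    next
      case False then show ?thesis using generate_field.m_inv[OF x] by (simp add: inv)
    qed
    fix y assume y: "y \<in> ?G"
    show "x + y \<in> ?G" using generate_field.eng_add[OF x y] by simp
    show "x * y \<in> ?G" using generate_field.eng_mult[OF x y] by simp
  qed
  then show ?thesis by (simp add: rat_adjoin_def R_def)
qed

lemma rat_adjoin_superset: "S \<subseteq> rat_adjoin S"
  by (auto simp: rat_adjoin_def intro: generate_field.incl)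

lemma rat_adjoin_minimal:
  assumes "csubfield K" "S \<subseteq> K"
  shows "rat_adjoin S \<subseteq> K"
proof
  interpret csubfield K by fact
  define R :: "complex ring" where "R = ring_of_type_algebra"
  interpret R: field R unfolding R_def by (rule field_from_type_algebra)
  have c [simp]: "carrier R = UNIV" "monoid.mult R = (*)" "one R = 1" "zero R = 0" "add R = (+)"
    by (auto simp: R_def ring_of_type_algebra_def)
  have neg: "\<ominus>\<^bsub>R\<^esub> x = - x" for x
    by (rule R.minus_equality) auto
  have inv: "inv\<^bsub>R\<^esub> x = inverse x" if "x \<noteq> 0" for x
    by (rule R.comm_inv_char) (use that in auto)
  fix x assume "x \<in> rat_adjoin S"
  then have "x \<in> generate_field R S" by (simp add: rat_adjoin_def R_def)
  then show "x \<in> K"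
    by induction (use assms in \<open>auto simp: neg inv\<close>)
qed

lemma csubfield_Rats: "csubfield \<rat>"
  by standard auto

lemma csubfield_Reals: "csubfield \<real>"
  by standard auto

lemma csubfield_UNIV: "csubfield UNIV"
  by standard auto

lemma subfield_ring_simps [simp]:
  "carrier (subfield_ring K) = K" "monoid.mult (subfield_ring K) = (*)"
  "one (subfield_ring K) = 1" "zero (subfield_ring K) = 0" "add (subfield_ring K) = (+)"
  by (auto simp: subfield_ring_def ring_of_type_algebra_def)

lemma (in csubfield) cring_subfield_ring: "cring (subfield_ring K)"
proof (rule cringI)
  show "abelian_group (subfield_ring K)"
  proof (rule abelian_groupI)
    fix x assume "x \<in> carrier (subfield_ring K)"
    then show "\<exists>y\<in>carrier (subfield_ring K). y \<oplus>\<^bsub>subfield_ring K\<^esub> x = \<zero>\<^bsub>subfield_ring K\<^esub>"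
      by (intro bexI[of _ "- x"]) auto
  qed (auto simp: add_ac)
  show "Group.comm_monoid (subfield_ring K)"
    by (rule comm_monoidI) (auto simp: mult_ac)
qed (auto simp: algebra_simps)

section \<open>The tensor algebra\<close>

text \<open>The operations of \<open>tensor_algebra K m\<close> depend neither on \<open>K\<close>
  nor on \<open>m\<close>, so they are named once; sum and zero are those of pointwise function
  arithmetic. The product at \<open>w\<close> runs over all ways of cutting \<open>w\<close> in two,
  which is concatenation of words extended linearly.\<close>

definition conv :: "(nat list \<Rightarrow> complex) \<Rightarrow> (nat list \<Rightarrow> complex) \<Rightarrow> nat list \<Rightarrow> complex"
    (infixl \<open>\<star>\<close> 70) where
  "f \<star> g = (\<lambda>w. \<Sum>k\<le>length w. f (take k w) * g (drop k w))"

definition scl :: "complex \<Rightarrow> (nat list \<Rightarrow> complex) \<Rightarrow> nat list \<Rightarrow> complex" (infixr \<open>\<cdot>\<close> 72) where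
  "c \<cdot> f = (\<lambda>w. c * f w)"

definition monom_word :: "nat list \<Rightarrow> nat list \<Rightarrow> complex" where
  "monom_word u = (\<lambda>w. if w = u then 1 else 0)"

abbreviation unit_word :: "nat list \<Rightarrow> complex" where
  "unit_word \<equiv> monom_word []"

lemma conv_scl_left [simp]: "(c \<cdot> f) \<star> g = c \<cdot> (f \<star> g)"
  and conv_scl_right [simp]: "f \<star> (c \<cdot> g) = c \<cdot> (f \<star> g)"
  by (auto simp: conv_def scl_def fun_eq_iff sum_distrib_left mult_ac)

lemma conv_add_left: "(f + g) \<star> h = f \<star> h + g \<star> h"
  and conv_add_right: "f \<star> (g + h) = f \<star> g + f \<star> h"
  by (auto simp: conv_def fun_eq_iff algebra_simps sum.distrib)

lemma conv_diff_left: "(f - g) \<star> h = f \<star> h - g \<star> h"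
  and conv_diff_right: "f \<star> (g - h) = f \<star> g - f \<star> h"
  by (auto simp: conv_def fun_eq_iff algebra_simps sum_subtractf)

lemma conv_uminus_left [simp]: "(- f) \<star> h = - (f \<star> h)"
  and conv_uminus_right [simp]: "f \<star> (- h) = - (f \<star> h)"
  by (auto simp: conv_def fun_eq_iff sum_negf)

lemma conv_zero_left [simp]: "0 \<star> h = 0"
  and conv_zero_right [simp]: "f \<star> 0 = 0"
  by (auto simp: conv_def fun_eq_iff)

lemma conv_sum_right: "f \<star> (\<Sum>i\<in>A. g i) = (\<Sum>i\<in>A. f \<star> g i)"
  by (induction A rule: infinite_finite_induct) (simp_all only: sum.infinite sum.empty sum.insert conv_zero_right conv_add_right not_False_eq_True)

lemma conv_sum_left: "(\<Sum>i\<in>A. g i) \<star> f = (\<Sum>i\<in>A. g i \<star> f)"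
  by (induction A rule: infinite_finite_induct) (simp_all only: sum.infinite sum.empty sum.insert conv_zero_left conv_add_left not_False_eq_True)

lemma scl_add_right: "c \<cdot> (f + g) = c \<cdot> f + c \<cdot> g"
  and scl_add_left: "(c + d) \<cdot> f = c \<cdot> f + d \<cdot> f"
  and scl_diff_right: "c \<cdot> (f - g) = c \<cdot> f - c \<cdot> g"
  and scl_diff_left: "(c - d) \<cdot> f = c \<cdot> f - d \<cdot> f"
  and scl_scl [simp]: "c \<cdot> d \<cdot> f = (c * d) \<cdot> f"
  and scl_one [simp]: "1 \<cdot> f = f"
  and scl_zero [simp]: "0 \<cdot> f = 0"
  and scl_zero_right [simp]: "c \<cdot> 0 = 0"
  and scl_uminus_right [simp]: "c \<cdot> (- f) = - (c \<cdot> f)"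
  and scl_uminus_left [simp]: "(- c) \<cdot> f = - (c \<cdot> f)"
  by (auto simp: scl_def fun_eq_iff algebra_simps)

lemma scl_sum_right: "c \<cdot> (\<Sum>i\<in>A. g i) = (\<Sum>i\<in>A. c \<cdot> g i)"
  by (induction A rule: infinite_finite_induct) (simp_all only: sum.infinite sum.empty sum.insert scl_zero_right scl_add_right not_False_eq_True)

lemma scl_sum_left: "(\<Sum>i\<in>A. c i) \<cdot> f = (\<Sum>i\<in>A. c i \<cdot> f)"
  by (induction A rule: infinite_finite_induct) (auto simp: scl_add_left)

text \<open>Both sides run over the cuts of \<open>w\<close> into three consecutive pieces; the
  reindexing replaces the end points of the middle piece by its start and its length.\<close>

lemma conv_assoc: "(f \<star> g) \<star> h = f \<star> (g \<star> h)"
proof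
  fix w
  have "((f \<star> g) \<star> h) w = (\<Sum>k\<le>length w. \<Sum>j\<le>k. f (take j w) * g (drop j (take k w)) * h (drop k w))"
    by (auto simp: conv_def sum_distrib_right min_def intro!: sum.cong)
  also have "\<dots> = (\<Sum>(k, j)\<in>Sigma {..length w} (\<lambda>k. {..k}). f (take j w) * g (drop j (take k w)) * h (drop k w))"
    by (subst sum.Sigma) auto
  also have "\<dots> = (\<Sum>(j, i)\<in>Sigma {..length w} (\<lambda>j. {..length w - j}).
      f (take j w) * (g (take i (drop j w)) * h (drop i (drop j w))))"
    by (rule sum.reindex_bij_witness[of _ "\<lambda>(j, i). (j + i, j)" "\<lambda>(k, j). (j, k - j)"])
       (auto simp: take_drop add.commute mult.assoc)
  also have "\<dots> = (\<Sum>j\<le>length w. \<Sum>i\<le>length w - j.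
      f (take j w) * (g (take i (drop j w)) * h (drop i (drop j w))))"
    by (subst sum.Sigma) auto
  also have "\<dots> = (f \<star> (g \<star> h)) w"
    by (simp add: conv_def sum_distrib_left)
  finally show "((f \<star> g) \<star> h) w = (f \<star> (g \<star> h)) w" .
qed

lemma conv_unit_left [simp]: "unit_word \<star> f = f"
proof
  fix w
  have "(unit_word \<star> f) w = (\<Sum>k\<in>{0}. unit_word (take k w) * f (drop k w))"
    unfolding conv_def by (rule sum.mono_neutral_right) (auto simp: monom_word_def)
  then show "(unit_word \<star> f) w = f w" by (simp add: monom_word_def)
qed

lemma conv_unit_right [simp]: "f \<star> unit_word = f"
proof
  fix w
  have "(f \<star> unit_word) w = (\<Sum>k\<in>{length w}. f (take k w) * unit_word (drop k w))"
    unfolding conv_def by (rule sum.mono_neutral_right) (auto simp: monom_word_def)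
  then show "(f \<star> unit_word) w = f w" by (simp add: monom_word_def)
qed

lemma monom_word_append: "monom_word (u @ v) = monom_word u \<star> monom_word v"
proof
  fix w
  show "monom_word (u @ v) w = (monom_word u \<star> monom_word v) w"
  proof (cases "w = u @ v")
    case True
    have "(monom_word u \<star> monom_word v) w =
        (\<Sum>k\<in>{length u}. monom_word u (take k w) * monom_word v (drop k w))"
      unfolding conv_def proof (rule sum.mono_neutral_right)
      show "\<forall>k\<in>{..length w} - {length u}. monom_word u (take k w) * monom_word v (drop k w) = 0"
      proof
        fix k assume "k \<in> {..length w} - {length u}"
        then have "length (take k w) \<noteq> length u" by simp
        then show "monom_word u (take k w) * monom_word v (drop k w) = 0"
          by (auto simp: monom_word_def)
      qed
    qed (simp_all add: True)
    then show ?thesis by (simp add: monom_word_def True)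
  next
    case False
    then have "monom_word u (take k w) * monom_word v (drop k w) = 0" for k
      by (auto simp: monom_word_def)
    then have "(monom_word u \<star> monom_word v) w = 0" unfolding conv_def by (intro sum.neutral) blast
    then show ?thesis using False by (simp add: monom_word_def)
  qed
qed

lemma tensor_algebra_simps [simp]:
  "monoid.mult (tensor_algebra K m) = (\<star>)"
  "one (tensor_algebra K m) = unit_word"
  "zero (tensor_algebra K m) = 0"
  "add (tensor_algebra K m) = (+)"
  "module.smult (tensor_algebra K m) = (\<cdot>)"
  by (auto simp: tensor_algebra_def conv_def scl_def monom_word_def fun_eq_iff)

lemma tensor_carrier_iff:
  "f \<in> carrier (tensor_algebra K m) \<longleftrightarrow>
     finite {w. f w \<noteq> 0} \<and> range f \<subseteq> K \<and> (\<forall>w. f w \<noteq> 0 \<longrightarrow> set w \<subseteq> {..<m})"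
  by (simp add: tensor_algebra_def)

context csubfield
begin

lemma tensor_add_mem:
  assumes "f \<in> carrier (tensor_algebra K m)" "g \<in> carrier (tensor_algebra K m)"
  shows "f + g \<in> carrier (tensor_algebra K m)"
  unfolding tensor_carrier_iff
proof (intro conjI allI impI)
  have "{w. (f + g) w \<noteq> 0} \<subseteq> {w. f w \<noteq> 0} \<union> {w. g w \<noteq> 0}" by auto
  then show "finite {w. (f + g) w \<noteq> 0}"
    by (rule finite_subset) (use assms in \<open>auto simp: tensor_carrier_iff\<close>)
  show "range (f + g) \<subseteq> K" using assms by (auto simp: tensor_carrier_iff image_subset_iff)
  fix w assume "(f + g) w \<noteq> 0"
  then have "f w \<noteq> 0 \<or> g w \<noteq> 0" by auto
  then show "set w \<subseteq> {..<m}" using assms unfolding tensor_carrier_iff by blast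
qed

lemma tensor_scl_mem:
  assumes "f \<in> carrier (tensor_algebra K m)" "c \<in> K"
  shows "c \<cdot> f \<in> carrier (tensor_algebra K m)"
proof -
  have "{w. (c \<cdot> f) w \<noteq> 0} \<subseteq> {w. f w \<noteq> 0}" by (auto simp: scl_def)
  then show ?thesis using assms unfolding tensor_carrier_iff
    by (auto intro: finite_subset simp: scl_def)
qed

lemma tensor_uminus_mem:
  "f \<in> carrier (tensor_algebra K m) \<Longrightarrow> - f \<in> carrier (tensor_algebra K m)"
  using tensor_scl_mem[of f m "-1"] by simp

lemma tensor_diff_mem:
  "f \<in> carrier (tensor_algebra K m) \<Longrightarrow> g \<in> carrier (tensor_algebra K m) \<Longrightarrow>
    f - g \<in> carrier (tensor_algebra K m)"
  using tensor_add_mem[of f m "- g"] tensor_uminus_mem by simp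

lemma tensor_zero_mem: "0 \<in> carrier (tensor_algebra K m)"
  by (auto simp: tensor_carrier_iff)

lemma tensor_monom_mem: "set u \<subseteq> {..<m} \<Longrightarrow> monom_word u \<in> carrier (tensor_algebra K m)"
  by (auto simp: tensor_carrier_iff monom_word_def)

lemma conv_nonzero_split:
  assumes "(f \<star> g) w \<noteq> 0"
  obtains k where "f (take k w) \<noteq> 0" "g (drop k w) \<noteq> 0" "k \<le> length w"
  using assms unfolding conv_def by (metis (no_types, lifting) atMost_iff mult_eq_0_iff sum.neutral)

lemma tensor_conv_mem:
  assumes f: "f \<in> carrier (tensor_algebra K m)" and g: "g \<in> carrier (tensor_algebra K m)"
  shows "f \<star> g \<in> carrier (tensor_algebra K m)"
  unfolding tensor_carrier_iff
proof (intro conjI allI impI)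
  have "{w. (f \<star> g) w \<noteq> 0} \<subseteq> (\<lambda>(u, v). u @ v) ` ({w. f w \<noteq> 0} \<times> {w. g w \<noteq> 0})"
  proof
    fix w assume "w \<in> {w. (f \<star> g) w \<noteq> 0}"
    then obtain k where "f (take k w) \<noteq> 0" "g (drop k w) \<noteq> 0" by (auto elim: conv_nonzero_split)
    then show "w \<in> (\<lambda>(u, v). u @ v) ` ({w. f w \<noteq> 0} \<times> {w. g w \<noteq> 0})"
      by (intro image_eqI[of _ _ "(take k w, drop k w)"]) auto
  qed
  then show "finite {w. (f \<star> g) w \<noteq> 0}"
    by (rule finite_subset) (use f g in \<open>auto simp: tensor_carrier_iff\<close>)
  show "range (f \<star> g) \<subseteq> K"
    using f g by (auto simp: conv_def tensor_carrier_iff intro!: sum_mem mult_mem)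
  fix w assume "(f \<star> g) w \<noteq> 0"
  then obtain k where k: "f (take k w) \<noteq> 0" "g (drop k w) \<noteq> 0" by (auto elim: conv_nonzero_split)
  then have "set (take k w) \<subseteq> {..<m}" "set (drop k w) \<subseteq> {..<m}"
    using f g by (auto simp: tensor_carrier_iff)
  then show "set w \<subseteq> {..<m}" by (metis append_take_drop_id le_sup_iff set_append)
qed

lemmas tensor_mem = tensor_add_mem tensor_scl_mem tensor_uminus_mem tensor_diff_mem tensor_zero_mem
  tensor_monom_mem tensor_conv_mem

lemma tensor_sum_mem:
  "(\<And>i. i \<in> A \<Longrightarrow> f i \<in> carrier (tensor_algebra K m)) \<Longrightarrow> sum f A \<in> carrier (tensor_algebra K m)"
  by (induction A rule: infinite_finite_induct) (auto intro: tensor_mem)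

lemma ring_tensor_algebra: "ring (tensor_algebra K m)"
proof (rule ringI)
  show "abelian_group (tensor_algebra K m)"
  proof (rule abelian_groupI)
    fix x assume "x \<in> carrier (tensor_algebra K m)"
    then show "\<exists>y\<in>carrier (tensor_algebra K m). y \<oplus>\<^bsub>tensor_algebra K m\<^esub> x = \<zero>\<^bsub>tensor_algebra K m\<^esub>"
      by (intro bexI[of _ "- x"]) (auto intro: tensor_mem)
  qed (auto intro: tensor_mem simp: add_ac)
  show "Group.monoid (tensor_algebra K m)"
    by (rule monoidI) (auto intro: tensor_mem simp: conv_assoc)
qed (auto simp: conv_add_left conv_add_right)

lemma tensor_a_inv: "f \<in> carrier (tensor_algebra K m) \<Longrightarrow> \<ominus>\<^bsub>tensor_algebra K m\<^esub> f = - f"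
proof -
  interpret ring "tensor_algebra K m" by (rule ring_tensor_algebra)
  show "f \<in> carrier (tensor_algebra K m) \<Longrightarrow> \<ominus>\<^bsub>tensor_algebra K m\<^esub> f = - f"
    by (rule minus_equality) (auto intro: tensor_mem)
qed

lemma tensor_a_minus:
  "f \<in> carrier (tensor_algebra K m) \<Longrightarrow> g \<in> carrier (tensor_algebra K m) \<Longrightarrow>
    f \<ominus>\<^bsub>tensor_algebra K m\<^esub> g = f - g"
  by (simp add: a_minus_def tensor_a_inv)

lemma tensor_expand:
  assumes "f \<in> carrier (tensor_algebra K m)"
  shows "f = (\<Sum>w\<in>{w. f w \<noteq> 0}. f w \<cdot> monom_word w)"
proof
  fix u
  have fin: "finite {w. f w \<noteq> 0}" using assms by (simp add: tensor_carrier_iff)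
  have "(\<Sum>w\<in>A. f w \<cdot> monom_word w) u = (\<Sum>w\<in>A. if w = u then f w else 0)" if "finite A" for A
    using that by induction (auto simp: scl_def monom_word_def)
  from this[OF fin] show "f u = (\<Sum>w\<in>{w. f w \<noteq> 0}. f w \<cdot> monom_word w) u"
    using fin by (auto simp: sum.delta)
qed

end

section \<open>Quotients of the tensor algebra by anticommutation relations\<close>

locale tensor_ideal = csubfield K for K +
  fixes m :: nat and I :: "(nat list \<Rightarrow> complex) set"
  assumes ideal_I: "ideal I (tensor_algebra K m)"
begin

abbreviation "T \<equiv> carrier (tensor_algebra K m)"

sublocale I: ideal I "tensor_algebra K m" by (rule ideal_I)

lemma I_subset: "x \<in> I \<Longrightarrow> x \<in> T"
  by (rule I.Icarr)

lemma I_zero: "0 \<in> I"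
  using additive_subgroup.zero_closed[OF I.is_additive_subgroup] by simp

lemma I_add: "x \<in> I \<Longrightarrow> y \<in> I \<Longrightarrow> x + y \<in> I"
  using additive_subgroup.a_closed[OF I.is_additive_subgroup, of x y] by simp

lemma I_left: "t \<in> T \<Longrightarrow> x \<in> I \<Longrightarrow> t \<star> x \<in> I"
  using I.I_l_closed[of x t] by simp

lemma I_right: "t \<in> T \<Longrightarrow> x \<in> I \<Longrightarrow> x \<star> t \<in> I"
  using I.I_r_closed[of x t] by simp

lemma I_scl: "c \<in> K \<Longrightarrow> x \<in> I \<Longrightarrow> c \<cdot> x \<in> I"
  using I_left[of "c \<cdot> unit_word" x] by (simp add: tensor_mem)

lemma I_uminus: "x \<in> I \<Longrightarrow> - x \<in> I"
  using I_scl[of "-1" x] by simp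

lemma I_diff: "x \<in> I \<Longrightarrow> y \<in> I \<Longrightarrow> x - y \<in> I"
  using I_add[OF _ I_uminus, of x y] by simp

text \<open>Calculations are carried out on representatives modulo \<open>I\<close>, where the
  pointwise arithmetic of functions is at hand; cosets appear only when the quotient is assembled as
  an algebra.\<close>

definition eqv :: "(nat list \<Rightarrow> complex) \<Rightarrow> (nat list \<Rightarrow> complex) \<Rightarrow> bool" (infix \<open>\<approx>\<close> 50) where
  "x \<approx> y \<longleftrightarrow> x - y \<in> I"

lemma eqv_refl [simp, intro]: "x \<approx> x"
  by (simp only: eqv_def diff_self I_zero)

lemma eqv_sym: "x \<approx> y \<Longrightarrow> y \<approx> x"
  using I_uminus[of "x - y"] by (simp only: eqv_def minus_diff_eq)

lemma eqv_trans [trans]: "x \<approx> y \<Longrightarrow> y \<approx> z \<Longrightarrow> x \<approx> z"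
  unfolding eqv_def by (drule (1) I_add) (simp only: diff_add_cancel add_diff_eq)

lemma eqv_add: "x \<approx> y \<Longrightarrow> u \<approx> v \<Longrightarrow> x + u \<approx> y + v"
  unfolding eqv_def by (drule (1) I_add) (simp only: add_diff_add)

lemma eqv_uminus: "x \<approx> y \<Longrightarrow> - x \<approx> - y"
  unfolding eqv_def by (drule I_uminus) (simp only: minus_diff_minus)

lemma eqv_scl: "c \<in> K \<Longrightarrow> x \<approx> y \<Longrightarrow> c \<cdot> x \<approx> c \<cdot> y"
  unfolding eqv_def by (drule (1) I_scl) (simp only: scl_diff_right)

lemma eqv_left: "t \<in> T \<Longrightarrow> x \<approx> y \<Longrightarrow> t \<star> x \<approx> t \<star> y"
  unfolding eqv_def by (drule (1) I_left) (simp only: conv_diff_right)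

lemma eqv_right: "t \<in> T \<Longrightarrow> x \<approx> y \<Longrightarrow> x \<star> t \<approx> y \<star> t"
  unfolding eqv_def by (drule (1) I_right) (simp only: conv_diff_left)

lemma eqv_sum: "(\<And>i. i \<in> A \<Longrightarrow> f i \<approx> h i) \<Longrightarrow> sum f A \<approx> sum h A"
proof (induction A rule: infinite_finite_induct)
  case (insert x F)
  then show ?case by (simp only: sum.insert not_False_eq_True) (intro eqv_add; blast)
qed (simp_all only: sum.infinite sum.empty not_False_eq_True eqv_refl)

lemma eqv_zero_iff: "x \<approx> 0 \<longleftrightarrow> x \<in> I"
  by (simp only: eqv_def diff_zero)

end

text \<open>Two situations are treated at once: the even Clifford algebra, where \<open>Ev\<close>
  consists of the even tensors and \<open>g i\<close> is a product of two orthogonal vectors divided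
  by a scalar, and the quaternion algebra, where \<open>Ev\<close> is the whole tensor algebra,
  \<open>p = 1\<close> and the generators are the two letters. The number of generators is even
  because the product of an odd number of anticommuting generators would be central.\<close>

locale anticommuting_quotient = tensor_ideal K m I for K m I +
  fixes Ev :: "(nat list \<Rightarrow> complex) set" and p :: nat
    and g :: "nat \<Rightarrow> nat list \<Rightarrow> complex" and \<gamma> :: "nat \<Rightarrow> complex"
  assumes Ev_subset: "x \<in> Ev \<Longrightarrow> x \<in> carrier (tensor_algebra K m)"
    and Ev_add: "x \<in> Ev \<Longrightarrow> y \<in> Ev \<Longrightarrow> x + y \<in> Ev"
    and Ev_conv: "x \<in> Ev \<Longrightarrow> y \<in> Ev \<Longrightarrow> x \<star> y \<in> Ev"
    and Ev_scl: "c \<in> K \<Longrightarrow> x \<in> Ev \<Longrightarrow> c \<cdot> x \<in> Ev"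
    and Ev_unit: "unit_word \<in> Ev"
    and g_mem: "i < 2 * p \<Longrightarrow> g i \<in> Ev"
    and \<gamma>_mem: "i < 2 * p \<Longrightarrow> \<gamma> i \<in> K"
    and \<gamma>_nonzero: "i < 2 * p \<Longrightarrow> \<gamma> i \<noteq> 0"
    and g_square: "i < 2 * p \<Longrightarrow> g i \<star> g i - \<gamma> i \<cdot> unit_word \<in> I"
    and g_anticommute: "i < 2 * p \<Longrightarrow> j < 2 * p \<Longrightarrow> i \<noteq> j \<Longrightarrow> g i \<star> g j + g j \<star> g i \<in> I"
begin

lemma Ev_zero: "0 \<in> Ev"
  using Ev_scl[OF zero_mem Ev_unit] by simp

lemma Ev_uminus: "x \<in> Ev \<Longrightarrow> - x \<in> Ev"
  using Ev_scl[of "-1" x] by simp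

lemma Ev_sum: "(\<And>i. i \<in> A \<Longrightarrow> f i \<in> Ev) \<Longrightarrow> sum f A \<in> Ev"
proof (induction A rule: infinite_finite_induct)
  case (insert x F)
  then show ?case by (simp only: sum.insert not_False_eq_True) (intro Ev_add; blast)
qed (simp_all only: sum.infinite sum.empty not_False_eq_True Ev_zero)

lemmas Ev_mem = Ev_add Ev_conv Ev_scl Ev_unit g_mem Ev_zero Ev_uminus Ev_sum

definition G :: "nat list \<Rightarrow> nat list \<Rightarrow> complex" where
  "G w = foldr (\<lambda>i x. g i \<star> x) w unit_word"

lemma G_simps [simp]: "G [] = unit_word" "G (i # w) = g i \<star> G w"
  by (simp_all add: G_def)

lemma G_append: "G (u @ v) = G u \<star> G v"
  by (induction u) (simp_all add: conv_assoc)

lemma G_mem: "set w \<subseteq> {..<2 * p} \<Longrightarrow> G w \<in> Ev"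
  by (induction w) (auto intro: Ev_mem)

lemma G_T: "set w \<subseteq> {..<2 * p} \<Longrightarrow> G w \<in> T"
  using G_mem Ev_subset by blast

lemma g_T: "i < 2 * p \<Longrightarrow> g i \<in> T"
  using g_mem Ev_subset by blast

section \<open>Increasing words in the generators and their span\<close>

definition W :: "nat list set" where
  "W = {w. sorted_wrt (<) w \<and> set w \<subseteq> {..<2 * p}}"

text \<open>An increasing word is determined by its set of letters, so \<open>W\<close> is the power
  set of the index set in disguise; this gives the count \<open>2 ^ (2 * p)\<close>.\<close>

lemma W_eq_image: "W = sorted_list_of_set ` Pow {..<2 * p}"
proof
  show "W \<subseteq> sorted_list_of_set ` Pow {..<2 * p}"
  proof
    fix w assume "w \<in> W"
    then show "w \<in> sorted_list_of_set ` Pow {..<2 * p}"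
      by (intro image_eqI[of _ _ "set w"])
         (auto simp: W_def strict_sorted_iff sorted_list_of_set.idem_if_sorted_distinct)
  qed
  show "sorted_list_of_set ` Pow {..<2 * p} \<subseteq> W"
    using finite_subset[of _ "{..<2 * p}"] by (auto simp: W_def)
qed

lemma finite_W: "finite W"
  by (simp add: W_eq_image)

lemma card_W: "card W = 2 ^ (2 * p)"
proof -
  have "inj_on sorted_list_of_set (Pow {..<2 * p})"
    by (rule inj_onI) (metis PowD finite_lessThan finite_subset set_sorted_list_of_set)
  then show ?thesis by (simp add: W_eq_image card_image card_Pow)
qed

lemma W_eqI: "u \<in> W \<Longrightarrow> v \<in> W \<Longrightarrow> set u = set v \<Longrightarrow> u = v"
  by (auto simp: W_def strict_sorted_equal)

lemma W_subset: "w \<in> W \<Longrightarrow> set w \<subseteq> {..<2 * p}"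
  by (simp add: W_def)

lemma Nil_in_W: "[] \<in> W"
  by (simp add: W_def)

definition comb :: "(nat list \<Rightarrow> complex) \<Rightarrow> nat list \<Rightarrow> complex" where
  "comb c = (\<Sum>w\<in>W. c w \<cdot> G w)"

definition spanned :: "(nat list \<Rightarrow> complex) \<Rightarrow> bool" where
  "spanned x \<longleftrightarrow> (\<exists>c. range c \<subseteq> K \<and> x \<approx> comb c)"

lemma spanned_cong: "x \<approx> y \<Longrightarrow> spanned y \<Longrightarrow> spanned x"
  unfolding spanned_def by (blast intro: eqv_trans)

lemma spanned_add: "spanned x \<Longrightarrow> spanned y \<Longrightarrow> spanned (x + y)"
  unfolding spanned_def
proof (elim exE conjE)
  fix c d assume *: "range c \<subseteq> K" "range d \<subseteq> K" "x \<approx> comb c" "y \<approx> comb d"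
  have "comb c + comb d = comb (\<lambda>w. c w + d w)"
    by (simp only: comb_def scl_add_left sum.distrib)
  with * show "\<exists>c. range c \<subseteq> K \<and> x + y \<approx> comb c"
    by (intro exI[of _ "\<lambda>w. c w + d w"]) (auto simp: image_subset_iff dest: eqv_add)
qed

lemma spanned_scl: "a \<in> K \<Longrightarrow> spanned x \<Longrightarrow> spanned (a \<cdot> x)"
  unfolding spanned_def
proof (elim exE conjE)
  fix c assume *: "a \<in> K" "range c \<subseteq> K" "x \<approx> comb c"
  have "a \<cdot> comb c = comb (\<lambda>w. a * c w)"
    by (simp only: comb_def scl_sum_right scl_scl)
  with * eqv_scl[OF *(1,3)] show "\<exists>c. range c \<subseteq> K \<and> a \<cdot> x \<approx> comb c"
    by (intro exI[of _ "\<lambda>w. a * c w"]) (auto simp: image_subset_iff)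
qed

lemma comb_single: "w \<in> W \<Longrightarrow> comb (\<lambda>v. if v = w then 1 else 0) = G w"
proof -
  assume "w \<in> W"
  have "comb (\<lambda>v. if v = w then 1 else 0) = (\<Sum>v\<in>W. if v = w then G v else 0)"
    unfolding comb_def by (rule sum.cong) (auto simp only: scl_one scl_zero split: if_split)
  then show ?thesis using finite_W \<open>w \<in> W\<close> by (simp only: sum.delta if_True)
qed

lemma spanned_G: "w \<in> W \<Longrightarrow> spanned (G w)"
  unfolding spanned_def
  by (intro exI[of _ "\<lambda>v. if v = w then 1 else 0"]) (auto simp only: comb_single eqv_refl image_subset_iff zero_mem one_mem split: if_split)

lemma spanned_zero: "spanned 0"
  using spanned_scl[OF zero_mem spanned_G[OF Nil_in_W]] by simp

lemma spanned_uminus: "spanned x \<Longrightarrow> spanned (- x)"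
  using spanned_scl[of "-1" x] by simp

lemma spanned_sum: "(\<And>i. i \<in> A \<Longrightarrow> spanned (f i)) \<Longrightarrow> spanned (sum f A)"
proof (induction A rule: infinite_finite_induct)
  case (insert x F)
  then show ?case by (simp only: sum.insert not_False_eq_True) (intro spanned_add; blast)
qed (simp_all only: sum.infinite sum.empty not_False_eq_True spanned_zero)

lemma g_square_eqv: "i < 2 * p \<Longrightarrow> g i \<star> g i \<approx> \<gamma> i \<cdot> unit_word"
  unfolding eqv_def by (rule g_square)

lemma g_anticommute_eqv: "i < 2 * p \<Longrightarrow> j < 2 * p \<Longrightarrow> i \<noteq> j \<Longrightarrow> g i \<star> g j \<approx> - (g j \<star> g i)"
  unfolding eqv_def by (simp only: diff_minus_eq_add) (rule g_anticommute)

lemma g_square_left: "i < 2 * p \<Longrightarrow> x \<in> T \<Longrightarrow> g i \<star> (g i \<star> x) \<approx> \<gamma> i \<cdot> x"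
  using eqv_right[of x, OF _ g_square_eqv] by (simp add: conv_assoc)

lemma g_swap_left:
  "i < 2 * p \<Longrightarrow> j < 2 * p \<Longrightarrow> i \<noteq> j \<Longrightarrow> x \<in> T \<Longrightarrow> g i \<star> (g j \<star> x) \<approx> - (g j \<star> (g i \<star> x))"
  using eqv_right[of x, OF _ g_anticommute_eqv] by (simp add: conv_assoc)

text \<open>The letter \<open>a\<close> moves to the right past smaller letters, at the cost of
  signs, until it finds its place or meets its equal and is absorbed by the square relation. The
  bound on \<open>set v\<close> is carried along so that \<open>b # v\<close> in the last case is
  again increasing.\<close>

lemma g_mult_G:
  assumes "a < 2 * p" "w \<in> W"
  shows "\<exists>c\<in>K. \<exists>v\<in>W. set v \<subseteq> insert a (set w) \<and> g a \<star> G w \<approx> c \<cdot> G v"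
  using assms(2)
proof (induction w)
  case Nil
  have "[a] \<in> W" using assms(1) by (simp add: W_def)
  then show ?case by (intro bexI[of _ 1] bexI[of _ "[a]"]) auto
next
  case (Cons b w)
  then have b: "b < 2 * p" and w: "w \<in> W" and bw: "\<And>x. x \<in> set w \<Longrightarrow> b < x" by (auto simp: W_def)
  show ?case
  proof (cases a b rule: linorder_cases)
    case 1: less
    then have "a # b # w \<in> W" using Cons.prems assms(1) by (fastforce simp: W_def)
    then show ?thesis by (intro bexI[of _ 1] bexI[of _ "a # b # w"]) auto
  next
    case 2: equal
    then show ?thesis using g_square_left[OF b G_T[OF W_subset[OF w]]] w \<gamma>_mem[OF b]
      by (intro bexI[of _ "\<gamma> b"] bexI[of _ w]) auto
  next
    case 3: greater
    from Cons.IH[OF w] obtain c v where c: "c \<in> K" "v \<in> W" "set v \<subseteq> insert a (set w)"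
      "g a \<star> G w \<approx> c \<cdot> G v" by blast
    have "b # v \<in> W" using b c 3 bw by (auto simp: W_def)
    have "g a \<star> (g b \<star> G w) \<approx> - (g b \<star> (g a \<star> G w))"
      by (rule g_swap_left) (use 3 assms b G_T[OF W_subset[OF w]] in auto)
    also have "\<dots> \<approx> - (g b \<star> (c \<cdot> G v))"
      by (intro eqv_uminus eqv_left c g_T b)
    finally have "g a \<star> G (b # w) \<approx> (- c) \<cdot> G (b # v)" by simp
    then show ?thesis using \<open>b # v \<in> W\<close> c 
      by (intro bexI[of _ "- c"] bexI[of _ "b # v"]) (auto simp del: scl_uminus_left G_simps)
  qed
qed

lemma spanned_g_mult:
  assumes "a < 2 * p" "spanned x"
  shows "spanned (g a \<star> x)"
proof -
  obtain c where c: "range c \<subseteq> K" "x \<approx> comb c" using assms(2) unfolding spanned_def by blast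
  have "g a \<star> x \<approx> g a \<star> comb c" by (intro eqv_left g_T assms c)
  moreover have "g a \<star> comb c = (\<Sum>w\<in>W. c w \<cdot> (g a \<star> G w))"
    by (simp only: comb_def conv_sum_right conv_scl_right)
  moreover have "spanned (\<Sum>w\<in>W. c w \<cdot> (g a \<star> G w))"
  proof (rule spanned_sum)
    fix w assume "w \<in> W"
    then obtain d v where "d \<in> K" "v \<in> W" "g a \<star> G w \<approx> d \<cdot> G v" using g_mult_G[OF assms(1)] by blast
    then have "spanned (g a \<star> G w)" by (blast intro: spanned_cong spanned_scl spanned_G)
    then show "spanned (c w \<cdot> (g a \<star> G w))" using c by (intro spanned_scl) auto
  qed
  ultimately show ?thesis by (simp add: spanned_cong)
qed

section \<open>Commutation signs and averaging over conjugation\<close>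

definition sgnw :: "nat \<Rightarrow> nat list \<Rightarrow> complex" where
  "sgnw i u = (- 1) ^ (length u + count_list u i)"

lemma sgnw_cases: "sgnw i u = 1 \<or> sgnw i u = - 1"
  by (simp add: sgnw_def minus_one_power_iff)

lemma sgnw_K: "sgnw i u \<in> K"
  using sgnw_cases[of i u] by auto

text \<open>Passing \<open>g i\<close> through a word changes the sign once for each letter
  different from \<open>i\<close>. Adding \<open>count_list u i\<close> to the length has the same
  parity as subtracting it and avoids truncated subtraction.\<close>

lemma g_G_commute:
  assumes "i < 2 * p" "set u \<subseteq> {..<2 * p}"
  shows "g i \<star> G u \<approx> sgnw i u \<cdot> (G u \<star> g i)"
  using assms(2)
proof (induction u)
  case Nil then show ?case by (simp add: sgnw_def)
next
  case (Cons j u)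
  then have j: "j < 2 * p" and u: "set u \<subseteq> {..<2 * p}" by auto
  note IH = Cons.IH[OF u]
  have *: "g j \<star> (g i \<star> G u) \<approx> sgnw i u \<cdot> (G (j # u) \<star> g i)"
    using eqv_left[OF g_T[OF j] IH] by (simp add: conv_assoc)
  show ?case
  proof (cases "i = j")
    case True
    then show ?thesis using * by (simp add: sgnw_def)
  next
    case False
    have "g i \<star> G (j # u) \<approx> - (g j \<star> (g i \<star> G u))"
      using g_swap_left[OF assms(1) j False G_T[OF u]] by simp
    also have "\<dots> \<approx> - (sgnw i u \<cdot> (G (j # u) \<star> g i))" by (rule eqv_uminus[OF *])
    also have "\<dots> = sgnw i (j # u) \<cdot> (G (j # u) \<star> g i)"
      using False by (simp only: sgnw_def scl_uminus_left[symmetric]) simp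
    finally show ?thesis .
  qed
qed

text \<open>Half the sum of \<open>x\<close> and its conjugate by \<open>g i\<close>, since
  \<open>(1 / \<gamma> i) \<cdot> g i\<close> is inverse to \<open>g i\<close> modulo
  \<open>I\<close>. On the quotient it is the projection onto the commutant of
  \<open>g i\<close>.\<close>

definition av :: "nat \<Rightarrow> (nat list \<Rightarrow> complex) \<Rightarrow> nat list \<Rightarrow> complex" where
  "av i x = (1 / 2) \<cdot> (x + (1 / \<gamma> i) \<cdot> (g i \<star> x \<star> g i))"

lemma av_add: "av i (x + y) = av i x + av i y"
  by (simp add: av_def conv_add_left conv_add_right scl_add_right)

lemma av_scl: "av i (c \<cdot> x) = c \<cdot> av i x"
  by (simp add: av_def scl_add_right mult_ac)

lemma av_cong: "i < 2 * p \<Longrightarrow> x \<approx> y \<Longrightarrow> av i x \<approx> av i y"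
  unfolding av_def by (intro eqv_scl eqv_add eqv_left eqv_right g_T) (auto intro: \<gamma>_mem)

lemma av_G:
  assumes i: "i < 2 * p" and u: "set u \<subseteq> {..<2 * p}"
  shows "av i (G u) \<approx> (if sgnw i u = 1 then 1 else 0) \<cdot> G u"
proof -
  have "g i \<star> G u \<star> g i \<approx> sgnw i u \<cdot> (G u \<star> g i) \<star> g i"
    by (intro eqv_right g_G_commute g_T assms)
  also have "sgnw i u \<cdot> (G u \<star> g i) \<star> g i = sgnw i u \<cdot> (G u \<star> (g i \<star> g i))" by (simp add: conv_assoc)
  also have "\<dots> \<approx> sgnw i u \<cdot> (G u \<star> (\<gamma> i \<cdot> unit_word))"
    by (intro eqv_scl sgnw_K eqv_left G_T u g_square_eqv i)
  finally have "av i (G u) \<approx> (1 / 2) \<cdot> (G u + (1 / \<gamma> i) \<cdot> (sgnw i u \<cdot> (G u \<star> (\<gamma> i \<cdot> unit_word))))"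
    unfolding av_def by (intro eqv_scl eqv_add eqv_refl) (auto intro: \<gamma>_mem i)
  also have "\<dots> = (1 / 2 * (1 + sgnw i u)) \<cdot> G u"
    using \<gamma>_nonzero[OF i] by (simp add: scl_add_right scl_add_left distrib_left)
  also have "\<dots> = (if sgnw i u = 1 then 1 else 0) \<cdot> G u"
    using sgnw_cases[of i u] by auto
  finally show ?thesis .
qed

definition avs :: "nat list \<Rightarrow> (nat list \<Rightarrow> complex) \<Rightarrow> nat list \<Rightarrow> complex" where
  "avs xs = fold av xs"

lemma avs_simps [simp]: "avs [] x = x" "avs (i # xs) x = avs xs (av i x)"
  by (simp_all add: avs_def)

lemma avs_add: "avs xs (x + y) = avs xs x + avs xs y"
  by (induction xs arbitrary: x y) (simp_all add: av_add)

lemma avs_scl: "avs xs (c \<cdot> x) = c \<cdot> avs xs x"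
  by (induction xs arbitrary: x) (simp_all add: av_scl)

lemma avs_zero: "avs xs 0 = 0"
  using avs_scl[of xs 0 0] by simp

lemma avs_sum: "avs xs (sum f A) = (\<Sum>i\<in>A. avs xs (f i))"
  by (induction A rule: infinite_finite_induct)
     (simp_all only: sum.infinite sum.empty sum.insert avs_zero avs_add not_False_eq_True)

lemma avs_cong: "set xs \<subseteq> {..<2 * p} \<Longrightarrow> x \<approx> y \<Longrightarrow> avs xs x \<approx> avs xs y"
  by (induction xs arbitrary: x y) (auto intro: av_cong)

lemma avs_G:
  assumes "set xs \<subseteq> {..<2 * p}" "set u \<subseteq> {..<2 * p}"
  shows "avs xs (G u) \<approx> (if \<forall>i\<in>set xs. sgnw i u = 1 then 1 else 0) \<cdot> G u"
  using assms(1)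
proof (induction xs)
  case (Cons i xs)
  then have i: "i < 2 * p" and xs: "set xs \<subseteq> {..<2 * p}" by auto
  have "avs (i # xs) (G u) \<approx> avs xs ((if sgnw i u = 1 then 1 else 0) \<cdot> G u)"
    using avs_cong[OF xs av_G[OF i assms(2)]] by simp
  also have "\<dots> = (if sgnw i u = 1 then 1 else 0) \<cdot> avs xs (G u)" by (rule avs_scl)
  also have "\<dots> \<approx> (if sgnw i u = 1 then 1 else 0) \<cdot> (if \<forall>i\<in>set xs. sgnw i u = 1 then 1 else 0) \<cdot> G u"
    by (rule eqv_scl[OF _ Cons.IH[OF xs]]) auto
  also have "\<dots> = (if \<forall>i\<in>set (i # xs). sgnw i u = 1 then 1 else 0) \<cdot> G u" by simp
  finally show ?case .
qed simp

lemma count_list_distinct: "distinct u \<Longrightarrow> count_list u i = (if i \<in> set u then 1 else 0)"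
  by (induction u) auto

lemma sgnw_rev_append: "v \<in> W \<Longrightarrow> w \<in> W \<Longrightarrow>
  sgnw i (rev v @ w) = (- 1) ^ (card (set v) + card (set w) + (if i \<in> set v then 1 else 0) + (if i \<in> set w then 1 else 0))"
  by (auto simp: sgnw_def W_def strict_sorted_iff distinct_card count_list_distinct)

text \<open>The sign belonging to \<open>i\<close> depends only on the symmetric difference
  \<open>D\<close> of the two letter sets: its exponent has the parity of \<open>card D\<close>,
  increased by one if \<open>i\<close> lies in \<open>D\<close>. If \<open>card D\<close> is even,
  any element of the nonempty \<open>D\<close> gives -1. If it is odd, a letter outside
  \<open>D\<close> does, and such a letter exists because \<open>2 * p\<close> is even.\<close>

lemma exists_sign_change:
  assumes "v \<in> W" "w \<in> W" "v \<noteq> w"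
  shows "\<exists>i<2 * p. sgnw i (rev v @ w) = - 1"
proof -
  define D where "D = (set v - set w) \<union> (set w - set v)"
  have D: "D \<subseteq> {..<2 * p}" "D \<noteq> {}" using assms W_eqI[OF assms(1,2)] by (auto simp: D_def W_def)
  have card: "card (set v) + card (set w) = card D + 2 * card (set v \<inter> set w)"
  proof -
    have "card (set v) = card (set v - set w) + card (set v \<inter> set w)"
      by (metis List.finite_set card_Diff_subset_Int card_mono finite_Int inf_le1 le_add_diff_inverse2)
    moreover have "card (set w) = card (set w - set v) + card (set v \<inter> set w)"
      by (metis List.finite_set card_Diff_subset_Int card_mono finite_Int inf_le1 le_add_diff_inverse2 inf_commute)
    moreover have "card D = card (set v - set w) + card (set w - set v)"
      unfolding D_def by (rule card_Un_disjoint) auto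
    ultimately show ?thesis by simp
  qed
  have "\<exists>i<2 * p. odd (card D) \<longleftrightarrow> i \<notin> D"
  proof (cases "odd (card D)")
    case True
    then have "D \<noteq> {..<2 * p}" by auto
    then show ?thesis using D True by blast
  next
    case False
    then show ?thesis using D by blast
  qed
  then obtain i where i: "i < 2 * p" "odd (card D) \<longleftrightarrow> i \<notin> D" by blast
  have "odd (card (set v) + card (set w) + (if i \<in> set v then 1 else 0) + (if i \<in> set w then 1 else 0))"
    using i(2) unfolding card by (auto simp: D_def)
  then show ?thesis using i(1) by (auto simp: sgnw_rev_append[OF assms(1,2)])
qed

definition \<Gamma> :: "nat list \<Rightarrow> complex" where
  "\<Gamma> v = prod_list (map \<gamma> v)"

lemma \<Gamma>_props: "set v \<subseteq> {..<2 * p} \<Longrightarrow> \<Gamma> v \<in> K \<and> \<Gamma> v \<noteq> 0"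
  by (induction v) (auto simp: \<Gamma>_def \<gamma>_nonzero \<gamma>_mem)

text \<open>The reversed word is the inverse of \<open>G v\<close> up to a scalar: the two innermost
  letters are equal, collapse to a scalar, and expose the next pair.\<close>

lemma G_rev_mult:
  assumes "set v \<subseteq> {..<2 * p}"
  shows "G (rev v @ v) \<approx> \<Gamma> v \<cdot> unit_word"
  using assms
proof (induction v)
  case Nil then show ?case by (simp add: \<Gamma>_def)
next
  case (Cons b v)
  then have b: "b < 2 * p" and v: "set v \<subseteq> {..<2 * p}" by auto
  have eq: "G (rev (b # v) @ b # v) = G (rev v) \<star> (g b \<star> (g b \<star> G v))"
    by (simp add: G_append conv_assoc)
  have "G (rev v) \<star> (g b \<star> (g b \<star> G v)) \<approx> G (rev v) \<star> (\<gamma> b \<cdot> G v)"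
    by (intro eqv_left g_square_left b G_T) (use v in auto)
  then have "G (rev (b # v) @ b # v) \<approx> \<gamma> b \<cdot> G (rev v @ v)"
    by (simp only: eq conv_scl_right G_append[of "rev v" v])
  also have "\<dots> \<approx> \<gamma> b \<cdot> \<Gamma> v \<cdot> unit_word"
    by (intro eqv_scl Cons.IH v \<gamma>_mem b)
  finally show ?case by (simp add: \<Gamma>_def)
qed

text \<open>Averaging over conjugation by the generators annihilates every basis word except the unit,
  so it reads off coefficients.\<close>

lemma avs_coefficient:
  assumes x: "x \<approx> comb c" and c: "range c \<subseteq> K" and v: "v \<in> W"
  shows "avs [0..<2 * p] (G (rev v) \<star> x) \<approx> (c v * \<Gamma> v) \<cdot> unit_word"
proof -
  have vs: "set v \<subseteq> {..<2 * p}" by (rule W_subset[OF v])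
  have cK: "c w \<in> K" for w using c by auto
  have "avs [0..<2 * p] (G (rev v) \<star> x) \<approx> avs [0..<2 * p] (G (rev v) \<star> comb c)"
    by (intro avs_cong eqv_left x G_T) (use vs in auto)
  also have "\<dots> = (\<Sum>w\<in>W. c w \<cdot> avs [0..<2 * p] (G (rev v @ w)))"
    by (simp only: comb_def conv_sum_right conv_scl_right avs_sum avs_scl G_append)
  also have "\<dots> \<approx> (\<Sum>w\<in>W. if w = v then (c v * \<Gamma> v) \<cdot> unit_word else 0)"
  proof (rule eqv_sum)
    fix w assume w: "w \<in> W"
    have sub: "set (rev v @ w) \<subseteq> {..<2 * p}" using vs W_subset[OF w] by auto
    have av: "avs [0..<2 * p] (G (rev v @ w)) \<approx>
        (if \<forall>i<2 * p. sgnw i (rev v @ w) = 1 then 1 else 0) \<cdot> G (rev v @ w)"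
      using avs_G[OF _ sub, of "[0..<2 * p]"] by (simp add: Ball_def atLeast0LessThan)
    show "c w \<cdot> avs [0..<2 * p] (G (rev v @ w)) \<approx> (if w = v then (c v * \<Gamma> v) \<cdot> unit_word else 0)"
    proof (cases "w = v")
      case True
      have "sgnw i (rev v @ v) = 1" for i by (simp add: sgnw_rev_append v)
      then have "avs [0..<2 * p] (G (rev v @ w)) \<approx> G (rev v @ v)" using av True by simp
      also have "\<dots> \<approx> \<Gamma> v \<cdot> unit_word" by (rule G_rev_mult[OF vs])
      finally have "c w \<cdot> avs [0..<2 * p] (G (rev v @ w)) \<approx> c w \<cdot> \<Gamma> v \<cdot> unit_word"
        by (intro eqv_scl cK)
      then show ?thesis using True by simp
    next
      case False
      then obtain i where "i < 2 * p" "sgnw i (rev v @ w) = - 1" using exists_sign_change[OF v w] by auto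
      then have "\<not> (\<forall>i<2 * p. sgnw i (rev v @ w) = 1)" by (metis one_neq_neg_one)
      then have "avs [0..<2 * p] (G (rev v @ w)) \<approx> 0" using av by (simp only: if_False scl_zero)
      then have "c w \<cdot> avs [0..<2 * p] (G (rev v @ w)) \<approx> c w \<cdot> 0" by (intro eqv_scl cK)
      then show ?thesis using False by simp
    qed
  qed
  also have "\<dots> = (c v * \<Gamma> v) \<cdot> unit_word"
    using finite_W v by (simp only: sum.delta if_True)
  finally show ?thesis .
qed

lemma avs_mem_two_sided:
  assumes "\<And>x y. x \<in> J \<Longrightarrow> y \<in> J \<Longrightarrow> x + y \<in> J"
    and "\<And>c x. c \<in> K \<Longrightarrow> x \<in> J \<Longrightarrow> c \<cdot> x \<in> J"
    and "\<And>e x. e \<in> Ev \<Longrightarrow> x \<in> J \<Longrightarrow> e \<star> x \<in> J"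
    and "\<And>e x. e \<in> Ev \<Longrightarrow> x \<in> J \<Longrightarrow> x \<star> e \<in> J"
    and "set xs \<subseteq> {..<2 * p}" "x \<in> J"
  shows "avs xs x \<in> J"
  using assms(5,6)
proof (induction xs arbitrary: x)
  case (Cons i xs)
  then have "av i x \<in> J" unfolding av_def by (intro assms(1-4) g_mem) (auto intro: \<gamma>_mem)
  then show ?case using Cons by simp
qed simp

text \<open>This is applied to two choices of \<open>J\<close>: the preimage of an ideal of the
  quotient, which gives simplicity, and the kernel of a matrix evaluation, which gives faithfulness.
  An element outside \<open>I\<close> has a nonzero coefficient; multiplication and averaging, under
  which \<open>J\<close> is stable, turn the element into a nonzero multiple of the unit.\<close>

lemma unit_in_two_sided:
  assumes J: "\<And>x y. x \<in> J \<Longrightarrow> y \<in> J \<Longrightarrow> x + y \<in> J"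
    "\<And>c x. c \<in> K \<Longrightarrow> x \<in> J \<Longrightarrow> c \<cdot> x \<in> J"
    "\<And>e x. e \<in> Ev \<Longrightarrow> x \<in> J \<Longrightarrow> e \<star> x \<in> J"
    "\<And>e x. e \<in> Ev \<Longrightarrow> x \<in> J \<Longrightarrow> x \<star> e \<in> J"
    and cong: "\<And>x y. x \<in> J \<Longrightarrow> x \<approx> y \<Longrightarrow> y \<in> Ev \<Longrightarrow> y \<in> J"
    and x: "x \<in> J" "x \<notin> I" "spanned x"
  shows "unit_word \<in> J"
proof -
  obtain c where c: "range c \<subseteq> K" "x \<approx> comb c" using x(3) unfolding spanned_def by blast
  have "\<exists>v\<in>W. c v \<noteq> 0"
  proof (rule ccontr)
    assume "\<not> ?thesis"
    then have "comb c = 0" unfolding comb_def by (intro sum.neutral) auto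
    then show False using c x(2) eqv_zero_iff by metis
  qed
  then obtain v where v: "v \<in> W" "c v \<noteq> 0" by blast
  note \<Gamma> = \<Gamma>_props[OF W_subset[OF v(1)]]
  let ?k = "c v * \<Gamma> v"
  have k: "?k \<noteq> 0" "?k \<in> K" using v \<Gamma> c by auto
  have "avs [0..<2 * p] (G (rev v) \<star> x) \<in> J"
    by (rule avs_mem_two_sided[OF J]) (use W_subset[OF v(1)] in \<open>auto intro!: J(3) G_mem x\<close>)
  from cong[OF this avs_coefficient[OF c(2,1) v(1)]] have "?k \<cdot> unit_word \<in> J"
    using k by (auto intro: Ev_mem)
  from J(2)[OF inverse_mem[OF k(2)] this] show ?thesis
    using k(1) by (simp only: scl_scl left_inverse scl_one not_False_eq_True)
qed

lemma comb_mem: "range c \<subseteq> K \<Longrightarrow> comb c \<in> Ev"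
  unfolding comb_def by (intro Ev_sum Ev_scl G_mem W_subset) auto

text \<open>The combination is congruent to 0 and so has average 0, while averaging extracts the
  unit with the factor \<open>c v * \<Gamma> v\<close>. Hence the words can only be dependent if the
  whole quotient collapses.\<close>

lemma comb_in_I_imp_zero:
  assumes unit: "unit_word \<notin> I" and "range c \<subseteq> K" "comb c \<in> I" "v \<in> W"
  shows "c v = 0"
proof (rule ccontr)
  assume nz: "c v \<noteq> 0"
  have "0 \<approx> comb c" by (rule eqv_sym) (simp only: eqv_zero_iff assms)
  from avs_coefficient[OF this assms(2,4)]
  have "(c v * \<Gamma> v) \<cdot> unit_word \<in> I"
    by (metis avs_zero conv_zero_right eqv_sym eqv_zero_iff)
  moreover have k: "c v * \<Gamma> v \<in> K" "c v * \<Gamma> v \<noteq> 0"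
    using nz \<Gamma>_props[OF W_subset[OF assms(4)]] assms(2) by auto
  ultimately have "inverse (c v * \<Gamma> v) \<cdot> (c v * \<Gamma> v) \<cdot> unit_word \<in> I"
    by (intro I_scl[of "inverse (c v * \<Gamma> v)"] inverse_mem)
  also have "inverse (c v * \<Gamma> v) \<cdot> (c v * \<Gamma> v) \<cdot> unit_word = unit_word"
    using k by (simp only: scl_scl left_inverse scl_one not_False_eq_True)
  finally show False using unit by simp
qed

end

section \<open>The quotient as an algebra of cosets\<close>

context tensor_ideal
begin

abbreviation coset :: "(nat list \<Rightarrow> complex) \<Rightarrow> (nat list \<Rightarrow> complex) set" where
  "coset x \<equiv> I +>\<^bsub>tensor_algebra K m\<^esub> x"

lemma coset_eq_iff: "x \<in> T \<Longrightarrow> y \<in> T \<Longrightarrow> coset x = coset y \<longleftrightarrow> x \<approx> y"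
  using I.quotient_eq_iff_same_a_r_cos[OF ideal_I, of x y]
  by (simp add: tensor_a_minus eqv_def)

lemma coset_zero: "coset 0 = I"
  using I.a_rcos_zero[OF ideal_I I_zero] by simp

lemma coset_self: "x \<in> T \<Longrightarrow> x \<in> coset x"
  by (rule I.a_rcos_self)

lemma in_coset: "x \<in> T \<Longrightarrow> y \<in> coset x \<Longrightarrow> y \<in> T \<and> coset y = coset x"
proof -
  assume "x \<in> T" "y \<in> coset x"
  then obtain h where h: "h \<in> I" "y = h + x" by (auto simp: a_r_coset_def r_coset_def)
  then have y: "y \<in> T" using I_subset[OF h(1)] \<open>x \<in> T\<close> by (auto intro: tensor_mem)
  moreover have "y - x = h" by (simp only: h add_diff_cancel_right')
  then have "y \<approx> x" using h by (simp only: eqv_def)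
  ultimately show ?thesis using \<open>x \<in> T\<close> by (simp add: coset_eq_iff)
qed

text \<open>Scalar multiplication on \<open>quotient_algebra\<close> is a union over all
  representatives; since they all lead to the same coset, the union is that coset.\<close>

lemma coset_smult:
  assumes "c \<in> K" "x \<in> T"
  shows "(\<Union>y\<in>coset x. coset (c \<cdot> y)) = coset (c \<cdot> x)"
proof -
  have "coset (c \<cdot> y) = coset (c \<cdot> x)" if "y \<in> coset x" for y
  proof -
    have "y \<in> T" "y \<approx> x" using in_coset[OF assms(2) that] assms by (auto simp: coset_eq_iff)
    then have "c \<cdot> y \<approx> c \<cdot> x" "c \<cdot> y \<in> T" "c \<cdot> x \<in> T" using assms by (auto intro: eqv_scl tensor_mem)
    then show ?thesis by (simp add: coset_eq_iff)
  qed
  then show ?thesis using coset_self[OF assms(2)] by blast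
qed

end

context anticommuting_quotient
begin

definition alg :: "(complex, (nat list \<Rightarrow> complex) set) module" where
  "alg = (quotient_algebra (tensor_algebra K m) I)\<lparr>carrier := {coset x | x. x \<in> Ev}\<rparr>"

lemma carrier_alg: "carrier alg = coset ` Ev"
  by (auto simp: alg_def)

lemma coset_in_alg: "x \<in> Ev \<Longrightarrow> coset x \<in> carrier alg"
  by (simp add: carrier_alg)

lemma mult_alg: "x \<in> T \<Longrightarrow> y \<in> T \<Longrightarrow> coset x \<otimes>\<^bsub>alg\<^esub> coset y = coset (x \<star> y)"
  using I.rcoset_mult_add[of x y] by (simp add: alg_def quotient_algebra_def FactRing_def)

lemma add_alg: "x \<in> T \<Longrightarrow> y \<in> T \<Longrightarrow> coset x \<oplus>\<^bsub>alg\<^esub> coset y = coset (x + y)"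
  using I.a_rcos_sum[of x y] by (simp add: alg_def quotient_algebra_def FactRing_def)

lemma one_alg: "\<one>\<^bsub>alg\<^esub> = coset unit_word"
  by (simp add: alg_def quotient_algebra_def FactRing_def)

lemma zero_alg: "\<zero>\<^bsub>alg\<^esub> = coset 0"
  by (simp add: alg_def quotient_algebra_def FactRing_def coset_zero)

lemma smult_alg: "c \<in> K \<Longrightarrow> x \<in> T \<Longrightarrow> c \<odot>\<^bsub>alg\<^esub> coset x = coset (c \<cdot> x)"
  using coset_smult[of c x] by (simp add: alg_def quotient_algebra_def)

lemmas alg_ops = mult_alg add_alg one_alg zero_alg smult_alg

lemma ring_alg: "ring alg"
proof (rule ringI)
  show "abelian_group alg"
  proof (rule abelian_groupI)
    fix x assume "x \<in> carrier alg"
    then obtain u where u: "u \<in> Ev" "x = coset u" by (auto simp: carrier_alg)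
    show "\<exists>y\<in>carrier alg. y \<oplus>\<^bsub>alg\<^esub> x = \<zero>\<^bsub>alg\<^esub>"
      by (rule bexI[of _ "coset (- u)"])
         (use u in \<open>simp_all add: alg_ops Ev_subset Ev_uminus coset_in_alg\<close>)
  qed (auto simp: carrier_alg alg_ops Ev_subset Ev_mem add_ac)
  show "Group.monoid alg"
    by (rule monoidI) (auto simp: carrier_alg alg_ops Ev_subset Ev_mem conv_assoc)
qed (auto simp: carrier_alg alg_ops Ev_subset Ev_mem conv_add_left conv_add_right)

lemma assoc_algebra_alg: "assoc_algebra (subfield_ring K) alg"
  unfolding assoc_algebra_def
proof (intro conjI ballI)
  interpret A: ring alg by (rule ring_alg)
  show "module (subfield_ring K) alg"
    by (rule moduleI[OF cring_subfield_ring A.is_abelian_group])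
       (auto simp: carrier_alg alg_ops Ev_subset Ev_mem scl_add_left scl_add_right)
qed (auto simp: carrier_alg alg_ops Ev_subset Ev_mem intro: ring_alg)

lemma finsum_alg:
  assumes "finite A" "\<And>i. i \<in> A \<Longrightarrow> f i \<in> Ev"
  shows "(\<Oplus>\<^bsub>alg\<^esub>i\<in>A. coset (f i)) = coset (sum f A)"
  using assms
proof (induction A)
  interpret A: ring alg by (rule ring_alg)
  case empty
  show ?case by (simp only: A.finsum_empty sum.empty zero_alg)
next
  interpret A: ring alg by (rule ring_alg)
  case (insert a A)
  then have "(\<Oplus>\<^bsub>alg\<^esub>i\<in>insert a A. coset (f i)) = coset (f a) \<oplus>\<^bsub>alg\<^esub> coset (sum f A)"
    by (subst A.finsum_insert) (auto simp: carrier_alg)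
  also have "\<dots> = coset (f a + sum f A)"
    using insert.prems by (intro add_alg Ev_subset Ev_sum) auto
  finally show ?case using insert.hyps by (simp only: sum.insert not_False_eq_True)
qed

end

text \<open>The first condition says that the generators exhaust \<open>Ev\<close>. The second
  excludes a zero quotient, which the relations alone do not do; it is later discharged by
  exhibiting matrices that satisfy the relations.\<close>

locale spanned_quotient = anticommuting_quotient K m I Ev p g \<gamma> for K m I Ev p g \<gamma> +
  assumes Ev_spanned: "x \<in> Ev \<Longrightarrow> spanned x"
    and unit_notin_I: "unit_word \<notin> I"
begin

text \<open>\<open>finite_dimensional\<close> indexes coefficients by the spanning elements
  themselves, so distinct words must give distinct cosets before coefficients of words can be
  transported to cosets.\<close>

lemma coset_G_inj: "inj_on (\<lambda>w. coset (G w)) W"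
proof (rule inj_onI)
  fix u v assume u: "u \<in> W" and v: "v \<in> W" and eq: "coset (G u) = coset (G v)"
  define c where "c = (\<lambda>w. (if w = u then 1 else 0) - (if w = v then 1 else 0) :: complex)"
  have "comb c = G u - G v"
    unfolding comb_single[OF u, symmetric] comb_single[OF v, symmetric]
    by (simp only: c_def comb_def scl_diff_left sum_subtractf)
  moreover have "G u - G v \<in> I" using eq u v by (simp add: coset_eq_iff G_T W_subset eqv_def)
  moreover have "range c \<subseteq> K" by (auto simp: c_def)
  ultimately have "c u = 0" using comb_in_I_imp_zero[OF unit_notin_I, of c u] u by simp
  then show "u = v" by (simp add: c_def split: if_splits)
qed

lemma alg_combination:
  assumes "C \<in> carrier alg"
  shows "\<exists>f. (\<forall>s\<in>(\<lambda>w. coset (G w)) ` W. f s \<in> K) \<and>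
    C = finsum alg (\<lambda>s. module.smult alg (f s) s) ((\<lambda>w. coset (G w)) ` W)"
proof -
  interpret A: ring alg by (rule ring_alg)
  obtain x where x: "x \<in> Ev" "C = coset x" using assms by (auto simp: carrier_alg)
  obtain c where c: "range c \<subseteq> K" "x \<approx> comb c"
    using Ev_spanned[OF x(1)] unfolding spanned_def by blast
  let ?f = "\<lambda>s. c (inv_into W (\<lambda>w. coset (G w)) s)"
  have f: "?f (coset (G w)) = c w" if "w \<in> W" for w
    using inv_into_f_f[OF coset_G_inj that] by simp
  have cK: "c w \<in> K" for w using c by auto
  have GE: "G w \<in> Ev" if "w \<in> W" for w using G_mem[OF W_subset[OF that]] .
  have cos: "module.smult alg (?f (coset (G w))) (coset (G w)) = coset (c w \<cdot> G w)" if "w \<in> W" for w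
    unfolding f[OF that] by (rule smult_alg[OF cK Ev_subset[OF GE[OF that]]])
  have mem: "coset (c w \<cdot> G w) \<in> carrier alg" if "w \<in> W" for w
    by (intro coset_in_alg Ev_scl cK GE that)
  have "finsum alg (\<lambda>s. module.smult alg (?f s) s) ((\<lambda>w. coset (G w)) ` W)
      = finsum alg (\<lambda>w. module.smult alg (?f (coset (G w))) (coset (G w))) W"
    by (rule A.finsum_reindex[OF _ coset_G_inj]) (use cos mem in auto)
  also have "\<dots> = finsum alg (\<lambda>w. coset (c w \<cdot> G w)) W"
    by (rule A.finsum_cong') (use cos mem in auto)
  also have "\<dots> = coset (comb c)"
    unfolding comb_def by (rule finsum_alg[OF finite_W]) (rule Ev_scl[OF cK GE])
  also have "\<dots> = C"
    unfolding x(2) by (rule coset_eq_iff[THEN iffD2, OF _ _ eqv_sym[OF c(2)]])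
      (use x comb_mem[OF c(1)] Ev_subset in auto)
  finally show ?thesis using f cK by (intro exI[of _ ?f]) auto
qed

lemma finite_dimensional_alg: "finite_dimensional (subfield_ring K) alg"
  unfolding finite_dimensional_def
proof (intro exI conjI ballI)
  show "(\<lambda>w. coset (G w)) ` W \<subseteq> carrier alg"
    using coset_in_alg[OF G_mem[OF W_subset]] by auto
  show "finite ((\<lambda>w. coset (G w)) ` W)" using finite_W by simp
  fix C assume "C \<in> carrier alg"
  from alg_combination[OF this] obtain f where "\<forall>s\<in>(\<lambda>w. coset (G w)) ` W. f s \<in> K"
    "C = finsum alg (\<lambda>s. module.smult alg (f s) s) ((\<lambda>w. coset (G w)) ` W)" by blast
  then show "\<exists>f\<in>(\<lambda>w. coset (G w)) ` W \<rightarrow> carrier (subfield_ring K).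
      C = finsum alg (\<lambda>s. module.smult alg (f s) s) ((\<lambda>w. coset (G w)) ` W)"
    by (intro bexI[of _ f]) auto
qed

text \<open>A central element is fixed by every averaging operator, whereas all of them together
  leave only the coefficient of the empty word.\<close>

lemma central_imp_scalar:
  assumes x: "x \<in> Ev" and comm: "\<And>y. y \<in> Ev \<Longrightarrow> x \<star> y \<approx> y \<star> x"
  shows "\<exists>c\<in>K. x \<approx> c \<cdot> unit_word"
proof -
  obtain c where c: "range c \<subseteq> K" "x \<approx> comb c" using Ev_spanned[OF x] unfolding spanned_def by blast
  have av: "av i x \<approx> x" if i: "i < 2 * p" for i
  proof -
    have "g i \<star> x \<star> g i \<approx> x \<star> g i \<star> g i"
      by (intro eqv_right g_T i eqv_sym[OF comm] g_mem)
    moreover have "x \<star> (g i \<star> g i) \<approx> x \<star> (\<gamma> i \<cdot> unit_word)"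
      by (intro eqv_left Ev_subset x g_square_eqv i)
    ultimately have "g i \<star> x \<star> g i \<approx> \<gamma> i \<cdot> x"
      by (simp only: conv_assoc conv_scl_right conv_unit_right) (rule eqv_trans)
    then have "av i x \<approx> (1 / 2) \<cdot> (x + (1 / \<gamma> i) \<cdot> \<gamma> i \<cdot> x)"
      unfolding av_def by (intro eqv_scl eqv_add eqv_refl) (auto intro: \<gamma>_mem i)
    moreover have "(1 / 2) \<cdot> (x + (1 / \<gamma> i) \<cdot> \<gamma> i \<cdot> x) = x"
    proof -
      have "(1 / 2) \<cdot> (x + (1 / \<gamma> i) \<cdot> \<gamma> i \<cdot> x) = (1 / 2 + 1 / 2) \<cdot> x"
        using \<gamma>_nonzero[OF i]
        by (simp only: scl_add_left scl_add_right scl_scl) (simp only: nonzero_eq_divide_eq mult_1_right times_divide_eq_left divide_self not_False_eq_True mult_1_left)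
      then show ?thesis by simp
    qed
    ultimately show ?thesis by simp
  qed
  have avs: "avs xs x \<approx> x" if "set xs \<subseteq> {..<2 * p}" for xs
    using that
  proof (induction xs)
    case (Cons i xs)
    then have "avs (i # xs) x \<approx> avs xs x" using avs_cong[of xs "av i x" x] av[of i] by auto
    also have "\<dots> \<approx> x" using Cons by auto
    finally show ?case .
  qed simp
  have "avs [0..<2 * p] (G (rev []) \<star> x) \<approx> (c [] * \<Gamma> []) \<cdot> unit_word"
    by (rule avs_coefficient[OF c(2,1) Nil_in_W])
  then have "avs [0..<2 * p] x \<approx> c [] \<cdot> unit_word" by (simp add: \<Gamma>_def)
  then have "x \<approx> c [] \<cdot> unit_word"
    using eqv_trans[OF eqv_sym[OF avs[of "[0..<2 * p]"]]] by (simp add: atLeast0LessThan)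
  then show ?thesis using c by auto
qed

theorem central_simple_alg: "central_simple (subfield_ring K) alg"
  unfolding central_simple_def
proof (intro conjI allI impI)
  show "assoc_algebra (subfield_ring K) alg" by (rule assoc_algebra_alg)
  show "finite_dimensional (subfield_ring K) alg" by (rule finite_dimensional_alg)
  interpret A: ring alg by (rule ring_alg)
  show "{z \<in> carrier alg. \<forall>x\<in>carrier alg. z \<otimes>\<^bsub>alg\<^esub> x = x \<otimes>\<^bsub>alg\<^esub> z} =
    {c \<odot>\<^bsub>alg\<^esub> \<one>\<^bsub>alg\<^esub> |c. c \<in> carrier (subfield_ring K)}" (is "?L = ?R")
  proof
    show "?L \<subseteq> ?R"
    proof
      fix z assume z: "z \<in> ?L"
      then obtain x where x: "x \<in> Ev" "z = coset x" by (auto simp: carrier_alg)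
      have "x \<star> y \<approx> y \<star> x" if "y \<in> Ev" for y
      proof -
        have "coset x \<otimes>\<^bsub>alg\<^esub> coset y = coset y \<otimes>\<^bsub>alg\<^esub> coset x" using z x coset_in_alg[OF that] by auto
        then show ?thesis using x that by (simp add: alg_ops Ev_subset coset_eq_iff tensor_mem)
      qed
      then obtain c where "c \<in> K" "x \<approx> c \<cdot> unit_word" using central_imp_scalar[OF x(1)] by blast
      then have "z = c \<odot>\<^bsub>alg\<^esub> \<one>\<^bsub>alg\<^esub>"
        using x by (simp add: alg_ops tensor_mem coset_eq_iff Ev_subset)
      then show "z \<in> ?R" using \<open>c \<in> K\<close> by auto
    qed
    show "?R \<subseteq> ?L" by (auto simp: carrier_alg alg_ops tensor_mem Ev_subset intro!: imageI Ev_scl Ev_unit)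
  qed
  show "\<one>\<^bsub>alg\<^esub> \<noteq> \<zero>\<^bsub>alg\<^esub>"
    using unit_notin_I by (simp add: alg_ops coset_eq_iff tensor_mem eqv_zero_iff)
  fix J assume "ideal J alg"
  then interpret J: ideal J alg .
  have J0: "\<zero>\<^bsub>alg\<^esub> \<in> J" by (rule additive_subgroup.zero_closed[OF J.is_additive_subgroup])
  show "J = {\<zero>\<^bsub>alg\<^esub>} \<or> J = carrier alg"
  proof (rule disjCI)
    assume nc: "J \<noteq> carrier alg"
    show "J = {\<zero>\<^bsub>alg\<^esub>}"
    proof (rule ccontr)
    assume "J \<noteq> {\<zero>\<^bsub>alg\<^esub>}"
    then have "\<not> J \<subseteq> {\<zero>\<^bsub>alg\<^esub>}" using J0 by (metis empty_iff subset_singletonD)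
    then obtain z where z: "z \<in> J" "z \<noteq> \<zero>\<^bsub>alg\<^esub>" by (metis singletonI subsetI)
    have "z \<in> carrier alg" by (rule J.Icarr[OF z(1)])
    then obtain x where x: "x \<in> Ev" "z = coset x" unfolding carrier_alg by blast
    \<comment> \<open>The preimage of \<open>J\<close> in \<open>Ev\<close> absorbs multiplication
      by \<open>Ev\<close> from both sides, so the representative \<open>x\<close> outside
      \<open>I\<close> forces the unit into it.\<close>
    have "unit_word \<in> {y \<in> Ev. coset y \<in> J}"
    proof (rule unit_in_two_sided[where J = "{y \<in> Ev. coset y \<in> J}"])
      show "spanned x" by (rule Ev_spanned[OF x(1)])
      show "x \<in> {y \<in> Ev. coset y \<in> J}" using x z by simp
      show "x \<notin> I" using z x by (simp add: zero_alg coset_eq_iff Ev_subset tensor_mem eqv_zero_iff)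
    next
      fix u v assume "u \<in> {y \<in> Ev. coset y \<in> J}" "v \<in> {y \<in> Ev. coset y \<in> J}"
      then show "u + v \<in> {y \<in> Ev. coset y \<in> J}"
        using additive_subgroup.a_closed[OF J.is_additive_subgroup, of "coset u" "coset v"]
        by (simp add: alg_ops Ev_subset Ev_add)
    next
      fix c u assume c: "c \<in> K" and u: "u \<in> {y \<in> Ev. coset y \<in> J}"
      have "coset (c \<cdot> unit_word) \<otimes>\<^bsub>alg\<^esub> coset u \<in> J"
        using u c by (intro J.I_l_closed coset_in_alg Ev_scl Ev_unit) auto
      then show "c \<cdot> u \<in> {y \<in> Ev. coset y \<in> J}"
        using c u by (simp add: alg_ops Ev_subset Ev_scl tensor_mem)
    next
      fix e u assume eu: "e \<in> Ev" "u \<in> {y \<in> Ev. coset y \<in> J}"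
      then show "e \<star> u \<in> {y \<in> Ev. coset y \<in> J}"
        using J.I_l_closed[of "coset u" "coset e"] by (simp add: alg_ops Ev_subset Ev_conv coset_in_alg)
      from eu show "u \<star> e \<in> {y \<in> Ev. coset y \<in> J}"
        using J.I_r_closed[of "coset u" "coset e"] by (simp add: alg_ops Ev_subset Ev_conv coset_in_alg)
    next
      fix u v assume uv: "u \<in> {y \<in> Ev. coset y \<in> J}" "u \<approx> v" "v \<in> Ev"
      then have "coset u = coset v" by (simp add: coset_eq_iff Ev_subset)
      then show "v \<in> {y \<in> Ev. coset y \<in> J}" using uv by simp
    qed
    then have "\<one>\<^bsub>alg\<^esub> \<in> J" by (simp add: one_alg)
    then have "J = carrier alg" by (rule J.one_imp_carrier)
    then show False using nc by simp
    qed
  qed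
qed

end

section \<open>Matrix models\<close>

lemma mult_mat_entry:
  assumes "A \<in> carrier_mat n k" "B \<in> carrier_mat k l" "i < n" "j < l"
  shows "(A * B) $$ (i, j) = (\<Sum>t<k. A $$ (i, t) * B $$ (t, j))"
  using assms by (auto simp: scalar_prod_def atLeast0LessThan intro!: sum.cong)

definition word_mat :: "nat \<Rightarrow> (nat \<Rightarrow> complex mat) \<Rightarrow> nat list \<Rightarrow> complex mat" where
  "word_mat N Z w = foldr (\<lambda>i A. Z i * A) w (1\<^sub>m N)"

lemma word_mat_simps [simp]: "word_mat N Z [] = 1\<^sub>m N" "word_mat N Z (i # w) = Z i * word_mat N Z w"
  by (simp_all add: word_mat_def)

definition eval_mat :: "nat \<Rightarrow> (nat \<Rightarrow> complex mat) \<Rightarrow> (nat list \<Rightarrow> complex) \<Rightarrow> complex mat" where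
  "eval_mat N Z f = mat N N (\<lambda>(r, s). \<Sum>w | f w \<noteq> 0. f w * word_mat N Z w $$ (r, s))"

lemma eval_mat_carrier [simp, intro]: "eval_mat N Z f \<in> carrier_mat N N"
  by (simp add: eval_mat_def)

lemma eval_mat_dim [simp]: "dim_row (eval_mat N Z f) = N" "dim_col (eval_mat N Z f) = N"
  by (simp_all add: eval_mat_def)

text \<open>The sum defining an entry runs over the support of \<open>f\<close>. To compare
  evaluations of different tensors it is extended to a common finite superset.\<close>

lemma eval_mat_entry:
  assumes "finite A" "{w. f w \<noteq> 0} \<subseteq> A" "r < N" "s < N"
  shows "eval_mat N Z f $$ (r, s) = (\<Sum>w\<in>A. f w * word_mat N Z w $$ (r, s))"
  using assms by (auto simp: eval_mat_def intro!: sum.mono_neutral_left)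

locale tensor_eval = csubfield K for K +
  fixes m N :: nat and Z :: "nat \<Rightarrow> complex mat"
  assumes Z_carrier: "i < m \<Longrightarrow> Z i \<in> carrier_mat N N"
begin

abbreviation "TT \<equiv> carrier (tensor_algebra K m)"
abbreviation "ev \<equiv> eval_mat N Z"

lemma word_mat_carrier: "set w \<subseteq> {..<m} \<Longrightarrow> word_mat N Z w \<in> carrier_mat N N"
  by (induction w) (auto intro: mult_carrier_mat Z_carrier)

lemma word_mat_append:
  "set u \<subseteq> {..<m} \<Longrightarrow> set v \<subseteq> {..<m} \<Longrightarrow> word_mat N Z (u @ v) = word_mat N Z u * word_mat N Z v"
proof (induction u)
  case Nil then show ?case using word_mat_carrier[of v] by simp
next
  case (Cons i u)
  then show ?case
    using assoc_mult_mat[OF Z_carrier word_mat_carrier word_mat_carrier, of i u v] by simp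
qed

lemma supp_finite: "f \<in> TT \<Longrightarrow> finite {w. f w \<noteq> 0}"
  by (simp add: tensor_carrier_iff)

lemma ev_add: "f \<in> TT \<Longrightarrow> g \<in> TT \<Longrightarrow> ev (f + g) = ev f + ev g"
proof (rule eq_matI)
  fix r s assume fg: "f \<in> TT" "g \<in> TT" and rs: "r < dim_row (ev f + ev g)" "s < dim_col (ev f + ev g)"
  let ?A = "{w. f w \<noteq> 0} \<union> {w. g w \<noteq> 0}"
  have A: "finite ?A" using fg supp_finite by simp
  show "ev (f + g) $$ (r, s) = (ev f + ev g) $$ (r, s)"
  proof -
    have "{w. (f + g) w \<noteq> 0} \<subseteq> ?A" by auto
    with rs show ?thesis by (simp add: eval_mat_entry[OF A, of f] eval_mat_entry[OF A, of g]
      eval_mat_entry[OF A, of "f + g"] sum.distrib distrib_right)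
  qed
qed auto

lemma ev_scl: "f \<in> TT \<Longrightarrow> ev (c \<cdot> f) = c \<cdot>\<^sub>m ev f"
proof (rule eq_matI)
  fix r s assume f: "f \<in> TT" and rs: "r < dim_row (c \<cdot>\<^sub>m ev f)" "s < dim_col (c \<cdot>\<^sub>m ev f)"
  show "ev (c \<cdot> f) $$ (r, s) = (c \<cdot>\<^sub>m ev f) $$ (r, s)"
  proof -
    have "{w. (c \<cdot> f) w \<noteq> 0} \<subseteq> {w. f w \<noteq> 0}" by (auto simp: scl_def)
    then have "ev (c \<cdot> f) $$ (r, s) = (\<Sum>w | f w \<noteq> 0. c * (f w * word_mat N Z w $$ (r, s)))"
      using rs by (simp add: eval_mat_entry[OF supp_finite[OF f], of "c \<cdot> f"])
        (simp add: scl_def mult.assoc)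
    then show ?thesis using rs
      by (simp add: eval_mat_entry[OF supp_finite[OF f], of f] sum_distrib_left)
  qed
qed auto

lemma ev_zero: "ev 0 = 0\<^sub>m N N"
  by (rule eq_matI) (auto simp: eval_mat_def)

lemma ev_uminus: "f \<in> TT \<Longrightarrow> ev (- f) = - ev f"
  using ev_scl[of f "-1"] by (auto intro!: eq_matI)

lemma ev_diff: "f \<in> TT \<Longrightarrow> g \<in> TT \<Longrightarrow> ev (f - g) = ev f - ev g"
  using ev_add[of f "- g"] ev_uminus[of g] tensor_uminus_mem[of g] by (auto intro!: eq_matI)

lemma ev_monom: "set u \<subseteq> {..<m} \<Longrightarrow> ev (monom_word u) = word_mat N Z u"
proof (rule eq_matI)
  fix r s assume u: "set u \<subseteq> {..<m}" and "r < dim_row (word_mat N Z u)" "s < dim_col (word_mat N Z u)"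
  then have rs: "r < N" "s < N" using word_mat_carrier[OF u] by auto
  then show "ev (monom_word u) $$ (r, s) = word_mat N Z u $$ (r, s)"
    by (subst eval_mat_entry[of "{u}"]) (auto simp: monom_word_def)
next
  assume "set u \<subseteq> {..<m}"
  from word_mat_carrier[OF this]
  show "dim_row (ev (monom_word u)) = dim_row (word_mat N Z u)"
    "dim_col (ev (monom_word u)) = dim_col (word_mat N Z u)" by auto
qed

lemma ev_unit: "ev unit_word = 1\<^sub>m N"
  using ev_monom[of "[]"] by simp

lemma ev_sum_entry:
  assumes "\<And>i. i \<in> A \<Longrightarrow> f i \<in> TT" "r < N" "s < N"
  shows "ev (sum f A) $$ (r, s) = (\<Sum>i\<in>A. ev (f i) $$ (r, s))"
  using assms(1)
proof (induction A rule: infinite_finite_induct)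
  case (insert a A)
  have "ev (sum f (insert a A)) = ev (f a) + ev (sum f A)"
    using insert by (simp only: sum.insert not_False_eq_True) (intro ev_add tensor_sum_mem; blast)
  then have "ev (sum f (insert a A)) $$ (r, s) = ev (f a) $$ (r, s) + ev (sum f A) $$ (r, s)"
    using assms(2,3) by (simp only: index_add_mat eval_mat_dim)
  moreover have "ev (sum f A) $$ (r, s) = (\<Sum>i\<in>A. ev (f i) $$ (r, s))"
    using insert.IH insert.prems by blast
  ultimately show ?case using insert.hyps by (simp only: sum.insert not_False_eq_True)
qed (use assms(2,3) in \<open>simp_all only: sum.infinite sum.empty not_False_eq_True ev_zero index_zero_mat\<close>)

text \<open>Both factors are expanded into words, on which multiplicativity is that of
  \<open>word_mat\<close>; the entries of the product are recovered by interchanging three finite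
  sums.\<close>

lemma ev_conv:
  assumes f: "f \<in> TT" and g: "g \<in> TT"
  shows "ev (f \<star> g) = ev f * ev g"
proof (rule eq_matI)
  fix r s assume "r < dim_row (ev f * ev g)" "s < dim_col (ev f * ev g)"
  then have rs: "r < N" "s < N" by auto
  let ?F = "{w. f w \<noteq> 0}" and ?G = "{w. g w \<noteq> 0}"
  let ?P = "\<lambda>w. word_mat N Z w"
  have sub: "set u \<subseteq> {..<m}" if "u \<in> ?F \<or> u \<in> ?G" for u
    using that f g unfolding tensor_carrier_iff by blast
  have fK: "f w \<in> K" "g w \<in> K" for w using f g unfolding tensor_carrier_iff by auto
  have "f \<star> g = (\<Sum>u\<in>?F. f u \<cdot> monom_word u) \<star> (\<Sum>v\<in>?G. g v \<cdot> monom_word v)"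
    using tensor_expand[OF f] tensor_expand[OF g] by simp
  also have "\<dots> = (\<Sum>u\<in>?F. \<Sum>v\<in>?G. (f u * g v) \<cdot> monom_word (u @ v))"
  proof (simp only: conv_sum_left, rule sum.cong[OF refl])
    fix u
    show "f u \<cdot> monom_word u \<star> (\<Sum>v\<in>?G. g v \<cdot> monom_word v) = (\<Sum>v\<in>?G. (f u * g v) \<cdot> monom_word (u @ v))"
      by (simp only: conv_sum_right conv_scl_left conv_scl_right scl_scl monom_word_append mult.commute)
  qed
  finally have "ev (f \<star> g) $$ (r, s) =
      (\<Sum>u\<in>?F. ev (\<Sum>v\<in>?G. (f u * g v) \<cdot> monom_word (u @ v)) $$ (r, s))"
    by (simp only:) (rule ev_sum_entry, intro tensor_sum_mem tensor_scl_mem tensor_monom_mem,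
      use sub fK rs in auto)
  also have "\<dots> = (\<Sum>u\<in>?F. \<Sum>v\<in>?G. ev ((f u * g v) \<cdot> monom_word (u @ v)) $$ (r, s))"
    by (intro sum.cong refl ev_sum_entry tensor_scl_mem tensor_monom_mem) (use sub fK rs in auto)
  also have "\<dots> = (\<Sum>u\<in>?F. \<Sum>v\<in>?G. f u * g v * (\<Sum>t<N. ?P u $$ (r, t) * ?P v $$ (t, s)))"
  proof (intro sum.cong refl)
    fix u v assume "u \<in> ?F" "v \<in> ?G"
    then have uv: "set u \<subseteq> {..<m}" "set v \<subseteq> {..<m}" using sub by blast+
    have "ev ((f u * g v) \<cdot> monom_word (u @ v)) = (f u * g v) \<cdot>\<^sub>m word_mat N Z (u @ v)"
      using uv by (subst ev_scl) (auto intro!: tensor_monom_mem simp: ev_monom)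
    then show "ev ((f u * g v) \<cdot> monom_word (u @ v)) $$ (r, s) =
        f u * g v * (\<Sum>t<N. ?P u $$ (r, t) * ?P v $$ (t, s))"
      using uv rs word_mat_carrier[OF uv(1)] word_mat_carrier[OF uv(2)]
      by (simp add: word_mat_append mult_mat_entry[OF word_mat_carrier[OF uv(1)] word_mat_carrier[OF uv(2)]]
          del: index_mult_mat(1))
  qed
  also have "\<dots> = (\<Sum>t<N. (\<Sum>u\<in>?F. f u * ?P u $$ (r, t)) * (\<Sum>v\<in>?G. g v * ?P v $$ (t, s)))"
  proof -
    have "(\<Sum>t<N. (\<Sum>u\<in>?F. f u * ?P u $$ (r, t)) * (\<Sum>v\<in>?G. g v * ?P v $$ (t, s))) =
      (\<Sum>t<N. \<Sum>u\<in>?F. \<Sum>v\<in>?G. f u * g v * (?P u $$ (r, t) * ?P v $$ (t, s)))"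
      by (simp add: sum_product mult_ac)
    also have "\<dots> = (\<Sum>u\<in>?F. \<Sum>t<N. \<Sum>v\<in>?G. f u * g v * (?P u $$ (r, t) * ?P v $$ (t, s)))"
      by (rule sum.swap)
    also have "\<dots> = (\<Sum>u\<in>?F. \<Sum>v\<in>?G. \<Sum>t<N. f u * g v * (?P u $$ (r, t) * ?P v $$ (t, s)))"
      by (intro sum.cong refl sum.swap)
    finally show ?thesis by (simp add: sum_distrib_left)
  qed
  also have "\<dots> = (\<Sum>t<N. ev f $$ (r, t) * ev g $$ (t, s))"
    using rs by (intro sum.cong refl) (simp add: eval_mat_def)
  also have "\<dots> = (ev f * ev g) $$ (r, s)"
    using rs by (intro mult_mat_entry[symmetric]) auto
  finally show "ev (f \<star> g) $$ (r, s) = (ev f * ev g) $$ (r, s)" .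
qed auto

lemma kernel_ideal: "ideal {x \<in> TT. ev x = 0\<^sub>m N N} (tensor_algebra K m)"
proof (rule idealI)
  interpret R: ring "tensor_algebra K m" by (rule ring_tensor_algebra)
  show "ring (tensor_algebra K m)" by (rule ring_tensor_algebra)
  show "subgroup {x \<in> TT. ev x = 0\<^sub>m N N} (add_monoid (tensor_algebra K m))"
  proof (rule R.add.subgroupI)
    show "{x \<in> TT. ev x = 0\<^sub>m N N} \<noteq> {}" using ev_zero tensor_zero_mem by blast
    fix a assume a: "a \<in> {x \<in> TT. ev x = 0\<^sub>m N N}"
    then show "\<ominus>\<^bsub>tensor_algebra K m\<^esub> a \<in> {x \<in> TT. ev x = 0\<^sub>m N N}"
      by (auto simp: tensor_a_inv ev_uminus tensor_uminus_mem intro!: eq_matI)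
    fix b assume "b \<in> {x \<in> TT. ev x = 0\<^sub>m N N}"
    with a show "a \<oplus>\<^bsub>tensor_algebra K m\<^esub> b \<in> {x \<in> TT. ev x = 0\<^sub>m N N}"
      by (simp add: ev_add tensor_add_mem)
  qed auto
qed (auto simp: ev_conv tensor_conv_mem)

lemma ev_genideal:
  assumes "S \<subseteq> TT" "\<And>x. x \<in> S \<Longrightarrow> ev x = 0\<^sub>m N N" "x \<in> Idl\<^bsub>tensor_algebra K m\<^esub> S"
  shows "ev x = 0\<^sub>m N N"
proof -
  interpret R: ring "tensor_algebra K m" by (rule ring_tensor_algebra)
  have "Idl\<^bsub>tensor_algebra K m\<^esub> S \<subseteq> {x \<in> TT. ev x = 0\<^sub>m N N}"
    by (rule R.genideal_minimal[OF kernel_ideal]) (use assms in auto)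
  then show ?thesis using assms(3) by auto
qed

end

text \<open>The matrices \<open>Z\<close> are complex and may lie outside \<open>K\<close>. A model
  of any positive size shows that the quotient is nonzero and is embedded by evaluation; the exact
  size matters only when the image is to be all matrices over \<open>K\<close>.\<close>

locale matrix_model = anticommuting_quotient K m I Ev p g \<gamma> + tensor_eval K m N Z
  for K m I Ev p g \<gamma> N Z +
  assumes N_pos: "N > 0"
    and ev_I: "x \<in> I \<Longrightarrow> eval_mat N Z x = 0\<^sub>m N N"
    and Ev_spanned': "x \<in> Ev \<Longrightarrow> spanned x"
begin

lemma one_mat_nonzero: "1\<^sub>m N \<noteq> (0\<^sub>m N N :: complex mat)"
proof
  assume "1\<^sub>m N = (0\<^sub>m N N :: complex mat)"
  then have "1\<^sub>m N $$ (0, 0) = (0\<^sub>m N N :: complex mat) $$ (0, 0)" by simp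
  then show False using N_pos by simp
qed

sublocale spanned_quotient K m I Ev p g \<gamma>
  by standard (use Ev_spanned' ev_I ev_unit one_mat_nonzero in auto)

lemma ev_cong: "x \<in> T \<Longrightarrow> y \<in> T \<Longrightarrow> x \<approx> y \<Longrightarrow> ev x = ev y"
proof -
  assume xy: "x \<in> T" "y \<in> T" "x \<approx> y"
  have "ev (x - y) = 0\<^sub>m N N" using ev_I[of "x - y"] xy by (simp add: eqv_def)
  then have eq: "ev x - ev y = 0\<^sub>m N N" using ev_diff[OF xy(1,2)] by simp
  show ?thesis
  proof (rule eq_matI)
    fix i j assume "i < dim_row (ev y)" "j < dim_col (ev y)"
    then have "(ev x - ev y) $$ (i, j) = 0" using eq by simp
    then show "ev x $$ (i, j) = ev y $$ (i, j)" using \<open>i < _\<close> \<open>j < _\<close> by simp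
  qed auto
qed

text \<open>If evaluation killed an element of \<open>Ev\<close> outside \<open>I\<close>, the
  two-sided argument would put the unit into its kernel, but the unit evaluates to the identity
  matrix.\<close>

lemma ev_zero_imp: 
  assumes "x \<in> Ev" "ev x = 0\<^sub>m N N"
  shows "x \<in> I"
proof (rule ccontr)
  assume "x \<notin> I"
  have "unit_word \<in> {x \<in> T. ev x = 0\<^sub>m N N}"
  proof (rule unit_in_two_sided[where J = "{x \<in> T. ev x = 0\<^sub>m N N}"])
    show "x \<in> {x \<in> T. ev x = 0\<^sub>m N N}" using assms Ev_subset by simp
    show "x \<notin> I" by fact
    show "spanned x" by (rule Ev_spanned[OF assms(1)])
    fix u v assume "u \<in> {x \<in> T. ev x = 0\<^sub>m N N}" "u \<approx> v" "v \<in> Ev"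
    then show "v \<in> {x \<in> T. ev x = 0\<^sub>m N N}" using ev_cong[of u v] Ev_subset[of v] by simp
  qed (auto simp: ev_add ev_scl ev_conv tensor_mem Ev_subset)
  then show False using ev_unit one_mat_nonzero by simp
qed

definition h :: "(nat list \<Rightarrow> complex) set \<Rightarrow> complex mat" where
  "h C = ev (SOME x. x \<in> Ev \<and> C = coset x)"

lemma h_coset: "x \<in> Ev \<Longrightarrow> h (coset x) = ev x"
proof -
  assume x: "x \<in> Ev"
  let ?y = "SOME y. y \<in> Ev \<and> coset x = coset y"
  have "?y \<in> Ev \<and> coset x = coset ?y" by (rule someI[of _ x]) (use x in simp)
  then show ?thesis unfolding h_def using x by (intro ev_cong Ev_subset) (auto simp: coset_eq_iff Ev_subset eqv_sym)
qed

lemma h_inj: "inj_on h (carrier alg)"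
proof (rule inj_onI)
  fix C C' assume "C \<in> carrier alg" "C' \<in> carrier alg" "h C = h C'"
  then obtain x y where xy: "x \<in> Ev" "y \<in> Ev" "C = coset x" "C' = coset y" "ev x = ev y"
    by (auto simp: carrier_alg h_coset)
  have "ev (x + (- y)) = 0\<^sub>m N N"
  proof -
    have "ev (x + (- y)) = ev x + - ev y"
      using xy by (simp only: ev_add ev_uminus Ev_subset tensor_uminus_mem)
    then show ?thesis unfolding xy(5) by (auto intro!: eq_matI)
  qed
  then have "x + (- y) \<in> I" using xy by (intro ev_zero_imp Ev_add Ev_uminus)
  then have "x \<approx> y" by (simp only: eqv_def diff_conv_add_uminus)
  then show "C = C'" using xy by (simp add: coset_eq_iff Ev_subset)
qed

lemma h_image: "h ` carrier alg = ev ` Ev"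
  unfolding carrier_alg image_image by (rule image_cong) (simp_all add: h_coset)

lemma h_ops:
  assumes "C \<in> carrier alg" "C' \<in> carrier alg" "c \<in> K"
  shows "h (C \<otimes>\<^bsub>alg\<^esub> C') = h C * h C'" "h (C \<oplus>\<^bsub>alg\<^esub> C') = h C + h C'"
    "h (c \<odot>\<^bsub>alg\<^esub> C) = c \<cdot>\<^sub>m h C"
  using assms
  by (auto simp: carrier_alg alg_ops h_coset Ev_subset Ev_conv Ev_add Ev_scl ev_conv ev_add ev_scl)

lemma h_one: "h \<one>\<^bsub>alg\<^esub> = 1\<^sub>m N"
  by (simp add: one_alg h_coset Ev_unit ev_unit)

lemma h_carrier: "C \<in> carrier alg \<Longrightarrow> h C \<in> carrier_mat N N"
  by (auto simp: carrier_alg h_coset)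

lemma ev_comb_entry:
  assumes "range c \<subseteq> K" "r < N" "s < N"
  shows "ev (comb c) $$ (r, s) = (\<Sum>w\<in>W. c w * ev (G w) $$ (r, s))"
proof -
  have "ev (comb c) $$ (r, s) = (\<Sum>w\<in>W. ev (c w \<cdot> G w) $$ (r, s))"
    unfolding comb_def using assms by (intro ev_sum_entry tensor_scl_mem G_T W_subset) auto
  also have "\<dots> = (\<Sum>w\<in>W. c w * ev (G w) $$ (r, s))"
    using assms by (intro sum.cong refl) (simp add: ev_scl G_T W_subset)
  finally show ?thesis .
qed

lemma ev_G: "set w \<subseteq> {..<2 * p} \<Longrightarrow> ev (G w) = word_mat N (\<lambda>i. ev (g i)) w"
  by (induction w) (auto simp: ev_unit ev_conv g_T G_T)

lemma ev_image: "ev ` Ev = {ev (comb c) | c. range c \<subseteq> K}"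
proof
  show "ev ` Ev \<subseteq> {ev (comb c) | c. range c \<subseteq> K}"
  proof (rule image_subsetI)
    fix x assume x: "x \<in> Ev"
    then obtain c where c: "range c \<subseteq> K" "x \<approx> comb c" using Ev_spanned unfolding spanned_def by blast
    then have "ev x = ev (comb c)" using x comb_mem by (intro ev_cong Ev_subset) auto
    then show "ev x \<in> {ev (comb c) | c. range c \<subseteq> K}" using c by auto
  qed
  show "{ev (comb c) | c. range c \<subseteq> K} \<subseteq> ev ` Ev" using comb_mem by auto
qed

end

section \<open>Matrix algebras of size one\<close>

lemma matrix_algebra_1_simps:
  "carrier (matrix_algebra 1 A) = {(0, 0)} \<rightarrow>\<^sub>E carrier A"
  "P \<otimes>\<^bsub>matrix_algebra 1 A\<^esub> Q = restrict (\<lambda>(i, j). \<Oplus>\<^bsub>A\<^esub>k\<in>{0}. P (i, k) \<otimes>\<^bsub>A\<^esub> Q (k, j)) {(0, 0)}"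
  "\<one>\<^bsub>matrix_algebra 1 A\<^esub> = restrict (\<lambda>_. \<one>\<^bsub>A\<^esub>) {(0, 0)}"
  "P \<oplus>\<^bsub>matrix_algebra 1 A\<^esub> Q = restrict (\<lambda>e. P e \<oplus>\<^bsub>A\<^esub> Q e) {(0, 0)}"
  "c \<odot>\<^bsub>matrix_algebra 1 A\<^esub> P = restrict (\<lambda>e. c \<odot>\<^bsub>A\<^esub> P e) {(0, 0)}"
proof -
  have "{..<1::nat} = {0}" by auto
  then show "carrier (matrix_algebra 1 A) = {(0, 0)} \<rightarrow>\<^sub>E carrier A"
    "P \<otimes>\<^bsub>matrix_algebra 1 A\<^esub> Q = restrict (\<lambda>(i, j). \<Oplus>\<^bsub>A\<^esub>k\<in>{0}. P (i, k) \<otimes>\<^bsub>A\<^esub> Q (k, j)) {(0, 0)}"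
    "\<one>\<^bsub>matrix_algebra 1 A\<^esub> = restrict (\<lambda>_. \<one>\<^bsub>A\<^esub>) {(0, 0)}"
    "P \<oplus>\<^bsub>matrix_algebra 1 A\<^esub> Q = restrict (\<lambda>e. P e \<oplus>\<^bsub>A\<^esub> Q e) {(0, 0)}"
    "c \<odot>\<^bsub>matrix_algebra 1 A\<^esub> P = restrict (\<lambda>e. c \<odot>\<^bsub>A\<^esub> P e) {(0, 0)}"
    by (auto simp: matrix_algebra_def Let_def restrict_def fun_eq_iff)
qed

lemma matrix_algebra_1_mult:
  assumes "ring A" "P \<in> carrier (matrix_algebra 1 A)" "Q \<in> carrier (matrix_algebra 1 A)"
  shows "P \<otimes>\<^bsub>matrix_algebra 1 A\<^esub> Q = restrict (\<lambda>_. P (0, 0) \<otimes>\<^bsub>A\<^esub> Q (0, 0)) {(0, 0)}"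
proof -
  interpret ring A by fact
  have "P (0, 0) \<in> carrier A" "Q (0, 0) \<in> carrier A" using assms(2,3) unfolding matrix_algebra_1_simps by auto
  then show ?thesis unfolding matrix_algebra_1_simps by (auto simp: finsum_insert fun_eq_iff)
qed

lemma bij_betw_matrix_algebra_1:
  "bij_betw (\<lambda>P. P (0, 0)) (carrier (matrix_algebra 1 A)) (carrier A)"
  "bij_betw (\<lambda>x. restrict (\<lambda>_. x) {(0, 0)}) (carrier A) (carrier (matrix_algebra 1 A))"
proof -
  have *: "restrict (\<lambda>_. P (0, 0)) {(0, 0)} = P" if "P \<in> carrier (matrix_algebra 1 A)" for P
    using that unfolding matrix_algebra_1_simps
    by (intro extensionalityI[of _ "{(0, 0)}"]) (auto simp: PiE_def)
  have m1: "P (0, 0) \<in> carrier A" if "P \<in> carrier (matrix_algebra 1 A)" for P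
    using that unfolding matrix_algebra_1_simps by auto
  have m2: "restrict (\<lambda>_. x) {(0, 0)} \<in> carrier (matrix_algebra 1 A)" if "x \<in> carrier A" for x
    using that unfolding matrix_algebra_1_simps by (intro restrict_PiE_iff[THEN iffD2]) auto
  show "bij_betw (\<lambda>P. P (0, 0)) (carrier (matrix_algebra 1 A)) (carrier A)"
    by (rule bij_betw_byWitness[where f' = "\<lambda>x. restrict (\<lambda>_. x) {(0, 0)}"])
       (use * m1 m2 in \<open>auto simp del: One_nat_def\<close>)
  show "bij_betw (\<lambda>x. restrict (\<lambda>_. x) {(0, 0)}) (carrier A) (carrier (matrix_algebra 1 A))"
    by (rule bij_betw_byWitness[where f' = "\<lambda>P. P (0, 0)"])
       (use * m1 m2 in \<open>auto simp del: One_nat_def\<close>)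
qed

lemma algebra_isomorphicI:
  assumes "f \<in> ring_iso A B"
    "\<And>c x. c \<in> carrier R \<Longrightarrow> x \<in> carrier A \<Longrightarrow> f (c \<odot>\<^bsub>A\<^esub> x) = c \<odot>\<^bsub>B\<^esub> f x"
  shows "algebra_isomorphic R A B"
  unfolding algebra_isomorphic_def using assms by (intro bexI[of _ f] ballI)

text \<open>Brauer equivalence compares matrix algebras on both sides. An algebra that is itself
  isomorphic to the other side therefore enters through its own 1 by 1 matrices.\<close>

lemma algebra_isomorphic_matrix_1_left:
  assumes "ring A" "algebra_isomorphic R A B" 
  shows "algebra_isomorphic R (matrix_algebra 1 A) B"
proof -
  obtain f where f: "f \<in> ring_iso A B"
    "\<And>c x. c \<in> carrier R \<Longrightarrow> x \<in> carrier A \<Longrightarrow> f (c \<odot>\<^bsub>A\<^esub> x) = c \<odot>\<^bsub>B\<^esub> f x"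
    using assms(2) unfolding algebra_isomorphic_def by blast
  let ?M = "matrix_algebra 1 A"
  let ?f = "\<lambda>P. f (P (0, 0))"
  have mem: "P (0, 0) \<in> carrier A" if "P \<in> carrier ?M" for P
    using that unfolding matrix_algebra_1_simps by auto
  note fE = ring_iso_memE[OF f(1)]
  have iso: "?f \<in> ring_iso ?M B"
  proof (rule ring_iso_memI)
    fix P assume P: "P \<in> carrier ?M"
    show "?f P \<in> carrier B" using fE(1) mem[OF P] by blast
    fix Q assume Q: "Q \<in> carrier ?M"
    show "?f (P \<otimes>\<^bsub>?M\<^esub> Q) = ?f P \<otimes>\<^bsub>B\<^esub> ?f Q"
      unfolding matrix_algebra_1_mult[OF assms(1) P Q] using fE(2) mem[OF P] mem[OF Q] by simp
    show "?f (P \<oplus>\<^bsub>?M\<^esub> Q) = ?f P \<oplus>\<^bsub>B\<^esub> ?f Q"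
      unfolding matrix_algebra_1_simps using fE(3) mem[OF P] mem[OF Q] by simp
  next
    show "?f \<one>\<^bsub>?M\<^esub> = \<one>\<^bsub>B\<^esub>" unfolding matrix_algebra_1_simps using fE(4) by simp
    from bij_betw_trans[OF bij_betw_matrix_algebra_1(1) fE(5)] show "bij_betw ?f (carrier ?M) (carrier B)"
      by (simp add: comp_def)
  qed
  have sm: "?f (c \<odot>\<^bsub>?M\<^esub> P) = c \<odot>\<^bsub>B\<^esub> ?f P" if "c \<in> carrier R" "P \<in> carrier ?M" for c P
    unfolding matrix_algebra_1_simps using f(2) that mem by simp
  show ?thesis by (rule algebra_isomorphicI[where f = ?f], rule iso, rule sm)
qed

lemma algebra_isomorphic_matrix_1_right:
  assumes "ring B" "algebra_isomorphic R A B" 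
  shows "algebra_isomorphic R A (matrix_algebra 1 B)"
proof -
  obtain f where f: "f \<in> ring_iso A B"
    "\<And>c x. c \<in> carrier R \<Longrightarrow> x \<in> carrier A \<Longrightarrow> f (c \<odot>\<^bsub>A\<^esub> x) = c \<odot>\<^bsub>B\<^esub> f x"
    using assms(2) unfolding algebra_isomorphic_def by blast
  let ?M = "matrix_algebra 1 B"
  let ?f = "\<lambda>x. restrict (\<lambda>_. f x) {(0, 0)}"
  note fE = ring_iso_memE[OF f(1)]
  have mem: "?f x \<in> carrier ?M" if "x \<in> carrier A" for x
    using fE(1)[OF that] unfolding matrix_algebra_1_simps by auto
  have iso: "?f \<in> ring_iso A ?M"
  proof (rule ring_iso_memI)
    fix x assume x: "x \<in> carrier A"
    show "?f x \<in> carrier ?M" by (rule mem[OF x])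
    fix y assume y: "y \<in> carrier A"
    show "?f (x \<otimes>\<^bsub>A\<^esub> y) = ?f x \<otimes>\<^bsub>?M\<^esub> ?f y"
      unfolding matrix_algebra_1_mult[OF assms(1) mem[OF x] mem[OF y]] fE(2)[OF x y] by simp
    show "?f (x \<oplus>\<^bsub>A\<^esub> y) = ?f x \<oplus>\<^bsub>?M\<^esub> ?f y"
      unfolding matrix_algebra_1_simps fE(3)[OF x y] by (auto simp: fun_eq_iff)
  next
    show "?f \<one>\<^bsub>A\<^esub> = \<one>\<^bsub>?M\<^esub>" unfolding matrix_algebra_1_simps fE(4) ..
    from bij_betw_trans[OF fE(5) bij_betw_matrix_algebra_1(2)] show "bij_betw ?f (carrier A) (carrier ?M)"
      by (simp add: comp_def)
  qed
  have sm: "?f (c \<odot>\<^bsub>A\<^esub> x) = c \<odot>\<^bsub>?M\<^esub> ?f x" if "c \<in> carrier R" "x \<in> carrier A" for c x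
    unfolding matrix_algebra_1_simps f(2)[OF that] by (auto simp: fun_eq_iff)
  show ?thesis by (rule algebra_isomorphicI[where f = ?f], rule iso, rule sm)
qed

section \<open>The base field as a central simple algebra\<close>

lemma (in csubfield) ring_base_algebra: "ring (base_algebra K)"
proof (rule ringI)
  show "abelian_group (base_algebra K)"
  proof (rule abelian_groupI)
    fix x assume "x \<in> carrier (base_algebra K)"
    then show "\<exists>y\<in>carrier (base_algebra K). y \<oplus>\<^bsub>base_algebra K\<^esub> x = \<zero>\<^bsub>base_algebra K\<^esub>"
      by (intro bexI[of _ "- x"]) (auto simp: base_algebra_def)
  qed (auto simp: add_ac base_algebra_def)
  show "Group.monoid (base_algebra K)"
    by (rule monoidI) (auto simp: mult_ac base_algebra_def)
qed (auto simp: algebra_simps base_algebra_def)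

lemma (in csubfield) central_simple_base: "central_simple (subfield_ring K) (base_algebra K)"
  unfolding central_simple_def
proof (intro conjI allI impI)
  let ?B = "base_algebra K"
  interpret B: ring ?B by (rule ring_base_algebra)
  have b: "carrier ?B = K" "monoid.mult ?B = (*)" "one ?B = 1" "zero ?B = 0" "add ?B = (+)"
    "module.smult ?B = (*)" by (simp_all add: base_algebra_def)
  show "assoc_algebra (subfield_ring K) ?B" unfolding assoc_algebra_def
  proof (intro conjI)
    show "module (subfield_ring K) ?B"
      by (rule moduleI[OF cring_subfield_ring B.is_abelian_group]) (auto simp: b algebra_simps)
  qed (use ring_base_algebra in \<open>auto simp: b\<close>)
  show "finite_dimensional (subfield_ring K) ?B" unfolding finite_dimensional_def
  proof (intro exI[of _ "{1}"] conjI ballI)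
    fix x assume x: "x \<in> carrier ?B"
    have "finsum ?B (\<lambda>s. x * s) {1} = x" using x by (subst B.finsum_insert) (auto simp: b)
    then show "\<exists>f\<in>{1} \<rightarrow> carrier (subfield_ring K). x = (\<Oplus>\<^bsub>?B\<^esub>s\<in>{1}. f s \<odot>\<^bsub>?B\<^esub> s)"
      using x by (intro bexI[of _ "\<lambda>_. x"]) (auto simp: b)
  qed (auto simp: b)
  show "{z \<in> carrier ?B. \<forall>x\<in>carrier ?B. z \<otimes>\<^bsub>?B\<^esub> x = x \<otimes>\<^bsub>?B\<^esub> z} =
    {c \<odot>\<^bsub>?B\<^esub> \<one>\<^bsub>?B\<^esub> |c. c \<in> carrier (subfield_ring K)}" by (auto simp: b mult.commute)
  show "\<one>\<^bsub>?B\<^esub> \<noteq> \<zero>\<^bsub>?B\<^esub>" by (simp add: b)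
  fix J assume "ideal J ?B"
  then interpret J: ideal J ?B .
  have J0: "\<zero>\<^bsub>?B\<^esub> \<in> J" by (rule additive_subgroup.zero_closed[OF J.is_additive_subgroup])
  show "J = {\<zero>\<^bsub>?B\<^esub>} \<or> J = carrier ?B"
  proof (rule disjCI)
    assume nc: "J \<noteq> carrier ?B"
    show "J = {\<zero>\<^bsub>?B\<^esub>}"
    proof (rule ccontr)
      assume "J \<noteq> {\<zero>\<^bsub>?B\<^esub>}"
      then have "\<not> J \<subseteq> {\<zero>\<^bsub>?B\<^esub>}" using J0 by (metis empty_iff subset_singletonD)
      then obtain z where z: "z \<in> J" "z \<noteq> \<zero>\<^bsub>?B\<^esub>" by (metis singletonI subsetI)
      have zK: "z \<in> K" using J.Icarr[OF z(1)] by (simp add: b)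
      have "inverse z \<otimes>\<^bsub>?B\<^esub> z \<in> J" by (rule J.I_l_closed[OF z(1)]) (use zK in \<open>simp add: b\<close>)
      then have "\<one>\<^bsub>?B\<^esub> \<in> J" using z by (simp add: b)
      then show False using J.one_imp_carrier nc by simp
    qed
  qed
qed

lemma (in csubfield) finsum_base:
  assumes "finite A" "\<And>i. i \<in> A \<Longrightarrow> f i \<in> K"
  shows "finsum (base_algebra K) f A = sum f A"
  using assms
proof (induction A)
  case empty
  interpret B: ring "base_algebra K" by (rule ring_base_algebra)
  show ?case unfolding B.finsum_empty sum.empty by (simp add: base_algebra_def)
next
  case (insert a A)
  interpret B: ring "base_algebra K" by (rule ring_base_algebra)
  have "finsum (base_algebra K) f (insert a A) = f a \<oplus>\<^bsub>base_algebra K\<^esub> finsum (base_algebra K) f A"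
    by (rule B.finsum_insert) (use insert in \<open>auto simp: base_algebra_def\<close>)
  also have "\<dots> = f a + sum f A" using insert by (simp add: base_algebra_def[of K])
  finally show ?case using insert by simp
qed

section \<open>The trace form on words and the splitting criterion\<close>

definition mtr :: "complex mat \<Rightarrow> complex" where
  "mtr A = (\<Sum>i<dim_row A. A $$ (i, i))"

lemma mtr_commute:
  assumes "A \<in> carrier_mat n n" "B \<in> carrier_mat n n"
  shows "mtr (A * B) = mtr (B * A)"
proof -
  have "mtr (A * B) = (\<Sum>i<n. \<Sum>k<n. A $$ (i, k) * B $$ (k, i))"
    using assms by (simp add: mtr_def mult_mat_entry[OF assms] del: index_mult_mat(1))
  also have "\<dots> = (\<Sum>k<n. \<Sum>i<n. B $$ (k, i) * A $$ (i, k))"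
    by (subst sum.swap) (simp add: mult.commute)
  also have "\<dots> = mtr (B * A)"
    using assms by (simp add: mtr_def mult_mat_entry[OF assms(2,1)] del: index_mult_mat(1))
  finally show ?thesis .
qed

lemma mtr_smult: "mtr (c \<cdot>\<^sub>m A) = c * mtr A" if "A \<in> carrier_mat n n"
  using that by (simp add: mtr_def sum_distrib_left)

lemma elements_mat_subset_iff:
  assumes "A \<in> carrier_mat n k"
  shows "elements_mat A \<subseteq> K \<longleftrightarrow> (\<forall>i<n. \<forall>j<k. A $$ (i, j) \<in> K)"
proof (intro iffI allI impI subsetI)
  fix i j assume "elements_mat A \<subseteq> K" "i < n" "j < k"
  then show "A $$ (i, j) \<in> K" using elements_matI[OF assms] by (meson subsetD)
next
  fix x assume *: "\<forall>i<n. \<forall>j<k. A $$ (i, j) \<in> K" and "x \<in> elements_mat A"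
  then obtain i j where "i < dim_row A" "j < dim_col A" "x = A $$ (i, j)" by (meson elements_matD)
  then show "x \<in> K" using * assms by simp
qed

context matrix_model
begin

text \<open>Such a word is conjugated to its negative by \<open>g i\<close>. Inserting
  \<open>g i\<close> twice and using cyclicity of the trace shows that \<open>\<gamma> i\<close>
  times the trace equals its own negative.\<close>

lemma mtr_ev_G_zero:
  assumes i: "i < 2 * p" and u: "set u \<subseteq> {..<2 * p}" and sg: "sgnw i u = - 1"
  shows "mtr (ev (G u)) = 0"
proof -
  let ?A = "ev (G u)" and ?B = "ev (g i)"
  have gT: "g i \<in> T" "G u \<in> T" using i u by (auto intro: g_T G_T)
  have "ev (g i \<star> G u) = ev ((- 1) \<cdot> (G u \<star> g i))"
    by (rule ev_cong) (use gT g_G_commute[OF i u] in \<open>auto simp only: sg intro!: tensor_mem uminus_mem one_mem\<close>)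
  then have BA: "?B * ?A = (- 1) \<cdot>\<^sub>m (?A * ?B)"
    using gT by (simp only: ev_conv ev_scl tensor_conv_mem)
  have "ev (g i \<star> g i) = ev (\<gamma> i \<cdot> unit_word)"
    by (rule ev_cong) (use gT g_square_eqv[OF i] \<gamma>_mem[OF i] in \<open>auto intro!: tensor_mem\<close>)
  then have BB: "?B * ?B = \<gamma> i \<cdot>\<^sub>m 1\<^sub>m N"
    using gT by (simp only: ev_conv ev_scl ev_unit tensor_monom_mem set_simps empty_subsetI)
  have c: "?A \<in> carrier_mat N N" "?B \<in> carrier_mat N N" by auto
  have "mtr (?B * (?B * ?A)) = mtr ((?B * ?A) * ?B)" by (rule mtr_commute) auto
  also have "?B * (?B * ?A) = (\<gamma> i \<cdot>\<^sub>m 1\<^sub>m N) * ?A"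
    using assoc_mult_mat[OF c(2) c(2) c(1)] BB by simp
  also have "\<dots> = \<gamma> i \<cdot>\<^sub>m ?A" using mult_smult_assoc_mat[of "1\<^sub>m N" N N ?A N "\<gamma> i"] by simp
  also have "(?B * ?A) * ?B = (- 1) \<cdot>\<^sub>m (?A * ?B * ?B)"
    unfolding BA using c by (intro mult_smult_assoc_mat[of _ N N _ N] mult_carrier_mat)
  also have "?A * ?B * ?B = ?A * (\<gamma> i \<cdot>\<^sub>m 1\<^sub>m N)" using assoc_mult_mat[OF c(1) c(2) c(2)] BB by simp
  also have "\<dots> = \<gamma> i \<cdot>\<^sub>m ?A" using mult_smult_distrib[of ?A N N "1\<^sub>m N" N "\<gamma> i"] by simp
  finally have "\<gamma> i * mtr ?A = - (\<gamma> i * mtr ?A)"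
    by (simp add: mtr_smult[of _ N])
  then show ?thesis using \<gamma>_nonzero[OF i] by simp
qed

text \<open>Consequently the reversed words divided by \<open>of_nat N * \<Gamma> v\<close> are dual
  to the words under the trace form.\<close>

lemma mtr_ev_G_pair:
  assumes "v \<in> W" "w \<in> W"
  shows "mtr (ev (G (rev v)) * ev (G w)) = (if v = w then of_nat N * \<Gamma> v else 0)"
proof -
  have sub: "set v \<subseteq> {..<2 * p}" "set w \<subseteq> {..<2 * p}" using assms W_subset by auto
  have eq: "ev (G (rev v)) * ev (G w) = ev (G (rev v @ w))"
    using sub by (simp add: G_append ev_conv G_T)
  show ?thesis
  proof (cases "v = w")
    case True
    have "ev (G (rev v @ v)) = ev (\<Gamma> v \<cdot> unit_word)"
      by (rule ev_cong) (use sub \<Gamma>_props[OF sub(1)] G_rev_mult[OF sub(1)] in \<open>auto intro!: tensor_mem G_T\<close>)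
    also have "\<dots> = \<Gamma> v \<cdot>\<^sub>m 1\<^sub>m N" by (simp add: ev_scl ev_unit tensor_monom_mem)
    finally show ?thesis using True eq by (simp add: mtr_def)
  next
    case False
    then obtain i where "i < 2 * p" "sgnw i (rev v @ w) = - 1" using exists_sign_change[OF assms] by auto
    then show ?thesis using False eq mtr_ev_G_zero[of i "rev v @ w"] sub by simp
  qed
qed

lemma ev_G_over_K:
  assumes gK: "\<And>i. i < 2 * p \<Longrightarrow> elements_mat (ev (g i)) \<subseteq> K"
    and w: "set w \<subseteq> {..<2 * p}" and rs: "r < N" "s < N"
  shows "ev (G w) $$ (r, s) \<in> K"
  using w rs
proof (induction w arbitrary: r s)
  case Nil then show ?case by (auto simp: ev_unit)
next
  case (Cons i w)
  then have i: "i < 2 * p" and w: "set w \<subseteq> {..<2 * p}" by auto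
  have "ev (G (i # w)) $$ (r, s) = (\<Sum>t<N. ev (g i) $$ (r, t) * ev (G w) $$ (t, s))"
    using Cons.prems i w by (simp add: ev_conv g_T G_T mult_mat_entry[of _ N N _ N] del: index_mult_mat(1))
  moreover have "ev (g i) $$ (r, t) \<in> K" if "t < N" for t
    using gK[OF i] elements_mat_subset_iff[of "ev (g i)" N N K] Cons.prems that by auto
  ultimately show ?case using Cons.IH[OF w] Cons.prems by (auto intro!: sum_mem)
qed

lemma pair_index_less: "r < N \<Longrightarrow> s < N \<Longrightarrow> r * N + s < N * N"
proof -
  assume "r < N" "s < N"
  then have "r * N + s < Suc r * N" by simp
  also have "\<dots> \<le> N * N" using \<open>r < N\<close> by (intro mult_right_mono) auto
  finally show ?thesis .
qed

text \<open>The words are orthogonal for the trace form, so the square matrix of their coordinates has a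
  left inverse, hence a right inverse, which says that they span all matrices.\<close>

lemma ev_surj:
  assumes gK: "\<And>i. i < 2 * p \<Longrightarrow> elements_mat (ev (g i)) \<subseteq> K"
    and NN: "N * N = 2 ^ (2 * p)"
    and A: "A \<in> carrier_mat N N" "elements_mat A \<subseteq> K"
  shows "A \<in> ev ` Ev"
proof -
  let ?n = "N * N"
  obtain e where e: "bij_betw e {..<?n} W"
    using ex_bij_betw_nat_finite[OF finite_W] by (auto simp: card_W NN atLeast0LessThan)
  have eW: "e a \<in> W" if "a < ?n" for a using e that by (auto simp: bij_betw_def)
  \<comment> \<open>Position \<open>(r, s)\<close> of an \<open>N\<close> by \<open>N\<close> matrix
    is numbered \<open>r * N + s\<close>. The rows of \<open>P\<close> hold the transposed entries
    of the dual elements, so that a row of \<open>P\<close> times a column of \<open>Q\<close> is a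
    trace.\<close>
  define P where "P = mat ?n ?n (\<lambda>(a, k). ev (G (rev (e a))) $$ (k mod N, k div N) / (of_nat N * \<Gamma> (e a)))"
  define Q where "Q = mat ?n ?n (\<lambda>(k, b). ev (G (e b)) $$ (k div N, k mod N))"
  have PQ: "P \<in> carrier_mat ?n ?n" "Q \<in> carrier_mat ?n ?n" by (auto simp: P_def Q_def)
  have split: "(\<Sum>k<?n. f (k div N) (k mod N)) = (\<Sum>r<N. \<Sum>s<N. f r s)" for f :: "nat \<Rightarrow> nat \<Rightarrow> complex"
  proof -
    have "(\<Sum>r<N. \<Sum>s<N. f r s) = (\<Sum>(r, s)\<in>{..<N} \<times> {..<N}. f r s)" by (rule sum.cartesian_product)
    also have "\<dots> = (\<Sum>k<?n. f (k div N) (k mod N))"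
      by (rule sum.reindex_bij_witness[of _ "\<lambda>k. (k div N, k mod N)" "\<lambda>(r, s). r * N + s"])
         (use N_pos in \<open>auto simp: less_mult_imp_div_less mult.commute intro: pair_index_less\<close>)
    finally show ?thesis ..
  qed
  have "P * Q = 1\<^sub>m ?n"
  proof (rule eq_matI)
    fix a b assume "a < dim_row (1\<^sub>m ?n :: complex mat)" "b < dim_col (1\<^sub>m ?n :: complex mat)"
    then have ab: "a < ?n" "b < ?n" by auto
    have "(P * Q) $$ (a, b) = (\<Sum>k<?n. P $$ (a, k) * Q $$ (k, b))"
      by (rule mult_mat_entry[OF PQ ab])
    also have "\<dots> = (\<Sum>k<?n. ev (G (rev (e a))) $$ (k mod N, k div N) / (of_nat N * \<Gamma> (e a)) *
        ev (G (e b)) $$ (k div N, k mod N))"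
      using ab by (intro sum.cong) (auto simp: P_def Q_def)
    also have "\<dots> = (\<Sum>r<N. \<Sum>s<N. ev (G (rev (e a))) $$ (s, r) / (of_nat N * \<Gamma> (e a)) * ev (G (e b)) $$ (r, s))"
      by (rule split)
    also have "\<dots> = mtr (ev (G (rev (e a))) * ev (G (e b))) / (of_nat N * \<Gamma> (e a))"
      unfolding mtr_def
      by (subst sum.swap) (simp add: mult_mat_entry[of _ N N _ N] sum_divide_distrib del: index_mult_mat(1))
    also have "\<dots> = (if a = b then 1 else 0)"
      unfolding mtr_ev_G_pair[OF eW[OF ab(1)] eW[OF ab(2)]]
      using e ab N_pos \<Gamma>_props[OF W_subset[OF eW[OF ab(1)]]]
      by (auto simp: bij_betw_def inj_on_def)
    finally show "(P * Q) $$ (a, b) = 1\<^sub>m ?n $$ (a, b)" using ab by simp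
  qed (use PQ in auto)
  from mat_mult_left_right_inverse[OF PQ this] have QP: "Q * P = 1\<^sub>m ?n" .
  have AK: "A $$ (r, s) \<in> K" if "r < N" "s < N" for r s
    using A that elements_mat_subset_iff by blast
  have PK: "P $$ (b, k) \<in> K" if "b < ?n" "k < ?n" for b k
  proof -
    have "k mod N < N" "k div N < N" using that N_pos by (auto simp: less_mult_imp_div_less)
    then show ?thesis
      using that ev_G_over_K[OF gK, of "rev (e b)" "k mod N" "k div N"] W_subset[OF eW[OF that(1)]] \<Gamma>_props
      by (auto simp: P_def)
  qed
  \<comment> \<open>For \<open>w\<close> in \<open>W\<close> this is the trace of the reversed word
    times \<open>A\<close>, divided by \<open>of_nat N * \<Gamma> w\<close>: the coordinate of
    \<open>A\<close> given by the dual element. It lies in \<open>K\<close> because the entries of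
    all words and of \<open>A\<close> do.\<close>
  define c where "c w = (if w \<in> W then \<Sum>k<?n. P $$ (inv_into {..<?n} e w, k) * A $$ (k div N, k mod N) else 0)" for w
  have inv: "inv_into {..<?n} e w < ?n" if "w \<in> W" for w
    using that e by (metis bij_betw_imp_surj_on inv_into_into lessThan_iff)
  have cK: "range c \<subseteq> K"
    using inv N_pos by (auto simp: c_def less_mult_imp_div_less intro!: sum_mem mult_mem PK AK)
  have "ev (comb c) = A"
  proof (rule eq_matI)
    fix r s assume "r < dim_row A" "s < dim_col A"
    then have rs: "r < N" "s < N" using A by auto
    define l where "l = r * N + s"
    have l: "l < ?n" "l div N = r" "l mod N = s" using rs pair_index_less[OF rs] by (auto simp: l_def mult.commute)
    have "ev (comb c) $$ (r, s) = (\<Sum>w\<in>W. c w * ev (G w) $$ (r, s))" by (rule ev_comb_entry[OF cK rs])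
    also have "\<dots> = (\<Sum>b<?n. c (e b) * ev (G (e b)) $$ (r, s))"
      by (rule sum.reindex_bij_betw[OF e, symmetric])
    also have "\<dots> = (\<Sum>b<?n. \<Sum>k<?n. Q $$ (l, b) * P $$ (b, k) * A $$ (k div N, k mod N))"
    proof (rule sum.cong[OF refl])
      fix b assume "b \<in> {..<?n}"
      then have b: "b < ?n" by simp
      have "inv_into {..<?n} e (e b) = b" using e b by (auto simp: bij_betw_def)
      moreover have "Q $$ (l, b) = ev (G (e b)) $$ (r, s)" using l b by (simp add: Q_def)
      ultimately show "c (e b) * ev (G (e b)) $$ (r, s) = (\<Sum>k<?n. Q $$ (l, b) * P $$ (b, k) * A $$ (k div N, k mod N))"
        using eW[OF b] by (simp add: c_def sum_distrib_left sum_distrib_right mult_ac)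
    qed
    also have "\<dots> = (\<Sum>k<?n. (\<Sum>b<?n. Q $$ (l, b) * P $$ (b, k)) * A $$ (k div N, k mod N))"
      by (subst sum.swap) (simp add: sum_distrib_right)
    also have "\<dots> = (\<Sum>k<?n. (if k = l then A $$ (k div N, k mod N) else 0))"
    proof (rule sum.cong[OF refl])
      fix k assume "k \<in> {..<?n}"
      then have k: "k < ?n" by simp
      have "(\<Sum>b<?n. Q $$ (l, b) * P $$ (b, k)) = (Q * P) $$ (l, k)"
        by (rule mult_mat_entry[OF PQ(2,1) l(1) k, symmetric])
      then show "(\<Sum>b<?n. Q $$ (l, b) * P $$ (b, k)) * A $$ (k div N, k mod N) = (if k = l then A $$ (k div N, k mod N) else 0)"
        using k l by (simp add: QP)
    qed
    also have "\<dots> = A $$ (r, s)" using l by (simp add: sum.delta)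
    finally show "ev (comb c) $$ (r, s) = A $$ (r, s)" .
  qed (use A in auto)
  then show ?thesis using comb_mem[OF cK] by blast
qed

text \<open>Evaluation is injective by the simplicity argument, takes values over \<open>K\<close>
  because the generators do, and reaches every matrix over \<open>K\<close> because the number of
  words is \<open>N * N\<close>. So it identifies the quotient with a full matrix algebra over
  \<open>K\<close>.\<close>

theorem split_same_brauer_class:
  assumes gK: "\<And>i. i < 2 * p \<Longrightarrow> elements_mat (ev (g i)) \<subseteq> K"
    and NN: "N * N = 2 ^ (2 * p)"
  shows "same_brauer_class (subfield_ring K) alg (base_algebra K)"
proof -
  let ?M = "matrix_algebra N (base_algebra K)"
  let ?D = "{..<N} \<times> {..<N}"
  let ?t = "\<lambda>A :: complex mat. restrict (\<lambda>(i, j). A $$ (i, j)) ?D"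
  let ?f = "\<lambda>C. ?t (h C)"
  have M: "carrier ?M = ?D \<rightarrow>\<^sub>E K"
    "\<And>P Q. P \<otimes>\<^bsub>?M\<^esub> Q = restrict (\<lambda>(i, j). finsum (base_algebra K) (\<lambda>k. P (i, k) * Q (k, j)) {..<N}) ?D"
    "\<one>\<^bsub>?M\<^esub> = restrict (\<lambda>(i, j). if i = j then 1 else 0) ?D"
    "\<And>P Q. P \<oplus>\<^bsub>?M\<^esub> Q = restrict (\<lambda>e. P e + Q e) ?D"
    "\<And>c P. c \<odot>\<^bsub>?M\<^esub> P = restrict (\<lambda>e. c * P e) ?D"
    by (auto simp: matrix_algebra_def Let_def base_algebra_def fun_eq_iff)
  have hK: "h C $$ (i, j) \<in> K" if C: "C \<in> carrier alg" and ij: "i < N" "j < N" for C i j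
  proof -
    have "h C \<in> ev ` Ev" using C h_image by blast
    then obtain c where c: "range c \<subseteq> K" "h C = ev (comb c)" unfolding ev_image by blast
    show ?thesis unfolding c(2) ev_comb_entry[OF c(1) ij]
      using c ev_G_over_K[OF gK W_subset ij] by (intro sum_mem mult_mem) auto
  qed
  have iso: "?f \<in> ring_iso alg ?M"
  proof (rule ring_iso_memI)
    fix C assume C: "C \<in> carrier alg"
    show "?f C \<in> carrier ?M" using hK[OF C] by (auto simp: M)
    fix C' assume C': "C' \<in> carrier alg"
    note ops = h_ops[OF C C' zero_mem]
    show "?f (C \<otimes>\<^bsub>alg\<^esub> C') = ?f C \<otimes>\<^bsub>?M\<^esub> ?f C'"
    proof
      fix ij :: "nat \<times> nat"
      obtain i j where ij: "ij = (i, j)" by (cases ij)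
      have "finsum (base_algebra K) (\<lambda>k. ?t (h C) (i, k) * ?t (h C') (k, j)) {..<N} = (h C * h C') $$ (i, j)" if "i < N" "j < N"
        using that hK[OF C] hK[OF C'] mult_mat_entry[OF h_carrier[OF C] h_carrier[OF C'] that]
        by (subst finsum_base) auto
      then show "?f (C \<otimes>\<^bsub>alg\<^esub> C') ij = (?f C \<otimes>\<^bsub>?M\<^esub> ?f C') ij"
        unfolding M ops ij by (cases "(i, j) \<in> ?D") (auto simp only: restrict_apply if_True if_False split mem_Sigma_iff lessThan_iff)
    qed
    show "?f (C \<oplus>\<^bsub>alg\<^esub> C') = ?f C \<oplus>\<^bsub>?M\<^esub> ?f C'"
      unfolding M ops using h_carrier[OF C] h_carrier[OF C'] by (auto simp: fun_eq_iff)
  next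
    show "?f \<one>\<^bsub>alg\<^esub> = \<one>\<^bsub>?M\<^esub>" unfolding M h_one by (auto simp: fun_eq_iff)
    show "bij_betw ?f (carrier alg) (carrier ?M)"
    proof (rule bij_betw_imageI)
      have t_inj: "A = B" if "A \<in> carrier_mat N N" "B \<in> carrier_mat N N" "?t A = ?t B" for A B
      proof (rule eq_matI)
        fix i j assume "i < dim_row B" "j < dim_col B"
        then have "(i, j) \<in> ?D" using that by auto
        then show "A $$ (i, j) = B $$ (i, j)" using fun_cong[OF that(3), of "(i, j)"] by simp
      qed (use that in auto)
      show "inj_on ?f (carrier alg)"
        by (rule inj_onI) (metis h_carrier h_inj inj_onD t_inj)
      show "?f ` carrier alg = carrier ?M"
      proof
        show "?f ` carrier alg \<subseteq> carrier ?M" using hK by (auto simp: M split: if_splits)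
        show "carrier ?M \<subseteq> ?f ` carrier alg"
        proof
          fix P assume P: "P \<in> carrier ?M"
          define A where "A = mat N N P"
          have A: "A \<in> carrier_mat N N" by (simp add: A_def)
          have "elements_mat A \<subseteq> K" unfolding elements_mat_subset_iff[OF A]
            using P by (auto simp: A_def M)
          from ev_surj[OF gK NN A this] obtain C where C: "C \<in> carrier alg" "h C = A"
            using h_image by (metis (no_types, lifting) imageE)
          have "?f C = P" using P C by (auto simp: A_def M fun_eq_iff PiE_def extensional_def restrict_def)
          then show "P \<in> ?f ` carrier alg" using C by blast
        qed
      qed
    qed
  qed
  have sm: "?f (c \<odot>\<^bsub>alg\<^esub> C) = c \<odot>\<^bsub>?M\<^esub> ?f C" if "c \<in> carrier (subfield_ring K)" "C \<in> carrier alg" for c C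
    using h_ops(3)[of C C c] h_carrier[of C] that unfolding M by (auto simp: fun_eq_iff)
  have "algebra_isomorphic (subfield_ring K) alg ?M"
    by (rule algebra_isomorphicI[where f = ?f], rule iso, rule sm)
  then have "algebra_isomorphic (subfield_ring K) (matrix_algebra 1 alg) ?M"
    by (rule algebra_isomorphic_matrix_1_left[OF ring_alg])
  moreover have "0 < (1 :: nat)" by simp
  ultimately show ?thesis unfolding same_brauer_class_def
    using central_simple_alg central_simple_base N_pos by blast
qed

end

text \<open>Both images consist of the \<open>K\<close>-combinations of the same matrix words, so
  they coincide, and one evaluation followed by the inverse of the other is an isomorphism. The
  common image may be a proper \<open>K\<close>-subalgebra of the complex matrices, so the argument
  also serves for algebras that do not split over \<open>K\<close>.\<close>

lemma matrix_models_same_brauer_class: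
  assumes A: "matrix_model K m I Ev p g \<gamma> N Z" and B: "matrix_model K m' I' Ev' p g' \<gamma>' N Z'"
    and eq: "\<And>i. i < 2 * p \<Longrightarrow> eval_mat N Z (g i) = eval_mat N Z' (g' i)"
  shows "same_brauer_class (subfield_ring K)
    (anticommuting_quotient.alg K m I Ev) (anticommuting_quotient.alg K m' I' Ev')"
proof -
  interpret A: matrix_model K m I Ev p g \<gamma> N Z by (rule A)
  interpret B: matrix_model K m' I' Ev' p g' \<gamma>' N Z' by (rule B)
  have wm: "word_mat N (\<lambda>i. A.ev (g i)) w = word_mat N (\<lambda>i. B.ev (g' i)) w"
    if "set w \<subseteq> {..<2 * p}" for w
    using that by (induction w) (auto simp: eq)
  have evq: "A.ev (A.comb c) = B.ev (B.comb c)" if "range c \<subseteq> K" for c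
  proof (rule eq_matI)
    fix r s assume "r < dim_row (B.ev (B.comb c))" "s < dim_col (B.ev (B.comb c))"
    then have rs: "r < N" "s < N" by auto
    show "A.ev (A.comb c) $$ (r, s) = B.ev (B.comb c) $$ (r, s)"
      unfolding A.ev_comb_entry[OF that rs] B.ev_comb_entry[OF that rs]
      by (intro sum.cong refl) (simp add: A.ev_G B.ev_G B.W_subset wm)
  qed auto
  have im: "A.ev ` Ev = B.ev ` Ev'"
    unfolding A.ev_image B.ev_image by (intro Collect_cong ex_cong1) (metis evq)
  define f where "f = inv_into (carrier B.alg) B.h \<circ> A.h"
  have bij: "bij_betw f (carrier A.alg) (carrier B.alg)"
    unfolding f_def
  proof (rule bij_betw_trans)
    show "bij_betw A.h (carrier A.alg) (B.h ` carrier B.alg)"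
      using A.h_inj by (simp add: bij_betw_def A.h_image B.h_image im)
    show "bij_betw (inv_into (carrier B.alg) B.h) (B.h ` carrier B.alg) (carrier B.alg)"
      by (rule bij_betw_inv_into[OF inj_on_imp_bij_betw[OF B.h_inj]])
  qed
  have fB: "f C \<in> carrier B.alg" "B.h (f C) = A.h C" if "C \<in> carrier A.alg" for C
  proof -
    have "A.h C \<in> B.h ` carrier B.alg" using that A.h_image B.h_image im by blast
    then show "f C \<in> carrier B.alg" "B.h (f C) = A.h C"
      by (auto simp: f_def inv_into_into f_inv_into_f)
  qed
  interpret RA: ring A.alg by (rule A.ring_alg)
  interpret RB: ring B.alg by (rule B.ring_alg)
  have smA: "c \<odot>\<^bsub>A.alg\<^esub> C \<in> carrier A.alg" if "c \<in> K" "C \<in> carrier A.alg" for c C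
    using that by (auto simp: A.carrier_alg A.smult_alg A.Ev_subset A.Ev_scl)
  have smB: "c \<odot>\<^bsub>B.alg\<^esub> C \<in> carrier B.alg" if "c \<in> K" "C \<in> carrier B.alg" for c C
    using that by (auto simp: B.carrier_alg B.smult_alg B.Ev_subset B.Ev_scl)
  have eqI: "C = C'" if "C \<in> carrier B.alg" "C' \<in> carrier B.alg" "B.h C = B.h C'" for C C'
    using B.h_inj that by (meson inj_onD)
  have iso: "f \<in> ring_iso A.alg B.alg"
  proof (rule ring_iso_memI)
    fix C assume C: "C \<in> carrier A.alg"
    show "f C \<in> carrier B.alg" by (rule fB(1)[OF C])
    fix D assume D: "D \<in> carrier A.alg"
    show "f (C \<otimes>\<^bsub>A.alg\<^esub> D) = f C \<otimes>\<^bsub>B.alg\<^esub> f D"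
      by (rule eqI) (simp_all add: fB C D A.h_ops(1)[OF C D A.zero_mem] B.h_ops(1)[OF fB(1)[OF C] fB(1)[OF D] A.zero_mem])
    show "f (C \<oplus>\<^bsub>A.alg\<^esub> D) = f C \<oplus>\<^bsub>B.alg\<^esub> f D"
      by (rule eqI) (simp_all add: fB C D A.h_ops(2)[OF C D A.zero_mem] B.h_ops(2)[OF fB(1)[OF C] fB(1)[OF D] A.zero_mem])
  next
    show "f \<one>\<^bsub>A.alg\<^esub> = \<one>\<^bsub>B.alg\<^esub>" by (rule eqI) (simp_all add: fB A.h_one B.h_one)
    show "bij_betw f (carrier A.alg) (carrier B.alg)" by (rule bij)
  qed
  have sm: "f (c \<odot>\<^bsub>A.alg\<^esub> C) = c \<odot>\<^bsub>B.alg\<^esub> f C" if "c \<in> carrier (subfield_ring K)" "C \<in> carrier A.alg" for c C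
    by (rule eqI) (use that in \<open>simp_all add: fB smA smB A.h_ops(3)[of C C c] B.h_ops(3)[of "f C" "f C" c]\<close>)
  have "algebra_isomorphic (subfield_ring K) A.alg B.alg"
    by (rule algebra_isomorphicI[where f = f], rule iso, rule sm)
  then have "algebra_isomorphic (subfield_ring K) (matrix_algebra 1 A.alg) (matrix_algebra 1 B.alg)"
    by (intro algebra_isomorphic_matrix_1_left algebra_isomorphic_matrix_1_right A.ring_alg B.ring_alg)
  moreover have "0 < (1 :: nat)" by simp
  ultimately show ?thesis unfolding same_brauer_class_def
    using A.central_simple_alg B.central_simple_alg by blast
qed

section \<open>Even Clifford algebras of diagonalised forms and quaternion algebras\<close>

text \<open>The numbers \<open>c i\<close> play the part of half the norms of an orthogonal basis,
  on account of the factor 1/2 in the Clifford relation.\<close>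

definition clifford_matrices :: "nat \<Rightarrow> nat \<Rightarrow> (nat \<Rightarrow> complex) \<Rightarrow> (nat \<Rightarrow> complex mat) \<Rightarrow> bool" where
  "clifford_matrices N m c Z \<longleftrightarrow>
     (\<forall>i<m. Z i \<in> carrier_mat N N) \<and> (\<forall>i<m. Z i * Z i = c i \<cdot>\<^sub>m 1\<^sub>m N) \<and>
     (\<forall>i<m. \<forall>j<m. i \<noteq> j \<longrightarrow> Z i * Z j = (- 1) \<cdot>\<^sub>m (Z j * Z i))"

section \<open>Vectors as tensors, and the subalgebra of even tensors\<close>

lemma vec_tensor_add:
  "u \<in> carrier_vec m \<Longrightarrow> v \<in> carrier_vec m \<Longrightarrow> vec_tensor (u + v) = vec_tensor u + vec_tensor v"
  by (auto simp: vec_tensor_def fun_eq_iff)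

lemma vec_tensor_expand:
  fixes v :: "complex vec"
  assumes "v \<in> carrier_vec m"
  shows "vec_tensor v = (\<Sum>i<m. v $ i \<cdot> monom_word [i])"
proof
  fix w
  have app: "(\<Sum>i\<in>A. v $ i \<cdot> monom_word [i]) w = (\<Sum>i\<in>A. if w = [i] then v $ i else 0)" if "finite A" for A
    using that by induction (auto simp: scl_def monom_word_def)
  show "vec_tensor v w = (\<Sum>i<m. v $ i \<cdot> monom_word [i]) w"
  proof (cases "\<exists>k. w = [k]")
    case True
    then obtain k where k: "w = [k]" by blast
    have "(\<Sum>i<m. if w = [i] then v $ i else 0) = (\<Sum>i<m. if i = k then v $ i else 0)"
      by (intro sum.cong) (auto simp: k)
    then show ?thesis using assms unfolding app[OF finite_lessThan] by (auto simp: vec_tensor_def k)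
  next
    case False
    then show ?thesis unfolding app[OF finite_lessThan] by (auto simp: vec_tensor_def length_Suc_conv)
  qed
qed

lemma (in csubfield) vec_tensor_mem:
  "(v :: complex vec) \<in> carrier_vec m \<Longrightarrow> (\<And>i. i < m \<Longrightarrow> v $ i \<in> K) \<Longrightarrow> vec_tensor v \<in> carrier (tensor_algebra K m)"
  unfolding vec_tensor_expand by (intro tensor_sum_mem tensor_scl_mem tensor_monom_mem) auto

definition even_tensors :: "complex set \<Rightarrow> nat \<Rightarrow> (nat list \<Rightarrow> complex) set" where
  "even_tensors K m = {x \<in> carrier (tensor_algebra K m). \<forall>w. x w \<noteq> 0 \<longrightarrow> even (length w)}"

context csubfield
begin

lemma even_tensors_conv: "x \<in> even_tensors K m \<Longrightarrow> y \<in> even_tensors K m \<Longrightarrow> x \<star> y \<in> even_tensors K m"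
  unfolding even_tensors_def
proof (safe intro!: tensor_conv_mem)
  fix w assume x: "\<forall>w. x w \<noteq> 0 \<longrightarrow> even (length w)" "\<forall>w. y w \<noteq> 0 \<longrightarrow> even (length w)" and "(x \<star> y) w \<noteq> 0"
  from this(3) obtain k where k: "x (take k w) \<noteq> 0" "y (drop k w) \<noteq> 0" "k \<le> length w" by (rule conv_nonzero_split)
  then have "even (length (take k w))" "even (length (drop k w))" using x by blast+
  then have "even (length (take k w) + length (drop k w))" by simp
  then show "even (length w)" using k(3) by simp
qed

lemma even_tensors_add: "x \<in> even_tensors K m \<Longrightarrow> y \<in> even_tensors K m \<Longrightarrow> x + y \<in> even_tensors K m"
  unfolding even_tensors_def
proof (safe intro!: tensor_add_mem)
  fix w assume x: "\<forall>w. x w \<noteq> 0 \<longrightarrow> even (length w)" "\<forall>w. y w \<noteq> 0 \<longrightarrow> even (length w)" and "(x + y) w \<noteq> 0"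
  then have "x w \<noteq> 0 \<or> y w \<noteq> 0" by auto
  then show "even (length w)" using x by blast
qed

lemma even_tensors_scl: "c \<in> K \<Longrightarrow> x \<in> even_tensors K m \<Longrightarrow> c \<cdot> x \<in> even_tensors K m"
  unfolding even_tensors_def using tensor_scl_mem[of x m c] by (auto simp: scl_def)

lemma even_tensors_monom: "set w \<subseteq> {..<m} \<Longrightarrow> even (length w) \<Longrightarrow> monom_word w \<in> even_tensors K m"
  unfolding even_tensors_def using tensor_monom_mem[of w m] by (auto simp: monom_word_def)

lemma vec_tensor_conv_even:
  fixes u v :: "complex vec"
  assumes "u \<in> carrier_vec m" "v \<in> carrier_vec m" "\<And>i. i < m \<Longrightarrow> u $ i \<in> K" "\<And>i. i < m \<Longrightarrow> v $ i \<in> K"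
  shows "vec_tensor u \<star> vec_tensor v \<in> even_tensors K m"
  unfolding even_tensors_def
proof (safe intro!: tensor_conv_mem vec_tensor_mem assms)
  fix w assume "(vec_tensor u \<star> vec_tensor v) w \<noteq> 0"
  then obtain k where k: "vec_tensor u (take k w) \<noteq> 0" "vec_tensor v (drop k w) \<noteq> 0" "k \<le> length w"
    by (rule conv_nonzero_split)
  then have "length (take k w) = 1" "length (drop k w) = 1" by (auto simp: vec_tensor_def split: if_splits)
  then have "length (take k w) + length (drop k w) = 2" by simp
  then show "even (length w)" using k(3) by simp
qed

end

text \<open>The columns of \<open>S\<close> form an orthogonal basis over \<open>K\<close> with
  norms \<open>2 * c i\<close>, so their squares in the Clifford algebra are the \<open>c i\<close>.
  The dimension is odd, and the last index \<open>l\<close> is singled out: the products of the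
  other basis vectors with the last one will be the even number of generators of the even
  algebra.\<close>

locale diagonal_form = csubfield K for K +
  fixes p :: nat and F S :: "complex mat" and c :: "nat \<Rightarrow> complex" and m l :: nat
  assumes m_def: "m = 2 * p + 1" and l_def: "l = 2 * p"
    and F: "F \<in> carrier_mat m m" "elements_mat F \<subseteq> K"
    and S: "S \<in> carrier_mat m m" "elements_mat S \<subseteq> K"
    and diag: "S\<^sup>T * F * S = mat m m (\<lambda>(i, j). if i = j then 2 * c i else 0)"
    and c_mem: "i < m \<Longrightarrow> c i \<in> K" and c_nonzero: "i < m \<Longrightarrow> c i \<noteq> 0"
begin

lemma l_less: "l < m" by (simp add: m_def l_def)

text \<open>The inverse of \<open>S\<close>, read off from the diagonalisation so that its entries
  visibly lie in \<open>K\<close>.\<close>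

definition S' :: "complex mat" where
  "S' = mat m m (\<lambda>(i, j). (S\<^sup>T * F) $$ (i, j) / (2 * c i))"

lemma S'_carrier: "S' \<in> carrier_mat m m" by (simp add: S'_def)

lemma S_K: "i < m \<Longrightarrow> j < m \<Longrightarrow> S $$ (i, j) \<in> K"
  using S elements_mat_subset_iff by blast

lemma F_K: "i < m \<Longrightarrow> j < m \<Longrightarrow> F $$ (i, j) \<in> K"
  using F elements_mat_subset_iff by blast

lemma STF_carrier: "S\<^sup>T * F \<in> carrier_mat m m"
  using S F by simp

lemma S'_K: "i < m \<Longrightarrow> j < m \<Longrightarrow> S' $$ (i, j) \<in> K"
proof -
  assume ij: "i < m" "j < m"
  have "S\<^sup>T \<in> carrier_mat m m" using S by simp
  from mult_mat_entry[OF this F(1) ij] have "(S\<^sup>T * F) $$ (i, j) = (\<Sum>t<m. S\<^sup>T $$ (i, t) * F $$ (t, j))" .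
  moreover have "\<dots> \<in> K" using ij S by (intro sum_mem mult_mem) (auto intro: S_K F_K)
  ultimately show ?thesis using ij c_mem[of i] by (auto simp: S'_def)
qed

lemma S'_S: "S' * S = 1\<^sub>m m"
proof (rule eq_matI)
  fix i j assume "i < dim_row (1\<^sub>m m :: complex mat)" "j < dim_col (1\<^sub>m m :: complex mat)"
  then have ij: "i < m" "j < m" by auto
  have "(S' * S) $$ (i, j) = (\<Sum>t<m. S' $$ (i, t) * S $$ (t, j))"
    by (rule mult_mat_entry[OF S'_carrier S(1) ij])
  also have "\<dots> = (\<Sum>t<m. (S\<^sup>T * F) $$ (i, t) * S $$ (t, j)) / (2 * c i)"
    using ij by (simp add: S'_def sum_divide_distrib del: index_mult_mat(1))
  also have "\<dots> = (S\<^sup>T * F * S) $$ (i, j) / (2 * c i)"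
    by (simp only: mult_mat_entry[OF STF_carrier S(1) ij])
  also have "\<dots> = 1\<^sub>m m $$ (i, j)" using ij c_nonzero[of i] by (auto simp: diag)
  finally show "(S' * S) $$ (i, j) = 1\<^sub>m m $$ (i, j)" .
qed (use S S'_carrier in auto)

lemma S_S': "S * S' = 1\<^sub>m m"
  by (rule mat_mult_left_right_inverse[OF S'_carrier S(1) S'_S])

lemma col_K: "j < m \<Longrightarrow> i < m \<Longrightarrow> col S j $ i \<in> K"
  using S S_K[of i j] by simp

lemma col_carrier: "j < m \<Longrightarrow> col S j \<in> carrier_vec m"
  by (intro carrier_vecI) (use S(1) in simp)

definition y :: "nat \<Rightarrow> nat list \<Rightarrow> complex" where
  "y j = vec_tensor (col S j)"

abbreviation "TA \<equiv> carrier (tensor_algebra K m)"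
abbreviation "CI \<equiv> clifford_ideal K m F"

lemma y_T: "j < m \<Longrightarrow> y j \<in> TA"
  unfolding y_def by (intro vec_tensor_mem col_carrier col_K)

definition gens :: "(nat list \<Rightarrow> complex) set" where
  "gens = {vec_tensor v \<star> vec_tensor v - (1 / 2 * (v \<bullet> (F *\<^sub>v v))) \<cdot> unit_word | v.
     v \<in> carrier_vec m \<and> (\<forall>i<m. v $ i \<in> K)}"

lemma form_K:
  fixes v :: "complex vec"
  assumes "v \<in> carrier_vec m" "\<forall>i<m. v $ i \<in> K"
  shows "v \<bullet> (F *\<^sub>v v) \<in> K"
  using assms F by (auto simp: scalar_prod_def intro!: sum_mem mult_mem F_K)

lemma gen_terms_mem:
  fixes v :: "complex vec"
  assumes "v \<in> carrier_vec m" "\<forall>i<m. v $ i \<in> K"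
  shows "vec_tensor v \<star> vec_tensor v \<in> TA" "(1 / 2 * (v \<bullet> (F *\<^sub>v v))) \<cdot> unit_word \<in> TA"
  using assms form_K[OF assms] by (auto intro!: tensor_mem vec_tensor_mem mult_mem divide_mem)

lemma gens_T: "gens \<subseteq> TA"
  unfolding gens_def using gen_terms_mem tensor_diff_mem by blast

lemma clifford_ideal_eq: "CI = Idl\<^bsub>tensor_algebra K m\<^esub> gens"
proof -
  have vs: "set\<^sub>v v \<subseteq> K \<longleftrightarrow> (\<forall>i<m. v $ i \<in> K)" if "v \<in> carrier_vec m" for v :: "complex vec"
    using that by (auto simp: vec_set_def)
  have "{(vec_tensor v \<star> vec_tensor v) \<ominus>\<^bsub>tensor_algebra K m\<^esub> ((1 / 2 * (v \<bullet> (F *\<^sub>v v))) \<cdot> unit_word) | v.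
        v \<in> carrier_vec m \<and> set\<^sub>v v \<subseteq> K} = gens"
    unfolding gens_def
  proof (intro Collect_cong ex_cong1)
    fix x and v :: "complex vec"
    show "(x = (vec_tensor v \<star> vec_tensor v) \<ominus>\<^bsub>tensor_algebra K m\<^esub> ((1 / 2 * (v \<bullet> (F *\<^sub>v v))) \<cdot> unit_word) \<and>
        v \<in> carrier_vec m \<and> set\<^sub>v v \<subseteq> K) =
      (x = vec_tensor v \<star> vec_tensor v - (1 / 2 * (v \<bullet> (F *\<^sub>v v))) \<cdot> unit_word \<and>
        v \<in> carrier_vec m \<and> (\<forall>i<m. v $ i \<in> K))"
      using vs[of v] gen_terms_mem[of v] tensor_a_minus by metis
  qed
  then show ?thesis unfolding clifford_ideal_def Let_def tensor_algebra_simps by simp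
qed

lemma ideal_CI: "ideal CI (tensor_algebra K m)"
proof -
  interpret R: ring "tensor_algebra K m" by (rule ring_tensor_algebra)
  show ?thesis unfolding clifford_ideal_eq by (rule R.genideal_ideal[OF gens_T])
qed

lemma gens_subset: "gens \<subseteq> CI"
proof -
  interpret R: ring "tensor_algebra K m" by (rule ring_tensor_algebra)
  show ?thesis unfolding clifford_ideal_eq by (rule R.genideal_self[OF gens_T])
qed

sublocale C: tensor_ideal K m CI
  by (intro tensor_ideal.intro tensor_ideal_axioms.intro csubfield_axioms ideal_CI)

notation C.eqv (infix \<open>\<approx>\<close> 50)

lemma square_eqv:
  fixes v :: "complex vec"
  assumes "v \<in> carrier_vec m" "\<forall>i<m. v $ i \<in> K"
  shows "vec_tensor v \<star> vec_tensor v \<approx> (1 / 2 * (v \<bullet> (F *\<^sub>v v))) \<cdot> unit_word"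
  unfolding C.eqv_def using gens_subset assms unfolding gens_def by blast

lemma col_form: "i < m \<Longrightarrow> j < m \<Longrightarrow> col S i \<bullet> (F *\<^sub>v col S j) = (if i = j then 2 * c i else 0)"
proof -
  assume ij: "i < m" "j < m"
  have ST: "S\<^sup>T \<in> carrier_mat m m" using S by simp
  have "S\<^sup>T * F * S = S\<^sup>T * (F * S)" by (rule assoc_mult_mat[OF ST F(1) S(1)])
  then have "(S\<^sup>T * F * S) $$ (i, j) = row (S\<^sup>T) i \<bullet> col (F * S) j" using ij S F by simp
  also have "row (S\<^sup>T) i = col S i" using ij S by simp
  also have "col (F * S) j = F *\<^sub>v col S j" using ij S F by (intro col_mult2[of _ m m _ m]) auto
  finally show ?thesis using ij by (simp add: diag)
qed

lemma y_square: "j < m \<Longrightarrow> y j \<star> y j \<approx> c j \<cdot> unit_word"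
  using square_eqv[of "col S j"] col_carrier[of j] col_K[of j] col_form[of j j] by (simp add: y_def)

text \<open>Polarisation: the ideal contains only relations for squares, so the relation is applied
  to the sum of the two columns, whose norm is the sum of their norms by orthogonality.\<close>

lemma y_anticommute:
  assumes "i < m" "j < m" "i \<noteq> j"
  shows "y i \<star> y j \<approx> - (y j \<star> y i)"
proof -
  let ?u = "col S i" and ?v = "col S j"
  have cr: "?u \<in> carrier_vec m" "?v \<in> carrier_vec m" using assms col_carrier by auto
  have fu: "F *\<^sub>v ?u \<in> carrier_vec m" "F *\<^sub>v ?v \<in> carrier_vec m" using F cr by auto
  have K: "\<forall>k<m. (?u + ?v) $ k \<in> K"
  proof (intro allI impI)
    fix k assume k: "k < m"
    then have "(?u + ?v) $ k = ?u $ k + ?v $ k" using S(1) by (intro index_add_vec(1)) simp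
    then show "(?u + ?v) $ k \<in> K" using col_K[OF assms(1) k] col_K[OF assms(2) k] by (simp only: add_mem)
  qed
  have "F *\<^sub>v (?u + ?v) = F *\<^sub>v ?u + F *\<^sub>v ?v" by (rule mult_add_distrib_mat_vec[OF F(1) cr])
  then have form: "(?u + ?v) \<bullet> (F *\<^sub>v (?u + ?v)) = 2 * c i + 2 * c j"
    using col_form assms cr fu
    by (simp add: add_scalar_prod_distrib[of _ m] scalar_prod_add_distrib[of _ m])
  have "(y i + y j) \<star> (y i + y j) \<approx> (c i + c j) \<cdot> unit_word"
    using square_eqv[OF _ K] cr form by (simp add: y_def vec_tensor_add[OF cr])
  then have a: "(y i + y j) \<star> (y i + y j) - (c i + c j) \<cdot> unit_word \<in> CI" by (simp only: C.eqv_def)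
  have b: "y i \<star> y i - c i \<cdot> unit_word \<in> CI" and d: "y j \<star> y j - c j \<cdot> unit_word \<in> CI"
    using y_square[OF assms(1)] y_square[OF assms(2)] by (simp_all only: C.eqv_def)
  have "((y i + y j) \<star> (y i + y j) - (c i + c j) \<cdot> unit_word) - (y i \<star> y i - c i \<cdot> unit_word)
      - (y j \<star> y j - c j \<cdot> unit_word) \<in> CI" by (rule C.I_diff[OF C.I_diff[OF a b] d])
  moreover have "((y i + y j) \<star> (y i + y j) - (c i + c j) \<cdot> unit_word) - (y i \<star> y i - c i \<cdot> unit_word)
      - (y j \<star> y j - c j \<cdot> unit_word) = y i \<star> y j - - (y j \<star> y i)"
    by (simp only: conv_add_left conv_add_right scl_add_left) (simp add: fun_eq_iff)
  ultimately show ?thesis unfolding C.eqv_def by (simp only:)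
qed

text \<open>Dividing by \<open>c l\<close> makes \<open>g i\<close> equal to \<open>y i\<close>
  times the inverse of \<open>y l\<close>. Its square \<open>\<gamma> i\<close> is a ratio of norms,
  with a sign from moving \<open>y l\<close> past \<open>y i\<close>, so a common factor of the form
  cancels.\<close>

definition g :: "nat \<Rightarrow> nat list \<Rightarrow> complex" where
  "g i = (1 / c l) \<cdot> (y i \<star> y l)"

definition \<gamma> :: "nat \<Rightarrow> complex" where
  "\<gamma> i = - (c i / c l)"

lemma cl: "c l \<in> K" "c l \<noteq> 0" "1 / c l \<in> K"
  using c_mem c_nonzero l_less by auto

lemma swap_last:
  assumes "j < 2 * p" "z \<in> TA"
  shows "y l \<star> (y j \<star> z) \<approx> - (y j \<star> (y l \<star> z))"
proof -
  have "y l \<star> y j \<approx> - (y j \<star> y l)" by (rule y_anticommute) (use assms in \<open>auto simp: m_def l_def\<close>)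
  from C.eqv_right[OF assms(2) this] show ?thesis by (simp only: conv_assoc conv_uminus_left)
qed

lemma square_left:
  assumes "j < m" "z \<in> TA"
  shows "y j \<star> (y j \<star> z) \<approx> c j \<cdot> z"
  using C.eqv_right[OF assms(2) y_square[OF assms(1)]]
  by (simp only: conv_assoc conv_scl_left conv_unit_left)

text \<open>Moving \<open>y l\<close> past \<open>y j\<close> costs a sign and brings it next to the
  other \<open>y l\<close>; their product is \<open>c l\<close> and cancels one of the two
  denominators. The right factor \<open>z\<close> allows the relation to be applied in front of an
  arbitrary tensor.\<close>

lemma g_mult_eqv:
  assumes ij: "i < 2 * p" "j < 2 * p" and z: "z \<in> TA"
  shows "g i \<star> (g j \<star> z) \<approx> (- (1 / c l)) \<cdot> (y i \<star> (y j \<star> z))"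
proof -
  have lm: "l < m" "i < m" "j < m" using ij by (auto simp: m_def l_def)
  have yT: "y l \<in> TA" "y i \<in> TA" "y j \<in> TA" using lm y_T by auto
  have "y l \<star> (y j \<star> (y l \<star> z)) \<approx> - (y j \<star> (y l \<star> (y l \<star> z)))"
    by (rule swap_last) (use ij z yT in \<open>auto intro: tensor_conv_mem\<close>)
  also have "\<dots> \<approx> - (y j \<star> (c l \<cdot> z))"
    by (intro C.eqv_uminus C.eqv_left square_left yT lm z)
  finally have "y i \<star> (y l \<star> (y j \<star> (y l \<star> z))) \<approx> y i \<star> (- (y j \<star> (c l \<cdot> z)))"
    by (intro C.eqv_left yT)
  from C.eqv_scl[OF _ this, of "1 / c l * (1 / c l)"]
  have "(1 / c l * (1 / c l)) \<cdot> (y i \<star> (y l \<star> (y j \<star> (y l \<star> z)))) \<approx>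
      (1 / c l * (1 / c l)) \<cdot> (y i \<star> (- (y j \<star> (c l \<cdot> z))))" using cl by auto
  moreover have "g i \<star> (g j \<star> z) = (1 / c l * (1 / c l)) \<cdot> (y i \<star> (y l \<star> (y j \<star> (y l \<star> z))))"
    by (simp only: g_def conv_scl_left conv_scl_right scl_scl conv_assoc)
  moreover have "(1 / c l * (1 / c l)) \<cdot> (y i \<star> (- (y j \<star> (c l \<cdot> z)))) = (- (1 / c l)) \<cdot> (y i \<star> (y j \<star> z))"
    using cl by (simp only: conv_uminus_right conv_scl_right scl_scl scl_uminus_right scl_uminus_left)
      (simp only: mult.assoc times_divide_eq_left mult_1_left divide_self mult_1_right not_False_eq_True)
  ultimately show ?thesis by simp
qed

sublocale E: anticommuting_quotient K m CI "even_tensors K m" p g \<gamma>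
proof
  show "x \<in> TA" if "x \<in> even_tensors K m" for x using that by (simp add: even_tensors_def)
  show "unit_word \<in> even_tensors K m" by (rule even_tensors_monom) auto
  fix i assume i: "i < 2 * p"
  then have im: "i < m" by (simp add: m_def)
  show "g i \<in> even_tensors K m" unfolding g_def y_def
    by (intro even_tensors_scl vec_tensor_conv_even cl col_carrier col_K l_less im)
  show "\<gamma> i \<in> K" "\<gamma> i \<noteq> 0" using c_mem[OF im] c_nonzero[OF im] cl by (auto simp: \<gamma>_def)
  have "g i \<star> (g i \<star> unit_word) \<approx> (- (1 / c l)) \<cdot> (y i \<star> (y i \<star> unit_word))"
    by (rule g_mult_eqv[OF i i]) (auto intro: tensor_monom_mem)
  also have "\<dots> \<approx> (- (1 / c l)) \<cdot> c i \<cdot> unit_word"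
    by (intro C.eqv_scl square_left im uminus_mem cl tensor_monom_mem) auto
  also have "(- (1 / c l)) \<cdot> c i \<cdot> unit_word = \<gamma> i \<cdot> unit_word"
    by (simp only: scl_scl \<gamma>_def mult_minus_left times_divide_eq_left mult_1_left)
  finally show "g i \<star> g i - \<gamma> i \<cdot> unit_word \<in> CI" by (simp only: conv_unit_right C.eqv_def)
  fix j assume j: "j < 2 * p" and ij: "i \<noteq> j"
  have jm: "j < m" using j by (simp add: m_def)
  have "g i \<star> (g j \<star> unit_word) \<approx> (- (1 / c l)) \<cdot> (y i \<star> (y j \<star> unit_word))"
    by (rule g_mult_eqv[OF i j]) (auto intro: tensor_monom_mem)
  moreover have "g j \<star> (g i \<star> unit_word) \<approx> (- (1 / c l)) \<cdot> (y j \<star> (y i \<star> unit_word))"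
    by (rule g_mult_eqv[OF j i]) (auto intro: tensor_monom_mem)
  ultimately have "g i \<star> g j + g j \<star> g i \<approx> (- (1 / c l)) \<cdot> (y i \<star> y j) + (- (1 / c l)) \<cdot> (y j \<star> y i)"
    unfolding conv_unit_right by (rule C.eqv_add)
  also have "\<dots> \<approx> (- (1 / c l)) \<cdot> (- (y j \<star> y i)) + (- (1 / c l)) \<cdot> (y j \<star> y i)"
    by (intro C.eqv_add C.eqv_refl C.eqv_scl y_anticommute ij im jm uminus_mem cl)
  also have "(- (1 / c l)) \<cdot> (- (y j \<star> y i)) + (- (1 / c l)) \<cdot> (y j \<star> y i) = 0"
    by (simp only: scl_uminus_right) (simp only: left_minus)
  finally show "g i \<star> g j + g j \<star> g i \<in> CI" by (simp only: C.eqv_zero_iff)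
qed (fact even_tensors_add even_tensors_conv even_tensors_scl)+

text \<open>An even word is a product of pairs of vectors. A pair avoiding \<open>l\<close> is a
  scalar times two generators, a pair with one \<open>l\<close> is a single generator up to a scalar
  and a sign, and the pair of two \<open>l\<close> is a scalar.\<close>

lemma spanned_yy:
  assumes a: "a < m" and b: "b < m" and z: "z \<in> TA" "E.spanned z"
  shows "E.spanned (y a \<star> (y b \<star> z))"
proof -
  have yl: "y l \<in> TA" by (rule y_T[OF l_less])
  have mixed: "E.spanned (y i \<star> (y l \<star> z))" if "i < 2 * p" for i
  proof -
    have "y i \<star> (y l \<star> z) = c l \<cdot> (g i \<star> z)"
      using cl by (simp only: g_def conv_scl_left scl_scl conv_assoc)
        (simp only: times_divide_eq_right mult_1_right divide_self not_False_eq_True scl_one)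
    then show ?thesis by (simp only:) (intro E.spanned_scl cl E.spanned_g_mult that z)
  qed
  consider "a < 2 * p" "b < 2 * p" | "a < 2 * p" "b = l" | "a = l" "b < 2 * p" | "a = l" "b = l"
    using a b by (auto simp: m_def l_def less_Suc_eq)
  then show ?thesis
  proof cases
    case 1
    have sp: "E.spanned ((- c l) \<cdot> (g a \<star> (g b \<star> z)))"
      by (intro E.spanned_scl E.spanned_g_mult 1 z uminus_mem cl)
    have "(- c l) \<cdot> (g a \<star> (g b \<star> z)) \<approx> (- c l) \<cdot> (- (1 / c l)) \<cdot> (y a \<star> (y b \<star> z))"
      by (intro C.eqv_scl g_mult_eqv 1 z uminus_mem cl)
    also have "(- c l) \<cdot> (- (1 / c l)) \<cdot> (y a \<star> (y b \<star> z)) = y a \<star> (y b \<star> z)"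
      using cl by (simp only: scl_scl minus_mult_minus times_divide_eq_right mult_1_right divide_self not_False_eq_True scl_one)
    finally have "y a \<star> (y b \<star> z) \<approx> (- c l) \<cdot> (g a \<star> (g b \<star> z))" by (rule C.eqv_sym)
    then show ?thesis using sp by (rule E.spanned_cong)
  next
    case 2 then show ?thesis using mixed by simp
  next
    case 3
    have "y l \<star> (y b \<star> z) \<approx> - (y b \<star> (y l \<star> z))" by (rule swap_last[OF 3(2) z(1)])
    then show ?thesis unfolding 3(1) by (rule E.spanned_cong) (intro E.spanned_uminus mixed 3)
  next
    case 4
    show ?thesis unfolding 4
      by (rule E.spanned_cong[OF square_left[OF l_less z(1)]]) (intro E.spanned_scl cl z)
  qed
qed

lemma monom_eq_y: "i < m \<Longrightarrow> monom_word [i] = (\<Sum>j<m. S' $$ (j, i) \<cdot> y j)"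
proof -
  assume i: "i < m"
  have "(\<Sum>j<m. S' $$ (j, i) \<cdot> y j) = (\<Sum>j<m. \<Sum>k<m. (S' $$ (j, i) * S $$ (k, j)) \<cdot> monom_word [k])"
  proof (rule sum.cong[OF refl])
    fix j assume "j \<in> {..<m}"
    then have j: "j < m" by simp
    have "y j = (\<Sum>k<m. S $$ (k, j) \<cdot> monom_word [k])"
      unfolding y_def vec_tensor_expand[OF col_carrier[OF j]]
      using S j by (intro sum.cong refl) auto
    then show "S' $$ (j, i) \<cdot> y j = (\<Sum>k<m. (S' $$ (j, i) * S $$ (k, j)) \<cdot> monom_word [k])"
      by (simp only: scl_sum_right scl_scl)
  qed
  also have "\<dots> = (\<Sum>k<m. \<Sum>j<m. (S' $$ (j, i) * S $$ (k, j)) \<cdot> monom_word [k])" by (rule sum.swap)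
  also have "\<dots> = (\<Sum>k<m. (\<Sum>j<m. S $$ (k, j) * S' $$ (j, i)) \<cdot> monom_word [k])"
    by (simp only: scl_sum_left mult.commute)
  also have "\<dots> = (\<Sum>k<m. if k = i then monom_word [k] else 0)"
  proof (rule sum.cong[OF refl])
    fix k assume "k \<in> {..<m}"
    then have "(\<Sum>j<m. S $$ (k, j) * S' $$ (j, i)) = (S * S') $$ (k, i)"
      using i by (intro mult_mat_entry[OF S(1) S'_carrier, symmetric]) auto
    then show "(\<Sum>j<m. S $$ (k, j) * S' $$ (j, i)) \<cdot> monom_word [k] = (if k = i then monom_word [k] else 0)"
      using i \<open>k \<in> {..<m}\<close> by (cases "k = i") (simp_all only: S_S' index_one_mat lessThan_iff simp_thms if_True if_False scl_one scl_zero)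
  qed
  also have "\<dots> = monom_word [i]" using i by (simp only: sum.delta finite_lessThan lessThan_iff if_True)
  finally show ?thesis ..
qed

lemma spanned_monom_pair:
  assumes "i < m" "j < m" and z: "z \<in> TA" "E.spanned z"
  shows "E.spanned (monom_word [i] \<star> (monom_word [j] \<star> z))"
proof -
  have "monom_word [i] \<star> (monom_word [j] \<star> z) =
      (\<Sum>a<m. \<Sum>b<m. (S' $$ (a, i) * S' $$ (b, j)) \<cdot> (y a \<star> (y b \<star> z)))"
  proof -
    have "monom_word [j] \<star> z = (\<Sum>b<m. S' $$ (b, j) \<cdot> (y b \<star> z))"
      unfolding monom_eq_y[OF assms(2)] by (simp only: conv_sum_left conv_scl_left)
    then have "y a \<star> (monom_word [j] \<star> z) = (\<Sum>b<m. S' $$ (b, j) \<cdot> (y a \<star> (y b \<star> z)))" for a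
      by (simp only: conv_sum_right conv_scl_right)
    then show ?thesis unfolding monom_eq_y[OF assms(1)]
      by (simp only: conv_sum_left conv_scl_left scl_sum_right scl_scl)
  qed
  then show ?thesis
    by (simp only:) (intro E.spanned_sum E.spanned_scl spanned_yy z mult_mem S'_K; use assms in simp)
qed

lemma spanned_monom: "set w \<subseteq> {..<m} \<Longrightarrow> even (length w) \<Longrightarrow> E.spanned (monom_word w)"
proof (induction w rule: induct_list012)
  case 1
  show ?case using E.spanned_G[OF E.Nil_in_W] by simp
next
  case (3 i j w)
  have "monom_word (i # j # w) = monom_word [i] \<star> (monom_word [j] \<star> monom_word w)"
    using monom_word_append[of "[i]" "[j] @ w"] monom_word_append[of "[j]" w] by simp
  then show ?case using 3 by (simp only:) (intro spanned_monom_pair tensor_monom_mem; auto)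
qed simp

lemma even_spanned: "x \<in> even_tensors K m \<Longrightarrow> E.spanned x"
proof -
  assume x: "x \<in> even_tensors K m"
  then have xT: "x \<in> TA" by (simp add: even_tensors_def)
  have "E.spanned (\<Sum>w\<in>{w. x w \<noteq> 0}. x w \<cdot> monom_word w)"
    using x by (intro E.spanned_sum E.spanned_scl spanned_monom)
      (auto simp: even_tensors_def tensor_carrier_iff)
  then show ?thesis using tensor_expand[OF xT] by simp
qed

lemma alg_eq: "E.alg = even_clifford_algebra K m F"
  unfolding E.alg_def
  unfolding even_clifford_algebra_def clifford_algebra_def even_tensors_def by simp

text \<open>The tensor algebra is free on the standard basis, while the matrices are prescribed on
  the orthogonal one. These are the images of the standard vectors under the linear map that sends
  \<open>y j\<close> to \<open>Z j\<close>.\<close>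

definition V :: "nat \<Rightarrow> (nat \<Rightarrow> complex mat) \<Rightarrow> nat \<Rightarrow> complex mat" where
  "V N Z i = mat N N (\<lambda>(r, s). \<Sum>j<m. S' $$ (j, i) * Z j $$ (r, s))"

context
  fixes N :: nat and Z :: "nat \<Rightarrow> complex mat"
  assumes Z: "clifford_matrices N m c Z" and N_pos: "N > 0"
begin

interpretation tensor_eval K m N "V N Z"
  by standard (simp add: V_def)

lemma ev_vec_tensor:
  fixes v :: "complex vec"
  assumes v: "v \<in> carrier_vec m" "\<forall>i<m. v $ i \<in> K" and rs: "r < N" "s < N"
  shows "eval_mat N (V N Z) (vec_tensor v) $$ (r, s) = (\<Sum>j<m. (S' *\<^sub>v v) $ j * Z j $$ (r, s))"
proof -
  have V: "V N Z i \<in> carrier_mat N N" for i by (simp add: V_def)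
  have "eval_mat N (V N Z) (vec_tensor v) $$ (r, s) = (\<Sum>i<m. ev (v $ i \<cdot> monom_word [i]) $$ (r, s))"
    unfolding vec_tensor_expand[OF v(1)] using v rs
    by (intro ev_sum_entry tensor_scl_mem tensor_monom_mem) auto
  also have "\<dots> = (\<Sum>i<m. v $ i * V N Z i $$ (r, s))"
  proof (rule sum.cong[OF refl])
    fix i assume "i \<in> {..<m}"
    then have "ev (v $ i \<cdot> monom_word [i]) = v $ i \<cdot>\<^sub>m V N Z i"
      using V[of i] by (subst ev_scl) (auto intro!: tensor_monom_mem simp: ev_monom)
    then show "ev (v $ i \<cdot> monom_word [i]) $$ (r, s) = v $ i * V N Z i $$ (r, s)"
      using V[of i] rs by simp
  qed
  also have "\<dots> = (\<Sum>i<m. \<Sum>j<m. S' $$ (j, i) * v $ i * Z j $$ (r, s))"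
    using rs by (simp add: V_def sum_distrib_left mult_ac)
  also have "\<dots> = (\<Sum>j<m. (\<Sum>i<m. S' $$ (j, i) * v $ i) * Z j $$ (r, s))"
    by (subst sum.swap) (simp add: sum_distrib_right)
  also have "\<dots> = (\<Sum>j<m. (S' *\<^sub>v v) $ j * Z j $$ (r, s))"
    using v S'_carrier by (intro sum.cong refl) (auto simp: scalar_prod_def atLeast0LessThan)
  finally show ?thesis .
qed

lemma ev_y: "j < m \<Longrightarrow> ev (y j) = Z j"
proof (rule eq_matI)
  assume j: "j < m"
  have Zc: "Z j \<in> carrier_mat N N" using Z j unfolding clifford_matrices_def by blast
  then show "dim_row (ev (y j)) = dim_row (Z j)" "dim_col (ev (y j)) = dim_col (Z j)" by auto
  fix r s assume "r < dim_row (Z j)" "s < dim_col (Z j)"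
  then have rs: "r < N" "s < N" using Zc by auto
  have "S' *\<^sub>v col S j = col (S' * S) j" using S S'_carrier j by (intro col_mult2[symmetric, of _ m m _ m]) auto
  then have unit: "(S' *\<^sub>v col S j) $ k = (if k = j then 1 else 0)" if "k < m" for k
    using that j by (simp add: S'_S)
  have "ev (y j) $$ (r, s) = (\<Sum>k<m. (S' *\<^sub>v col S j) $ k * Z k $$ (r, s))"
    unfolding y_def using col_K[OF j] by (intro ev_vec_tensor col_carrier j rs) auto
  also have "\<dots> = (\<Sum>k<m. if k = j then Z k $$ (r, s) else 0)"
    by (intro sum.cong refl) (simp add: unit)
  finally show "ev (y j) $$ (r, s) = Z j $$ (r, s)" using j by simp
qed

text \<open>The ideal has a generator for every vector over \<open>K\<close>, so the relation is
  checked for an arbitrary \<open>v\<close>, through its coordinates \<open>d\<close> with respect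
  to the columns of \<open>S\<close>, in which the form is diagonal.\<close>

lemma ev_gens: "x \<in> gens \<Longrightarrow> ev x = 0\<^sub>m N N"
proof -
  assume "x \<in> gens"
  then obtain v :: "complex vec" where v: "v \<in> carrier_vec m" "\<forall>i<m. v $ i \<in> K"
    and x: "x = vec_tensor v \<star> vec_tensor v - (1 / 2 * (v \<bullet> (F *\<^sub>v v))) \<cdot> unit_word"
    unfolding gens_def by blast
  define u where "u = S' *\<^sub>v v"
  define d where "d j = vec_index u j" for j
  have u: "u \<in> carrier_vec m" using v S'_carrier by (auto simp: u_def)
  have vS: "v = S *\<^sub>v u"
    unfolding u_def using assoc_mult_mat_vec[OF S(1) S'_carrier v(1)] S_S' v by simp
  have ST: "S\<^sup>T \<in> carrier_mat m m" using S by simp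
  have Fv: "F *\<^sub>v v \<in> carrier_vec m" using F v by auto
  have "v \<bullet> (F *\<^sub>v v) = (F *\<^sub>v v) \<bullet> (S *\<^sub>v u)"
    using comm_scalar_prod[OF v(1) Fv] vS by simp
  also have "\<dots> = (S\<^sup>T *\<^sub>v (F *\<^sub>v v)) \<bullet> u"
    by (rule transpose_vec_mult_scalar[OF S(1) u Fv, symmetric])
  also have "S\<^sup>T *\<^sub>v (F *\<^sub>v v) = (S\<^sup>T * F) *\<^sub>v v" by (rule assoc_mult_mat_vec[OF ST F(1) v(1), symmetric])
  also have "\<dots> = (S\<^sup>T * F * S) *\<^sub>v u"
    unfolding vS by (rule assoc_mult_mat_vec[OF STF_carrier S(1) u, symmetric])
  also have "\<dots> \<bullet> u = (\<Sum>j<m. 2 * c j * d j * d j)"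
  proof -
    have "(mat m m (\<lambda>(i, j). if i = j then 2 * c i else 0) *\<^sub>v u) $ j = 2 * c j * u $ j" if "j < m" for j
    proof -
      have "(mat m m (\<lambda>(i, j). if i = j then 2 * c i else 0) *\<^sub>v u) $ j =
          (\<Sum>k<m. (if j = k then 2 * c j else 0) * u $ k)"
        using that u by (auto simp: scalar_prod_def atLeast0LessThan)
      also have "\<dots> = (\<Sum>k<m. if k = j then 2 * c k * u $ k else 0)" by (intro sum.cong refl) auto
      finally show ?thesis using that by simp
    qed
    then show ?thesis unfolding diag d_def using u by (simp add: scalar_prod_def atLeast0LessThan)
  qed
  finally have form: "1 / 2 * (v \<bullet> (F *\<^sub>v v)) = (\<Sum>j<m. c j * d j * d j)"
    by (simp add: sum_distrib_left mult_ac)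
  have vT: "vec_tensor v \<in> TA" using v by (intro vec_tensor_mem) auto
  have ev_x: "ev x = ev (vec_tensor v) * ev (vec_tensor v) - (1 / 2 * (v \<bullet> (F *\<^sub>v v))) \<cdot>\<^sub>m 1\<^sub>m N"
    unfolding x using gen_terms_mem[OF v] vT by (simp add: ev_diff ev_conv ev_scl ev_unit tensor_monom_mem)
  show ?thesis
  proof (rule eq_matI)
    fix r s assume "r < dim_row (0\<^sub>m N N :: complex mat)" "s < dim_col (0\<^sub>m N N :: complex mat)"
    then have rs: "r < N" "s < N" by auto
    have Zc: "Z j \<in> carrier_mat N N" if "j < m" for j using Z that unfolding clifford_matrices_def by blast
    let ?q = "\<lambda>j k. d j * d k * (Z j * Z k) $$ (r, s)"
    have ZZ: "(Z j * Z k) $$ (r, s) + (Z k * Z j) $$ (r, s) = (if j = k then (if r = s then 2 * c j else 0) else 0)"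
      if "j < m" "k < m" for j k
    proof (cases "j = k")
      case True
      have "Z j * Z j = c j \<cdot>\<^sub>m 1\<^sub>m N" using Z that unfolding clifford_matrices_def by blast
      then show ?thesis using True rs by (simp del: index_mult_mat(1))
    next
      case False
      then have "Z j * Z k = (- 1) \<cdot>\<^sub>m (Z k * Z j)" using Z that unfolding clifford_matrices_def by blast
      then have "(Z j * Z k) $$ (r, s) = - ((Z k * Z j) $$ (r, s))"
        using rs Zc[OF that(1)] Zc[OF that(2)] by (simp del: index_mult_mat(1))
      then show ?thesis using False by simp
    qed
    have "(ev (vec_tensor v) * ev (vec_tensor v)) $$ (r, s) =
        (\<Sum>t<N. (\<Sum>j<m. d j * Z j $$ (r, t)) * (\<Sum>k<m. d k * Z k $$ (t, s)))"
      unfolding mult_mat_entry[OF eval_mat_carrier eval_mat_carrier rs]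
    proof (rule sum.cong[OF refl])
      fix t assume "t \<in> {..<N}"
      then have t: "t < N" by simp
      show "ev (vec_tensor v) $$ (r, t) * ev (vec_tensor v) $$ (t, s) =
          (\<Sum>j<m. d j * Z j $$ (r, t)) * (\<Sum>k<m. d k * Z k $$ (t, s))"
        by (simp only: ev_vec_tensor[OF v rs(1) t] ev_vec_tensor[OF v t rs(2)] d_def u_def)
    qed
    also have "\<dots> = (\<Sum>t<N. \<Sum>j<m. \<Sum>k<m. d j * d k * (Z j $$ (r, t) * Z k $$ (t, s)))"
      unfolding sum_product by (intro sum.cong refl) (simp only: mult_ac)
    also have "\<dots> = (\<Sum>j<m. \<Sum>t<N. \<Sum>k<m. d j * d k * (Z j $$ (r, t) * Z k $$ (t, s)))"
      by (rule sum.swap)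
    also have "\<dots> = (\<Sum>j<m. \<Sum>k<m. \<Sum>t<N. d j * d k * (Z j $$ (r, t) * Z k $$ (t, s)))"
      by (intro sum.cong refl sum.swap)
    also have "\<dots> = (\<Sum>j<m. \<Sum>k<m. ?q j k)"
      by (intro sum.cong refl) (simp add: mult_mat_entry[OF Zc Zc rs] sum_distrib_left del: index_mult_mat(1))
    finally have sq: "(ev (vec_tensor v) * ev (vec_tensor v)) $$ (r, s) = (\<Sum>j<m. \<Sum>k<m. ?q j k)" .
    \<comment> \<open>The double sum is added to its transpose, so that anticommutation removes the
      mixed terms without splitting the index set.\<close>
    have "2 * (\<Sum>j<m. \<Sum>k<m. ?q j k) = (\<Sum>j<m. \<Sum>k<m. ?q j k) + (\<Sum>j<m. \<Sum>k<m. ?q k j)"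
      by (subst sum.swap[of "\<lambda>j k. ?q k j"]) simp
    also have "\<dots> = (\<Sum>j<m. \<Sum>k<m. d j * d k * ((Z j * Z k) $$ (r, s) + (Z k * Z j) $$ (r, s)))"
      by (simp add: sum.distrib[symmetric] algebra_simps del: index_mult_mat(1))
    also have "\<dots> = (\<Sum>j<m. \<Sum>k<m. if k = j then d j * d j * (if r = s then 2 * c j else 0) else 0)"
      by (intro sum.cong refl) (simp add: ZZ del: index_mult_mat(1))
    also have "\<dots> = (if r = s then 2 * (\<Sum>j<m. c j * d j * d j) else 0)"
      by (simp add: sum_distrib_left mult_ac)
    finally have "(\<Sum>j<m. \<Sum>k<m. ?q j k) = (if r = s then 1 / 2 * (v \<bullet> (F *\<^sub>v v)) else 0)"
      unfolding form by (simp split: if_splits)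
    then show "ev x $$ (r, s) = 0\<^sub>m N N $$ (r, s)"
      unfolding ev_x using rs sq by (simp del: index_mult_mat(1))
  qed (auto simp: ev_x)
qed

lemma clifford_matrix_model: "matrix_model K m CI (even_tensors K m) p g \<gamma> N (V N Z)"
proof
  show "eval_mat N (V N Z) x = 0\<^sub>m N N" if "x \<in> CI" for x
    using ev_genideal[OF gens_T ev_gens] that unfolding clifford_ideal_eq by blast
qed (use N_pos even_spanned in auto)

lemma ev_g: "i < 2 * p \<Longrightarrow> eval_mat N (V N Z) (g i) = (1 / c l) \<cdot>\<^sub>m (Z i * Z l)"
proof -
  assume "i < 2 * p"
  then have i: "i < m" by (simp add: m_def)
  show ?thesis unfolding g_def
    by (simp only: ev_scl ev_conv ev_y y_T tensor_conv_mem i l_less)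
qed

end

end

section \<open>Splitting representations\<close>

lemma smult_smult_times: "a \<cdot>\<^sub>m (b \<cdot>\<^sub>m A) = (a * b) \<cdot>\<^sub>m A" for A :: "complex mat"
  by (rule eq_matI) auto

lemma one_smult_mat: "1 \<cdot>\<^sub>m A = A" for A :: "complex mat"
  by (rule eq_matI) auto

text \<open>With the sign as a parameter, the signs of products are multiplied instead of
  distinguishing commuting and anticommuting factors at each step.\<close>

definition comm_sign :: "complex \<Rightarrow> complex mat \<Rightarrow> complex mat \<Rightarrow> bool" where
  "comm_sign s A B \<longleftrightarrow> A * B = s \<cdot>\<^sub>m (B * A)"

lemma comm_sign_mult_right:
  assumes "A \<in> carrier_mat N N" "B \<in> carrier_mat N N" "C \<in> carrier_mat N N"
    and "comm_sign s A B" "comm_sign t A C"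
  shows "comm_sign (s * t) A (B * C)"
proof -
  have "A * (B * C) = (A * B) * C" using assms by (simp add: assoc_mult_mat[of A N N B N C N])
  also have "\<dots> = s \<cdot>\<^sub>m (B * A * C)"
    using assms by (simp add: comm_sign_def mult_smult_assoc_mat[of "B * A" N N C N])
  also have "B * A * C = B * (A * C)" using assms by (simp add: assoc_mult_mat[of B N N A N C N])
  also have "\<dots> = t \<cdot>\<^sub>m (B * (C * A))"
    using assms by (simp add: comm_sign_def mult_smult_distrib[of B N N "C * A" N])
  also have "B * (C * A) = B * C * A" using assms by (simp add: assoc_mult_mat[of B N N C N A N])
  finally show ?thesis unfolding comm_sign_def by (simp add: smult_smult_times)
qed

lemma comm_sign_sym: "comm_sign s A B \<Longrightarrow> s * s = 1 \<Longrightarrow> comm_sign s B A"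
  by (simp add: comm_sign_def smult_smult_times one_smult_mat)

lemma comm_sign_mult_left:
  assumes "A \<in> carrier_mat N N" "B \<in> carrier_mat N N" "C \<in> carrier_mat N N"
    and "comm_sign s A C" "comm_sign t B C" "s * s = 1" "t * t = 1"
  shows "comm_sign (s * t) (A * B) C"
proof (rule comm_sign_sym)
  show "comm_sign (s * t) C (A * B)"
    by (rule comm_sign_mult_right[OF assms(3,1,2)]) (use assms comm_sign_sym in auto)
  show "s * t * (s * t) = 1" using assms(6,7) by (metis mult.assoc mult.commute mult.right_neutral)
qed

lemma comm_sign_square:
  assumes A: "A \<in> carrier_mat N N" and B: "B \<in> carrier_mat N N"
    and "comm_sign s B A" "A * A = a \<cdot>\<^sub>m 1\<^sub>m N" "B * B = b \<cdot>\<^sub>m 1\<^sub>m N"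
  shows "(A * B) * (A * B) = (s * a * b) \<cdot>\<^sub>m 1\<^sub>m N"
proof -
  have AB: "A * B \<in> carrier_mat N N" using A B by simp
  have "(A * B) * (A * B) = A * (B * (A * B))" by (rule assoc_mult_mat[OF A B AB])
  also have "B * (A * B) = (B * A) * B" by (rule assoc_mult_mat[OF B A B, symmetric])
  also have "\<dots> = s \<cdot>\<^sub>m (A * B * B)"
    unfolding assms(3)[unfolded comm_sign_def] by (rule mult_smult_assoc_mat[OF AB B])
  also have "A * B * B = A * (B * B)" by (rule assoc_mult_mat[OF A B B])
  also have "\<dots> = b \<cdot>\<^sub>m A" unfolding assms(5) using A by (simp add: mult_smult_distrib[OF A one_carrier_mat])
  also have "A * (s \<cdot>\<^sub>m (b \<cdot>\<^sub>m A)) = (s * b) \<cdot>\<^sub>m (A * A)"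
    using A by (simp add: mult_smult_distrib[OF A, of _ N] smult_smult_times)
  finally show ?thesis unfolding assms(4) by (simp add: smult_smult_times mult_ac)
qed

lemma smult_mult_smult:
  fixes A B :: "complex mat"
  assumes "A \<in> carrier_mat N N" "B \<in> carrier_mat N N"
  shows "(x \<cdot>\<^sub>m A) * (z \<cdot>\<^sub>m B) = (x * z) \<cdot>\<^sub>m (A * B)"
  using mult_smult_assoc_mat[OF assms(1), of "z \<cdot>\<^sub>m B" N x] mult_smult_distrib[OF assms, of z] assms(2)
  by (simp add: smult_smult_times)

lemma comm_sign_smult:
  assumes "A \<in> carrier_mat N N" "B \<in> carrier_mat N N" "comm_sign s A B"
  shows "comm_sign s (x \<cdot>\<^sub>m A) (z \<cdot>\<^sub>m B)"
  using assms(3) unfolding comm_sign_def smult_mult_smult[OF assms(1,2)] smult_mult_smult[OF assms(2,1)]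
  by (simp add: smult_smult_times mult_ac)

lemma smult_square:
  fixes A :: "complex mat"
  assumes "A \<in> carrier_mat N N" "A * A = a \<cdot>\<^sub>m 1\<^sub>m N"
  shows "(x \<cdot>\<^sub>m A) * (x \<cdot>\<^sub>m A) = (x * x * a) \<cdot>\<^sub>m 1\<^sub>m N"
  unfolding smult_mult_smult[OF assms(1,1)] assms(2) by (simp add: smult_smult_times)

lemma clifford_matricesI:
  assumes "\<And>i. i < m \<Longrightarrow> Z i \<in> carrier_mat N N" "\<And>i. i < m \<Longrightarrow> Z i * Z i = c i \<cdot>\<^sub>m 1\<^sub>m N"
    "\<And>i j. i < m \<Longrightarrow> j < m \<Longrightarrow> i \<noteq> j \<Longrightarrow> comm_sign (- 1) (Z i) (Z j)"
  shows "clifford_matrices N m c Z"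
  using assms unfolding clifford_matrices_def comm_sign_def by blast

lemma clifford_matricesD:
  assumes "clifford_matrices N m c Z" "i < m"
  shows "Z i \<in> carrier_mat N N" "Z i * Z i = c i \<cdot>\<^sub>m 1\<^sub>m N"
    "j < m \<Longrightarrow> i \<noteq> j \<Longrightarrow> comm_sign (- 1) (Z i) (Z j)"
  using assms unfolding clifford_matrices_def comm_sign_def by blast+

lemma clifford_matrices_scale:
  assumes "clifford_matrices N m c Z"
  shows "clifford_matrices N m (\<lambda>i. x i * x i * c i) (\<lambda>i. x i \<cdot>\<^sub>m Z i)"
  using clifford_matricesD[OF assms]
  by (intro clifford_matricesI smult_square comm_sign_smult[of _ N] smult_carrier_mat) auto

lemma clifford_matrices_cong:
  assumes "clifford_matrices N m c Z" "\<And>i. i < m \<Longrightarrow> c i = c' i" "N = N'" "m = m'"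
  shows "clifford_matrices N' m' c' Z"
proof (rule clifford_matricesI)
  fix i assume "i < m'"
  then have i: "i < m" using assms(4) by simp
  show "Z i \<in> carrier_mat N' N'" "Z i * Z i = c' i \<cdot>\<^sub>m 1\<^sub>m N'"
    using clifford_matricesD(1,2)[OF assms(1) i] assms(2)[OF i] assms(3) by simp_all
  fix j assume "j < m'" "i \<noteq> j"
  then show "comm_sign (- 1) (Z i) (Z j)" using clifford_matricesD(3)[OF assms(1) i] assms(4) by simp
qed

context csubfield
begin

definition over_K :: "nat \<Rightarrow> complex mat \<Rightarrow> bool" where
  "over_K N A \<longleftrightarrow> A \<in> carrier_mat N N \<and> (\<forall>i<N. \<forall>j<N. A $$ (i, j) \<in> K)"

lemma over_K_mult: "over_K N A \<Longrightarrow> over_K N B \<Longrightarrow> over_K N (A * B)"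
  unfolding over_K_def by (auto simp: mult_mat_entry[of _ N N _ N] simp del: index_mult_mat(1) intro!: sum_mem)

lemma over_K_smult: "x \<in> K \<Longrightarrow> over_K N A \<Longrightarrow> over_K N (x \<cdot>\<^sub>m A)"
  unfolding over_K_def by auto

lemma over_K_elements: "over_K N A \<Longrightarrow> elements_mat A \<subseteq> K"
  unfolding over_K_def by (auto simp: elements_mat_subset_iff)

text \<open>The old generators become block diagonal with blocks \<open>Z i\<close> and its
  negative, and so anticommute with every block antidiagonal \<open>H x\<close>. The square of
  \<open>H x\<close> is \<open>e * x\<close>, so \<open>H 1\<close> and \<open>H (- 1)\<close>
  adjoin the squares \<open>e\<close> and \<open>- e\<close>; no root is extracted, and everything
  stays over \<open>K\<close>.\<close>

lemma hyperbolic_extension: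
  assumes Z: "clifford_matrices N m c Z" and K: "\<And>i. i < m \<Longrightarrow> over_K N (Z i)" and e: "e \<in> K"
  shows "\<exists>Z'. clifford_matrices (N + N) (m + 2) (c(m := e, m + 1 := - e)) Z' \<and> (\<forall>i<m + 2. over_K (N + N) (Z' i))"
proof -
  let ?O = "0\<^sub>m N N :: complex mat" and ?E = "1\<^sub>m N :: complex mat"
  define Y where "Y A = four_block_mat A ?O ?O ((- 1) \<cdot>\<^sub>m A)" for A :: "complex mat"
  define H where "H x = four_block_mat ?O (e \<cdot>\<^sub>m ?E) (x \<cdot>\<^sub>m ?E) ?O" for x
  define Z' where "Z' i = (if i < m then Y (Z i) else if i = m then H 1 else H (- 1))" for i
  note Zc = clifford_matricesD(1)[OF Z]
  have Yc: "Y A \<in> carrier_mat (N + N) (N + N)" if "A \<in> carrier_mat N N" for A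
    unfolding Y_def using that by (intro four_block_carrier_mat) auto
  have Hc: "H x \<in> carrier_mat (N + N) (N + N)" for x
    unfolding H_def by (intro four_block_carrier_mat) auto
  have sm: "x \<cdot>\<^sub>m four_block_mat A B C D = four_block_mat (x \<cdot>\<^sub>m A) (x \<cdot>\<^sub>m B) (x \<cdot>\<^sub>m C) (x \<cdot>\<^sub>m D)"
    if "A \<in> carrier_mat N N" "B \<in> carrier_mat N N" "C \<in> carrier_mat N N" "D \<in> carrier_mat N N"
    for x and A B C D :: "complex mat"
    by (rule smult_four_block_mat) (use that in auto)
  have one: "x \<cdot>\<^sub>m 1\<^sub>m (N + N) = four_block_mat (x \<cdot>\<^sub>m ?E) ?O ?O (x \<cdot>\<^sub>m ?E)" for x
    unfolding four_block_one_mat[of N N, symmetric] by (subst sm) auto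
  have YY: "Y A * Y B = four_block_mat (A * B) ?O ?O (A * B)"
    if "A \<in> carrier_mat N N" "B \<in> carrier_mat N N" for A B
    unfolding Y_def using that
    by (subst mult_four_block_mat[of _ N N _ N _ N _ _ N _ N])
       (auto simp: mult_smult_assoc_mat[of A N N _ N] mult_smult_distrib[of A N N _ N] smult_smult_times)
  have HH: "H x * H z = four_block_mat ((e * z) \<cdot>\<^sub>m ?E) ?O ?O ((e * x) \<cdot>\<^sub>m ?E)" for x z
    unfolding H_def
    by (subst mult_four_block_mat[of _ N N _ N _ N _ _ N _ N])
       (auto simp: mult_smult_assoc_mat[of ?E N N _ N] mult_smult_distrib[of ?E N N _ N] smult_smult_times mult_ac)
  have YH: "Y A * H x = four_block_mat ?O (e \<cdot>\<^sub>m A) ((- x) \<cdot>\<^sub>m A) ?O"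
    and HY: "H x * Y A = four_block_mat ?O ((- e) \<cdot>\<^sub>m A) (x \<cdot>\<^sub>m A) ?O"
    if "A \<in> carrier_mat N N" for A x
    unfolding H_def Y_def using that
    by (subst mult_four_block_mat[of _ N N _ N _ N _ _ N _ N];
        auto simp: mult_smult_assoc_mat[of A N N _ N] mult_smult_distrib[of A N N _ N]
        mult_smult_assoc_mat[of ?E N N _ N] smult_smult_times mult_ac)+
  have anti_sym: "comm_sign (- 1) A B \<Longrightarrow> comm_sign (- 1) B A" for A B by (rule comm_sign_sym) auto
  have cYH: "comm_sign (- 1) (Y A) (H x)" if "A \<in> carrier_mat N N" for A x
    unfolding comm_sign_def YH[OF that] HY[OF that] using that by (subst sm) (auto simp: smult_smult_times)
  have cYY: "comm_sign (- 1) (Y A) (Y B)" if "A \<in> carrier_mat N N" "B \<in> carrier_mat N N" "comm_sign (- 1) A B" for A B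
    unfolding comm_sign_def YY[OF that(1,2)] YY[OF that(2,1)] using that
    by (subst sm) (auto simp: comm_sign_def)
  have cHH: "comm_sign (- 1) (H 1) (H (- 1))"
    unfolding comm_sign_def HH by (subst sm) (auto simp: smult_smult_times)
  have "clifford_matrices (N + N) (m + 2) (c(m := e, m + 1 := - e)) Z'"
  proof (rule clifford_matricesI)
    fix i assume i: "i < m + 2"
    then consider "i < m" | "i = m" | "i = m + 1" by linarith
    note icases = this
    show "Z' i \<in> carrier_mat (N + N) (N + N)" using Yc Hc Zc by (auto simp: Z'_def)
    show "Z' i * Z' i = (c(m := e, m + 1 := - e)) i \<cdot>\<^sub>m 1\<^sub>m (N + N)"
      using icases
    proof cases
      case 1
      then show ?thesis using clifford_matricesD(2)[OF Z 1] unfolding one by (simp add: Z'_def YY Zc)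
    qed (simp_all add: Z'_def HH one)
    fix j assume j: "j < m + 2" and ij: "i \<noteq> j"
    from j consider "j < m" | "j = m" | "j = m + 1" by linarith
    note jcases = this
    show "comm_sign (- 1) (Z' i) (Z' j)"
      using icases
    proof cases
      case 1
      from jcases show ?thesis
        by cases (use 1 ij clifford_matricesD(3)[OF Z 1] in \<open>auto simp: Z'_def intro!: cYY cYH Zc\<close>)
    next
      case 2
      from jcases show ?thesis
        by cases (use 2 ij in \<open>auto simp: Z'_def intro!: cYH[THEN anti_sym] cHH Zc\<close>)
    next
      case 3
      from jcases show ?thesis
        by cases (use 3 ij in \<open>auto simp: Z'_def intro!: cYH[THEN anti_sym] cHH[THEN anti_sym] Zc\<close>)
    qed
  qed
  moreover have "over_K (N + N) (Z' i)" if "i < m + 2" for i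
  proof -
    have fb: "over_K (N + N) (four_block_mat A B C D)" if "over_K N A" "over_K N B" "over_K N C" "over_K N D" for A B C D
      using that unfolding over_K_def by auto
    have "over_K N ?O" "over_K N ?E" unfolding over_K_def by auto
    then show ?thesis unfolding Z'_def Y_def H_def using that K e by (auto intro!: fb over_K_smult)
  qed
  ultimately show ?thesis by blast
qed

text \<open>For anticommuting y1, y2, y3, y4 with the same square and w = y1 y2 y3 y4, the elements w yi
  anticommute again, but their squares have the opposite sign.\<close>

lemma flip_four:
  assumes Z: "clifford_matrices N m c Z" and K: "\<And>i. i < m \<Longrightarrow> over_K N (Z i)"
    and a: "distinct [i1, i2, i3, i4]" "i1 < m" "i2 < m" "i3 < m" "i4 < m"
    and c: "c i1 = d" "c i2 = d" "c i3 = d" "c i4 = d" and d: "d \<in> K" "d \<noteq> 0"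
  shows "\<exists>Z'. clifford_matrices N m (\<lambda>i. if i \<in> {i1, i2, i3, i4} then - d else c i) Z' \<and> (\<forall>i<m. over_K N (Z' i))"
proof -
  note Zc = clifford_matricesD(1)[OF Z] and Zs = clifford_matricesD(2)[OF Z] and Za = clifford_matricesD(3)[OF Z]
  define A where "A = Z i1 * Z i2"
  define B where "B = Z i3 * Z i4"
  define w where "w = A * B"
  have carr: "A \<in> carrier_mat N N" "B \<in> carrier_mat N N" "w \<in> carrier_mat N N"
    using Zc[OF a(2)] Zc[OF a(3)] Zc[OF a(4)] Zc[OF a(5)] unfolding A_def B_def w_def
    by (blast intro: mult_carrier_mat)+
  have pair: "comm_sign 1 (Z i * Z j) (Z k)" if "i < m" "j < m" "k < m" "k \<noteq> i" "k \<noteq> j" for i j k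
    using comm_sign_mult_left[OF Zc Zc Zc Za Za, of i j k] that by simp
  have pair1: "comm_sign (- 1) (Z i * Z j) (Z i)" if "i < m" "j < m" "i \<noteq> j" for i j
    using comm_sign_mult_left[OF Zc Zc Zc _ Za, of i j i 1] that by (simp add: comm_sign_def one_smult_mat)
  have pair2: "comm_sign (- 1) (Z i * Z j) (Z j)" if "i < m" "j < m" "i \<noteq> j" for i j
    using comm_sign_mult_left[OF Zc Zc Zc Za, of i j j 1] that by (simp add: comm_sign_def one_smult_mat)
  \<comment> \<open>A generator outside the four anticommutes with all four factors of
    \<open>w\<close> and hence commutes with \<open>w\<close>. One of the four anticommutes only
    with the three others and hence anticommutes with \<open>w\<close>.\<close>
  have wout: "comm_sign 1 w (Z k)" if "k < m" "k \<notin> {i1, i2, i3, i4}" for k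
    using comm_sign_mult_left[OF carr(1,2) Zc, of k 1 1] pair[of i1 i2 k] pair[of i3 i4 k] that a
    by (auto simp: A_def B_def w_def)
  have win: "comm_sign (- 1) w (Z k)" if "k \<in> {i1, i2, i3, i4}" for k
  proof -
    have "comm_sign (- 1) A (Z k) \<and> comm_sign 1 B (Z k) \<or> comm_sign 1 A (Z k) \<and> comm_sign (- 1) B (Z k)"
      using that a pair1[of i1 i2] pair2[of i1 i2] pair1[of i3 i4] pair2[of i3 i4] pair
      by (auto simp: A_def B_def)
    then show ?thesis
      using comm_sign_mult_left[OF carr(1,2) Zc, of k "- 1" 1] comm_sign_mult_left[OF carr(1,2) Zc, of k 1 "- 1"] that a
      by (auto simp: w_def)
  qed
  have km: "k < m" if "k \<in> {i1, i2, i3, i4}" for k using that a by auto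
  have AA: "A * A = (- d * d) \<cdot>\<^sub>m 1\<^sub>m N" "B * B = (- d * d) \<cdot>\<^sub>m 1\<^sub>m N"
    unfolding A_def B_def
    using comm_sign_square[OF Zc Zc Za Zs Zs, of i1 i2] comm_sign_square[OF Zc Zc Za Zs Zs, of i3 i4] a c by auto
  have "comm_sign 1 A B" unfolding B_def
    using comm_sign_mult_right[OF carr(1) Zc Zc, of i3 i4 1 1] pair[of i1 i2 i3] pair[of i1 i2 i4] a
    by (auto simp: A_def)
  then have "comm_sign 1 B A" by (rule comm_sign_sym) simp
  from comm_sign_square[OF carr(1,2) this AA] have ww: "w * w = (d * d * d * d) \<cdot>\<^sub>m 1\<^sub>m N"
    by (simp add: w_def mult_ac)
  have wsq: "(w * Z k) * (w * Z k) = (- (d * d * d * d * d)) \<cdot>\<^sub>m 1\<^sub>m N" if "k \<in> {i1, i2, i3, i4}" for k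
  proof -
    have "comm_sign (- 1) (Z k) w" by (rule comm_sign_sym[OF win[OF that]]) simp
    from comm_sign_square[OF carr(3) Zc[OF km[OF that]] this ww Zs[OF km[OF that]]] show ?thesis
      using that c by (auto simp: mult_ac)
  qed
  \<comment> \<open>The square of \<open>w\<close> is the fourth power of \<open>d\<close>, so each
    \<open>w * Z k\<close> squares to minus the fifth power; this scaling brings it to
    \<open>- d\<close>.\<close>
  define x where "x = 1 / (d * d)"
  define Z' where "Z' i = (if i \<in> {i1, i2, i3, i4} then x \<cdot>\<^sub>m (w * Z i) else Z i)" for i
  have cw: "w * Z k \<in> carrier_mat N N" if "k < m" for k using carr Zc[OF that] by simp
  have out: "comm_sign (- 1) (w * Z k) (Z j)" if "k \<in> {i1, i2, i3, i4}" "j < m" "j \<notin> {i1, i2, i3, i4}" for k j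
    using comm_sign_mult_left[OF carr(3) Zc[OF km[OF that(1)]] Zc[OF that(2)] wout[OF that(2,3)] Za[OF km[OF that(1)] that(2)]] that by auto
  have inn: "comm_sign (- 1) (w * Z k) (w * Z j)" if "k \<in> {i1, i2, i3, i4}" "j \<in> {i1, i2, i3, i4}" "k \<noteq> j" for k j
  proof -
    note kj = km[OF that(1)] km[OF that(2)]
    have 1: "comm_sign 1 w w" by (simp add: comm_sign_def one_smult_mat)
    have 2: "comm_sign (- 1) (Z k) w" by (rule comm_sign_sym[OF win[OF that(1)]]) simp
    have 3: "comm_sign (1 * - 1) (w * Z k) w"
      by (rule comm_sign_mult_left[OF carr(3) Zc[OF kj(1)] carr(3) 1 2]) auto
    have 4: "comm_sign (- 1 * - 1) (w * Z k) (Z j)"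
      by (rule comm_sign_mult_left[OF carr(3) Zc[OF kj(1)] Zc[OF kj(2)] win[OF that(2)] Za[OF kj that(3)]]) auto
    show ?thesis using comm_sign_mult_right[OF cw[OF kj(1)] carr(3) Zc[OF kj(2)] 3 4] by simp
  qed
  have "clifford_matrices N m (\<lambda>i. if i \<in> {i1, i2, i3, i4} then - d else c i) Z'"
  proof (rule clifford_matricesI)
    fix i assume i: "i < m"
    show "Z' i \<in> carrier_mat N N" using cw[OF i] Zc[OF i] by (simp add: Z'_def)
    show "Z' i * Z' i = (if i \<in> {i1, i2, i3, i4} then - d else c i) \<cdot>\<^sub>m 1\<^sub>m N"
    proof (cases "i \<in> {i1, i2, i3, i4}")
      case True
      have "x * x * (- (d * d * d * d * d)) = - d" using d by (simp add: x_def)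
      then show ?thesis using smult_square[OF cw[OF i] wsq[OF True], of x] True by (simp only: Z'_def if_True)
    qed (use Zs[OF i] in \<open>simp add: Z'_def\<close>)
    fix j assume j: "j < m" and ij: "i \<noteq> j"
    show "comm_sign (- 1) (Z' i) (Z' j)"
    proof (cases "i \<in> {i1, i2, i3, i4}"; cases "j \<in> {i1, i2, i3, i4}")
      assume 1: "i \<in> {i1, i2, i3, i4}" "j \<in> {i1, i2, i3, i4}"
      show ?thesis using comm_sign_smult[OF cw[OF i] cw[OF j] inn[OF 1 ij], of x x] 1 by (simp only: Z'_def if_True)
    next
      assume 1: "i \<in> {i1, i2, i3, i4}" "j \<notin> {i1, i2, i3, i4}"
      show ?thesis using comm_sign_smult[OF cw[OF i] Zc[OF j] out[OF 1(1) j 1(2)], of x 1] 1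
        by (simp only: Z'_def if_True if_False one_smult_mat)
    next
      assume 1: "i \<notin> {i1, i2, i3, i4}" "j \<in> {i1, i2, i3, i4}"
      have "comm_sign (- 1) (Z i) (w * Z j)" by (rule comm_sign_sym[OF out[OF 1(2) i 1(1)]]) simp
      from comm_sign_smult[OF Zc[OF i] cw[OF j] this, of 1 x] 1 show ?thesis
        by (simp only: Z'_def if_True if_False one_smult_mat)
    next
      assume 1: "i \<notin> {i1, i2, i3, i4}" "j \<notin> {i1, i2, i3, i4}"
      then show ?thesis using Za[OF i j ij] by (simp only: Z'_def if_False)
    qed
  qed
  moreover have "over_K N (Z' i)" if "i < m" for i
    using K a d that by (auto simp: Z'_def A_def B_def w_def x_def intro!: over_K_smult over_K_mult)
  ultimately show ?thesis by blast
qed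

text \<open>Repeated hyperbolic extension. The alternation of the new squares fixes the places at
  which equal signs stand, where they can be flipped four at a time.\<close>

lemma four_hyperbolic:
  assumes "clifford_matrices N m c Z" "\<And>i. i < m \<Longrightarrow> over_K N (Z i)" and e: "e \<in> K"
  shows "\<exists>Z'. clifford_matrices (N * 2 ^ k) (m + 2 * k) (\<lambda>i. if i < m then c i else if even (i - m) then e else - e) Z' \<and>
    (\<forall>i<m + 2 * k. over_K (N * 2 ^ k) (Z' i))"
proof (induction k)
  case 0
  show ?case using assms by (intro exI[of _ Z] conjI clifford_matrices_cong[OF assms(1)]) auto
next
  case (Suc k)
  let ?c = "\<lambda>i. if i < m then c i else if even (i - m) then e else - e"
  from Suc obtain Z' where Z': "clifford_matrices (N * 2 ^ k) (m + 2 * k) ?c Z'"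
    "\<And>i. i < m + 2 * k \<Longrightarrow> over_K (N * 2 ^ k) (Z' i)" by blast
  from hyperbolic_extension[OF this e] obtain Y where Y:
    "clifford_matrices (N * 2 ^ k + N * 2 ^ k) (m + 2 * k + 2) (?c(m + 2 * k := e, m + 2 * k + 1 := - e)) Y"
    "\<forall>i<m + 2 * k + 2. over_K (N * 2 ^ k + N * 2 ^ k) (Y i)" by blast
  have dim: "N * 2 ^ k + N * 2 ^ k = N * 2 ^ Suc k" "m + 2 * k + 2 = m + 2 * Suc k" by auto
  have "clifford_matrices (N * 2 ^ Suc k) (m + 2 * Suc k) ?c Y"
    by (rule clifford_matrices_cong[OF Y(1) _ dim]) auto
  then show ?case using Y(2) unfolding dim by blast
qed

text \<open>Four hyperbolic planes contribute four squares \<open>e\<close> and four squares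
  \<open>- e\<close>; flipping the latter leaves eight equal squares. This is the periodicity of
  Clifford algebras, with the matrix size growing by the factor 16.\<close>

lemma add_eight:
  assumes "clifford_matrices N m c Z" "\<And>i. i < m \<Longrightarrow> over_K N (Z i)" and e: "e \<in> K" "e \<noteq> 0"
  shows "\<exists>Z'. clifford_matrices (N * 16 ^ k) (m + 8 * k) (\<lambda>i. if i < m then c i else e) Z' \<and>
    (\<forall>i<m + 8 * k. over_K (N * 16 ^ k) (Z' i))"
proof (induction k)
  case 0
  show ?case using assms by (intro exI[of _ Z] conjI clifford_matrices_cong[OF assms(1)]) auto
next
  case (Suc k)
  let ?m = "m + 8 * k" and ?N = "N * 16 ^ k"
  let ?c = "\<lambda>i. if i < m then c i else e"
  from Suc obtain Z' where Z': "clifford_matrices ?N ?m ?c Z'"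
    "\<And>i. i < ?m \<Longrightarrow> over_K ?N (Z' i)" by blast
  let ?d = "\<lambda>i. if i < ?m then ?c i else if even (i - ?m) then e else - e"
  from four_hyperbolic[OF Z' e(1), of 4] obtain Y where Y:
    "clifford_matrices (?N * 2 ^ 4) (?m + 2 * 4) ?d Y" "\<And>i. i < ?m + 2 * 4 \<Longrightarrow> over_K (?N * 2 ^ 4) (Y i)" by blast
  have "\<exists>Z'. clifford_matrices (?N * 2 ^ 4) (?m + 2 * 4)
     (\<lambda>i. if i \<in> {?m + 1, ?m + 3, ?m + 5, ?m + 7} then - (- e) else ?d i) Z' \<and>
     (\<forall>i<?m + 2 * 4. over_K (?N * 2 ^ 4) (Z' i))"
    by (rule flip_four[OF Y]) (use e in auto)
  then obtain V where V: "clifford_matrices (?N * 2 ^ 4) (?m + 2 * 4)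
     (\<lambda>i. if i \<in> {?m + 1, ?m + 3, ?m + 5, ?m + 7} then - (- e) else ?d i) V"
     "\<forall>i<?m + 2 * 4. over_K (?N * 2 ^ 4) (V i)" by blast
  have dim: "?N * 2 ^ 4 = N * 16 ^ Suc k" "?m + 2 * 4 = m + 8 * Suc k" by auto
  have "clifford_matrices (N * 16 ^ Suc k) (m + 8 * Suc k) ?c V"
  proof (rule clifford_matrices_cong[OF V(1) _ dim])
    fix i assume i: "i < ?m + 2 * 4"
    show "(if i \<in> {?m + 1, ?m + 3, ?m + 5, ?m + 7} then - (- e) else ?d i) = ?c i"
    proof (cases "i < ?m")
      case False
      then obtain t where t: "i = ?m + t" using le_Suc_ex by (metis not_less)
      then have "t < 8" using i by simp
      then have "t = 0 \<or> t = 1 \<or> t = 2 \<or> t = 3 \<or> t = 4 \<or> t = 5 \<or> t = 6 \<or> t = 7" by linarith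
      then show ?thesis using t by auto
    qed auto
  qed
  then show ?case using V(2) unfolding dim by blast
qed

lemma one_dim_matrices:
  assumes "d \<in> K"
  shows "clifford_matrices 1 1 (\<lambda>_. d * d) (\<lambda>_. d \<cdot>\<^sub>m 1\<^sub>m 1)" "over_K 1 (d \<cdot>\<^sub>m 1\<^sub>m 1)"
  using assms smult_square[of "1\<^sub>m 1" 1 1 d] by (auto intro!: clifford_matricesI simp: over_K_def)

text \<open>The induction starts from a 1 by 1 matrix over \<open>K\<close>, whose square is
  necessarily a square of \<open>K\<close>. This dictates the pattern
  \<open>d * d, d, ..., d\<close>.\<close>

lemma matrices_8k1:
  assumes d: "d \<in> K" "d \<noteq> 0"
  shows "\<exists>Z. clifford_matrices (16 ^ k) (8 * k + 1) (\<lambda>i. if i = 0 then d * d else d) Z \<and>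
    (\<forall>i<8 * k + 1. over_K (16 ^ k) (Z i))"
proof -
  from add_eight[OF one_dim_matrices(1)[OF d(1)] one_dim_matrices(2)[OF d(1)] d, of k]
  obtain Z where Z: "clifford_matrices (1 * 16 ^ k) (1 + 8 * k) (\<lambda>i. if i < 1 then d * d else d) Z"
    "\<forall>i<1 + 8 * k. over_K (1 * 16 ^ k) (Z i)" by blast
  have "clifford_matrices (16 ^ k) (8 * k + 1) (\<lambda>i. if i = 0 then d * d else d) Z"
    by (rule clifford_matrices_cong[OF Z(1)]) auto
  then show ?thesis using Z(2) by (auto simp: add.commute)
qed

text \<open>One square 1 and three hyperbolic planes give the squares 1, 1, -1, 1, -1, 1, -1. The
  four squares 1 stand at the indices 0, 1, 3, 5 and are flipped; further blocks of eight squares -1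
  follow by periodicity.\<close>

lemma matrices_8k7:
  "\<exists>Z. clifford_matrices (8 * 16 ^ k) (8 * k + 7) (\<lambda>i. - 1) Z \<and> (\<forall>i<8 * k + 7. over_K (8 * 16 ^ k) (Z i))"
proof -
  from four_hyperbolic[OF one_dim_matrices(1)[OF one_mem] one_dim_matrices(2)[OF one_mem] one_mem, of 3]
  obtain Z where Z: "clifford_matrices (1 * 2 ^ 3) (1 + 2 * 3) (\<lambda>i. if i < 1 then 1 * 1 else if even (i - 1) then 1 else - 1) Z"
    "\<And>i. i < 1 + 2 * 3 \<Longrightarrow> over_K (1 * 2 ^ 3) (Z i)" by blast
  have "\<exists>Z'. clifford_matrices (1 * 2 ^ 3) (1 + 2 * 3)
     (\<lambda>i. if i \<in> {0, 1, 3, 5} then - 1 else (\<lambda>i. if i < 1 then 1 * 1 else if even (i - 1) then 1 else - 1) i) Z' \<and>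
     (\<forall>i<1 + 2 * 3. over_K (1 * 2 ^ 3) (Z' i))"
    by (rule flip_four[OF Z]) auto
  then obtain Y where Y: "clifford_matrices (1 * 2 ^ 3) (1 + 2 * 3)
     (\<lambda>i. if i \<in> {0, 1, 3, 5} then - 1 else (\<lambda>i. if i < 1 then 1 * 1 else if even (i - 1) then 1 else - 1) i) Y"
     "\<forall>i<1 + 2 * 3. over_K (1 * 2 ^ 3) (Y i)" by blast
  have "clifford_matrices 8 7 (\<lambda>_. - 1) Y"
  proof (rule clifford_matrices_cong[OF Y(1)])
    fix i :: nat assume "i < 1 + 2 * 3"
    then have "i = 0 \<or> i = 1 \<or> i = 2 \<or> i = 3 \<or> i = 4 \<or> i = 5 \<or> i = 6" by linarith
    then show "(if i \<in> {0, 1, 3, 5} then - 1 else if i < 1 then 1 * 1 else if even (i - 1) then 1 else - 1) = (- 1 :: complex)"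
      by auto
  qed auto
  moreover have "\<And>i. i < 7 \<Longrightarrow> over_K 8 (Y i)" using Y(2) by simp
  ultimately obtain V where V: "clifford_matrices (8 * 16 ^ k) (7 + 8 * k) (\<lambda>i. if i < 7 then - 1 else - 1) V"
    "\<forall>i<7 + 8 * k. over_K (8 * 16 ^ k) (V i)"
    using add_eight[of 8 7 "\<lambda>_. - 1" Y "- 1" k] by auto
  have "clifford_matrices (8 * 16 ^ k) (8 * k + 7) (\<lambda>i. - 1) V"
    by (rule clifford_matrices_cong[OF V(1)]) auto
  then show ?thesis using V(2) by (auto simp: add.commute)
qed

text \<open>A model over \<open>K\<close> for the squares \<open>c\<close> serves for every multiple
  \<open>t\<close> of the form: a square root of \<open>t / 2\<close> may lie outside
  \<open>K\<close>, but each generator of the even algebra is a product of two matrices and contains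
  only \<open>t / 2\<close> itself.\<close>

theorem even_clifford_split:
  assumes m: "m = 2 * p + 1" and F: "F \<in> carrier_mat m m" "elements_mat F \<subseteq> K"
    and S: "S \<in> carrier_mat m m" "elements_mat S \<subseteq> K"
    and diag: "S\<^sup>T * F * S = mat m m (\<lambda>(i, j). if i = j then t * c i else 0)"
    and t: "t \<in> K" "t \<noteq> 0" and c: "\<And>i. i < m \<Longrightarrow> c i \<in> K" "\<And>i. i < m \<Longrightarrow> c i \<noteq> 0"
    and Z: "clifford_matrices (2 ^ p) m c Z" "\<And>i. i < m \<Longrightarrow> over_K (2 ^ p) (Z i)"
  shows "same_brauer_class (subfield_ring K) (even_clifford_algebra K m F) (base_algebra K)"
proof -
  let ?c = "\<lambda>i. t / 2 * c i"
  interpret D: diagonal_form K p F S ?c m "2 * p"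
    by (intro diagonal_form.intro diagonal_form_axioms.intro csubfield_axioms m F S refl)
       (use diag t c in auto)
  let ?k = "csqrt (t / 2)"
  have k: "?k * ?k = t / 2" using power2_csqrt[of "t / 2"] by (simp only: power2_eq_square)
  have Z': "clifford_matrices (2 ^ p) m ?c (\<lambda>i. ?k \<cdot>\<^sub>m Z i)"
    using clifford_matrices_scale[OF Z(1), of "\<lambda>_. ?k"] unfolding k .
  interpret M: matrix_model K m D.CI "even_tensors K m" p D.g D.\<gamma> "2 ^ p" "D.V (2 ^ p) (\<lambda>i. ?k \<cdot>\<^sub>m Z i)"
    by (rule D.clifford_matrix_model[OF Z']) simp
  have "same_brauer_class (subfield_ring K) D.E.alg (base_algebra K)"
  proof (rule M.split_same_brauer_class)
    show "2 ^ p * 2 ^ p = (2 :: nat) ^ (2 * p)" by (simp add: power_add[symmetric] mult_2)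
    fix i assume i: "i < 2 * p"
    have im: "i < m" "2 * p < m" using i m by auto
    have "(?k \<cdot>\<^sub>m Z i) * (?k \<cdot>\<^sub>m Z (2 * p)) = (t / 2) \<cdot>\<^sub>m (Z i * Z (2 * p))"
      unfolding smult_mult_smult[OF clifford_matricesD(1)[OF Z(1) im(1)] clifford_matricesD(1)[OF Z(1) im(2)]] k ..
    then have "M.ev (D.g i) = (1 / ?c (2 * p)) \<cdot>\<^sub>m ((t / 2) \<cdot>\<^sub>m (Z i * Z (2 * p)))"
      using D.ev_g[OF Z' _ i] by simp
    moreover have "over_K (2 ^ p) \<dots>"
      using t c(1)[OF im(2)] by (intro over_K_smult over_K_mult Z(2) im) auto
    ultimately show "elements_mat (M.ev (D.g i)) \<subseteq> K" using over_K_elements by simp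
  qed
  then show ?thesis by (simp only: D.alg_eq)
qed

end

section \<open>The quaternion algebra with both parameters equal to -1\<close>

context csubfield
begin

definition quat_gens :: "(nat list \<Rightarrow> complex) set" where
  "quat_gens = {monom_word [0] \<star> monom_word [0] - (- 1) \<cdot> unit_word,
     monom_word [1] \<star> monom_word [1] - (- 1) \<cdot> unit_word,
     monom_word [0] \<star> monom_word [1] + monom_word [1] \<star> monom_word [0]}"

abbreviation quat_ideal :: "(nat list \<Rightarrow> complex) set" where
  "quat_ideal \<equiv> Idl\<^bsub>tensor_algebra K 2\<^esub> quat_gens"

lemma letter_mem: "i < 2 \<Longrightarrow> monom_word [i] \<in> carrier (tensor_algebra K 2)"
  by (rule tensor_monom_mem) auto

lemma scalar_mem: "c \<in> K \<Longrightarrow> c \<cdot> unit_word \<in> carrier (tensor_algebra K m)"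
  by (intro tensor_scl_mem tensor_monom_mem) auto

lemma quat_gens_mem: "quat_gens \<subseteq> carrier (tensor_algebra K 2)"
  unfolding quat_gens_def insert_subset
  by (intro conjI empty_subsetI tensor_diff_mem tensor_add_mem tensor_conv_mem letter_mem scalar_mem uminus_mem one_mem) auto

lemma quat_ideal: "ideal quat_ideal (tensor_algebra K 2)" "quat_gens \<subseteq> quat_ideal"
proof -
  interpret R: ring "tensor_algebra K 2" by (rule ring_tensor_algebra)
  show "ideal quat_ideal (tensor_algebra K 2)" by (rule R.genideal_ideal[OF quat_gens_mem])
  show "quat_gens \<subseteq> quat_ideal" by (rule R.genideal_self[OF quat_gens_mem])
qed

lemma quaternion_algebra_eq:
  "quaternion_algebra K (- 1) (- 1) = quotient_algebra (tensor_algebra K 2) quat_ideal"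
proof -
  have mem: "monom_word [0] \<star> monom_word [0] \<in> carrier (tensor_algebra K 2)"
    "monom_word [1] \<star> monom_word [1] \<in> carrier (tensor_algebra K 2)"
    "(- 1) \<cdot> unit_word \<in> carrier (tensor_algebra K 2)"
    by (intro tensor_conv_mem letter_mem scalar_mem uminus_mem one_mem; simp)+
  have eq: "(\<lambda>w. if w = u then 1 else 0) = monom_word u" for u by (simp add: monom_word_def)
  show ?thesis
    unfolding quaternion_algebra_def Let_def eq tensor_algebra_simps
      tensor_a_minus[OF mem(1,3)] tensor_a_minus[OF mem(2,3)] quat_gens_def ..
qed

lemma quat_quotient:
  "anticommuting_quotient K 2 quat_ideal (carrier (tensor_algebra K 2)) 1 (\<lambda>i. monom_word [i]) (\<lambda>_. - 1)"
proof (intro anticommuting_quotient.intro anticommuting_quotient_axioms.intro tensor_ideal.intro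
    tensor_ideal_axioms.intro csubfield_axioms quat_ideal(1))
  have g: "monom_word [0] \<star> monom_word [0] - (- 1) \<cdot> unit_word \<in> quat_ideal"
    "monom_word [1] \<star> monom_word [1] - (- 1) \<cdot> unit_word \<in> quat_ideal"
    "monom_word [0] \<star> monom_word [1] + monom_word [1] \<star> monom_word [0] \<in> quat_ideal"
    using quat_ideal(2) unfolding quat_gens_def insert_subset by blast+
  fix i :: nat assume "i < 2 * 1"
  then have i: "i = 0 \<or> i = 1" by auto
  show "monom_word [i] \<star> monom_word [i] - (- 1) \<cdot> unit_word \<in> quat_ideal"
    using i g(1,2) by (elim disjE) (simp_all only:)
  fix j :: nat assume "j < 2 * 1" "i \<noteq> j"
  then have "i = 0 \<and> j = 1 \<or> i = 1 \<and> j = 0" using i by auto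
  then show "monom_word [i] \<star> monom_word [j] + monom_word [j] \<star> monom_word [i] \<in> quat_ideal"
    using g(3) by (elim disjE conjE) (simp_all only: add.commute)
qed (auto intro: tensor_mem letter_mem)

lemma quat_spanned:
  assumes "x \<in> carrier (tensor_algebra K 2)"
  shows "anticommuting_quotient.spanned K quat_ideal 1 (\<lambda>i. monom_word [i]) x"
proof -
  interpret Q: anticommuting_quotient K 2 quat_ideal "carrier (tensor_algebra K 2)" 1 "\<lambda>i. monom_word [i]" "\<lambda>_. - 1"
    by (rule quat_quotient)
  have word: "Q.spanned (monom_word w)" if "set w \<subseteq> {..<2}" for w
    using that
  proof (induction w)
    case Nil
    show ?case using Q.spanned_G[OF Q.Nil_in_W] by simp
  next
    case (Cons i w)
    then have "Q.spanned (monom_word [i] \<star> monom_word w)" by (intro Q.spanned_g_mult) auto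
    then show ?case using monom_word_append[of "[i]" w] by simp
  qed
  have "Q.spanned (\<Sum>w\<in>{w. x w \<noteq> 0}. x w \<cdot> monom_word w)"
    using assms by (intro Q.spanned_sum Q.spanned_scl word) (auto simp: tensor_carrier_iff)
  then show ?thesis using tensor_expand[OF assms] by simp
qed

lemma quat_alg_eq:
  "anticommuting_quotient.alg K 2 quat_ideal (carrier (tensor_algebra K 2)) = quaternion_algebra K (- 1) (- 1)"
proof -
  interpret Q: anticommuting_quotient K 2 quat_ideal "carrier (tensor_algebra K 2)" 1 "\<lambda>i. monom_word [i]" "\<lambda>_. - 1"
    by (rule quat_quotient)
  have "carrier (quotient_algebra (tensor_algebra K 2) quat_ideal) =
      {quat_ideal +>\<^bsub>tensor_algebra K 2\<^esub> x | x. x \<in> carrier (tensor_algebra K 2)}"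
    by (auto simp: quotient_algebra_def FactRing_def A_RCOSETS_def' a_r_coset_def r_coset_def)
  then show ?thesis unfolding Q.alg_def quaternion_algebra_eq by (metis (no_types, lifting) partial_object.surjective partial_object.update_convs(1))
qed

lemma quat_matrix_model:
  assumes Z: "Z 0 \<in> carrier_mat N N" "Z 1 \<in> carrier_mat N N" "N > 0"
    "Z 0 * Z 0 = (- 1) \<cdot>\<^sub>m 1\<^sub>m N" "Z 1 * Z 1 = (- 1) \<cdot>\<^sub>m 1\<^sub>m N" "Z 0 * Z 1 = (- 1) \<cdot>\<^sub>m (Z 1 * Z 0)"
  shows "matrix_model K 2 quat_ideal (carrier (tensor_algebra K 2)) 1 (\<lambda>i. monom_word [i]) (\<lambda>_. - 1) N Z"
    "i < 2 \<Longrightarrow> eval_mat N Z (monom_word [i]) = Z i"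
proof -
  have Zc: "Z i \<in> carrier_mat N N" if "i < 2" for i
  proof -
    have "i = 0 \<or> i = 1" using that by auto
    then show ?thesis using Z by auto
  qed
  interpret V: tensor_eval K 2 N Z
    by (intro tensor_eval.intro tensor_eval_axioms.intro csubfield_axioms Zc)
  have evl: "eval_mat N Z (monom_word [i]) = Z i" if "i < 2" for i
    using V.ev_monom[of "[i]"] Zc[OF that] that by simp
  show "i < 2 \<Longrightarrow> eval_mat N Z (monom_word [i]) = Z i" by (rule evl)
  have l01: "monom_word [0] \<in> carrier (tensor_algebra K 2)" "monom_word [1] \<in> carrier (tensor_algebra K 2)"
    by (rule letter_mem; simp)+
  have e01: "eval_mat N Z (monom_word [0]) = Z 0" "eval_mat N Z (monom_word [1]) = Z 1"
    by (rule evl; simp)+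
  have es: "eval_mat N Z ((- 1) \<cdot> unit_word) = (- 1) \<cdot>\<^sub>m 1\<^sub>m N"
    by (subst V.ev_scl) (auto simp: V.ev_unit intro: tensor_monom_mem)
  have 1: "eval_mat N Z (monom_word [0] \<star> monom_word [0] - (- 1) \<cdot> unit_word) = 0\<^sub>m N N"
    using Z(4) by (simp only: V.ev_diff V.ev_conv tensor_conv_mem l01 scalar_mem uminus_mem one_mem e01 es) auto
  have 2: "eval_mat N Z (monom_word [1] \<star> monom_word [1] - (- 1) \<cdot> unit_word) = 0\<^sub>m N N"
    using Z(5) by (simp only: V.ev_diff V.ev_conv tensor_conv_mem l01 scalar_mem uminus_mem one_mem e01 es) auto
  have 3: "eval_mat N Z (monom_word [0] \<star> monom_word [1] + monom_word [1] \<star> monom_word [0]) = 0\<^sub>m N N"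
    using Z(1,2) by (simp only: V.ev_add V.ev_conv tensor_conv_mem l01 e01 Z(6)) (auto intro!: eq_matI)
  interpret Q: anticommuting_quotient K 2 quat_ideal "carrier (tensor_algebra K 2)" 1 "\<lambda>i. monom_word [i]" "\<lambda>_. - 1"
    by (rule quat_quotient)
  show "matrix_model K 2 quat_ideal (carrier (tensor_algebra K 2)) 1 (\<lambda>i. monom_word [i]) (\<lambda>_. - 1) N Z"
  proof (intro matrix_model.intro matrix_model_axioms.intro quat_quotient V.tensor_eval_axioms Z(3) quat_spanned)
    fix x assume "x \<in> quat_ideal"
    then show "eval_mat N Z x = 0\<^sub>m N N"
    proof (rule V.ev_genideal[OF quat_gens_mem, rotated])
      fix x assume "x \<in> quat_gens"
      then show "eval_mat N Z x = 0\<^sub>m N N" unfolding quat_gens_def insert_iff empty_iff using 1 2 3 by metis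
    qed
  qed
qed

text \<open>With three equal norms both generators of the even algebra have square -1 and
  anticommute, as the quaternion generators do. For an isomorphism both algebras are evaluated at
  the same matrices; these are complex, since (-1,-1) need not split over \<open>K\<close>.\<close>

theorem even_clifford_quaternion:
  assumes F: "F \<in> carrier_mat 3 3" "elements_mat F \<subseteq> K"
    and S: "S \<in> carrier_mat 3 3" "elements_mat S \<subseteq> K"
    and diag: "S\<^sup>T * F * S = mat 3 3 (\<lambda>(i, j). if i = j then t else 0)"
    and t: "t \<in> K" "t \<noteq> 0"
  shows "same_brauer_class (subfield_ring K) (even_clifford_algebra K 3 F) (quaternion_algebra K (- 1) (- 1))"
proof -
  interpret C: csubfield UNIV by (rule csubfield_UNIV)
  let ?c = "\<lambda>i :: nat. t / 2"
  interpret D: diagonal_form K 1 F S ?c 3 2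
    by (intro diagonal_form.intro diagonal_form_axioms.intro csubfield_axioms F S)
       (use diag t in auto)
  obtain Y where Y: "clifford_matrices (1 * 2 ^ 1) (1 + 2 * 1)
      (\<lambda>i. if i < 1 then 1 * 1 else if even (i - 1) then 1 else - 1) Y"
    using C.four_hyperbolic[OF C.one_dim_matrices(1)[OF C.one_mem] C.one_dim_matrices(2)[OF C.one_mem] C.one_mem, of 1]
    by blast
  let ?k = "csqrt (t / 2)"
  have k: "?k * ?k = t / 2" using power2_csqrt[of "t / 2"] by (simp only: power2_eq_square)
  \<comment> \<open>The matrices at hand have squares 1, 1, -1. The factor \<open>\<i>\<close>
    corrects the last sign, so that all three squares become \<open>t / 2\<close>.\<close>
  define x where "x i = (if i < 2 then ?k else \<i> * ?k)" for i :: nat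
  define Z where "Z i = x i \<cdot>\<^sub>m Y i" for i
  have Z: "clifford_matrices 2 3 ?c Z"
    unfolding Z_def
  proof (rule clifford_matrices_cong[OF clifford_matrices_scale[OF Y, of x]])
    fix i :: nat assume "i < 1 + 2 * 1"
    then have "i = 0 \<or> i = 1 \<or> i = 2" by linarith
    then have "x i * x i * (if i < 1 then 1 * 1 else if even (i - 1) then 1 else - 1) = ?k * ?k"
      by (elim disjE) (simp_all add: x_def complex_eq_iff algebra_simps)
    then show "x i * x i * (if i < 1 then 1 * 1 else if even (i - 1) then 1 else - 1) = t / 2"
      by (simp only: k)
  qed auto
  let ?V = "D.V 2 Z"
  have MM: "matrix_model K 3 D.CI (even_tensors K 3) 1 D.g D.\<gamma> 2 ?V"
    by (rule D.clifford_matrix_model[OF Z]) simp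
  interpret M: matrix_model K 3 D.CI "even_tensors K 3" 1 D.g D.\<gamma> 2 ?V by (rule MM)
  \<comment> \<open>The quaternion letters are sent to the values of the Clifford generators, so the
    two models agree by construction.\<close>
  define P where "P i = eval_mat 2 ?V (D.g i)" for i
  have gT: "D.g i \<in> carrier (tensor_algebra K 3)" if "i < 2" for i using D.E.g_T[of i] that by simp
  have \<gamma>: "D.\<gamma> i = - 1" for i using t by (simp add: D.\<gamma>_def)
  have sq: "P i * P i = (- 1) \<cdot>\<^sub>m 1\<^sub>m 2" if "i < 2" for i
  proof -
    have "eval_mat 2 ?V (D.g i \<star> D.g i) = eval_mat 2 ?V ((- 1) \<cdot> unit_word)"
      using M.ev_cong[OF _ _ D.E.g_square_eqv[of i]] gT[OF that] that unfolding \<gamma>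
      by (simp only: tensor_conv_mem scalar_mem uminus_mem one_mem mult_1_right)
    then show ?thesis using gT[OF that]
      by (simp only: M.ev_conv M.ev_scl M.ev_unit tensor_monom_mem P_def set_simps empty_subsetI)
  qed
  have anti: "P 0 * P 1 = (- 1) \<cdot>\<^sub>m (P 1 * P 0)"
  proof -
    have "D.g 0 \<star> D.g 1 + D.g 1 \<star> D.g 0 \<in> D.CI" by (rule D.E.g_anticommute) auto
    from M.ev_I[OF this] have z: "P 0 * P 1 + P 1 * P 0 = 0\<^sub>m 2 2"
      using gT[of 0] gT[of 1] by (simp add: M.ev_add M.ev_conv tensor_conv_mem P_def del: One_nat_def)
    show ?thesis
    proof (rule eq_matI)
      have c: "P i \<in> carrier_mat 2 2" for i by (simp add: P_def)
      fix i j assume "i < dim_row (- 1 \<cdot>\<^sub>m (P 1 * P 0))" "j < dim_col (- 1 \<cdot>\<^sub>m (P 1 * P 0))"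
      then have ij: "i < 2" "j < 2" using c[of 0] c[of 1] by auto
      have "(P 0 * P 1 + P 1 * P 0) $$ (i, j) = 0" unfolding z using ij by simp
      then have "(P 0 * P 1) $$ (i, j) = - (P 1 * P 0) $$ (i, j)"
        using ij c[of 0] c[of 1] by (simp add: add_eq_0_iff2 del: index_mult_mat(1))
      then show "(P 0 * P 1) $$ (i, j) = (- 1 \<cdot>\<^sub>m (P 1 * P 0)) $$ (i, j)"
        using ij c[of 0] c[of 1] by (simp del: index_mult_mat(1))
    qed (simp_all add: P_def)
  qed
  have Pc: "P 0 \<in> carrier_mat 2 2" "P 1 \<in> carrier_mat 2 2" by (simp_all add: P_def)
  have two: "0 < (2 :: nat)" "0 < (2 :: nat)" "1 < (2 :: nat)" by auto
  note Q = quat_matrix_model[OF Pc two(1) sq[OF two(2)] sq[OF two(3)] anti]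
  have "same_brauer_class (subfield_ring K) (anticommuting_quotient.alg K 3 D.CI (even_tensors K 3))
      (anticommuting_quotient.alg K 2 quat_ideal (carrier (tensor_algebra K 2)))"
    by (rule matrix_models_same_brauer_class[OF MM Q(1)]) (use Q(2) in \<open>simp add: P_def\<close>)
  then show ?thesis unfolding quat_alg_eq D.alg_eq .
qed

text \<open>The norms \<open>a * d, a, ..., a\<close> are \<open>a / d\<close> times
  \<open>d * d, d, ..., d\<close>, the pattern realised by \<open>matrices_8k1\<close>.\<close>

theorem even_clifford_split_8k1:
  assumes m: "m = 8 * k + 1" and F: "F \<in> carrier_mat m m" "elements_mat F \<subseteq> K"
    and S: "S \<in> carrier_mat m m" "elements_mat S \<subseteq> K"
    and diag: "S\<^sup>T * F * S = mat m m (\<lambda>(i, j). if i = j then (if i = 0 then a * d else a) else 0)"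
    and a: "a \<in> K" "a \<noteq> 0" and d: "d \<in> K" "d \<noteq> 0"
  shows "same_brauer_class (subfield_ring K) (even_clifford_algebra K m F) (base_algebra K)"
proof -
  obtain Z where Z: "clifford_matrices (16 ^ k) m (\<lambda>i. if i = 0 then d * d else d) Z"
    "\<And>i. i < m \<Longrightarrow> over_K (16 ^ k) (Z i)" using matrices_8k1[OF d, of k] m by auto
  have pw: "(16 :: nat) ^ k = 2 ^ (4 * k)" by (simp add: power_mult)
  show ?thesis
  proof (rule even_clifford_split[where c = "\<lambda>i. if i = 0 then d * d else d" and t = "a / d"])
    show "m = 2 * (4 * k) + 1" using m by simp
    show "S\<^sup>T * F * S = mat m m (\<lambda>(i, j). if i = j then a / d * (if i = 0 then d * d else d) else 0)"
      unfolding diag using d by (intro eq_matI) auto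
  qed (use F S a d Z in \<open>auto simp: pw\<close>)
qed

text \<open>Equal norms \<open>a\<close> are \<open>- a\<close> times norms -1, the pattern realised
  by \<open>matrices_8k7\<close>.\<close>

theorem even_clifford_split_8k7:
  assumes m: "m = 8 * k + 7" and F: "F \<in> carrier_mat m m" "elements_mat F \<subseteq> K"
    and S: "S \<in> carrier_mat m m" "elements_mat S \<subseteq> K"
    and diag: "S\<^sup>T * F * S = mat m m (\<lambda>(i, j). if i = j then a else 0)"
    and a: "a \<in> K" "a \<noteq> 0"
  shows "same_brauer_class (subfield_ring K) (even_clifford_algebra K m F) (base_algebra K)"
proof -
  obtain Z where Z: "clifford_matrices (8 * 16 ^ k) m (\<lambda>i. - 1) Z"
    "\<And>i. i < m \<Longrightarrow> over_K (8 * 16 ^ k) (Z i)" using matrices_8k7[of k] m by auto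
  have pw: "8 * (16 :: nat) ^ k = 2 ^ (4 * k + 3)" by (simp add: power_mult power_add)
  show ?thesis
  proof (rule even_clifford_split[where c = "\<lambda>i. - 1" and t = "- a"])
    show "m = 2 * (4 * k + 3) + 1" using m by simp
    show "S\<^sup>T * F * S = mat m m (\<lambda>(i, j). if i = j then - a * - 1 else 0)"
      unfolding diag by (intro eq_matI) auto
  qed (use F S a Z in \<open>auto simp: pw\<close>)
qed

end

section \<open>Conjugacy classes of SL2 in characteristic 2\<close>

abbreviation m2 :: "'f::field \<Rightarrow> 'f \<Rightarrow> 'f \<Rightarrow> 'f \<Rightarrow> 'f mat" where
  "m2 a b c d \<equiv> mat_of_rows_list 2 [[a, b], [c, d]]"

lemma m2_carrier [simp]: "m2 a b c d \<in> carrier_mat 2 2"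
  by (simp add: mat_of_rows_list_def numeral_2_eq_2)

lemma m2_index [simp]:
  "m2 a b c d $$ (0, 0) = a" "m2 a b c d $$ (0, Suc 0) = b"
  "m2 a b c d $$ (Suc 0, 0) = c" "m2 a b c d $$ (Suc 0, Suc 0) = d"
  by (simp_all add: mat_of_rows_list_def)

lemma mat2_eqI:
  assumes "A \<in> carrier_mat 2 2" "B \<in> carrier_mat 2 2"
    "A $$ (0, 0) = B $$ (0, 0)" "A $$ (0, Suc 0) = B $$ (0, Suc 0)"
    "A $$ (Suc 0, 0) = B $$ (Suc 0, 0)" "A $$ (Suc 0, Suc 0) = B $$ (Suc 0, Suc 0)"
  shows "A = B"
proof (rule eq_matI)
  fix i j assume "i < dim_row B" "j < dim_col B"
  then have "i = 0 \<or> i = Suc 0" "j = 0 \<or> j = Suc 0" using assms(2) by auto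
  then show "A $$ (i, j) = B $$ (i, j)" using assms by auto
qed (use assms in auto)

lemma m2_eq_iff [simp]: "m2 a b c d = m2 a' b' c' d' \<longleftrightarrow> a = a' \<and> b = b' \<and> c = c' \<and> d = d'"
  by (metis m2_index)

lemma m2_mult [simp]:
  "m2 a b c d * m2 a' b' c' d' = m2 (a * a' + b * c') (a * b' + b * d') (c * a' + d * c') (c * b' + d * d')"
proof (rule mat2_eqI)
  have s: "(\<Sum>t<2. f t) = f 0 + f (Suc 0)" for f :: "nat \<Rightarrow> 'a" by (simp add: numeral_2_eq_2)
  have e: "(m2 a b c d * m2 a' b' c' d') $$ (i, j) =
      m2 a b c d $$ (i, 0) * m2 a' b' c' d' $$ (0, j) + m2 a b c d $$ (i, Suc 0) * m2 a' b' c' d' $$ (Suc 0, j)"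
    if "i < 2" "j < 2" for i j
    unfolding mult_mat_entry[OF m2_carrier m2_carrier that] by (rule s)
  show "(m2 a b c d * m2 a' b' c' d') $$ (0, 0) = m2 (a * a' + b * c') (a * b' + b * d') (c * a' + d * c') (c * b' + d * d') $$ (0, 0)"
    by (subst e) (simp_all del: index_mult_mat)
  show "(m2 a b c d * m2 a' b' c' d') $$ (0, Suc 0) = m2 (a * a' + b * c') (a * b' + b * d') (c * a' + d * c') (c * b' + d * d') $$ (0, Suc 0)"
    by (subst e) (simp_all del: index_mult_mat)
  show "(m2 a b c d * m2 a' b' c' d') $$ (Suc 0, 0) = m2 (a * a' + b * c') (a * b' + b * d') (c * a' + d * c') (c * b' + d * d') $$ (Suc 0, 0)"
    by (subst e) (simp_all del: index_mult_mat)
  show "(m2 a b c d * m2 a' b' c' d') $$ (Suc 0, Suc 0) = m2 (a * a' + b * c') (a * b' + b * d') (c * a' + d * c') (c * b' + d * d') $$ (Suc 0, Suc 0)"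
    by (subst e) (simp_all del: index_mult_mat)
qed (auto intro: mult_carrier_mat[of _ 2 2])

lemma m2_one: "1\<^sub>m 2 = m2 1 0 0 1"
  by (rule mat2_eqI) auto

lemma m2_det: "det (m2 a b c d) = a * d - b * c"
proof -
  have d: "dim_row (m2 a b c d) = 2" "dim_col (m2 a b c d) = 2" using carrier_matD[OF m2_carrier[of a b c d]] by simp_all
  have s: "(\<Sum>t<2. f t) = f 0 + f (Suc 0)" for f :: "nat \<Rightarrow> 'a" by (simp add: numeral_2_eq_2)
  have "det (mat_delete (m2 a b c d) 0 j) = m2 a b c d $$ (Suc 0, if 0 < j then 0 else Suc 0)" for j
    by (subst det_single) (simp_all add: mat_delete_def d)
  then show ?thesis
    using laplace_expansion_row[OF m2_carrier[of a b c d], of 0] by (simp add: s cofactor_def)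
qed

lemma m2_exhaust:
  assumes "g \<in> carrier_mat 2 2"
  obtains a b c d where "g = m2 a b c d"
proof -
  have "g = m2 (g $$ (0, 0)) (g $$ (0, Suc 0)) (g $$ (Suc 0, 0)) (g $$ (Suc 0, Suc 0))"
    by (rule mat2_eqI) (use assms in auto)
  then show ?thesis using that by blast
qed

lemma SL2_simps [simp]: "monoid.mult SL2 = (*)" "one SL2 = 1\<^sub>m 2"
  by (simp_all add: SL2_def)

lemma m2_in_SL2 [simp]: "m2 a b c d \<in> carrier SL2 \<longleftrightarrow> a * d - b * c = 1"
  by (simp add: SL2_def m2_det)

lemma SL2_cases:
  assumes "g \<in> carrier SL2"
  obtains a b c d where "g = m2 a b c d" "a * d - b * c = 1"
proof -
  have "g \<in> carrier_mat 2 2" using assms by (simp add: SL2_def)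
  then obtain a b c d where g: "g = m2 a b c d" by (rule m2_exhaust)
  with assms have "a * d - b * c = 1" by simp
  with g show ?thesis by (rule that)
qed

lemma group_SL2: "group (SL2 :: 'f::field mat monoid)"
proof (rule groupI)
  fix x y z :: "'f mat"
  assume x: "x \<in> carrier SL2" and y: "y \<in> carrier SL2" and z: "z \<in> carrier SL2"
  obtain a b c d where x': "x = m2 a b c d" "a * d - b * c = 1" using x by (rule SL2_cases)
  obtain a' b' c' d' where y': "y = m2 a' b' c' d'" "a' * d' - b' * c' = 1" using y by (rule SL2_cases)
  have "(a * a' + b * c') * (c * b' + d * d') - (a * b' + b * d') * (c * a' + d * c') =
      (a * d - b * c) * (a' * d' - b' * c')" by (simp add: algebra_simps)
  then show "x \<otimes>\<^bsub>SL2\<^esub> y \<in> carrier SL2" using x' y' by simp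
  show "x \<otimes>\<^bsub>SL2\<^esub> y \<otimes>\<^bsub>SL2\<^esub> z = x \<otimes>\<^bsub>SL2\<^esub> (y \<otimes>\<^bsub>SL2\<^esub> z)"
    using x y z by (simp add: SL2_def assoc_mult_mat[of x 2 2 y 2 z 2])
  show "\<one>\<^bsub>SL2\<^esub> \<otimes>\<^bsub>SL2\<^esub> x = x" unfolding x'(1) by (simp add: m2_one)
  show "\<exists>y\<in>carrier SL2. y \<otimes>\<^bsub>SL2\<^esub> x = \<one>\<^bsub>SL2\<^esub>"
    by (rule bexI[of _ "m2 d (- b) (- c) a"]) (use x' in \<open>auto simp: m2_one algebra_simps\<close>)
qed (simp add: m2_one)

interpretation SL2: group "SL2 :: 'f::field mat monoid"
  by (rule group_SL2)

definition Um :: "'f::field \<Rightarrow> 'f mat" where "Um t = m2 1 0 t 1"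
definition Dm :: "'f::field \<Rightarrow> 'f mat" where "Dm x = m2 x 0 0 (inverse x)"
definition wm :: "'f::field mat" where "wm = m2 0 1 1 0"

text \<open>Conjugacy is written without inverses so that it can be verified by multiplying explicit
  2 by 2 matrices.\<close>

definition conj_in :: "'f::field mat \<Rightarrow> 'f mat \<Rightarrow> bool" where
  "conj_in g r \<longleftrightarrow> g \<in> carrier SL2 \<and> r \<in> carrier SL2 \<and> (\<exists>h\<in>carrier SL2. g * h = h * r)"

lemma SL2_mult_closed: "g \<in> carrier SL2 \<Longrightarrow> h \<in> carrier SL2 \<Longrightarrow> g * h \<in> carrier SL2"
  using SL2.m_closed[of g h] by simp

lemma SL2_assoc: "x \<in> carrier SL2 \<Longrightarrow> y \<in> carrier SL2 \<Longrightarrow> z \<in> carrier SL2 \<Longrightarrow> x * y * z = x * (y * z)"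
  using SL2.m_assoc[of x y z] by simp

lemma conj_in_trans:
  assumes "conj_in g r" "conj_in r s" shows "conj_in g s"
proof -
  obtain h k where h: "h \<in> carrier SL2" "g * h = h * r" and k: "k \<in> carrier SL2" "r * k = k * s"
    and c: "g \<in> carrier SL2" "r \<in> carrier SL2" "s \<in> carrier SL2"
    using assms unfolding conj_in_def by blast
  have "g * (h * k) = (h * k) * s"
    using SL2_assoc[OF c(1) h(1) k(1)] SL2_assoc[OF h(1) c(2) k(1)] SL2_assoc[OF h(1) k(1) c(3)] h k by simp
  then show ?thesis unfolding conj_in_def using c h k SL2_mult_closed by blast
qed

lemma conj_in_sym:
  assumes "conj_in g r" shows "conj_in r g"
proof -
  obtain h where h: "h \<in> carrier SL2" "g * h = h * r" and c: "g \<in> carrier SL2" "r \<in> carrier SL2"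
    using assms unfolding conj_in_def by blast
  let ?i = "inv\<^bsub>SL2\<^esub> h"
  have i: "?i \<in> carrier SL2" using h by simp
  have hi: "h * ?i = 1\<^sub>m 2" "?i * h = 1\<^sub>m 2" using SL2.r_inv[OF h(1)] SL2.l_inv[OF h(1)] by simp_all
  have one: "x * 1\<^sub>m 2 = x" "1\<^sub>m 2 * x = x" if "x \<in> carrier SL2" for x :: "'a mat"
    using SL2.r_one[OF that] SL2.l_one[OF that] by simp_all
  have "r * ?i = ?i * (h * r) * ?i"
    using SL2_assoc[OF i h(1) c(2)] hi one c by simp
  also have "\<dots> = ?i * (g * h * ?i)" unfolding h(2)[symmetric] by (intro SL2_assoc SL2_mult_closed i h c)
  also have "g * h * ?i = g" using SL2_assoc[OF c(1) h(1) i] hi one c by simp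
  finally show ?thesis unfolding conj_in_def using i c by blast
qed

lemma conj_in_pow:
  assumes "conj_in g r" shows "conj_in (g [^]\<^bsub>SL2\<^esub> (k::nat)) (r [^]\<^bsub>SL2\<^esub> k)"
proof -
  obtain h where h: "h \<in> carrier SL2" "g * h = h * r" and c: "g \<in> carrier SL2" "r \<in> carrier SL2"
    using assms unfolding conj_in_def by blast
  have "g [^]\<^bsub>SL2\<^esub> k * h = h * r [^]\<^bsub>SL2\<^esub> k"
  proof (induction k)
    case 0
    show ?case using SL2.l_one[OF h(1)] SL2.r_one[OF h(1)] by simp
  next
    case (Suc k)
    have p: "g [^]\<^bsub>SL2\<^esub> k \<in> carrier SL2" "r [^]\<^bsub>SL2\<^esub> k \<in> carrier SL2" using c by simp_all
    have "g [^]\<^bsub>SL2\<^esub> Suc k * h = g [^]\<^bsub>SL2\<^esub> k * (g * h)" using SL2_assoc[OF p(1) c(1) h(1)] by simp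
    also have "\<dots> = g [^]\<^bsub>SL2\<^esub> k * h * r" unfolding h(2) using SL2_assoc[OF p(1) h(1) c(2)] by simp
    also have "\<dots> = h * (r [^]\<^bsub>SL2\<^esub> k * r)" unfolding Suc using SL2_assoc[OF h(1) p(2) c(2)] by simp
    finally show ?case by simp
  qed
  then show ?thesis unfolding conj_in_def using c h by auto
qed

lemma conj_in_one: "conj_in g (1\<^sub>m 2) \<Longrightarrow> g = 1\<^sub>m 2"
proof -
  assume "conj_in g (1\<^sub>m 2)"
  then obtain h where h: "h \<in> carrier SL2" "g * h = h * 1\<^sub>m 2" "g \<in> carrier SL2"
    unfolding conj_in_def by blast
  then have "g \<otimes>\<^bsub>SL2\<^esub> h = \<one>\<^bsub>SL2\<^esub> \<otimes>\<^bsub>SL2\<^esub> h" using SL2.r_one[OF h(1)] SL2.l_one[OF h(1)] by simp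
  then have "g = \<one>\<^bsub>SL2\<^esub>" by (rule SL2.r_cancel[OF _ h(3) SL2.one_closed h(1)])
  then show ?thesis by simp
qed

section \<open>Arithmetic of the field and elementary conjugations\<close>

locale sl2_even =
  fixes n q :: nat and \<nu> :: "'f::{field,finite}" and b :: "'f mat"
  assumes n: "n \<ge> 2" and q: "q = 2 ^ n" and card: "CARD('f) = q"
    and \<nu>: "generates_units \<nu>"
    and b: "b \<in> carrier SL2" and ord_b: "group.ord SL2 b = q + 1"
begin

lemma q_ge: "q \<ge> 4"
  using n q power_increasing[of 2 n "2::nat"] by simp

lemma q_even: "even q" "q div 2 * 2 = q" "(q - 2) div 2 = q div 2 - 1"
  using n q q_ge by (auto simp: dvd_div_mult_self)

lemma two_zero [simp]: "(2 :: 'f) = 0"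
proof -
  have "CHAR('f) dvd 2 ^ n" using CHAR_dvd_CARD[where 'a = 'f] card q by simp
  then have "(of_nat (2 ^ n) :: 'f) = 0" by (simp only: of_nat_eq_0_iff_char_dvd)
  then show ?thesis by simp
qed

lemma char2 [simp]: "x + x = (0 :: 'f)"
  using mult_2[of x] two_zero by (simp only: mult_zero_left)

lemma uminus_char2 [simp]: "- x = (x :: 'f)"
  by (simp add: minus_equation_iff eq_neg_iff_add_eq_0)

lemma minus_char2 [simp]: "x - y = x + (y :: 'f)"
  using uminus_char2[of y] by (metis diff_conv_add_uminus)

lemma char2_left [simp]: "x + (x + y) = (y :: 'f)"
  by (simp add: add.assoc[symmetric])

lemma add_eq_0_char2: "x + y = 0 \<longleftrightarrow> x = (y :: 'f)"
  using eq_neg_iff_add_eq_0[of x y] by simp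

lemma square_inj: "x * x = y * y \<Longrightarrow> x = (y :: 'f)"
proof -
  assume "x * x = y * y"
  then have "(x + y) * (x + y) = 0" by (simp add: algebra_simps)
  then show ?thesis by (simp add: add_eq_0_char2)
qed

text \<open>Squaring is additive in characteristic 2, hence injective and, on a finite field,
  surjective. Square roots supply the scalars that bring conjugating matrices to determinant
  1.\<close>

lemma square_surj: "\<exists>y. y * y = (x :: 'f)"
proof -
  have "inj (\<lambda>y :: 'f. y * y)" by (rule injI) (rule square_inj)
  then have "surj (\<lambda>y :: 'f. y * y)" by (simp add: finite_UNIV_inj_surj)
  then show ?thesis by (metis surjD)
qed

lemma \<nu>_nonzero [simp]: "\<nu> \<noteq> 0"
  using \<nu> by (simp add: generates_units_def)

lemma card_units: "card (UNIV - {0 :: 'f}) = q - 1"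
  using card by (simp add: card_Diff_singleton)

text \<open>\<open>generates_units\<close> only says that every unit is a natural power of
  \<open>\<nu>\<close>. A repetition among the first \<open>q\<close> powers gives a period
  \<open>d\<close> of at most \<open>q - 1\<close>, and counting the units forces
  \<open>d = q - 1\<close>.\<close>

lemma \<nu>_order: "\<nu> ^ (q - 1) = 1" "inj_on (\<lambda>k. \<nu> ^ k) {..<q - 1}" "(\<lambda>k. \<nu> ^ k) ` {..<q - 1} = UNIV - {0}"
proof -
  have "\<not> inj_on (\<lambda>k. \<nu> ^ k) {..q - 1}"
  proof
    assume "inj_on (\<lambda>k. \<nu> ^ k) {..q - 1}"
    then have "card ((\<lambda>k. \<nu> ^ k) ` {..q - 1}) = q" using q_ge by (simp add: card_image)
    moreover have "card ((\<lambda>k. \<nu> ^ k) ` {..q - 1}) \<le> q - 1"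
      unfolding card_units[symmetric] by (rule card_mono) auto
    ultimately show False using q_ge by simp
  qed
  then obtain i j where ij: "i < j" "\<nu> ^ i = \<nu> ^ j" "j \<le> q - 1"
    unfolding inj_on_def by (metis atMost_iff linorder_neqE_nat)
  define d where "d = j - i"
  have "\<nu> ^ i * \<nu> ^ d = \<nu> ^ i * 1" unfolding power_add[symmetric] using ij by (simp add: d_def)
  then have d: "\<nu> ^ d = 1" "d > 0" "d \<le> q - 1" using ij by (auto simp: d_def)
  have red: "\<nu> ^ k = \<nu> ^ (k mod d)" for k
  proof -
    have "\<nu> ^ k = (\<nu> ^ d) ^ (k div d) * \<nu> ^ (k mod d)"
      by (simp only: power_mult[symmetric] power_add[symmetric] mult_div_mod_eq)
    then show ?thesis by (simp add: d)
  qed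
  have im: "UNIV - {0} = (\<lambda>k. \<nu> ^ k) ` {..<d}"
  proof
    show "UNIV - {0} \<subseteq> (\<lambda>k. \<nu> ^ k) ` {..<d}"
    proof
      fix x :: 'f assume "x \<in> UNIV - {0}"
      then obtain k where "x = \<nu> ^ k" using \<nu> by (auto simp: generates_units_def)
      then show "x \<in> (\<lambda>k. \<nu> ^ k) ` {..<d}" using red[of k] d(2) by auto
    qed
  qed auto
  have "q - 1 \<le> d" using card_image_le[of "{..<d}" "\<lambda>k. \<nu> ^ k"] unfolding im[symmetric] card_units by simp
  then have dq: "d = q - 1" using d by simp
  show "\<nu> ^ (q - 1) = 1" using d dq by simp
  show "(\<lambda>k. \<nu> ^ k) ` {..<q - 1} = UNIV - {0}" using im dq by simp
  show "inj_on (\<lambda>k. \<nu> ^ k) {..<q - 1}"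
    by (rule eq_card_imp_inj_on) (simp_all only: im[symmetric, unfolded dq] card_units card_lessThan finite_lessThan)
qed

lemma unit_power: "x \<noteq> 0 \<Longrightarrow> \<exists>k<q - 1. x = \<nu> ^ k"
  using \<nu>_order(3) by (metis (no_types, lifting) Diff_iff UNIV_I imageE lessThan_iff singletonD)

lemma Um_SL2 [simp]: "Um t \<in> carrier SL2" and Dm_SL2 [simp]: "x \<noteq> 0 \<Longrightarrow> Dm x \<in> carrier SL2"
  and wm_SL2 [simp]: "wm \<in> carrier (SL2 :: 'f mat monoid)"
  by (simp_all add: Um_def Dm_def wm_def)

lemma SL2_a_pow: "SL2_a \<nu> [^]\<^bsub>SL2\<^esub> (l::nat) = Dm (\<nu> ^ l)"
  by (induction l) (simp_all add: SL2_a_def Dm_def m2_one power_inverse mult.commute)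

lemma SL2_c_eq: "SL2_c = Um 1"
  by (simp add: SL2_c_def Um_def)

text \<open>Diagonal matrices multiply the parameter of a unipotent element by squares, and every
  unit is a square.\<close>

lemma conj_Um: "(t :: 'f) \<noteq> 0 \<Longrightarrow> conj_in (Um t) (Um 1)"
proof -
  assume t: "t \<noteq> 0"
  obtain y where y: "y * y = inverse t" using square_surj by blast
  then have y0: "y \<noteq> 0" using t by auto
  have "t * y = inverse y"
  proof -
    have "t * y * y = 1" using y t by (simp add: mult.assoc)
    then show ?thesis using y0 by (simp add: field_simps)
  qed
  then have "Um t * Dm y = Dm y * Um 1" by (simp add: Um_def Dm_def)
  then show ?thesis unfolding conj_in_def using y0 by (intro conjI bexI[of _ "Dm y"]) auto
qed

text \<open>In characteristic 2 the eigenvalues \<open>x\<close> and \<open>inverse x\<close>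
  coincide only for \<open>x = 1\<close>. Otherwise a unipotent conjugation removes the lower left
  entry.\<close>

lemma conj_lower:
  fixes x z :: 'f
  assumes "x \<noteq> 0" "x \<noteq> 1"
  shows "conj_in (m2 x 0 z (inverse x)) (Dm x)"
proof -
  have ne: "x + inverse x \<noteq> 0"
  proof
    assume "x + inverse x = 0"
    then have "x = inverse x" by (simp add: add_eq_0_char2)
    then have "x * x = 1 * 1" using assms(1) by (metis mult_1_right right_inverse)
    then show False using square_inj assms(2) by blast
  qed
  define s where "s = z / (x + inverse x)"
  have "s * (x + inverse x) = z" using ne by (simp add: s_def)
  then have "z + inverse x * s = s * x" by (metis add.commute add.left_commute char2_left distrib_left mult.commute)
  then have "m2 x 0 z (inverse x) * Um s = Um s * Dm x" by (simp add: Um_def Dm_def)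
  then show ?thesis unfolding conj_in_def using assms by (intro conjI bexI[of _ "Um s"]) auto
qed

lemma conj_Dm_inverse: "(x :: 'f) \<noteq> 0 \<Longrightarrow> conj_in (Dm x) (Dm (inverse x))"
  unfolding conj_in_def by (intro conjI bexI[of _ wm]) (auto simp: Dm_def wm_def)

lemma \<nu>_power_ne_1: "0 < k \<Longrightarrow> k < q - 1 \<Longrightarrow> \<nu> ^ k \<noteq> 1"
proof
  assume k: "0 < k" "k < q - 1" and "\<nu> ^ k = 1"
  then have "\<nu> ^ k = \<nu> ^ 0" by simp
  then have "k = 0" using k by (intro inj_onD[OF \<nu>_order(2)]) auto
  then show False using k by simp
qed

lemma inverse_\<nu>_power: "k \<le> q - 1 \<Longrightarrow> inverse (\<nu> ^ k) = \<nu> ^ (q - 1 - k)"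
proof -
  assume "k \<le> q - 1"
  then have "\<nu> ^ k * \<nu> ^ (q - 1 - k) = \<nu> ^ (q - 1)" by (simp only: power_add[symmetric] le_add_diff_inverse)
  then have "\<nu> ^ k * \<nu> ^ (q - 1 - k) = 1" by (simp only: \<nu>_order(1))
  then show ?thesis by (rule inverse_unique)
qed

text \<open>Conjugation by \<open>wm\<close> inverts the torus, so an exponent beyond the middle is
  replaced by its complement to \<open>q - 1\<close>.\<close>

lemma conj_Dm:
  fixes x :: 'f
  assumes "x \<noteq> 0" "x \<noteq> 1"
  shows "\<exists>l\<in>{1..(q - 2) div 2}. conj_in (Dm x) (SL2_a \<nu> [^]\<^bsub>SL2\<^esub> l)"
proof -
  obtain k where k: "k < q - 1" "x = \<nu> ^ k" using unit_power assms by blast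
  then have "k > 0" using assms by (cases k) auto
  have refl: "conj_in (Dm x) (Dm x)" unfolding conj_in_def using assms
    by (intro conjI bexI[of _ "1\<^sub>m 2"]) (auto simp: m2_one Dm_def)
  show ?thesis
  proof (cases "k \<le> (q - 2) div 2")
    case True
    then show ?thesis using refl k \<open>k > 0\<close> by (intro bexI[of _ k]) (auto simp: SL2_a_pow)
  next
    case False
    have "conj_in (Dm x) (Dm (\<nu> ^ (q - 1 - k)))"
      using conj_Dm_inverse[OF assms(1)] inverse_\<nu>_power[of k] k by simp
    moreover have "q - 1 - k \<in> {1..(q - 2) div 2}" using False k q_even q_ge by auto
    ultimately show ?thesis by (intro bexI[of _ "q - 1 - k"]) (auto simp: SL2_a_pow)
  qed
qed

text \<open>The conjugating matrix has as columns a multiple of the second standard vector and its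
  image under the given matrix. The multiple is a square root of \<open>inverse b\<^sub>0\<close>,
  which makes the determinant 1.\<close>

lemma conj_companion:
  fixes a\<^sub>0 b\<^sub>0 c\<^sub>0 d\<^sub>0 :: 'f
  assumes g: "m2 a\<^sub>0 b\<^sub>0 c\<^sub>0 d\<^sub>0 \<in> carrier SL2" and ne: "b\<^sub>0 \<noteq> 0"
  shows "conj_in (m2 a\<^sub>0 b\<^sub>0 c\<^sub>0 d\<^sub>0) (m2 0 1 1 (a\<^sub>0 + d\<^sub>0))"
proof -
  obtain s where s: "s * s = inverse b\<^sub>0" using square_surj by blast
  have d: "a\<^sub>0 * d\<^sub>0 + b\<^sub>0 * c\<^sub>0 = 1" using g by simp
  have "b\<^sub>0 * (s * s) = 1" using s ne by simp
  then have h: "m2 0 (b\<^sub>0 * s) s (d\<^sub>0 * s) \<in> carrier SL2" by (simp add: mult_ac)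
  have 1: "a\<^sub>0 * (b\<^sub>0 * s) + b\<^sub>0 * (d\<^sub>0 * s) = b\<^sub>0 * s * (a\<^sub>0 + d\<^sub>0)" by (simp add: algebra_simps)
  have "c\<^sub>0 * (b\<^sub>0 * s) + d\<^sub>0 * (d\<^sub>0 * s) = s * (b\<^sub>0 * c\<^sub>0) + d\<^sub>0 * d\<^sub>0 * s" by (simp add: algebra_simps)
  also have "b\<^sub>0 * c\<^sub>0 = 1 + a\<^sub>0 * d\<^sub>0" using d by (metis add.commute char2_left)
  also have "s * (1 + a\<^sub>0 * d\<^sub>0) + d\<^sub>0 * d\<^sub>0 * s = s + d\<^sub>0 * s * (a\<^sub>0 + d\<^sub>0)" by (simp add: algebra_simps)
  finally have "m2 a\<^sub>0 b\<^sub>0 c\<^sub>0 d\<^sub>0 * m2 0 (b\<^sub>0 * s) s (d\<^sub>0 * s) = m2 0 (b\<^sub>0 * s) s (d\<^sub>0 * s) * m2 0 1 1 (a\<^sub>0 + d\<^sub>0)"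
    using 1 by simp
  then show ?thesis unfolding conj_in_def using g h by (intro conjI bexI[of _ "m2 0 (b\<^sub>0 * s) s (d\<^sub>0 * s)"]) auto
qed

text \<open>The trace condition says that \<open>x\<close> is an eigenvalue. If
  \<open>b\<^sub>0\<close> is nonzero, the matrix and a triangular one share the companion matrix of
  their trace. Otherwise the matrix is already triangular, and the Weyl element exchanges the
  diagonal entries if they stand in the other order.\<close>

lemma conj_triangular:
  fixes a\<^sub>0 b\<^sub>0 c\<^sub>0 d\<^sub>0 x :: 'f
  assumes g: "m2 a\<^sub>0 b\<^sub>0 c\<^sub>0 d\<^sub>0 \<in> carrier SL2" and x: "x \<noteq> 0" "x + inverse x = a\<^sub>0 + d\<^sub>0"
  shows "\<exists>z. conj_in (m2 a\<^sub>0 b\<^sub>0 c\<^sub>0 d\<^sub>0) (m2 x 0 z (inverse x))"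
proof (cases "b\<^sub>0 = 0")
  case True
  then have ad: "a\<^sub>0 * d\<^sub>0 = 1" using g by simp
  then have a0: "a\<^sub>0 \<noteq> 0" "d\<^sub>0 = inverse a\<^sub>0" by (auto simp: inverse_unique)
  have "(a\<^sub>0 + x) * (a\<^sub>0 + inverse x) = a\<^sub>0 * (a\<^sub>0 + (x + inverse x)) + 1"
    using x(1) by (simp add: algebra_simps)
  also have "\<dots> = a\<^sub>0 * d\<^sub>0 + 1" unfolding x(2) by simp
  also have "\<dots> = 0" using ad by simp
  finally consider "x = a\<^sub>0" | "x = inverse a\<^sub>0" by (auto simp: add_eq_0_char2)
  then show ?thesis
  proof cases
    case 1
    then have "conj_in (m2 a\<^sub>0 b\<^sub>0 c\<^sub>0 d\<^sub>0) (m2 x 0 c\<^sub>0 (inverse x))"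
      unfolding conj_in_def using True a0 g by (intro conjI bexI[of _ "1\<^sub>m 2"]) (auto simp: m2_one)
    then show ?thesis by blast
  next
    case 2
    show ?thesis
    proof (cases "a\<^sub>0 = 1")
      case True': True
      then have "conj_in (m2 a\<^sub>0 b\<^sub>0 c\<^sub>0 d\<^sub>0) (m2 x 0 c\<^sub>0 (inverse x))"
        unfolding conj_in_def using True 2 a0 g by (intro conjI bexI[of _ "1\<^sub>m 2"]) (auto simp: m2_one)
      then show ?thesis by blast
    next
      case False
      then have "conj_in (m2 a\<^sub>0 b\<^sub>0 c\<^sub>0 d\<^sub>0) (Dm a\<^sub>0)" using conj_lower[OF a0(1) False, of c\<^sub>0] True a0 by simp
      from conj_in_trans[OF this conj_Dm_inverse[OF a0(1)]] show ?thesis using 2 by (auto simp: Dm_def)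
    qed
  qed
next
  case False
  let ?u = "m2 0 1 1 (a\<^sub>0 + d\<^sub>0)"
  have c: "conj_in (m2 a\<^sub>0 b\<^sub>0 c\<^sub>0 d\<^sub>0) ?u" by (rule conj_companion[OF g False])
  have "conj_in (m2 x 0 1 (inverse x)) ?u"
  proof -
    have "m2 x 0 1 (inverse x) * m2 1 x 0 1 = m2 1 x 0 1 * m2 0 1 1 (x + inverse x)"
      using x(1) by (simp add: algebra_simps)
    then show ?thesis unfolding conj_in_def using x by (intro conjI bexI[of _ "m2 1 x 0 1"]) auto
  qed
  then show ?thesis using conj_in_trans[OF c conj_in_sym] by blast
qed

lemma Dm_pow: "x \<noteq> 0 \<Longrightarrow> Dm x [^]\<^bsub>SL2\<^esub> (k::nat) = Dm (x ^ k)" for x :: 'f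
  by (induction k) (simp_all add: Dm_def m2_one power_inverse mult.commute)

lemma unit_pow_order: "x \<noteq> 0 \<Longrightarrow> x ^ (q - 1) = (1 :: 'f)"
proof -
  assume "x \<noteq> 0"
  then obtain k where "x = \<nu> ^ k" using unit_power by blast
  then have "x ^ (q - 1) = (\<nu> ^ (q - 1)) ^ k" by (simp only: power_mult[symmetric] mult.commute)
  then show ?thesis by (simp only: \<nu>_order(1) power_one)
qed

section \<open>Traces, and the powers of an element of order q + 1\<close>

definition split_traces :: "'f set" where
  "split_traces = (\<lambda>x. x + inverse x) ` (UNIV - {0})"

text \<open>Two units with the same trace are equal or inverse to each other. For exponents below
  \<open>q div 2\<close> the sum of two exponents is less than \<open>q - 1\<close>, so they can be
  inverse only if both exponents are 0.\<close>

lemma card_split_traces: "card split_traces \<ge> q div 2"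
proof -
  have "inj_on (\<lambda>k. \<nu> ^ k + inverse (\<nu> ^ k)) {..<q div 2}"
  proof (rule inj_onI)
    fix k j assume kj: "k \<in> {..<q div 2}" "j \<in> {..<q div 2}"
      and eq: "\<nu> ^ k + inverse (\<nu> ^ k) = \<nu> ^ j + inverse (\<nu> ^ j)"
    let ?x = "\<nu> ^ k" and ?y = "\<nu> ^ j"
    have "(?x + ?y) * (1 + inverse (?x * ?y)) = (?x + inverse ?x) + (?y + inverse ?y)"
      by (simp add: algebra_simps)
    also have "\<dots> = 0" unfolding eq by (rule char2)
    finally have "?x + ?y = 0 \<or> 1 + inverse (?x * ?y) = 0" by (simp only: mult_eq_0_iff)
    then consider "?x = ?y" | "inverse (?x * ?y) = 1" by (metis add_eq_0_char2)
    then show "k = j"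
    proof cases
      case 1
      then show ?thesis using kj by (intro inj_onD[OF \<nu>_order(2)]) auto
    next
      case 2
      then have "\<nu> ^ (k + j) = 1" by (metis inverse_1 inverse_inverse_eq power_add)
      moreover have "k + j < q - 1" using kj q_ge q_even by auto
      ultimately have "\<not> 0 < k + j" using \<nu>_power_ne_1[of "k + j"] by blast
      then show ?thesis by simp
    qed
  qed
  from card_image[OF this] have "q div 2 = card ((\<lambda>k. \<nu> ^ k + inverse (\<nu> ^ k)) ` {..<q div 2})" by simp
  also have "\<dots> \<le> card split_traces" by (rule card_mono) (auto simp: split_traces_def)
  finally show ?thesis .
qed

definition tr2 :: "'f mat \<Rightarrow> 'f" where
  "tr2 g = g $$ (0, 0) + g $$ (Suc 0, Suc 0)"

lemma tr2_m2 [simp]: "tr2 (m2 a\<^sub>0 b\<^sub>0 c\<^sub>0 d\<^sub>0) = a\<^sub>0 + d\<^sub>0"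
  by (simp add: tr2_def)

lemma b_pow_SL2: "b [^]\<^bsub>SL2\<^esub> (k::nat) \<in> carrier SL2"
  using b by simp

lemma b_pow_one_iff: "b [^]\<^bsub>SL2\<^esub> (k::nat) = 1\<^sub>m 2 \<longleftrightarrow> q + 1 dvd k"
  using SL2.pow_eq_id[OF b, of k] ord_b by simp

text \<open>With a split trace the power would be conjugate to a triangular matrix and have order
  dividing 2 or \<open>q - 1\<close>. Both numbers are coprime to \<open>q + 1\<close>, so
  \<open>q + 1\<close> would divide \<open>k\<close>, which is too small.\<close>

lemma tr2_b_pow:
  assumes k: "k \<in> {1..q div 2}"
  shows "tr2 (b [^]\<^bsub>SL2\<^esub> k) \<notin> split_traces"
proof
  assume "tr2 (b [^]\<^bsub>SL2\<^esub> k) \<in> split_traces"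
  then obtain x where x: "x \<noteq> 0" "tr2 (b [^]\<^bsub>SL2\<^esub> k) = x + inverse x" by (auto simp: split_traces_def)
  obtain a\<^sub>0 b\<^sub>0 c\<^sub>0 d\<^sub>0 where g: "b [^]\<^bsub>SL2\<^esub> k = m2 a\<^sub>0 b\<^sub>0 c\<^sub>0 d\<^sub>0" using b_pow_SL2 by (rule SL2_cases)
  have "m2 a\<^sub>0 b\<^sub>0 c\<^sub>0 d\<^sub>0 \<in> carrier SL2" using b_pow_SL2[of k] unfolding g .
  from conj_triangular[OF this x(1)] x(2) obtain z where z: "conj_in (b [^]\<^bsub>SL2\<^esub> k) (m2 x 0 z (inverse x))"
    unfolding g by auto
  have ndvd: "\<not> q + 1 dvd k" using k by (auto dest: dvd_imp_le)
  have cop: "coprime (q + 1) 2" "coprime (q + 1) (q - 1)"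
  proof -
    show "coprime (q + 1) 2" using q_even by simp
    have "gcd (q + 1) (q - 1) dvd (q + 1) - (q - 1)" by (intro dvd_diff_nat gcd_dvd1 gcd_dvd2)
    then have "gcd (q + 1) (q - 1) dvd 2" using q_ge by simp
    then have "gcd (q + 1) (q - 1) dvd gcd (q + 1) 2" by (intro gcd_greatest gcd_dvd1)
    moreover have "gcd (q + 1) 2 = 1" using \<open>coprime (q + 1) 2\<close> by (simp only: coprime_iff_gcd_eq_1)
    ultimately have "gcd (q + 1) (q - 1) = 1" by (metis nat_dvd_1_iff_1)
    then show "coprime (q + 1) (q - 1)" by (simp only: coprime_iff_gcd_eq_1)
  qed
  have pow: "(b [^]\<^bsub>SL2\<^esub> k) [^]\<^bsub>SL2\<^esub> (e::nat) = b [^]\<^bsub>SL2\<^esub> (k * e)" for e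
    by (rule SL2.nat_pow_pow[OF b])
  show False
  proof (cases "x = 1")
    case True
    let ?r = "m2 x 0 z (inverse x)"
    have r: "?r \<in> carrier SL2" using x(1) by simp
    have "?r [^]\<^bsub>SL2\<^esub> ((1::nat) + 1) = ?r * ?r"
      using SL2.nat_pow_mult[OF r, of 1 1] SL2.nat_pow_eone[OF r] by simp
    also have "\<dots> = 1\<^sub>m 2" using True by (simp add: m2_one)
    finally have "b [^]\<^bsub>SL2\<^esub> (k * (1 + 1)) = 1\<^sub>m 2"
      using conj_in_pow[OF z, of "1 + 1"] unfolding pow by (metis conj_in_one)
    then have "q + 1 dvd k * 2" by (simp only: b_pow_one_iff one_add_one)
    then have "q + 1 dvd k" using cop(1) by (simp only: coprime_dvd_mult_left_iff)
    then show False using ndvd by simp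
  next
    case False
    have "conj_in (b [^]\<^bsub>SL2\<^esub> k) (Dm x)" by (rule conj_in_trans[OF z conj_lower[OF x(1) False]])
    from conj_in_pow[OF this, of "q - 1"] have "conj_in (b [^]\<^bsub>SL2\<^esub> (k * (q - 1))) (Dm (x ^ (q - 1)))"
      unfolding pow Dm_pow[OF x(1)] .
    moreover have "Dm (x ^ (q - 1)) = 1\<^sub>m 2" unfolding unit_pow_order[OF x(1)] by (simp add: Dm_def m2_one)
    ultimately have "b [^]\<^bsub>SL2\<^esub> (k * (q - 1)) = 1\<^sub>m 2" by (metis conj_in_one)
    then have "q + 1 dvd k * (q - 1)" by (simp only: b_pow_one_iff)
    then have "q + 1 dvd k" using cop(2) by (simp only: coprime_dvd_mult_left_iff)
    then show False using ndvd by simp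
  qed
qed

lemma nonsplit_entry:
  assumes "m2 a\<^sub>0 b\<^sub>0 c\<^sub>0 d\<^sub>0 \<in> carrier SL2" "a\<^sub>0 + d\<^sub>0 \<notin> split_traces"
  shows "b\<^sub>0 \<noteq> 0"
proof
  assume "b\<^sub>0 = 0"
  then have "a\<^sub>0 * d\<^sub>0 = 1" using assms(1) by simp
  then have "a\<^sub>0 \<noteq> 0" "d\<^sub>0 = inverse a\<^sub>0" by (auto simp: inverse_unique)
  then show False using assms(2) by (auto simp: split_traces_def)
qed

text \<open>In characteristic 2 the inverse is obtained by exchanging the diagonal entries.
  Commuting forces proportional off-diagonal parts, the common trace makes them equal, and the
  determinant then leaves only two choices of diagonal.\<close>

lemma commuting_same_trace:
  fixes a\<^sub>0 b\<^sub>0 c\<^sub>0 d\<^sub>0 a\<^sub>1 b\<^sub>1 c\<^sub>1 d\<^sub>1 :: 'f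
  assumes comm: "m2 a\<^sub>0 b\<^sub>0 c\<^sub>0 d\<^sub>0 * m2 a\<^sub>1 b\<^sub>1 c\<^sub>1 d\<^sub>1 = m2 a\<^sub>1 b\<^sub>1 c\<^sub>1 d\<^sub>1 * m2 a\<^sub>0 b\<^sub>0 c\<^sub>0 d\<^sub>0"
    and g0: "a\<^sub>0 * d\<^sub>0 + b\<^sub>0 * c\<^sub>0 = 1" and g1: "a\<^sub>1 * d\<^sub>1 + b\<^sub>1 * c\<^sub>1 = 1"
    and tr: "a\<^sub>1 + d\<^sub>1 = a\<^sub>0 + d\<^sub>0" "a\<^sub>0 + d\<^sub>0 \<noteq> 0" and ne: "b\<^sub>0 \<noteq> 0"
  shows "m2 a\<^sub>1 b\<^sub>1 c\<^sub>1 d\<^sub>1 = m2 a\<^sub>0 b\<^sub>0 c\<^sub>0 d\<^sub>0 \<or> m2 a\<^sub>1 b\<^sub>1 c\<^sub>1 d\<^sub>1 = m2 d\<^sub>0 b\<^sub>0 c\<^sub>0 a\<^sub>0"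
proof -
  have e1: "b\<^sub>0 * c\<^sub>1 = b\<^sub>1 * c\<^sub>0" and e2: "a\<^sub>0 * b\<^sub>1 + b\<^sub>0 * d\<^sub>1 = a\<^sub>1 * b\<^sub>0 + b\<^sub>1 * d\<^sub>0"
    using comm unfolding m2_mult m2_eq_iff mult.commute[of a\<^sub>1 a\<^sub>0] add_left_cancel by blast+
  have "b\<^sub>1 * (a\<^sub>0 + d\<^sub>0) = a\<^sub>0 * b\<^sub>1 + b\<^sub>1 * d\<^sub>0" by (simp add: algebra_simps)
  also have "b\<^sub>1 * d\<^sub>0 = a\<^sub>1 * b\<^sub>0 + (a\<^sub>0 * b\<^sub>1 + b\<^sub>0 * d\<^sub>1)" unfolding e2 by simp
  also have "a\<^sub>0 * b\<^sub>1 + (a\<^sub>1 * b\<^sub>0 + (a\<^sub>0 * b\<^sub>1 + b\<^sub>0 * d\<^sub>1)) = b\<^sub>0 * (a\<^sub>1 + d\<^sub>1)"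
    by (simp add: algebra_simps)
  finally have b1: "b\<^sub>1 = b\<^sub>0" using tr by simp
  then have c1: "c\<^sub>1 = c\<^sub>0" using e1 ne by simp
  have d: "d\<^sub>0 = a\<^sub>0 + (a\<^sub>0 + d\<^sub>0)" "d\<^sub>1 = a\<^sub>1 + (a\<^sub>0 + d\<^sub>0)"
    by (simp, simp only: tr(1)[symmetric] char2_left)
  have "a\<^sub>1 * d\<^sub>1 = a\<^sub>0 * d\<^sub>0" using g0 g1 b1 c1 by (metis add_right_cancel)
  then have "a\<^sub>1 * d\<^sub>1 + a\<^sub>0 * d\<^sub>0 = 0" by (simp only: char2)
  moreover have "a\<^sub>1 * d\<^sub>1 + a\<^sub>0 * d\<^sub>0 = (a\<^sub>1 + a\<^sub>0) * (a\<^sub>1 + d\<^sub>0)"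
    unfolding d(2) by (simp add: algebra_simps)
  ultimately have "a\<^sub>1 = a\<^sub>0 \<or> a\<^sub>1 = d\<^sub>0" by (simp add: add_eq_0_char2)
  then show ?thesis using b1 c1 d by (auto simp: add.commute)
qed

lemma zero_split_trace: "0 \<in> split_traces"
  unfolding split_traces_def by (rule image_eqI[of _ _ 1]) auto

text \<open>Powers of \<open>b\<close> commute, so equal traces make them equal or inverse. Being
  inverse would need \<open>q + 1\<close> to divide \<open>k + j\<close>, which is at most
  \<open>q\<close>.\<close>

lemma tr2_b_pow_inj: "inj_on (\<lambda>k. tr2 (b [^]\<^bsub>SL2\<^esub> k)) {1..q div 2}"
proof (rule inj_onI)
  fix k j assume k: "k \<in> {1..q div 2}" and j: "j \<in> {1..q div 2}"
    and eq: "tr2 (b [^]\<^bsub>SL2\<^esub> k) = tr2 (b [^]\<^bsub>SL2\<^esub> j)"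
  obtain a\<^sub>0 b\<^sub>0 c\<^sub>0 d\<^sub>0 where g0: "b [^]\<^bsub>SL2\<^esub> k = m2 a\<^sub>0 b\<^sub>0 c\<^sub>0 d\<^sub>0" "a\<^sub>0 * d\<^sub>0 - b\<^sub>0 * c\<^sub>0 = 1"
    using b_pow_SL2 by (rule SL2_cases)
  obtain a\<^sub>1 b\<^sub>1 c\<^sub>1 d\<^sub>1 where g1: "b [^]\<^bsub>SL2\<^esub> j = m2 a\<^sub>1 b\<^sub>1 c\<^sub>1 d\<^sub>1" "a\<^sub>1 * d\<^sub>1 - b\<^sub>1 * c\<^sub>1 = 1"
    using b_pow_SL2 by (rule SL2_cases)
  have ns: "a\<^sub>0 + d\<^sub>0 \<notin> split_traces" using tr2_b_pow[OF k] g0 by simp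
  have comm: "b [^]\<^bsub>SL2\<^esub> k * b [^]\<^bsub>SL2\<^esub> j = b [^]\<^bsub>SL2\<^esub> (k + j)" for k j :: nat
    using SL2.nat_pow_mult[OF b, of k j] by simp
  have "b [^]\<^bsub>SL2\<^esub> j = b [^]\<^bsub>SL2\<^esub> k \<or> b [^]\<^bsub>SL2\<^esub> j = m2 d\<^sub>0 b\<^sub>0 c\<^sub>0 a\<^sub>0"
    unfolding g0(1) g1(1)
  proof (rule commuting_same_trace)
    show "m2 a\<^sub>0 b\<^sub>0 c\<^sub>0 d\<^sub>0 * m2 a\<^sub>1 b\<^sub>1 c\<^sub>1 d\<^sub>1 = m2 a\<^sub>1 b\<^sub>1 c\<^sub>1 d\<^sub>1 * m2 a\<^sub>0 b\<^sub>0 c\<^sub>0 d\<^sub>0"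
      unfolding g0(1)[symmetric] g1(1)[symmetric] comm by (simp only: add.commute)
    show "b\<^sub>0 \<noteq> 0" by (rule nonsplit_entry[OF _ ns]) (use g0 in simp)
    show "a\<^sub>1 + d\<^sub>1 = a\<^sub>0 + d\<^sub>0" using eq g0 g1 by simp
    show "a\<^sub>0 + d\<^sub>0 \<noteq> 0" using ns zero_split_trace by auto
  qed (use g0 g1 in auto)
  then show "k = j"
  proof
    assume "b [^]\<^bsub>SL2\<^esub> j = b [^]\<^bsub>SL2\<^esub> k"
    then have *: "b [^]\<^bsub>SL2\<^esub> (k + (q + 1 - j)) = b [^]\<^bsub>SL2\<^esub> (j + (q + 1 - j))" by (simp only: comm[symmetric])
    have "j + (q + 1 - j) = q + 1" using j q_ge by auto
    then have "b [^]\<^bsub>SL2\<^esub> (k + (q + 1 - j)) = 1\<^sub>m 2" unfolding * by (simp only: b_pow_one_iff dvd_refl)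
    then have "q + 1 dvd k + (q + 1 - j)" by (simp only: b_pow_one_iff)
    then obtain e where e: "k + (q + 1 - j) = (q + 1) * e" by (elim dvdE)
    have "k + (q + 1 - j) < (q + 1) * 2" "0 < k + (q + 1 - j)" using k j q_ge by auto
    then have "e < 2" "0 < e" unfolding e by (simp_all only: mult_less_cancel1 nat_0_less_mult_iff)
    then have "e = 1" by simp
    then show "k = j" using e j q_ge by auto
  next
    assume *: "b [^]\<^bsub>SL2\<^esub> j = m2 d\<^sub>0 b\<^sub>0 c\<^sub>0 a\<^sub>0"
    have "b [^]\<^bsub>SL2\<^esub> (k + j) = 1\<^sub>m 2"
      unfolding comm[symmetric] g0(1) * m2_one using g0(2) by (simp add: mult.commute add.commute)
    then have "q + 1 dvd k + j" by (simp only: b_pow_one_iff)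
    then have "q + 1 \<le> k + j" using k by (intro dvd_imp_le) auto
    then show "k = j" using k j q_even by auto
  qed
qed

text \<open>At most half of the field consists of traces that are not split, and the powers of
  \<open>b\<close> already provide that many.\<close>

lemma nonsplit_trace_b:
  assumes "t \<notin> split_traces"
  shows "\<exists>k\<in>{1..q div 2}. tr2 (b [^]\<^bsub>SL2\<^esub> k) = t"
proof -
  let ?f = "\<lambda>k. tr2 (b [^]\<^bsub>SL2\<^esub> k)"
  have sub: "?f ` {1..q div 2} \<subseteq> UNIV - split_traces" using tr2_b_pow by auto
  have "card (UNIV - split_traces) = q - card split_traces" by (simp add: card_Diff_subset card)
  also have "\<dots> \<le> q div 2" using card_split_traces q_even by linarith
  also have "q div 2 = card (?f ` {1..q div 2})" using card_image[OF tr2_b_pow_inj] by simp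
  finally have "?f ` {1..q div 2} = UNIV - split_traces" by (intro card_seteq sub) auto
  then have "t \<in> ?f ` {1..q div 2}" using assms by auto
  then show ?thesis by auto
qed

text \<open>This bounds the values of a class function on the whole group, and thereby its character
  field. The trace decides the case: a split trace leads to a triangular matrix, and otherwise the
  element and a power of \<open>b\<close> with the same trace are conjugate to one companion
  matrix.\<close>

theorem conjugacy_representatives:
  assumes g: "g \<in> carrier SL2"
  shows "g = 1\<^sub>m 2 \<or> conj_in g SL2_c \<or> (\<exists>l\<in>{1..(q - 2) div 2}. conj_in g (SL2_a \<nu> [^]\<^bsub>SL2\<^esub> l)) \<or>
    (\<exists>k\<in>{1..q div 2}. conj_in g (b [^]\<^bsub>SL2\<^esub> k))"
proof -
  obtain a\<^sub>0 b\<^sub>0 c\<^sub>0 d\<^sub>0 where g0: "g = m2 a\<^sub>0 b\<^sub>0 c\<^sub>0 d\<^sub>0" using g by (rule SL2_cases)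
  have gc: "m2 a\<^sub>0 b\<^sub>0 c\<^sub>0 d\<^sub>0 \<in> carrier SL2" using g g0 by simp
  show ?thesis
  proof (cases "a\<^sub>0 + d\<^sub>0 \<in> split_traces")
    case True
    then obtain x where x: "x \<noteq> 0" "x + inverse x = a\<^sub>0 + d\<^sub>0"
      unfolding split_traces_def by (metis (no_types, lifting) DiffD2 imageE singletonI)
    obtain z where z: "conj_in g (m2 x 0 z (inverse x))" using conj_triangular[OF gc x] g0 by auto
    show ?thesis
    proof (cases "x = 1")
      case True
      then have cU: "conj_in g (Um z)" using z by (simp add: Um_def)
      show ?thesis
      proof (cases "z = 0")
        case True
        then show ?thesis using conj_in_one[of g] cU by (simp add: Um_def m2_one)
      next
        case False
        then show ?thesis using conj_in_trans[OF cU conj_Um] by (simp add: SL2_c_eq)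
      qed
    next
      case False
      have "conj_in g (Dm x)" by (rule conj_in_trans[OF z conj_lower[OF x(1) False]])
      then show ?thesis using conj_Dm[OF x(1) False] conj_in_trans by blast
    qed
  next
    case False
    then obtain k where k: "k \<in> {1..q div 2}" "tr2 (b [^]\<^bsub>SL2\<^esub> k) = a\<^sub>0 + d\<^sub>0" using nonsplit_trace_b by blast
    obtain a\<^sub>1 b\<^sub>1 c\<^sub>1 d\<^sub>1 where g1: "b [^]\<^bsub>SL2\<^esub> k = m2 a\<^sub>1 b\<^sub>1 c\<^sub>1 d\<^sub>1" using b_pow_SL2 by (rule SL2_cases)
    have gc1: "m2 a\<^sub>1 b\<^sub>1 c\<^sub>1 d\<^sub>1 \<in> carrier SL2" using b_pow_SL2[of k] unfolding g1 .
    have t1: "a\<^sub>1 + d\<^sub>1 = a\<^sub>0 + d\<^sub>0" using k g1 by simp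
    have "conj_in g (m2 0 1 1 (a\<^sub>0 + d\<^sub>0))" unfolding g0 by (rule conj_companion[OF gc nonsplit_entry[OF gc False]])
    moreover have "conj_in (b [^]\<^bsub>SL2\<^esub> k) (m2 0 1 1 (a\<^sub>0 + d\<^sub>0))"
      using conj_companion[OF gc1 nonsplit_entry[OF gc1]] False unfolding g1 t1 by blast
    ultimately show ?thesis using k conj_in_trans conj_in_sym by blast
  qed
qed

section \<open>Values of class functions\<close>

lemma class_function_conj:
  assumes cf: "class_function_with_values \<nu> b \<chi> v1 vc va vb" and "conj_in g r"
  shows "\<chi> g = \<chi> r"
proof -
  obtain h where h: "h \<in> carrier SL2" "g * h = h * r" and c: "g \<in> carrier SL2" "r \<in> carrier SL2"
    using assms(2) unfolding conj_in_def by blast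
  have "h \<otimes>\<^bsub>SL2\<^esub> r \<otimes>\<^bsub>SL2\<^esub> inv\<^bsub>SL2\<^esub> h = g \<otimes>\<^bsub>SL2\<^esub> h \<otimes>\<^bsub>SL2\<^esub> inv\<^bsub>SL2\<^esub> h" using h by simp
  also have "\<dots> = g \<otimes>\<^bsub>SL2\<^esub> (h \<otimes>\<^bsub>SL2\<^esub> inv\<^bsub>SL2\<^esub> h)" by (rule SL2.m_assoc[OF c(1) h(1) SL2.inv_closed[OF h(1)]])
  also have "\<dots> = g" unfolding SL2.r_inv[OF h(1)] by (rule SL2.r_one[OF c(1)])
  finally show ?thesis using cf c h unfolding class_function_with_values_def by metis
qed

lemma class_function_values:
  assumes cf: "class_function_with_values \<nu> b \<chi> v1 vc va vb"
  shows "\<chi> (1\<^sub>m 2) = v1"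
    and "t \<noteq> 0 \<Longrightarrow> \<chi> (Um t) = vc"
    and "l \<in> {1..(q - 2) div 2} \<Longrightarrow> \<chi> (Dm (\<nu> ^ l)) = va l"
    and "k \<in> {1..q div 2} \<Longrightarrow> \<chi> (b [^]\<^bsub>SL2\<^esub> k) = vb k"
    and "x \<noteq> 0 \<Longrightarrow> \<chi> (Dm (inverse x)) = \<chi> (Dm x)"
    and "x \<noteq> 0 \<Longrightarrow> x \<noteq> 1 \<Longrightarrow> \<chi> (Um t * Dm x) = \<chi> (Dm x)"
proof -
  show "\<chi> (1\<^sub>m 2) = v1" "l \<in> {1..(q - 2) div 2} \<Longrightarrow> \<chi> (Dm (\<nu> ^ l)) = va l"
    "k \<in> {1..q div 2} \<Longrightarrow> \<chi> (b [^]\<^bsub>SL2\<^esub> k) = vb k"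
    using cf unfolding class_function_with_values_def SL2_a_pow card SL2_simps by auto
  have c: "\<chi> (Um 1) = vc" using cf unfolding class_function_with_values_def SL2_c_eq by blast
  show "t \<noteq> 0 \<Longrightarrow> \<chi> (Um t) = vc" using class_function_conj[OF cf conj_Um] c by simp
  show "x \<noteq> 0 \<Longrightarrow> \<chi> (Dm (inverse x)) = \<chi> (Dm x)"
    by (rule class_function_conj[OF cf conj_in_sym[OF conj_Dm_inverse]])
  show "\<chi> (Um t * Dm x) = \<chi> (Dm x)" if "x \<noteq> 0" "x \<noteq> 1"
  proof -
    have "Um t * Dm x = m2 x 0 (t * x) (inverse x)" by (simp add: Um_def Dm_def)
    then show ?thesis using class_function_conj[OF cf conj_lower[OF that]] by (simp only:)
  qed
qed

lemma class_function_range: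
  assumes cf: "class_function_with_values \<nu> b \<chi> v1 vc va vb" and g: "g \<in> carrier SL2"
  shows "\<chi> g \<in> {v1, vc} \<union> va ` {1..(q - 2) div 2} \<union> vb ` {1..q div 2}"
proof -
  note v = class_function_values[OF cf]
  have c: "\<chi> SL2_c = vc" using v(2)[of 1] by (simp add: SL2_c_eq)
  from conjugacy_representatives[OF g] show ?thesis
  proof (elim disjE bexE)
    fix l assume "l \<in> {1..(q - 2) div 2}" "conj_in g (SL2_a \<nu> [^]\<^bsub>SL2\<^esub> l)"
    then have "\<chi> g = va l" using class_function_conj[OF cf] v(3) unfolding SL2_a_pow by metis
    then show ?thesis using \<open>l \<in> _\<close> by blast
  next
    fix k assume "k \<in> {1..q div 2}" "conj_in g (b [^]\<^bsub>SL2\<^esub> k)"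
    then have "\<chi> g = vb k" using class_function_conj[OF cf] v(4) by metis
    then show ?thesis using \<open>k \<in> _\<close> by blast
  qed (use class_function_conj[OF cf] v(1) c in auto)
qed

end

section \<open>Orthogonal representations restricted to the Borel subgroup\<close>

lemma sum_list_diag_mat: "A \<in> carrier_mat m m \<Longrightarrow> sum_list (diag_mat A) = (\<Sum>i<m. A $$ (i, i))"
  by (simp add: diag_mat_def sum_list_sum_nth atLeast0LessThan)

text \<open>The difference \<open>v1 - vc\<close> is \<open>q\<close> times the multiplicity of a
  nontrivial character of the unipotent subgroup. So \<open>v1_vc\<close>, which holds in all three
  families, says that each such character occurs exactly once.\<close>

locale sl2_rep = sl2_even n q \<nu> b + csubfield K
  for n q and \<nu> :: "'f::{field,finite}" and b K +
  fixes \<chi> :: "'f mat \<Rightarrow> complex" and m :: nat and \<rho> :: "'f mat \<Rightarrow> complex mat" and F :: "complex mat"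
    and v1 vc :: complex and va vb :: "nat \<Rightarrow> complex"
  assumes cf: "class_function_with_values \<nu> b \<chi> v1 vc va vb"
    and rep: "matrix_rep K m \<rho>" and irr: "absolutely_irreducible m \<rho>" and aff: "affords \<rho> \<chi>"
    and form: "invariant_symmetric_form K m \<rho> F" and F_nonzero: "F \<noteq> 0\<^sub>m m m"
    and v1_vc: "v1 - vc = of_nat q"
begin

lemma \<rho>_carrier: "g \<in> carrier SL2 \<Longrightarrow> \<rho> g \<in> carrier_mat m m"
  using rep by (simp add: matrix_rep_def)

lemma \<rho>_K: "g \<in> carrier SL2 \<Longrightarrow> i < m \<Longrightarrow> j < m \<Longrightarrow> \<rho> g $$ (i, j) \<in> K"
  using rep \<rho>_carrier[of g] elements_mat_subset_iff[of "\<rho> g" m m K] unfolding matrix_rep_def by blast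

lemma \<rho>_mult: "g \<in> carrier SL2 \<Longrightarrow> h \<in> carrier SL2 \<Longrightarrow> \<rho> (g * h) = \<rho> g * \<rho> h"
  using rep unfolding matrix_rep_def SL2_simps by blast

lemma F_carrier: "F \<in> carrier_mat m m" and F_elements: "elements_mat F \<subseteq> K" and F_sym: "F\<^sup>T = F"
  and F_inv: "g \<in> carrier SL2 \<Longrightarrow> (\<rho> g)\<^sup>T * F * \<rho> g = F"
  using form unfolding invariant_symmetric_form_def by blast+

lemma m_eq: "of_nat m = v1"
proof -
  have one: "1\<^sub>m 2 \<in> carrier (SL2 :: 'f mat monoid)" using SL2.one_closed by simp
  have "\<rho> (1\<^sub>m 2) = 1\<^sub>m m" using rep unfolding matrix_rep_def SL2_simps by blast
  then have "sum_list (diag_mat (1\<^sub>m m :: complex mat)) = \<chi> (1\<^sub>m 2)" using aff one unfolding affords_def by metis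
  moreover have "\<chi> (1\<^sub>m 2) = v1" by (rule class_function_values(1)[OF cf])
  ultimately have "(\<Sum>i<m. (1\<^sub>m m :: complex mat) $$ (i, i)) = v1"
    by (simp only: sum_list_diag_mat[OF one_carrier_mat])
  then show ?thesis by simp
qed

definition act :: "'f mat \<Rightarrow> complex vec \<Rightarrow> complex vec" where
  "act g v = \<rho> g *\<^sub>v v"

definition B :: "complex vec \<Rightarrow> complex vec \<Rightarrow> complex" where
  "B u v = u \<bullet> (F *\<^sub>v v)"

lemma act_carrier [simp, intro]: "g \<in> carrier SL2 \<Longrightarrow> v \<in> carrier_vec m \<Longrightarrow> act g v \<in> carrier_vec m"
  unfolding act_def by (rule mult_mat_vec_carrier[OF \<rho>_carrier])

lemma act_mult: "g \<in> carrier SL2 \<Longrightarrow> h \<in> carrier SL2 \<Longrightarrow> v \<in> carrier_vec m \<Longrightarrow> act (g * h) v = act g (act h v)"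
  unfolding act_def by (simp add: \<rho>_mult assoc_mult_mat_vec[OF \<rho>_carrier \<rho>_carrier])

lemma act_one: "v \<in> carrier_vec m \<Longrightarrow> act (1\<^sub>m 2) v = v"
  using rep unfolding matrix_rep_def act_def SL2_simps by simp

lemma act_add: "g \<in> carrier SL2 \<Longrightarrow> u \<in> carrier_vec m \<Longrightarrow> v \<in> carrier_vec m \<Longrightarrow> act g (u + v) = act g u + act g v"
  unfolding act_def by (rule mult_add_distrib_mat_vec[OF \<rho>_carrier])

lemma act_smult: "g \<in> carrier SL2 \<Longrightarrow> v \<in> carrier_vec m \<Longrightarrow> act g (c \<cdot>\<^sub>v v) = c \<cdot>\<^sub>v act g v"
  unfolding act_def by (rule mult_mat_vec[OF \<rho>_carrier])

lemma Fv_carrier [simp]: "v \<in> carrier_vec m \<Longrightarrow> F *\<^sub>v v \<in> carrier_vec m"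
  by (rule mult_mat_vec_carrier[OF F_carrier])

lemma B_add_left: "u \<in> carrier_vec m \<Longrightarrow> v \<in> carrier_vec m \<Longrightarrow> w \<in> carrier_vec m \<Longrightarrow> B (u + v) w = B u w + B v w"
  unfolding B_def by (rule add_scalar_prod_distrib) auto

lemma B_add_right: "u \<in> carrier_vec m \<Longrightarrow> v \<in> carrier_vec m \<Longrightarrow> w \<in> carrier_vec m \<Longrightarrow> B u (v + w) = B u v + B u w"
  unfolding B_def mult_add_distrib_mat_vec[OF F_carrier] by (rule scalar_prod_add_distrib) auto

lemma B_smult_left: "u \<in> carrier_vec m \<Longrightarrow> v \<in> carrier_vec m \<Longrightarrow> B (c \<cdot>\<^sub>v u) v = c * B u v"
  unfolding B_def by simp

lemma B_smult_right: "u \<in> carrier_vec m \<Longrightarrow> v \<in> carrier_vec m \<Longrightarrow> B u (c \<cdot>\<^sub>v v) = c * B u v"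
  unfolding B_def mult_mat_vec[OF F_carrier] by simp

lemma B_sym: "u \<in> carrier_vec m \<Longrightarrow> v \<in> carrier_vec m \<Longrightarrow> B u v = B v u"
  unfolding B_def
  using transpose_vec_mult_scalar[OF F_carrier, of v u] comm_scalar_prod[of v m "F *\<^sub>v u"] F_sym by simp

lemma B_act: "g \<in> carrier SL2 \<Longrightarrow> u \<in> carrier_vec m \<Longrightarrow> v \<in> carrier_vec m \<Longrightarrow> B (act g u) (act g v) = B u v"
proof -
  assume g: "g \<in> carrier SL2" and u: "u \<in> carrier_vec m" and v: "v \<in> carrier_vec m"
  note R = \<rho>_carrier[OF g]
  have RT: "(\<rho> g)\<^sup>T \<in> carrier_mat m m" using R by simp
  have RF: "(\<rho> g)\<^sup>T * F \<in> carrier_mat m m" using RT F_carrier by simp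
  have w: "F *\<^sub>v (\<rho> g *\<^sub>v v) \<in> carrier_vec m" using R v by simp
  have "B (act g u) (act g v) = (F *\<^sub>v (\<rho> g *\<^sub>v v)) \<bullet> (\<rho> g *\<^sub>v u)"
    unfolding B_def act_def by (rule comm_scalar_prod[OF _ w]) (use R u in simp)
  also have "\<dots> = ((\<rho> g)\<^sup>T *\<^sub>v (F *\<^sub>v (\<rho> g *\<^sub>v v))) \<bullet> u"
    by (rule transpose_vec_mult_scalar[OF R u w, symmetric])
  also have "(\<rho> g)\<^sup>T *\<^sub>v (F *\<^sub>v (\<rho> g *\<^sub>v v)) = ((\<rho> g)\<^sup>T * F) *\<^sub>v (\<rho> g *\<^sub>v v)"
    by (rule assoc_mult_mat_vec[OF RT F_carrier, symmetric]) (use R v in simp)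
  also have "\<dots> = ((\<rho> g)\<^sup>T * F * \<rho> g) *\<^sub>v v" by (rule assoc_mult_mat_vec[OF RF R v, symmetric])
  also have "\<dots> = F *\<^sub>v v" by (simp only: F_inv[OF g])
  also have "(F *\<^sub>v v) \<bullet> u = B u v" unfolding B_def by (rule comm_scalar_prod[OF _ u]) (use v in simp)
  finally show ?thesis .
qed

text \<open>The radical of the form is a stable complex subspace. It is proper since
  \<open>F\<close> is nonzero, so irreducibility makes it zero.\<close>

lemma F_nondegenerate:
  assumes "v \<in> carrier_vec m" "F *\<^sub>v v = 0\<^sub>v m"
  shows "v = 0\<^sub>v m"
proof -
  let ?U = "{v \<in> carrier_vec m. F *\<^sub>v v = 0\<^sub>v m}"
  have "?U = {0\<^sub>v m} \<or> ?U = carrier_vec m"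
  proof -
    have "F *\<^sub>v (\<rho> g *\<^sub>v u) = 0\<^sub>v m" if g: "g \<in> carrier SL2" and u: "u \<in> carrier_vec m" "F *\<^sub>v u = 0\<^sub>v m" for g u
    proof -
      have i: "inv\<^bsub>SL2\<^esub> g \<in> carrier SL2" using g by simp
      have gi: "inv\<^bsub>SL2\<^esub> g * g = 1\<^sub>m 2" using SL2.l_inv[OF g] by simp
      have zero: "B w (act g u) = 0" if w: "w \<in> carrier_vec m" for w
      proof -
        have "B w (act g u) = B (act (inv\<^bsub>SL2\<^esub> g) w) (act (inv\<^bsub>SL2\<^esub> g) (act g u))"
          by (rule B_act[OF i w, symmetric]) (use g u in auto)
        also have "act (inv\<^bsub>SL2\<^esub> g) (act g u) = u"
          unfolding act_mult[OF i g u(1), symmetric] gi by (rule act_one[OF u(1)])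
        also have "B (act (inv\<^bsub>SL2\<^esub> g) w) u = 0" unfolding B_def u(2) using i w by simp
        finally show ?thesis .
      qed
      show ?thesis
      proof (rule eq_vecI)
        fix r assume "r < dim_vec (0\<^sub>v m :: complex vec)"
        then have r: "r < m" by simp
        have "B (unit_vec m r) (act g u) = (F *\<^sub>v (\<rho> g *\<^sub>v u)) $ r"
          unfolding B_def act_def using r F_carrier by (intro scalar_prod_left_unit) (use \<rho>_carrier[OF g] u in auto)
        then show "(F *\<^sub>v (\<rho> g *\<^sub>v u)) $ r = 0\<^sub>v m $ r" using zero[of "unit_vec m r"] r by simp
      qed (use F_carrier in simp)
    qed
    then show ?thesis
      using irr unfolding absolutely_irreducible_def
      by (elim conjE allE[of _ ?U] impE)
         (auto simp: mult_add_distrib_mat_vec[OF F_carrier] mult_mat_vec[OF F_carrier]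
           intro!: mult_mat_vec_carrier[OF \<rho>_carrier] mult_mat_vec_carrier[OF F_carrier] eq_vecI, use F_carrier in auto)
  qed
  moreover have "?U \<noteq> carrier_vec m"
  proof
    assume *: "?U = carrier_vec m"
    have "F = 0\<^sub>m m m"
    proof (rule eq_matI)
      fix i j assume "i < dim_row (0\<^sub>m m m :: complex mat)" "j < dim_col (0\<^sub>m m m :: complex mat)"
      then have ij: "i < m" "j < m" by auto
      have "unit_vec m j \<in> ?U" unfolding * by simp
      then have z: "vec_index (F *\<^sub>v unit_vec m j) i = 0" using ij by simp
      have "vec_index (F *\<^sub>v unit_vec m j) i = row F i \<bullet> unit_vec m j" using ij F_carrier by simp
      also have "\<dots> = vec_index (row F i) j" using ij F_carrier by (intro scalar_prod_right_unit) auto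
      also have "\<dots> = F $$ (i, j)" using ij F_carrier by simp
      finally show "F $$ (i, j) = 0\<^sub>m m m $$ (i, j)" using z ij by simp
    qed (use F_carrier in auto)
    then show False using F_nonzero by simp
  qed
  ultimately show ?thesis using assms by auto
qed

text \<open>The set \<open>A\<close> parametrises a subgroup with multiplication law
  \<open>\<pi>\<close>, and \<open>\<omega>\<close> is a linear character of it. The weighted sum of
  the \<open>\<rho> (e a)\<close> is a multiple of the projection onto the eigenspace; its trace is
  nonzero, so some column is. That column is kept in explicit form because it shows over which field
  the eigenvector is defined.\<close>

lemma eigenvector_exists:
  fixes A :: "'a set" and e :: "'a \<Rightarrow> 'f mat" and \<omega> :: "'a \<Rightarrow> complex" and \<pi> :: "'a \<Rightarrow> 'a \<Rightarrow> 'a"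
  assumes e: "\<And>a. a \<in> A \<Longrightarrow> e a \<in> carrier SL2" and \<omega>: "\<And>a. a \<in> A \<Longrightarrow> \<omega> a \<noteq> 0"
    and \<pi>: "\<And>s. s \<in> A \<Longrightarrow> bij_betw (\<pi> s) A A" "\<And>s a. s \<in> A \<Longrightarrow> a \<in> A \<Longrightarrow> e s * e a = e (\<pi> s a)"
      "\<And>s a. s \<in> A \<Longrightarrow> a \<in> A \<Longrightarrow> \<omega> (\<pi> s a) = \<omega> s * \<omega> a"
    and nz: "(\<Sum>a\<in>A. inverse (\<omega> a) * \<chi> (e a)) \<noteq> 0"
  shows "\<exists>v\<in>carrier_vec m. v \<noteq> 0\<^sub>v m \<and> (\<forall>s\<in>A. act (e s) v = \<omega> s \<cdot>\<^sub>v v) \<and>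
    (\<exists>k<m. \<forall>r<m. vec_index v r = (\<Sum>a\<in>A. inverse (\<omega> a) * \<rho> (e a) $$ (r, k)))"
proof -
  define P where "P r k = (\<Sum>a\<in>A. inverse (\<omega> a) * \<rho> (e a) $$ (r, k))" for r k
  have "(\<Sum>k<m. P k k) = (\<Sum>a\<in>A. inverse (\<omega> a) * (\<Sum>k<m. \<rho> (e a) $$ (k, k)))"
    unfolding P_def sum_distrib_left by (rule sum.swap)
  also have "\<dots> = (\<Sum>a\<in>A. inverse (\<omega> a) * \<chi> (e a))"
    using aff e unfolding affords_def by (intro sum.cong refl) (metis sum_list_diag_mat \<rho>_carrier)
  finally have "(\<Sum>k<m. P k k) \<noteq> 0" using nz by simp
  then obtain k where k: "k < m" "P k k \<noteq> 0" by (metis (no_types, lifting) lessThan_iff sum.neutral)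
  define v where "v = vec m (\<lambda>r. P r k)"
  have v: "v \<in> carrier_vec m" by (simp add: v_def)
  have vr: "vec_index v r = P r k" if "r < m" for r using that by (simp add: v_def)
  have "v \<noteq> 0\<^sub>v m" using k vr[of k] by auto
  moreover have "act (e s) v = \<omega> s \<cdot>\<^sub>v v" if s: "s \<in> A" for s
  proof (rule eq_vecI)
    note R = \<rho>_carrier[OF e[OF s]]
    fix r assume "r < dim_vec (\<omega> s \<cdot>\<^sub>v v)"
    then have r: "r < m" using v by simp
    have "vec_index (act (e s) v) r = (\<Sum>j<m. \<rho> (e s) $$ (r, j) * P j k)"
      using R r v unfolding act_def by (simp add: scalar_prod_def atLeast0LessThan vr)
    also have "\<dots> = (\<Sum>a\<in>A. inverse (\<omega> a) * (\<Sum>j<m. \<rho> (e s) $$ (r, j) * \<rho> (e a) $$ (j, k)))"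
      unfolding P_def sum_distrib_left by (subst sum.swap) (simp add: mult_ac)
    also have "\<dots> = (\<Sum>a\<in>A. \<omega> s * (inverse (\<omega> (\<pi> s a)) * \<rho> (e (\<pi> s a)) $$ (r, k)))"
    proof (rule sum.cong[OF refl])
      fix a assume a: "a \<in> A"
      have "(\<Sum>j<m. \<rho> (e s) $$ (r, j) * \<rho> (e a) $$ (j, k)) = (\<rho> (e s) * \<rho> (e a)) $$ (r, k)"
        by (rule mult_mat_entry[OF R \<rho>_carrier[OF e[OF a]] r k(1), symmetric])
      also have "\<dots> = \<rho> (e (\<pi> s a)) $$ (r, k)" using \<rho>_mult[OF e[OF s] e[OF a]] \<pi>(2)[OF s a] by simp
      finally show "inverse (\<omega> a) * (\<Sum>j<m. \<rho> (e s) $$ (r, j) * \<rho> (e a) $$ (j, k)) =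
          \<omega> s * (inverse (\<omega> (\<pi> s a)) * \<rho> (e (\<pi> s a)) $$ (r, k))"
        using \<omega>[OF s] by (simp add: \<pi>(3)[OF s a])
    qed
    also have "\<dots> = (\<Sum>a\<in>A. \<omega> s * (inverse (\<omega> a) * \<rho> (e a) $$ (r, k)))"
      by (rule sum.reindex_bij_betw[OF \<pi>(1)[OF s]])
    also have "\<dots> = vec_index (\<omega> s \<cdot>\<^sub>v v) r" using r v by (simp add: vr P_def sum_distrib_left)
    finally show "vec_index (act (e s) v) r = vec_index (\<omega> s \<cdot>\<^sub>v v) r" .
  next
    show "dim_vec (act (e s) v) = dim_vec (\<omega> s \<cdot>\<^sub>v v)" using \<rho>_carrier[OF e[OF s]] v by (simp add: act_def)
  qed
  ultimately show ?thesis using v vr k(1) unfolding P_def by blast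
qed

end

section \<open>A sign character of the additive group, and matrix identities\<close>

context sl2_even
begin

text \<open>A subgroup \<open>H\<close> of maximal size among those avoiding 1 has index 2:
  adjoining any \<open>x\<close> outside \<open>H\<close> must bring in 1, so \<open>x + 1\<close>
  lies in \<open>H\<close>. The character is 1 on \<open>H\<close> and -1 outside.\<close>

lemma exists_additive_character:
  "\<exists>\<mu> :: 'f \<Rightarrow> complex. (\<forall>s t. \<mu> (s + t) = \<mu> s * \<mu> t) \<and> (\<forall>t. \<mu> t = 1 \<or> \<mu> t = - 1) \<and> \<mu> 1 = - 1"
proof -
  define \<S> where "\<S> = {H :: 'f set. 0 \<in> H \<and> (\<forall>x\<in>H. \<forall>y\<in>H. x + y \<in> H) \<and> 1 \<notin> H}"
  have "{0} \<in> \<S>" by (simp add: \<S>_def)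
  then have "card ` \<S> \<noteq> {}" by blast
  then have "Max (card ` \<S>) \<in> card ` \<S>" by (intro Max_in) auto
  then obtain H where H: "H \<in> \<S>" "card H = Max (card ` \<S>)" by auto
  have max: "card H' \<le> card H" if "H' \<in> \<S>" for H' unfolding H(2) using that by (intro Max_ge) auto
  have H0: "0 \<in> H" and Hadd: "\<And>x y. x \<in> H \<Longrightarrow> y \<in> H \<Longrightarrow> x + y \<in> H" and H1: "1 \<notin> H"
    using H(1) by (auto simp: \<S>_def)
  have shift: "x + 1 \<in> H" if x: "x \<notin> H" for x
  proof -
    let ?H' = "H \<union> (\<lambda>h. h + x) ` H"
    have "x \<in> ?H'" using H0 by (auto intro: image_eqI[of _ _ 0])
    then have "card H < card ?H'" using x by (intro psubset_card_mono) auto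
    then have "?H' \<notin> \<S>" using max[of ?H'] by linarith
    moreover have "0 \<in> ?H'" using H0 by simp
    moreover have "u + v \<in> ?H'" if uv: "u \<in> ?H'" "v \<in> ?H'" for u v
    proof -
      have *: "(h + x) + (h' + x) = h + h'" "h + (h' + x) = (h + h') + x" "(h + x) + h' = (h + h') + x" for h h'
        by (simp_all add: algebra_simps)
      obtain h where h: "h \<in> H" "u = h \<or> u = h + x" using uv(1) by auto
      obtain h' where h': "h' \<in> H" "v = h' \<or> v = h' + x" using uv(2) by auto
      have "u + v = h + h' \<or> u + v = (h + h') + x" using h(2) h'(2) *[of h h'] by metis
      moreover have "(h + h') + x \<in> (\<lambda>h. h + x) ` H" by (rule imageI) (rule Hadd[OF h(1) h'(1)])
      ultimately show ?thesis using Hadd[OF h(1) h'(1)] by (elim disjE) (simp_all only: Un_iff simp_thms)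
    qed
    ultimately have "1 \<in> ?H'" unfolding \<S>_def mem_Collect_eq by blast
    then obtain h where "h \<in> H" "1 = h + x" using H1 by auto
    then have "x + 1 = h" by (metis add.commute char2_left)
    then show ?thesis using \<open>h \<in> H\<close> by simp
  qed
  define \<mu> :: "'f \<Rightarrow> complex" where "\<mu> x = (if x \<in> H then 1 else - 1)" for x
  have mem: "x + y \<in> H \<longleftrightarrow> (x \<in> H \<longleftrightarrow> y \<in> H)" for x y
  proof (cases "x \<in> H"; cases "y \<in> H")
    assume "x \<in> H" "y \<notin> H"
    moreover have "y \<in> H" if "x + y \<in> H" using Hadd[OF \<open>x \<in> H\<close> that] by simp
    ultimately show ?thesis by blast
  next
    assume "x \<notin> H" "y \<in> H"
    moreover have "x \<in> H" if "x + y \<in> H" using Hadd[OF \<open>y \<in> H\<close> that] by (simp add: add.left_commute)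
    ultimately show ?thesis by blast
  next
    assume xy: "x \<notin> H" "y \<notin> H"
    have "(x + 1) + (y + 1) \<in> H" by (intro Hadd shift xy)
    moreover have "(x + 1) + (y + 1) = x + y" by (simp add: algebra_simps)
    ultimately show ?thesis using xy by simp
  qed (use Hadd in auto)
  have "\<mu> (s + t) = \<mu> s * \<mu> t" for s t by (auto simp: \<mu>_def mem)
  moreover have "\<mu> t = 1 \<or> \<mu> t = - 1" for t by (auto simp: \<mu>_def)
  moreover have "\<mu> 1 = - 1" using H1 by (simp add: \<mu>_def)
  ultimately show ?thesis by blast
qed

definition \<mu> :: "'f \<Rightarrow> complex" where
  "\<mu> = (SOME \<mu>. (\<forall>s t. \<mu> (s + t) = \<mu> s * \<mu> t) \<and> (\<forall>t. \<mu> t = 1 \<or> \<mu> t = - 1) \<and> \<mu> 1 = - 1)"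

lemma \<mu>_add: "\<mu> (s + t) = \<mu> s * \<mu> t" and \<mu>_cases: "\<mu> t = 1 \<or> \<mu> t = - 1" and \<mu>_1: "\<mu> 1 = - 1"
  using someI_ex[OF exists_additive_character] unfolding \<mu>_def by blast+

lemma \<mu>_0: "\<mu> 0 = 1"
  using \<mu>_add[of 0 0] \<mu>_cases[of 0] by auto

lemma \<mu>_inverse: "inverse (\<mu> t) = \<mu> t"
  using \<mu>_cases[of t] by auto

lemma sum_\<mu>: "(\<Sum>t\<in>UNIV. \<mu> (c * t)) = (if c = 0 then of_nat q else 0)"
proof (cases "c = 0")
  case True then show ?thesis using card by (simp add: \<mu>_0)
next
  case False
  have bij: "bij (\<lambda>t. inverse c + t)" by (rule bij_betw_byWitness[where f' = "\<lambda>t. inverse c + t"]) auto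
  have "(\<Sum>t\<in>UNIV. \<mu> (c * t)) = (\<Sum>t\<in>UNIV. \<mu> (c * (inverse c + t)))"
    by (rule sum.reindex_bij_betw[OF bij, symmetric])
  also have "\<dots> = - (\<Sum>t\<in>UNIV. \<mu> (c * t))"
    using False by (simp add: distrib_left \<mu>_add \<mu>_1 sum_negf)
  finally show ?thesis using False by simp
qed

lemma Um_mult: "Um s * Um t = Um (s + t)" and Dm_mult: "Dm x * Dm y = Dm (x * y)"
  and Um_0: "Um 0 = 1\<^sub>m 2" and Dm_1: "Dm 1 = 1\<^sub>m 2"
  for s t x y :: "'a::field"
  by (simp_all add: Um_def Dm_def m2_one)

lemma Um_Dm: "x \<noteq> 0 \<Longrightarrow> Um t * Dm x = Dm x * Um (x * x * t)" for x t :: "'a::field"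
  by (simp add: Um_def Dm_def)

lemma wm_Dm: "x \<noteq> 0 \<Longrightarrow> Dm x * wm = wm * Dm (inverse x)" for x :: "'a::field"
  by (simp add: wm_def Dm_def)

lemma wm_wm: "wm * wm = (1\<^sub>m 2 :: 'a::field mat)"
  by (simp add: wm_def m2_one)

lemma bruhat: "t \<noteq> 0 \<Longrightarrow> wm * Um t * wm = Um (inverse t) * Dm t * wm * Um (inverse t)" for t :: 'f
  by (simp add: wm_def Um_def Dm_def)

end

section \<open>The torus orbit of an eigenvector of the unipotent subgroup\<close>

context sl2_rep
begin

lemma mat_vec_entry: "A \<in> carrier_mat m m \<Longrightarrow> x \<in> carrier_vec m \<Longrightarrow> r < m \<Longrightarrow>
    vec_index (A *\<^sub>v x) r = (\<Sum>j<m. A $$ (r, j) * vec_index x j)"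
  by (simp add: scalar_prod_def atLeast0LessThan)

text \<open>The trace of the weighted sum is \<open>v1 - vc\<close>, hence \<open>q\<close>. Its
  weights are signs, so the column obtained has entries in \<open>K\<close>.\<close>

lemma exists_e0:
  "\<exists>v\<in>carrier_vec m. v \<noteq> 0\<^sub>v m \<and> (\<forall>s. act (Um s) v = \<mu> s \<cdot>\<^sub>v v) \<and> (\<forall>r<m. vec_index v r \<in> K)"
proof -
  have bij: "bij (\<lambda>t :: 'f. s + t)" for s by (rule bij_betw_byWitness[where f' = "\<lambda>t. s + t"]) auto
  have "(\<Sum>t\<in>UNIV. inverse (\<mu> t) * \<chi> (Um t)) = v1 - vc"
  proof -
    have "(\<Sum>t\<in>UNIV. inverse (\<mu> t) * \<chi> (Um t)) = v1 + (\<Sum>t\<in>UNIV - {0}. \<mu> t * vc)"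
      using class_function_values(1,2)[OF cf] by (subst sum.remove[of UNIV 0]) (auto simp: \<mu>_inverse \<mu>_0 Um_0)
    also have "(\<Sum>t\<in>UNIV - {0}. \<mu> t * vc) = (\<Sum>t\<in>UNIV - {0}. \<mu> t) * vc" by (simp add: sum_distrib_right)
    also have "(\<Sum>t\<in>UNIV - {0}. \<mu> t) = - 1"
      using sum_\<mu>[of 1] by (subst (asm) sum.remove[of UNIV 0]) (auto simp: \<mu>_0 add_eq_0_iff)
    finally show ?thesis by simp
  qed
  then have nz: "(\<Sum>t\<in>UNIV. inverse (\<mu> t) * \<chi> (Um t)) \<noteq> 0" using v1_vc q_ge by simp
  have "\<exists>v\<in>carrier_vec m. v \<noteq> 0\<^sub>v m \<and> (\<forall>s\<in>UNIV. act (Um s) v = \<mu> s \<cdot>\<^sub>v v) \<and>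
    (\<exists>k<m. \<forall>r<m. vec_index v r = (\<Sum>a\<in>UNIV. inverse (\<mu> a) * \<rho> (Um a) $$ (r, k)))"
  proof (rule eigenvector_exists[where \<pi> = "\<lambda>s t. s + t"])
    show "\<mu> a \<noteq> 0" for a using \<mu>_cases[of a] by auto
  qed (use bij nz in \<open>auto simp: Um_mult \<mu>_add\<close>)
  then obtain v k where v: "v \<in> carrier_vec m" "v \<noteq> 0\<^sub>v m" "\<forall>s\<in>UNIV. act (Um s) v = \<mu> s \<cdot>\<^sub>v v"
    "k < m" "\<forall>r<m. vec_index v r = (\<Sum>a\<in>UNIV. inverse (\<mu> a) * \<rho> (Um a) $$ (r, k))" by blast
  have "\<mu> a \<in> K" for a using \<mu>_cases[of a] by auto
  then have "\<forall>r<m. vec_index v r \<in> K" using v(4,5) by (auto intro!: sum_mem mult_mem \<rho>_K)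
  then show ?thesis using v by auto
qed

definition e0 :: "complex vec" where
  "e0 = (SOME v. v \<in> carrier_vec m \<and> v \<noteq> 0\<^sub>v m \<and> (\<forall>s. act (Um s) v = \<mu> s \<cdot>\<^sub>v v) \<and> (\<forall>r<m. vec_index v r \<in> K))"

lemma e0: "e0 \<in> carrier_vec m" "e0 \<noteq> 0\<^sub>v m" "act (Um s) e0 = \<mu> s \<cdot>\<^sub>v e0" "r < m \<Longrightarrow> vec_index e0 r \<in> K"
proof -
  have "\<exists>v. v \<in> carrier_vec m \<and> v \<noteq> 0\<^sub>v m \<and> (\<forall>s. act (Um s) v = \<mu> s \<cdot>\<^sub>v v) \<and> (\<forall>r<m. vec_index v r \<in> K)"
    using exists_e0 by blast
  from someI_ex[OF this] show "e0 \<in> carrier_vec m" "e0 \<noteq> 0\<^sub>v m" "act (Um s) e0 = \<mu> s \<cdot>\<^sub>v e0" "r < m \<Longrightarrow> vec_index e0 r \<in> K"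
    unfolding e0_def by blast+
qed

definition e :: "nat \<Rightarrow> complex vec" where
  "e l = act (Dm (\<nu> ^ l)) e0"

definition \<kappa> :: "nat \<Rightarrow> 'f" where
  "\<kappa> l = \<nu> ^ l * \<nu> ^ l"

lemma \<nu>_pow_nonzero [simp]: "\<nu> ^ l \<noteq> 0"
  by simp

lemma \<kappa>_nonzero: "\<kappa> l \<noteq> 0"
  by (simp add: \<kappa>_def)

text \<open>The torus acts on the unipotent parameter through squares, and squaring is injective in
  characteristic 2. Hence the translates \<open>e l\<close> belong to \<open>q - 1\<close> different
  characters.\<close>

lemma \<kappa>_inj: "l < q - 1 \<Longrightarrow> l' < q - 1 \<Longrightarrow> \<kappa> l = \<kappa> l' \<Longrightarrow> l = l'"
  unfolding \<kappa>_def by (rule inj_onD[OF \<nu>_order(2)]) (auto intro: square_inj)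

lemma e_carrier [simp, intro]: "e l \<in> carrier_vec m"
  unfolding e_def by (intro act_carrier e0 Dm_SL2) simp

lemma e_0: "e 0 = e0"
  unfolding e_def using act_one[OF e0(1)] by (simp add: Dm_1)

lemma act_Um_e: "act (Um t) (e l) = \<mu> (\<kappa> l * t) \<cdot>\<^sub>v e l"
proof -
  have "act (Um t) (e l) = act (Um t * Dm (\<nu> ^ l)) e0" unfolding e_def by (rule act_mult[symmetric]) (auto intro: e0)
  also have "Um t * Dm (\<nu> ^ l) = Dm (\<nu> ^ l) * Um (\<kappa> l * t)" unfolding \<kappa>_def by (rule Um_Dm) simp
  also have "act \<dots> e0 = act (Dm (\<nu> ^ l)) (act (Um (\<kappa> l * t)) e0)" by (rule act_mult) (auto intro: e0)
  also have "\<dots> = \<mu> (\<kappa> l * t) \<cdot>\<^sub>v e l" unfolding e0(3) e_def by (rule act_smult) (auto intro: e0)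
  finally show ?thesis .
qed

lemma e_K: "r < m \<Longrightarrow> vec_index (e l) r \<in> K"
proof -
  assume r: "r < m"
  have R: "\<rho> (Dm (\<nu> ^ l)) \<in> carrier_mat m m" by (rule \<rho>_carrier) simp
  have "vec_index (e l) r = (\<Sum>j<m. \<rho> (Dm (\<nu> ^ l)) $$ (r, j) * vec_index e0 j)"
    unfolding e_def act_def using R r e0(1) by (simp add: scalar_prod_def atLeast0LessThan)
  also have "\<dots> \<in> K" using r by (intro sum_mem mult_mem \<rho>_K e0(4)) auto
  finally show ?thesis .
qed

lemma B_smult2: "u \<in> carrier_vec m \<Longrightarrow> v \<in> carrier_vec m \<Longrightarrow> B (x \<cdot>\<^sub>v u) (y \<cdot>\<^sub>v v) = x * y * B u v"
  by (simp add: B_smult_left B_smult_right)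

lemma B_zero_of_sign:
  assumes "g \<in> carrier SL2" "u \<in> carrier_vec m" "v \<in> carrier_vec m"
    "act g u = x \<cdot>\<^sub>v u" "act g v = y \<cdot>\<^sub>v v" "x * y \<noteq> 1"
  shows "B u v = 0"
proof -
  have "B u v = x * y * B u v" using B_act[OF assms(1-3)] B_smult2[OF assms(2,3)] unfolding assms(4,5) by simp
  then show ?thesis using assms(6) by simp
qed

definition a :: complex where "a = B e0 e0"

lemma B_e_same: "B (e l) (e l) = a"
  unfolding a_def e_def by (rule B_act) (auto intro: e0)

lemma B_e_diff:
  assumes "l < q - 1" "l' < q - 1" "l \<noteq> l'"
  shows "B (e l) (e l') = 0"
proof -
  let ?c = "\<kappa> l + \<kappa> l'"
  have c: "?c \<noteq> 0" using \<kappa>_inj[OF assms(1,2)] assms(3) by (auto simp: add_eq_0_char2)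
  \<comment> \<open>The product of the two characters is \<open>\<mu>\<close> scaled by
    \<open>?c\<close>. At \<open>inverse ?c\<close> it takes the value \<open>\<mu> 1 = - 1\<close>,
    and invariance of the form makes the pairing vanish.\<close>
  have "\<mu> (\<kappa> l * inverse ?c) * \<mu> (\<kappa> l' * inverse ?c) = \<mu> (?c * inverse ?c)"
    by (simp only: \<mu>_add[symmetric] distrib_right)
  also have "\<dots> = - 1" using c by (simp add: \<mu>_1)
  finally show ?thesis by (intro B_zero_of_sign[OF _ _ _ act_Um_e[of "inverse ?c"] act_Um_e[of "inverse ?c"]]) auto
qed

definition fixU :: "complex vec \<Rightarrow> bool" where
  "fixU f \<longleftrightarrow> f \<in> carrier_vec m \<and> (\<forall>t. act (Um t) f = f)"

lemma B_fixU_e: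
  assumes "fixU f"
  shows "B f (e l) = 0"
proof -
  have f: "f \<in> carrier_vec m" "act (Um t) f = 1 \<cdot>\<^sub>v f" for t using assms by (auto simp: fixU_def)
  show ?thesis
    by (rule B_zero_of_sign[OF _ f(1) _ f(2)[of "inverse (\<kappa> l)"] act_Um_e]) (auto simp: \<kappa>_nonzero \<mu>_1)
qed

section \<open>Completing the orbit to a basis by vectors fixed by the unipotent subgroup\<close>

context
  fixes d :: nat and fs :: "nat \<Rightarrow> complex vec"
  assumes fs: "\<And>j. j < d \<Longrightarrow> fixU (fs j)" and md: "m = d + (q - 1)"
begin

definition bs :: "nat \<Rightarrow> complex vec" where
  "bs j = (if j < d then fs j else e (j - d))"

definition Sm :: "complex mat" where
  "Sm = mat m m (\<lambda>(r, j). vec_index (bs j) r)"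

definition \<omega> :: "nat \<Rightarrow> 'f \<Rightarrow> complex" where
  "\<omega> j t = (if j < d then 1 else \<mu> (\<kappa> (j - d) * t))"

lemma bs_carrier [simp, intro]: "bs j \<in> carrier_vec m"
  using fs by (auto simp: bs_def fixU_def)

lemma dim_bs [simp]: "dim_vec (bs j) = m" using carrier_vecD[OF bs_carrier[of j]] .

lemma Sm_carrier: "Sm \<in> carrier_mat m m" by (simp add: Sm_def)

lemma col_Sm: "j < m \<Longrightarrow> col Sm j = bs j"
proof (rule eq_vecI)
  assume j: "j < m"
  show "dim_vec (col Sm j) = dim_vec (bs j)" by (simp add: Sm_def)
  fix r assume "r < dim_vec (bs j)"
  then have "r < m" by simp
  then show "vec_index (col Sm j) r = vec_index (bs j) r" using j by (simp add: Sm_def)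
qed

lemma act_Um_bs: "act (Um t) (bs j) = \<omega> j t \<cdot>\<^sub>v bs j"
proof (cases "j < d")
  case True
  then show ?thesis using fs by (simp add: bs_def \<omega>_def fixU_def)
next
  case False
  then show ?thesis by (simp add: bs_def \<omega>_def act_Um_e)
qed

lemma Gram: "i < m \<Longrightarrow> j < m \<Longrightarrow> (Sm\<^sup>T * F * Sm) $$ (i, j) = B (bs i) (bs j)"
proof -
  assume ij: "i < m" "j < m"
  have ST: "Sm\<^sup>T \<in> carrier_mat m m" using Sm_carrier by simp
  have "Sm\<^sup>T * F * Sm = Sm\<^sup>T * (F * Sm)" by (rule assoc_mult_mat[OF ST F_carrier Sm_carrier])
  then have "(Sm\<^sup>T * F * Sm) $$ (i, j) = row (Sm\<^sup>T) i \<bullet> col (F * Sm) j" using ij Sm_carrier F_carrier by simp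
  also have "row (Sm\<^sup>T) i = bs i" using ij Sm_carrier col_Sm by simp
  also have "col (F * Sm) j = F *\<^sub>v bs j"
    unfolding col_Sm[OF ij(2), symmetric] by (rule col_mult2[OF F_carrier Sm_carrier ij(2)])
  finally show ?thesis by (simp add: B_def)
qed

lemma Sm_entry: "x \<in> carrier_vec m \<Longrightarrow> r < m \<Longrightarrow> vec_index (Sm *\<^sub>v x) r = (\<Sum>j<m. vec_index x j * vec_index (bs j) r)"
  by (simp add: Sm_def scalar_prod_def atLeast0LessThan mult.commute)

lemma act_Um_Sm:
  assumes x: "x \<in> carrier_vec m"
  shows "act (Um t) (Sm *\<^sub>v x) = Sm *\<^sub>v vec m (\<lambda>j. \<omega> j t * vec_index x j)"
proof -
  have R: "\<rho> (Um t) \<in> carrier_mat m m" by (rule \<rho>_carrier) simp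
  have RS: "\<rho> (Um t) * Sm \<in> carrier_mat m m" using R Sm_carrier by simp
  have x': "vec m (\<lambda>j. \<omega> j t * vec_index x j) \<in> carrier_vec m" by simp
  show ?thesis
  proof (rule eq_vecI)
    fix r assume "r < dim_vec (Sm *\<^sub>v vec m (\<lambda>j. \<omega> j t * vec_index x j))"
    then have r: "r < m" using Sm_carrier by simp
    have "act (Um t) (Sm *\<^sub>v x) = (\<rho> (Um t) * Sm) *\<^sub>v x"
      unfolding act_def by (rule assoc_mult_mat_vec[OF R Sm_carrier x, symmetric])
    then have "vec_index (act (Um t) (Sm *\<^sub>v x)) r = (\<Sum>j<m. (\<rho> (Um t) * Sm) $$ (r, j) * vec_index x j)"
      using mat_vec_entry[OF RS x r] by simp
    also have "\<dots> = (\<Sum>j<m. (\<omega> j t * vec_index x j) * vec_index (bs j) r)"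
    proof (rule sum.cong[OF refl])
      fix j assume "j \<in> {..<m}"
      then have j: "j < m" by simp
      have "col (\<rho> (Um t) * Sm) j = act (Um t) (bs j)"
        unfolding act_def col_Sm[OF j, symmetric] by (rule col_mult2[OF R Sm_carrier j])
      then have "vec_index (col (\<rho> (Um t) * Sm) j) r = \<omega> j t * vec_index (bs j) r"
        unfolding act_Um_bs using r carrier_vecD[OF bs_carrier[of j]] by simp
      moreover have "vec_index (col (\<rho> (Um t) * Sm) j) r = (\<rho> (Um t) * Sm) $$ (r, j)"
        using r j RS by (intro index_col) auto
      ultimately show "(\<rho> (Um t) * Sm) $$ (r, j) * vec_index x j = (\<omega> j t * vec_index x j) * vec_index (bs j) r"
        by (simp only: mult_ac)
    qed
    also have "\<dots> = vec_index (Sm *\<^sub>v vec m (\<lambda>j. \<omega> j t * vec_index x j)) r"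
      unfolding Sm_entry[OF x' r] by (intro sum.cong refl) simp
    finally show "vec_index (act (Um t) (Sm *\<^sub>v x)) r = vec_index (Sm *\<^sub>v vec m (\<lambda>j. \<omega> j t * vec_index x j)) r" .
  qed (use R Sm_carrier in \<open>simp add: act_def\<close>)
qed

lemma sum_\<omega>: "k < m \<Longrightarrow> \<not> k < d \<Longrightarrow> j < m \<Longrightarrow> (\<Sum>t\<in>UNIV. \<omega> j t * \<mu> (\<kappa> (k - d) * t)) = (if j = k then of_nat q else 0)"
proof (cases "j < d")
  case True
  assume "\<not> k < d"
  then show ?thesis using True sum_\<mu>[of "\<kappa> (k - d)"] by (auto simp: \<omega>_def \<kappa>_nonzero)
next
  case False
  assume k: "k < m" "\<not> k < d" and j: "j < m"
  have "(\<Sum>t\<in>UNIV. \<omega> j t * \<mu> (\<kappa> (k - d) * t)) = (\<Sum>t\<in>UNIV. \<mu> ((\<kappa> (j - d) + \<kappa> (k - d)) * t))"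
    using False by (simp add: \<omega>_def \<mu>_add[symmetric] distrib_right)
  moreover have "\<kappa> (j - d) + \<kappa> (k - d) = 0 \<longleftrightarrow> j = k"
  proof -
    have "j - d < q - 1" "k - d < q - 1" using k j False md by linarith+
    then have "\<kappa> (j - d) = \<kappa> (k - d) \<Longrightarrow> j - d = k - d" by (rule \<kappa>_inj)
    then show ?thesis using k(2) False by (auto simp: add_eq_0_char2)
  qed
  ultimately show ?thesis by (simp add: sum_\<mu>)
qed

lemma e_nonzero: "e l \<noteq> 0\<^sub>v m"
proof
  assume *: "e l = 0\<^sub>v m"
  let ?x = "\<nu> ^ l"
  have "act (Dm (inverse ?x)) (e l) = act (Dm (inverse ?x) * Dm ?x) e0"
    unfolding e_def by (rule act_mult[symmetric]) (auto intro: e0)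
  also have "Dm (inverse ?x) * Dm ?x = 1\<^sub>m 2" unfolding Dm_mult by (simp add: Dm_1)
  also have "act (1\<^sub>m 2) e0 = e0" by (rule act_one[OF e0(1)])
  finally have "e0 = act (Dm (inverse ?x)) (0\<^sub>v m)" unfolding * by (rule sym)
  also have "0\<^sub>v m = 0 \<cdot>\<^sub>v (0\<^sub>v m :: complex vec)" by (intro eq_vecI) auto
  also have "act (Dm (inverse ?x)) \<dots> = 0 \<cdot>\<^sub>v act (Dm (inverse ?x)) (0\<^sub>v m)" by (rule act_smult) auto
  also have "\<dots> = 0\<^sub>v m" by (intro eq_vecI) (use \<rho>_carrier[of "Dm (inverse ?x)"] in \<open>auto simp: act_def\<close>)
  finally show False using e0(2) by simp
qed

text \<open>Averaging a linear relation against the character of \<open>e (k - d)\<close> isolates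
  one coefficient, because the other characters are orthogonal to it. What remains of linear
  independence concerns the fixed vectors only.\<close>

lemma coefficients_zero:
  assumes x: "x \<in> carrier_vec m" and zero: "Sm *\<^sub>v x = 0\<^sub>v m" and k: "k < m" "\<not> k < d"
  shows "vec_index x k = 0"
proof (rule ccontr)
  assume nz: "vec_index x k \<noteq> 0"
  have az: "act (Um t) (0\<^sub>v m) = 0\<^sub>v m" for t
    using act_smult[of "Um t" "0\<^sub>v m" 0] \<rho>_carrier[of "Um t"] by (auto simp: act_def intro!: eq_vecI)
  have "vec_index (e (k - d)) r = 0" if r: "r < m" for r
  proof -
    have t: "(\<Sum>j<m. \<omega> j t * vec_index x j * vec_index (bs j) r) = 0" for t
    proof -
      have "vec_index (Sm *\<^sub>v vec m (\<lambda>j. \<omega> j t * vec_index x j)) r = 0"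
        using act_Um_Sm[OF x, of t] r unfolding zero az by (metis index_zero_vec(1))
      then show ?thesis using r by (subst (asm) Sm_entry) auto
    qed
    have "0 = (\<Sum>t\<in>UNIV. \<mu> (\<kappa> (k - d) * t) * (\<Sum>j<m. \<omega> j t * vec_index x j * vec_index (bs j) r))"
      by (simp add: t)
    also have "\<dots> = (\<Sum>j<m. (\<Sum>t\<in>UNIV. \<omega> j t * \<mu> (\<kappa> (k - d) * t)) * (vec_index x j * vec_index (bs j) r))"
      unfolding sum_distrib_left sum_distrib_right by (subst sum.swap) (simp add: mult_ac)
    also have "\<dots> = (\<Sum>j<m. if j = k then of_nat q * (vec_index x j * vec_index (bs j) r) else 0)"
      by (intro sum.cong refl) (simp add: sum_\<omega>[OF k])
    also have "\<dots> = of_nat q * (vec_index x k * vec_index (bs k) r)" using k by simp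
    finally show ?thesis using nz q_ge k by (simp add: bs_def)
  qed
  then have "e (k - d) = 0\<^sub>v m" using carrier_vecD[OF e_carrier[of "k - d"]] by (intro eq_vecI) auto
  then show False using e_nonzero by simp
qed

lemma B_Sm: "x \<in> carrier_vec m \<Longrightarrow> v \<in> carrier_vec m \<Longrightarrow> B (Sm *\<^sub>v x) v = (\<Sum>j<m. vec_index x j * B (bs j) v)"
proof -
  assume x: "x \<in> carrier_vec m" and v: "v \<in> carrier_vec m"
  have Fv: "F *\<^sub>v v \<in> carrier_vec m" using v by simp
  have "B (Sm *\<^sub>v x) v = (F *\<^sub>v v) \<bullet> (Sm *\<^sub>v x)"
    unfolding B_def by (rule comm_scalar_prod[OF _ Fv]) (use Sm_carrier x in simp)
  also have "\<dots> = (Sm\<^sup>T *\<^sub>v (F *\<^sub>v v)) \<bullet> x" by (rule transpose_vec_mult_scalar[OF Sm_carrier x Fv, symmetric])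
  also have "\<dots> = (\<Sum>j<m. vec_index (Sm\<^sup>T *\<^sub>v (F *\<^sub>v v)) j * vec_index x j)"
    using x by (simp add: scalar_prod_def atLeast0LessThan)
  also have "\<dots> = (\<Sum>j<m. vec_index x j * B (bs j) v)"
  proof (rule sum.cong[OF refl])
    fix j assume "j \<in> {..<m}"
    then have j: "j < m" by simp
    have "vec_index (Sm\<^sup>T *\<^sub>v (F *\<^sub>v v)) j = row (Sm\<^sup>T) j \<bullet> (F *\<^sub>v v)" using j Sm_carrier by simp
    also have "row (Sm\<^sup>T) j = bs j" using j Sm_carrier col_Sm by simp
    finally show "vec_index (Sm\<^sup>T *\<^sub>v (F *\<^sub>v v)) j * vec_index x j = vec_index x j * B (bs j) v" by (simp add: B_def)
  qed
  finally show ?thesis .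
qed

text \<open>Nontrivial characters sum to zero, so summation over the unipotent subgroup is
  \<open>q\<close> times the projection onto the fixed vectors along the \<open>e l\<close>.\<close>

lemma sum_Um_Sm:
  assumes x: "x \<in> carrier_vec m" and v: "v \<in> carrier_vec m"
  shows "(\<Sum>t\<in>UNIV. B (act (Um t) (Sm *\<^sub>v x)) v) = of_nat q * (\<Sum>j<d. vec_index x j * B (bs j) v)"
proof -
  have "(\<Sum>t\<in>UNIV. B (act (Um t) (Sm *\<^sub>v x)) v) = (\<Sum>t\<in>UNIV. \<Sum>j<m. \<omega> j t * vec_index x j * B (bs j) v)"
    unfolding act_Um_Sm[OF x] by (intro sum.cong refl) (subst B_Sm, use v in auto)
  also have "\<dots> = (\<Sum>j<m. (\<Sum>t\<in>UNIV. \<omega> j t) * (vec_index x j * B (bs j) v))"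
    by (subst sum.swap) (simp add: sum_distrib_right mult.assoc)
  also have "\<dots> = (\<Sum>j<m. if j < d then of_nat q * (vec_index x j * B (bs j) v) else 0)"
  proof (rule sum.cong[OF refl])
    fix j
    show "(\<Sum>t\<in>UNIV. \<omega> j t) * (vec_index x j * B (bs j) v) = (if j < d then of_nat q * (vec_index x j * B (bs j) v) else 0)"
      using sum_\<mu>[of "\<kappa> (j - d)"] card by (simp add: \<omega>_def \<kappa>_nonzero)
  qed
  also have "\<dots> = (\<Sum>j\<in>{..<m} \<inter> {j. j < d}. of_nat q * (vec_index x j * B (bs j) v))"
    using sum.inter_restrict[of "{..<m}" "\<lambda>j. of_nat q * (vec_index x j * B (bs j) v)" "{j. j < d}"] by simp
  also have "{..<m} \<inter> {j. j < d} = {..<d}" using md by auto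
  finally show ?thesis by (simp add: sum_distrib_left)
qed

text \<open>Independence is left open here, since for the fixed vectors its reason depends on the
  family of characters.\<close>

context
  assumes indep: "\<And>x. x \<in> carrier_vec m \<Longrightarrow> Sm *\<^sub>v x = 0\<^sub>v m \<Longrightarrow> x = 0\<^sub>v m"
begin

lemma det_Sm: "det Sm \<noteq> 0"
  using det_0_iff_vec_prod_zero_field[OF Sm_carrier] indep by blast

lemma expand: "u \<in> carrier_vec m \<Longrightarrow> \<exists>x\<in>carrier_vec m. u = Sm *\<^sub>v x"
proof -
  assume u: "u \<in> carrier_vec m"
  from det_non_zero_imp_unit[OF Sm_carrier det_Sm, of "()"]
  obtain T where T: "T \<in> carrier_mat m m" "Sm * T = 1\<^sub>m m" by (auto simp: Units_def ring_mat_def)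
  have "Sm *\<^sub>v (T *\<^sub>v u) = u"
    using assoc_mult_mat_vec[OF Sm_carrier T(1) u] T(2) u by simp
  then show ?thesis using T(1) u by (intro bexI[of _ "T *\<^sub>v u"]) auto
qed

lemma B_nondegenerate:
  assumes u: "u \<in> carrier_vec m" and zero: "\<And>j. j < m \<Longrightarrow> B (bs j) u = 0"
  shows "u = 0\<^sub>v m"
proof -
  have all: "B v u = 0" if v: "v \<in> carrier_vec m" for v
  proof -
    obtain x where x: "x \<in> carrier_vec m" "v = Sm *\<^sub>v x" using expand[OF v] by blast
    show ?thesis unfolding x(2) B_Sm[OF x(1) u] using zero by simp
  qed
  have "F *\<^sub>v u = 0\<^sub>v m"
  proof (rule eq_vecI)
    fix r assume "r < dim_vec (0\<^sub>v m :: complex vec)"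
    then have r: "r < m" by simp
    have "B (unit_vec m r) u = vec_index (F *\<^sub>v u) r"
      unfolding B_def using r u by (intro scalar_prod_left_unit) auto
    then show "vec_index (F *\<^sub>v u) r = vec_index (0\<^sub>v m) r" using all[of "unit_vec m r"] r by simp
  qed (use F_carrier in simp)
  then show ?thesis by (rule F_nondegenerate[OF u])
qed

text \<open>If \<open>a\<close> vanished, \<open>e 0\<close> would be orthogonal to the whole basis,
  against nondegeneracy of the form.\<close>

lemma a_nonzero: "a \<noteq> 0"
proof
  assume a0: "a = 0"
  have "e 0 = 0\<^sub>v m"
  proof (rule B_nondegenerate)
    fix j assume j: "j < m"
    show "B (bs j) (e 0) = 0"
    proof (cases "j < d")
      case True
      then show ?thesis using B_fixU_e[OF fs] by (simp add: bs_def)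
    next
      case False
      have "j - d < q - 1" "0 < q - 1" using False j md q_ge by linarith+
      then have "B (e (j - d)) (e 0) = 0" using B_e_diff[of "j - d" 0] B_e_same[of 0] a0 by (cases "j - d = 0") simp_all
      then show ?thesis using False by (simp add: bs_def)
    qed
  qed auto
  then show False using e_nonzero by simp
qed

end

end

lemma a_K: "a \<in> K"
  unfolding a_def B_def
proof -
  have "e0 \<bullet> (F *\<^sub>v e0) = (\<Sum>i<m. vec_index e0 i * (\<Sum>j<m. F $$ (i, j) * vec_index e0 j))"
    using e0(1) F_carrier by (simp add: scalar_prod_def atLeast0LessThan)
  also have "\<dots> \<in> K"
    using e0(4) F_elements elements_mat_subset_iff[OF F_carrier] by (intro sum_mem mult_mem) auto
  finally show "e0 \<bullet> (F *\<^sub>v e0) \<in> K" .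
qed

text \<open>Each summand with nonzero t is evaluated by w U(t) w = U(1/t) D(t) w U(1/t).\<close>

lemma sum_Um_Bruhat:
  assumes f: "fixU f" "\<And>x. x \<noteq> 0 \<Longrightarrow> act (Dm x) f = lam x \<cdot>\<^sub>v f" and f': "fixU f'"
  shows "(\<Sum>t\<in>UNIV. B (act (Um t) (act wm f)) (act wm f')) =
    B f f' + (\<Sum>t\<in>UNIV - {0}. lam (inverse t)) * B (act wm f) f'"
proof -
  have fc: "f \<in> carrier_vec m" "f' \<in> carrier_vec m" using f f' by (auto simp: fixU_def)
  have fU: "act (Um t) f = f" "act (Um t) f' = f'" for t using f f' by (auto simp: fixU_def)
  have wc: "act wm v \<in> carrier_vec m" if "v \<in> carrier_vec m" for v using that by auto
  have ww: "act wm (act wm v) = v" if "v \<in> carrier_vec m" for v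
    using act_mult[of wm wm v] that act_one[OF that] by (simp add: wm_wm)
  have 0: "B (act (Um 0) (act wm f)) (act wm f') = B f f'"
    using act_one[OF wc[OF fc(1)]] B_act[OF wm_SL2 fc] by (simp add: Um_0)
  have t: "B (act (Um t) (act wm f)) (act wm f') = lam (inverse t) * B (act wm f) f'" if t: "t \<noteq> 0" for t
  proof -
    have U: "Um t \<in> carrier SL2" "Um (inverse t) \<in> carrier SL2" "Dm t \<in> carrier SL2" "Dm (inverse t) \<in> carrier SL2"
      using t by auto
    have Uc: "act (Um t) (act wm f) \<in> carrier_vec m" using U wc fc by auto
    have UD: "Um (inverse t) * Dm t \<in> carrier SL2" "Um (inverse t) * Dm t * wm \<in> carrier SL2" "wm * Um t \<in> carrier SL2"
      by (intro SL2_mult_closed U wm_SL2)+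
    have "B (act (Um t) (act wm f)) (act wm f') = B (act wm (act (Um t) (act wm f))) (act wm (act wm f'))"
      by (rule B_act[OF wm_SL2 Uc wc[OF fc(2)], symmetric])
    also have "act wm (act wm f') = f'" by (rule ww[OF fc(2)])
    also have "act wm (act (Um t) (act wm f)) = act (wm * Um t * wm) f"
      using act_mult[OF wm_SL2 U(1) wc[OF fc(1)]] act_mult[OF UD(3) wm_SL2 fc(1)] by simp
    also have "wm * Um t * wm = Um (inverse t) * Dm t * wm * Um (inverse t)" by (rule bruhat[OF t])
    also have "act \<dots> f = act (Um (inverse t) * Dm t * wm) f"
      unfolding act_mult[OF UD(2) U(2) fc(1)] fU ..
    also have "\<dots> = act (Um (inverse t) * Dm t) (act wm f)" by (rule act_mult[OF UD(1) wm_SL2 fc(1)])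
    also have "\<dots> = act (Um (inverse t)) (act (Dm t) (act wm f))" by (rule act_mult[OF U(2,3) wc[OF fc(1)]])
    also have "act (Dm t) (act wm f) = act (Dm t * wm) f" by (rule act_mult[OF U(3) wm_SL2 fc(1), symmetric])
    also have "Dm t * wm = wm * Dm (inverse t)" by (rule wm_Dm[OF t])
    also have "act (wm * Dm (inverse t)) f = act wm (lam (inverse t) \<cdot>\<^sub>v f)"
      unfolding act_mult[OF wm_SL2 U(4) fc(1)] using f(2)[of "inverse t"] t by simp
    also have "\<dots> = lam (inverse t) \<cdot>\<^sub>v act wm f" by (rule act_smult[OF wm_SL2 fc(1)])
    also have "B (act (Um (inverse t)) (lam (inverse t) \<cdot>\<^sub>v act wm f)) f' =
        B (act (Um (inverse t)) (lam (inverse t) \<cdot>\<^sub>v act wm f)) (act (Um (inverse t)) f')" unfolding fU ..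
    also have "\<dots> = B (lam (inverse t) \<cdot>\<^sub>v act wm f) f'" by (rule B_act[OF U(2)]) (use wc fc in auto)
    also have "\<dots> = lam (inverse t) * B (act wm f) f'" by (rule B_smult_left) (use wc fc in auto)
    finally show ?thesis .
  qed
  have "(\<Sum>t\<in>UNIV. B (act (Um t) (act wm f)) (act wm f')) =
      B f f' + (\<Sum>t\<in>UNIV - {0}. lam (inverse t) * B (act wm f) f')"
    using 0 t by (subst sum.remove[of UNIV 0]) auto
  then show ?thesis by (simp add: sum_distrib_right)
qed

lemma act_Dm_wm:
  assumes "f \<in> carrier_vec m" "\<And>x. x \<noteq> 0 \<Longrightarrow> act (Dm x) f = lam x \<cdot>\<^sub>v f" "x \<noteq> 0"
  shows "act (Dm x) (act wm f) = lam (inverse x) \<cdot>\<^sub>v act wm f"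
proof -
  have D: "Dm x \<in> carrier SL2" "Dm (inverse x) \<in> carrier SL2" using assms(3) by auto
  have "act (Dm x) (act wm f) = act (wm * Dm (inverse x)) f"
    unfolding act_mult[OF D(1) wm_SL2 assms(1), symmetric] wm_Dm[OF assms(3)] ..
  also have "\<dots> = act wm (lam (inverse x) \<cdot>\<^sub>v f)"
    unfolding act_mult[OF wm_SL2 D(2) assms(1)] using assms(2)[of "inverse x"] assms(3) by simp
  also have "\<dots> = lam (inverse x) \<cdot>\<^sub>v act wm f" by (rule act_smult[OF wm_SL2 assms(1)])
  finally show ?thesis .
qed

text \<open>As the Weyl element inverts the torus, \<open>act wm f\<close> is again a torus
  eigenvector, so its pairing with \<open>e0\<close> determines those with all translates.\<close>

lemma B_wm_e:
  assumes "f \<in> carrier_vec m" "\<And>x. x \<noteq> 0 \<Longrightarrow> act (Dm x) f = lam x \<cdot>\<^sub>v f"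
    and "lam (inverse (\<nu> ^ l)) * z = 1"
  shows "B (act wm f) (e l) = z * B (act wm f) e0"
proof -
  have wc: "act wm f \<in> carrier_vec m" using assms by auto
  have "B (act wm f) e0 = B (act (Dm (\<nu> ^ l)) (act wm f)) (e l)"
    unfolding e_def by (rule B_act[symmetric]) (use wc e0 in auto)
  also have "\<dots> = lam (inverse (\<nu> ^ l)) * B (act wm f) (e l)"
    using act_Dm_wm[OF assms(1,2) \<nu>_pow_nonzero, of l] B_smult_left[OF wc e_carrier[of l]] by simp
  finally have "z * B (act wm f) e0 = (lam (inverse (\<nu> ^ l)) * z) * B (act wm f) (e l)" by simp
  then show ?thesis using assms(3) by simp
qed

end

section \<open>Determinants over the subfield and characters of the torus\<close>

lemma sum_lessThan_add: "(\<Sum>j<d + c. g j) = (\<Sum>j<d. g j) + (\<Sum>l<c. g (d + l :: nat))" for g :: "nat \<Rightarrow> complex"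
  by (induction c) (simp_all add: add.assoc)

lemma (in csubfield) prod_mem: "(\<And>i. i \<in> A \<Longrightarrow> f i \<in> K) \<Longrightarrow> prod f A \<in> K"
  by (induction A rule: infinite_finite_induct) auto

lemma (in csubfield) det_mem:
  assumes A: "A \<in> carrier_mat k k" and el: "elements_mat A \<subseteq> K"
  shows "det A \<in> K"
proof -
  have A_el: "A $$ (i, j) \<in> K" if "i < k" "j < k" for i j using el elements_mat_subset_iff[OF A] that by blast
  have "signof p * (\<Prod>i = 0..<k. A $$ (i, p i)) \<in> K" if "p permutes {0..<k}" for p
  proof (rule mult_mem)
    have "(signof p :: complex) \<in> {1, - 1}" by (simp add: sign_def)
    then show "(signof p :: complex) \<in> K" by auto
    show "(\<Prod>i = 0..<k. A $$ (i, p i)) \<in> K"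
      using permutes_in_image[OF that] by (intro prod_mem A_el) auto
  qed
  then show ?thesis unfolding det_def'[OF A] by (intro sum_mem) auto
qed

lemma det_diag: "det (mat k k (\<lambda>(i, j). if i = j then D i else 0)) = (\<Prod>i<k. D i)" for D :: "nat \<Rightarrow> complex"
proof -
  let ?A = "mat k k (\<lambda>(i, j). if i = j then D i else 0)"
  have "det ?A = prod_list (diag_mat ?A)" by (rule det_upper_triangular[where n = k]) (auto intro!: upper_triangularI)
  also have "\<dots> = (\<Prod>i<k. D i)" by (simp add: prod_list_diag_prod atLeast0LessThan)
  finally show ?thesis .
qed

context sl2_even
begin

lemma sum_units:
  fixes g :: "'f \<Rightarrow> complex"
  shows "(\<Sum>x\<in>UNIV - {0, 1}. g x) = (\<Sum>k\<in>{1..<q - 1}. g (\<nu> ^ k))"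
proof -
  have "(\<lambda>k. \<nu> ^ k) ` {1..<q - 1} = (\<lambda>k. \<nu> ^ k) ` {..<q - 1} - (\<lambda>k. \<nu> ^ k) ` {0}"
  proof -
    have "{1..<q - 1} = {..<q - 1} - {0}" by auto
    then show ?thesis using q_ge by (simp only:) (rule inj_on_image_set_diff[OF \<nu>_order(2)], auto)
  qed
  also have "\<dots> = UNIV - {0, 1}" unfolding \<nu>_order(3) by auto
  finally have im: "UNIV - {0, 1} = (\<lambda>k. \<nu> ^ k) ` {1..<q - 1}" by simp
  have inj: "inj_on (\<lambda>k. \<nu> ^ k) {1..<q - 1}" by (rule inj_on_subset[OF \<nu>_order(2)]) auto
  show ?thesis unfolding im sum.reindex[OF inj] o_def ..
qed

text \<open>The exponent of a unit is determined modulo \<open>q - 1\<close>, which is also a period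
  of the powers of \<open>z\<close>.\<close>

lemma exists_multiplicative_character:
  assumes z: "z ^ (q - 1) = (1 :: complex)"
  obtains lam :: "'f \<Rightarrow> complex" where "\<And>k. lam (\<nu> ^ k) = z ^ k"
proof -
  have m: "\<nu> ^ k = \<nu> ^ (k mod (q - 1))" "z ^ k = z ^ (k mod (q - 1))" for k
  proof -
    have k: "k = (q - 1) * (k div (q - 1)) + k mod (q - 1)" by simp
    show "\<nu> ^ k = \<nu> ^ (k mod (q - 1))" by (subst k) (simp only: power_add power_mult \<nu>_order(1) power_one mult_1)
    show "z ^ k = z ^ (k mod (q - 1))" by (subst k) (simp only: power_add power_mult z power_one mult_1)
  qed
  have q1: "q - 1 > 0" using q_ge by simp
  have wd: "z ^ k = z ^ k'" if "\<nu> ^ k = \<nu> ^ k'" for k k'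
  proof -
    have "\<nu> ^ (k mod (q - 1)) = \<nu> ^ (k' mod (q - 1))" using that m(1)[of k] m(1)[of k'] by simp
    then have "k mod (q - 1) = k' mod (q - 1)" by (rule inj_onD[OF \<nu>_order(2)]) (simp_all only: lessThan_iff mod_less_divisor[OF q1])
    then show ?thesis using m(2)[of k] m(2)[of k'] by simp
  qed
  show thesis
  proof (rule that)
    fix k
    have "\<nu> ^ k = \<nu> ^ (SOME k'. \<nu> ^ k = \<nu> ^ k')" by (rule someI[of "\<lambda>k'. \<nu> ^ k = \<nu> ^ k'"]) simp
    then show "(\<lambda>x. z ^ (SOME k'. x = \<nu> ^ k')) (\<nu> ^ k) = z ^ k" using wd by metis
  qed
qed

end

section \<open>Coordinates in the completed basis\<close>

context sl2_rep
begin

context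
  fixes d :: nat and fs :: "nat \<Rightarrow> complex vec"
  assumes fs: "\<And>j. j < d \<Longrightarrow> fixU (fs j)" and md: "m = d + (q - 1)"
begin

lemma bs_eq: "bs d fs j = (if j < d then fs j else e (j - d))"
  by (rule bs_def[where fs = fs, OF fs md])

lemma Sm_eq: "Sm d fs = mat m m (\<lambda>(r, j). vec_index (bs d fs j) r)"
  by (rule Sm_def[where fs = fs, OF fs md])

lemma B_Sm_split:
  assumes x: "x \<in> carrier_vec m" and v: "v \<in> carrier_vec m"
  shows "B (Sm d fs *\<^sub>v x) v = (\<Sum>j<d. vec_index x j * B (fs j) v) + (\<Sum>l<q - 1. vec_index x (d + l) * B (e l) v)"
proof -
  have "B (Sm d fs *\<^sub>v x) v = (\<Sum>j<d + (q - 1). vec_index x j * B (bs d fs j) v)"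
    unfolding md[symmetric] by (rule B_Sm[where fs = fs, OF fs md x v])
  then show ?thesis unfolding sum_lessThan_add by (simp add: bs_eq)
qed

lemma B_Sm_e:
  assumes x: "x \<in> carrier_vec m" and l: "l < q - 1"
  shows "B (Sm d fs *\<^sub>v x) (e l) = vec_index x (d + l) * a"
proof -
  have "(\<Sum>l'<q - 1. vec_index x (d + l') * B (e l') (e l)) = (\<Sum>l'<q - 1. if l' = l then vec_index x (d + l) * a else 0)"
    by (intro sum.cong refl) (use B_e_same B_e_diff l in auto)
  also have "\<dots> = vec_index x (d + l) * a" using l by simp
  finally show ?thesis using B_Sm_split[OF x e_carrier[of l]] B_fixU_e[OF fs] by simp
qed

lemma B_Sm_fix:
  assumes x: "x \<in> carrier_vec m" and u: "fixU u"
  shows "B (Sm d fs *\<^sub>v x) u = (\<Sum>j<d. vec_index x j * B (fs j) u)"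
proof -
  have uc: "u \<in> carrier_vec m" using u by (simp add: fixU_def)
  have "B (e l) u = 0" for l using B_fixU_e[OF u, of l] B_sym[OF e_carrier[of l] uc] by simp
  then show ?thesis using B_Sm_split[OF x uc] by simp
qed

lemma Sm_elements:
  assumes "\<And>j r. j < d \<Longrightarrow> r < m \<Longrightarrow> vec_index (fs j) r \<in> K"
  shows "elements_mat (Sm d fs) \<subseteq> K"
proof -
  have C: "Sm d fs \<in> carrier_mat m m" by (rule Sm_carrier[where fs = fs, OF fs md])
  show ?thesis unfolding elements_mat_subset_iff[OF C] using assms e_K by (auto simp: Sm_eq bs_eq)
qed

lemma Gram_diag:
  assumes D: "\<And>i j. i < d \<Longrightarrow> j < d \<Longrightarrow> B (fs i) (fs j) = (if i = j then D i else 0)"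
  shows "(Sm d fs)\<^sup>T * F * Sm d fs = mat m m (\<lambda>(i, j). if i = j then (if i < d then D i else a) else 0)"
proof (rule eq_matI)
  fix i j assume "i < dim_row (mat m m (\<lambda>(i, j). if i = j then (if i < d then D i else a) else 0))"
    "j < dim_col (mat m m (\<lambda>(i, j). if i = j then (if i < d then D i else a) else 0))"
  then have ij: "i < m" "j < m" by auto
  have l: "k - d < q - 1" if "k < m" "\<not> k < d" for k using that md by linarith
  have fc: "k < d \<Longrightarrow> fs k \<in> carrier_vec m" for k using fs by (simp add: fixU_def)
  have "B (bs d fs i) (bs d fs j) = (if i = j then (if i < d then D i else a) else 0)"
  proof (cases "i < d"; cases "j < d")
    assume "i < d" "\<not> j < d" then show ?thesis using B_fixU_e[OF fs] by (auto simp: bs_eq)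
  next
    assume "\<not> i < d" "j < d" then show ?thesis using B_fixU_e[OF fs] B_sym[OF e_carrier fc] by (auto simp: bs_eq)
  next
    assume nd: "\<not> i < d" "\<not> j < d"
    then have "i - d = j - d \<longleftrightarrow> i = j" by linarith
    then show ?thesis using nd B_e_same B_e_diff[OF l[OF ij(1) nd(1)] l[OF ij(2) nd(2)]] by (auto simp: bs_eq)
  qed (use D in \<open>auto simp: bs_eq\<close>)
  then show "((Sm d fs)\<^sup>T * F * Sm d fs) $$ (i, j) = mat m m (\<lambda>(i, j). if i = j then (if i < d then D i else a) else 0) $$ (i, j)"
    using Gram[where fs = fs, OF fs md ij] ij by simp
qed (use Sm_carrier[where fs = fs, OF fs md] in auto)

end

text \<open>The translates already fill the dimension. The list of fixed vectors is empty, its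
  function \<open>fs\<close> a mere placeholder, and the vanishing of the coefficients of the
  \<open>e l\<close> is full independence.\<close>

lemma cuspidal_diagonalization:
  assumes m: "m = q - 1"
  obtains S where "S \<in> carrier_mat m m" "elements_mat S \<subseteq> K"
    "S\<^sup>T * F * S = mat m m (\<lambda>(i, j). if i = j then a else 0)" "a \<noteq> 0"
proof -
  define fs where "fs = (\<lambda>_ :: nat. 0\<^sub>v m :: complex vec)"
  have fs: "\<And>j. j < 0 \<Longrightarrow> fixU (fs j)" by simp
  have md: "m = 0 + (q - 1)" using m by simp
  have indep: "x = 0\<^sub>v m" if "x \<in> carrier_vec m" "Sm 0 fs *\<^sub>v x = 0\<^sub>v m" for x
    using coefficients_zero[where fs = fs, OF fs md that] that(1) by (intro eq_vecI) auto
  show thesis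
  proof (rule that)
    show "Sm 0 fs \<in> carrier_mat m m" by (rule Sm_carrier[where fs = fs, OF fs md])
    show "elements_mat (Sm 0 fs) \<subseteq> K" by (rule Sm_elements[where fs = fs, OF fs md]) simp_all
    show "(Sm 0 fs)\<^sup>T * F * Sm 0 fs = mat m m (\<lambda>(i, j). if i = j then a else 0)"
      using Gram_diag[where fs = fs and D = "\<lambda>_. 0", OF fs md] by (simp only: not_less_zero if_False)
    show "a \<noteq> 0" by (rule a_nonzero[where fs = fs, OF fs md indep])
  qed
qed

text \<open>The Borel subgroup is parametrised by pairs \<open>(t, x)\<close> standing for
  \<open>Um t * Dm x\<close>, with product law \<open>\<pi>\<close>. The sum required to be nonzero
  is \<open>q * (q - 1)\<close> times the multiplicity of \<open>lam\<close>; the factor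
  \<open>q\<close> in it arises because \<open>\<chi> (Um t * Dm x)\<close> does not depend on
  \<open>t\<close> for \<open>x\<close> other than 0 and 1. The field \<open>L\<close> contains the
  values of \<open>lam\<close>, which may lie outside \<open>K\<close>.\<close>

lemma Borel_eigenvector:
  assumes lam: "\<And>x y. x \<noteq> 0 \<Longrightarrow> y \<noteq> 0 \<Longrightarrow> lam (x * y) = lam x * lam y" "lam 1 = 1" "\<And>x. x \<noteq> 0 \<Longrightarrow> lam x \<noteq> 0"
    and nz: "v1 + of_nat (q - 1) * vc + of_nat q * (\<Sum>x\<in>UNIV - {0, 1}. inverse (lam x) * \<chi> (Dm x)) \<noteq> 0"
    and L: "csubfield L" "K \<subseteq> L" "\<And>x. x \<noteq> 0 \<Longrightarrow> lam x \<in> L"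
  obtains f where "fixU f" "f \<noteq> 0\<^sub>v m" "\<And>x. x \<noteq> 0 \<Longrightarrow> act (Dm x) f = lam x \<cdot>\<^sub>v f" "\<And>r. r < m \<Longrightarrow> vec_index f r \<in> L"
proof -
  interpret L: csubfield L by (rule L(1))
  define A :: "('f \<times> 'f) set" where "A = UNIV \<times> (UNIV - {0})"
  define E :: "'f \<times> 'f \<Rightarrow> 'f mat" where "E p = Um (fst p) * Dm (snd p)" for p
  define \<pi> :: "'f \<times> 'f \<Rightarrow> 'f \<times> 'f \<Rightarrow> 'f \<times> 'f" where
    "\<pi> p r = (fst p + inverse (snd p) * inverse (snd p) * fst r, snd p * snd r)" for p r
  have A: "snd p \<noteq> 0" if "p \<in> A" for p using that by (auto simp: A_def)
  have E: "E p \<in> carrier SL2" if "p \<in> A" for p unfolding E_def using A[OF that] by (intro SL2_mult_closed) auto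
  have bij: "bij_betw (\<pi> s) A A" if s: "s \<in> A" for s
  proof (rule bij_betw_byWitness[where f' = "\<lambda>r. (snd s * snd s * (fst s + fst r), inverse (snd s) * snd r)"])
    have *: "inverse (snd s) * inverse (snd s) * (snd s * snd s * y) = y" "snd s * snd s * (inverse (snd s) * inverse (snd s) * y) = y" for y
      using A[OF s] by (simp_all add: field_simps)
    show "\<forall>r\<in>A. (snd s * snd s * (fst s + fst (\<pi> s r)), inverse (snd s) * snd (\<pi> s r)) = r"
      using A[OF s] by (auto simp: \<pi>_def *)
    show "\<forall>r\<in>A. \<pi> s (snd s * snd s * (fst s + fst r), inverse (snd s) * snd r) = r"
      using A[OF s] by (auto simp: \<pi>_def *)
  qed (use A[OF s] in \<open>auto simp: \<pi>_def A_def\<close>)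
  have mult: "E s * E r = E (\<pi> s r)" if "s \<in> A" "r \<in> A" for s r
  proof -
    have "(fst s + inverse (snd s) * inverse (snd s) * fst r) * (snd s * snd r) =
        fst s * snd s * snd r + inverse (snd s) * (fst r * snd r)"
      using A[OF that(1)] by (simp add: field_simps)
    then show ?thesis unfolding E_def \<pi>_def Um_def Dm_def by (simp add: mult_ac)
  qed
  have U: "(\<Sum>t\<in>UNIV. \<chi> (Um t)) = v1 + of_nat (q - 1) * vc"
    using class_function_values(1,2)[OF cf] card_units by (subst sum.remove[of UNIV 0]) (auto simp: Um_0)
  have "(\<Sum>p\<in>A. inverse (lam (snd p)) * \<chi> (E p)) = (\<Sum>t\<in>UNIV. \<Sum>x\<in>UNIV - {0}. inverse (lam x) * \<chi> (Um t * Dm x))"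
    unfolding A_def E_def by (simp add: sum.cartesian_product case_prod_beta)
  also have "\<dots> = (\<Sum>x\<in>UNIV - {0}. inverse (lam x) * (\<Sum>t\<in>UNIV. \<chi> (Um t * Dm x)))"
    by (subst sum.swap) (simp add: sum_distrib_left)
  also have "\<dots> = (\<Sum>t\<in>UNIV. \<chi> (Um t * Dm 1)) + (\<Sum>x\<in>UNIV - {0} - {1}. inverse (lam x) * (\<Sum>t\<in>UNIV. \<chi> (Um t * Dm x)))"
    by (subst sum.remove[of "UNIV - {0}" 1]) (auto simp: lam(2))
  also have "(\<Sum>t\<in>UNIV. \<chi> (Um t * Dm 1)) = v1 + of_nat (q - 1) * vc"
  proof -
    have "Um t * Dm 1 = Um t" for t :: 'f by (simp add: Um_def Dm_def)
    then show ?thesis using U by simp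
  qed
  also have "(\<Sum>x\<in>UNIV - {0} - {1}. inverse (lam x) * (\<Sum>t\<in>UNIV. \<chi> (Um t * Dm x))) =
      (\<Sum>x\<in>UNIV - {0, 1}. of_nat q * (inverse (lam x) * \<chi> (Dm x)))"
  proof (rule sum.cong)
    fix x :: 'f assume "x \<in> UNIV - {0, 1}"
    then have "(\<Sum>t\<in>UNIV. \<chi> (Um t * Dm x)) = (\<Sum>t\<in>(UNIV :: 'f set). \<chi> (Dm x))"
      using class_function_values(6)[OF cf] by (intro sum.cong) auto
    then show "inverse (lam x) * (\<Sum>t\<in>UNIV. \<chi> (Um t * Dm x)) = of_nat q * (inverse (lam x) * \<chi> (Dm x))"
      using card by simp
  qed auto
  finally have "(\<Sum>p\<in>A. inverse (lam (snd p)) * \<chi> (E p)) \<noteq> 0" using nz by (simp only: sum_distrib_left not_False_eq_True)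
  then have "\<exists>v\<in>carrier_vec m. v \<noteq> 0\<^sub>v m \<and> (\<forall>s\<in>A. act (E s) v = lam (snd s) \<cdot>\<^sub>v v) \<and>
    (\<exists>k<m. \<forall>r<m. vec_index v r = (\<Sum>p\<in>A. inverse (lam (snd p)) * \<rho> (E p) $$ (r, k)))"
    by (intro eigenvector_exists[where \<pi> = \<pi>] E bij mult) (use A lam in \<open>auto simp: \<pi>_def\<close>)
  then obtain f k where f: "f \<in> carrier_vec m" "f \<noteq> 0\<^sub>v m" "\<forall>s\<in>A. act (E s) f = lam (snd s) \<cdot>\<^sub>v f" and k: "k < m"
    "\<forall>r<m. vec_index f r = (\<Sum>p\<in>A. inverse (lam (snd p)) * \<rho> (E p) $$ (r, k))" by blast
  show thesis
  proof (rule that)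
    have "act (Um t) f = f" for t
    proof -
      have "E (t, 1) = Um t" by (simp add: E_def Um_def Dm_def)
      then show ?thesis using f(3)[rule_format, of "(t, 1)"] lam(2) by (simp add: A_def)
    qed
    then show "fixU f" using f(1) by (simp add: fixU_def)
    show "act (Dm x) f = lam x \<cdot>\<^sub>v f" if "x \<noteq> 0" for x
    proof -
      have "E (0, x) = Dm x" by (simp add: E_def Um_def Dm_def)
      then show ?thesis using f(3)[rule_format, of "(0, x)"] that by (simp add: A_def)
    qed
    show "vec_index f r \<in> L" if "r < m" for r
      unfolding k(2)[rule_format, OF that]
      by (intro L.sum_mem L.mult_mem L.inverse_mem L(3) A subsetD[OF L(2)] \<rho>_K E that k(1))
  qed (rule f(2))
qed

lemma B_mem:
  assumes "csubfield L" "K \<subseteq> L" "u \<in> carrier_vec m" "v \<in> carrier_vec m"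
    "\<And>r. r < m \<Longrightarrow> vec_index u r \<in> L" "\<And>r. r < m \<Longrightarrow> vec_index v r \<in> L"
  shows "B u v \<in> L"
proof -
  interpret L: csubfield L by fact
  have "B u v = (\<Sum>i<m. vec_index u i * (\<Sum>j<m. F $$ (i, j) * vec_index v j))"
    unfolding B_def using assms(3,4) F_carrier by (simp add: scalar_prod_def atLeast0LessThan)
  also have "\<dots> \<in> L"
    using assms F_elements elements_mat_subset_iff[OF F_carrier] by (intro L.sum_mem L.mult_mem) auto
  finally show ?thesis .
qed

lemma act_mem:
  assumes "csubfield L" "K \<subseteq> L" "g \<in> carrier SL2" "v \<in> carrier_vec m" "\<And>r. r < m \<Longrightarrow> vec_index v r \<in> L" "r < m"
  shows "vec_index (act g v) r \<in> L"
proof -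
  interpret L: csubfield L by fact
  show ?thesis unfolding act_def mat_vec_entry[OF \<rho>_carrier[OF assms(3)] assms(4,6)]
    using assms \<rho>_K by (intro L.sum_mem L.mult_mem) auto
qed

lemma \<chi>_Dm_cases:
  assumes k: "k \<in> {1..<q - 1}"
  shows "\<exists>l\<in>{1..(q - 2) div 2}. \<chi> (Dm (\<nu> ^ k)) = va l \<and> (l = k \<or> l = q - 1 - k)"
proof (cases "k \<le> (q - 2) div 2")
  case True
  then show ?thesis using class_function_values(3)[OF cf, of k] k by (intro bexI[of _ k]) auto
next
  case False
  have l: "q - 1 - k \<in> {1..(q - 2) div 2}" using False k q_even(2,3) q_ge unfolding atLeastAtMost_iff atLeastLessThan_iff by linarith
  have "\<chi> (Dm (\<nu> ^ k)) = \<chi> (Dm (inverse (\<nu> ^ k)))" using class_function_values(5)[OF cf, of "\<nu> ^ k"] by simp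
  also have "inverse (\<nu> ^ k) = \<nu> ^ (q - 1 - k)" by (rule inverse_\<nu>_power) (use k in auto)
  also have "\<chi> (Dm (\<nu> ^ (q - 1 - k))) = va (q - 1 - k)" by (rule class_function_values(3)[OF cf l])
  finally show ?thesis using l by blast
qed

lemma fixed_by_generators:
  assumes f: "fixU f" "\<And>x. x \<noteq> 0 \<Longrightarrow> act (Dm x) f = f" "act wm f = f" and g: "g \<in> carrier SL2"
  shows "act g f = f"
proof -
  have fc: "f \<in> carrier_vec m" and fU: "\<And>t. act (Um t) f = f" using f(1) by (auto simp: fixU_def)
  define P where "P g \<longleftrightarrow> g \<in> carrier SL2 \<and> act g f = f" for g
  have mult: "P (g * h)" if "P g" "P h" for g h
    using that act_mult[of g h f] fc SL2_mult_closed[of g h] by (simp add: P_def)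
  have U: "P (Um t)" for t using fU by (simp add: P_def)
  have D: "P (Dm x)" if "x \<noteq> 0" for x using f(2) that by (simp add: P_def)
  have w: "P wm" using f(3) by (simp add: P_def)
  obtain a\<^sub>0 b\<^sub>0 c\<^sub>0 d\<^sub>0 where gm: "g = m2 a\<^sub>0 b\<^sub>0 c\<^sub>0 d\<^sub>0" "a\<^sub>0 * d\<^sub>0 - b\<^sub>0 * c\<^sub>0 = 1" using g by (rule SL2_cases)
  then have det: "a\<^sub>0 * d\<^sub>0 + b\<^sub>0 * c\<^sub>0 = 1" by simp
  have "P g"
  proof (cases "b\<^sub>0 = 0")
    case True
    then have "a\<^sub>0 * d\<^sub>0 = 1" using det by simp
    then have a0: "a\<^sub>0 \<noteq> 0" "d\<^sub>0 = inverse a\<^sub>0" by (auto simp: inverse_unique)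
    then have "g = Um (c\<^sub>0 * inverse a\<^sub>0) * Dm a\<^sub>0" using True by (simp add: gm Um_def Dm_def)
    then show ?thesis using mult[OF U D] a0 by simp
  next
    case False
    have bb: "b\<^sub>0 * inverse b\<^sub>0 = 1" using False by simp
    have c: "c\<^sub>0 = (1 + a\<^sub>0 * d\<^sub>0) * inverse b\<^sub>0"
    proof -
      have "1 + a\<^sub>0 * d\<^sub>0 = b\<^sub>0 * c\<^sub>0" by (subst det[symmetric]) (simp add: add_ac)
      then show ?thesis using False by simp
    qed
    have wUw: "wm * Um b\<^sub>0 * wm = m2 1 b\<^sub>0 0 1" by (simp add: wm_def Um_def)
    \<comment> \<open>The parameters of the outer factors are solved from the diagonal entries; the
      lower left entry is then forced by the determinant.\<close>
    have "Um ((d\<^sub>0 + 1) * inverse b\<^sub>0) * (wm * Um b\<^sub>0 * wm) * Um ((a\<^sub>0 + 1) * inverse b\<^sub>0) =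
        m2 (1 + b\<^sub>0 * ((a\<^sub>0 + 1) * inverse b\<^sub>0)) b\<^sub>0
          ((d\<^sub>0 + 1) * inverse b\<^sub>0 + ((d\<^sub>0 + 1) * inverse b\<^sub>0 * b\<^sub>0 + 1) * ((a\<^sub>0 + 1) * inverse b\<^sub>0))
          ((d\<^sub>0 + 1) * inverse b\<^sub>0 * b\<^sub>0 + 1)"
      unfolding wUw by (simp add: Um_def)
    also have "1 + b\<^sub>0 * ((a\<^sub>0 + 1) * inverse b\<^sub>0) = a\<^sub>0" using False by (simp add: field_simps)
    also have "(d\<^sub>0 + 1) * inverse b\<^sub>0 * b\<^sub>0 + 1 = d\<^sub>0"
      by (simp only: mult.assoc left_inverse[OF False] mult_1_right add.assoc char2 add_0_right)
    also have "(d\<^sub>0 + 1) * inverse b\<^sub>0 + d\<^sub>0 * ((a\<^sub>0 + 1) * inverse b\<^sub>0) = c\<^sub>0"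
    proof -
      have "(d\<^sub>0 + 1) * inverse b\<^sub>0 + d\<^sub>0 * ((a\<^sub>0 + 1) * inverse b\<^sub>0) = (d\<^sub>0 + (d\<^sub>0 + (1 + a\<^sub>0 * d\<^sub>0))) * inverse b\<^sub>0"
        by (simp only: algebra_simps mult_1_left)
      then show ?thesis unfolding c by (simp only: char2_left)
    qed
    finally have "g = Um ((d\<^sub>0 + 1) * inverse b\<^sub>0) * (wm * Um b\<^sub>0 * wm) * Um ((a\<^sub>0 + 1) * inverse b\<^sub>0)" by (simp only: gm(1))
    then show ?thesis using mult[OF mult[OF U mult[OF mult[OF w U] w]] U] by simp
  qed
  then show ?thesis by (simp add: P_def)
qed

text \<open>A nonzero fixed vector would span the whole module, so \<open>e0\<close> would be a
  multiple of it. Orthogonality and the nonzero norm make the multiple 0.\<close>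

lemma no_fixed_vector:
  assumes f: "f \<in> carrier_vec m" "B f e0 = 0" "B f f \<noteq> 0" and fix_f: "\<And>g. g \<in> carrier SL2 \<Longrightarrow> act g f = f"
  shows False
proof -
  let ?U = "range (\<lambda>c. c \<cdot>\<^sub>v f)"
  have U: "?U = {0\<^sub>v m} \<or> ?U = carrier_vec m"
  proof (rule irr[unfolded absolutely_irreducible_def, THEN conjunct2, THEN spec, THEN mp, THEN mp])
    show "?U \<subseteq> carrier_vec m" using f(1) by auto
    have "0\<^sub>v m = 0 \<cdot>\<^sub>v f" using f(1) by (intro eq_vecI) auto
    then have 0: "0\<^sub>v m \<in> ?U" by (rule range_eqI)
    have 1: "u + v \<in> ?U" if uv: "u \<in> ?U" "v \<in> ?U" for u v
    proof -
      obtain c c' where "u = c \<cdot>\<^sub>v f" "v = c' \<cdot>\<^sub>v f" using uv by blast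
      then have "u + v = (c + c') \<cdot>\<^sub>v f" by (simp only: add_smult_distrib_vec)
      then show ?thesis by (rule range_eqI)
    qed
    have 2: "z \<cdot>\<^sub>v u \<in> ?U" if u: "u \<in> ?U" for z u
    proof -
      obtain c where "u = c \<cdot>\<^sub>v f" using u by blast
      then have "z \<cdot>\<^sub>v u = (z * c) \<cdot>\<^sub>v f" by (simp only: smult_smult_assoc)
      then show ?thesis by (rule range_eqI)
    qed
    have 3: "\<rho> g *\<^sub>v u \<in> ?U" if g: "g \<in> carrier SL2" and u: "u \<in> ?U" for g u
    proof -
      obtain c where "u = c \<cdot>\<^sub>v f" using u by blast
      then have "\<rho> g *\<^sub>v u = c \<cdot>\<^sub>v f" using act_smult[OF g f(1), of c] fix_f[OF g] by (simp only: act_def)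
      then show ?thesis by (rule range_eqI)
    qed
    show "0\<^sub>v m \<in> ?U \<and> (\<forall>u\<in>?U. \<forall>v\<in>?U. u + v \<in> ?U) \<and> (\<forall>z. \<forall>u\<in>?U. z \<cdot>\<^sub>v u \<in> ?U) \<and>
        (\<forall>g\<in>carrier SL2. \<forall>u\<in>?U. \<rho> g *\<^sub>v u \<in> ?U)"
      by (intro conjI ballI allI 0 1 2 3)
  qed
  have "f = 1 \<cdot>\<^sub>v f" by simp
  then have fU: "f \<in> ?U" by (rule range_eqI)
  have "f \<noteq> 0\<^sub>v m" using f(3) by (auto simp: B_def)
  then have "?U = carrier_vec m" using U fU by auto
  then have "e0 \<in> ?U" using e0(1) by simp
  then obtain c where c: "e0 = c \<cdot>\<^sub>v f" by blast
  then have "c * B f f = 0" using f(2) B_smult_right[OF f(1) f(1), of c] by simp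
  then have "c = 0" using f(3) by simp
  then have "e0 = 0\<^sub>v m" unfolding c using f(1) by (intro eq_vecI) auto
  then show False using e0(2) by simp
qed

text \<open>Write \<open>act wm f\<close> as \<open>k\<close> times \<open>f\<close> plus
  \<open>y\<close> times the sum of the \<open>e l\<close>. Invariance of the norm gives
  \<open>expd\<close>, and the two evaluations of the average give \<open>sm\<close>, a quadratic
  equation for \<open>k\<close> with roots 1 and -1/q. The root 1 is impossible, and -1/q turns
  \<open>expd\<close> into the relation \<open>Dq\<close> between the norms \<open>D\<close> of
  \<open>f\<close> and \<open>a\<close>.\<close>

lemma Steinberg_det:
  assumes v: "v1 = of_nat q" "vc = 0" "\<And>l. l \<in> {1..(q - 2) div 2} \<Longrightarrow> va l = 1"
  shows "m = q" and "\<exists>y\<in>K. y \<noteq> 0 \<and> det F = of_nat (q + 1) * y ^ 2"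
proof -
  show mq: "m = q" using m_eq v(1) by simp
  have q1: "of_nat (q - 1) = (of_nat q - 1 :: complex)" using q_ge by (simp add: of_nat_diff)
  have \<chi>1: "\<chi> (Dm x) = 1" if x: "x \<noteq> 0" "x \<noteq> 1" for x
  proof -
    obtain k where k: "k < q - 1" "x = \<nu> ^ k" using unit_power x by blast
    then have "k \<in> {1..<q - 1}" using x by (cases k) auto
    then show ?thesis using \<chi>_Dm_cases[of k] v(3) k(2) by auto
  qed
  obtain f where f: "fixU f" "f \<noteq> 0\<^sub>v m" "\<And>x. x \<noteq> 0 \<Longrightarrow> act (Dm x) f = 1 \<cdot>\<^sub>v f" "\<And>r. r < m \<Longrightarrow> vec_index f r \<in> K"
  proof (rule Borel_eigenvector[where lam = "\<lambda>_. 1" and L = K])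
    have "(\<Sum>x\<in>UNIV - {0, 1 :: 'f}. inverse 1 * \<chi> (Dm x)) = of_nat (card (UNIV - {0, 1 :: 'f}))" using \<chi>1 by simp
    then have "v1 + of_nat (q - 1) * vc + of_nat q * (\<Sum>x\<in>UNIV - {0, 1}. inverse 1 * \<chi> (Dm x)) =
        of_nat (q + q * card (UNIV - {0, 1 :: 'f}))" using v by simp
    then show "v1 + of_nat (q - 1) * vc + of_nat q * (\<Sum>x\<in>UNIV - {0, 1}. inverse 1 * \<chi> (Dm x)) \<noteq> 0"
      using q_ge by (simp only: of_nat_eq_0_iff)
  qed (auto intro: csubfield_axioms)
  define fs where "fs = (\<lambda>_ :: nat. f)"
  have fs: "\<And>j. j < Suc 0 \<Longrightarrow> fixU (fs j)" using f(1) by (simp add: fs_def)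
  have fs0: "fs j = f" for j by (simp add: fs_def)
  have md: "m = Suc 0 + (q - 1)" using mq q_ge by simp
  have bs0: "bs (Suc 0) fs j = (if j = 0 then f else e (j - Suc 0))" for j
    using bs_eq[where fs = fs, OF fs md, of j] fs0 by simp
  have fc: "f \<in> carrier_vec m" using f(1) by (simp add: fixU_def)
  define wf where "wf = act wm f"
  have wc: "wf \<in> carrier_vec m" unfolding wf_def using fc by auto
  have indep: "x = 0\<^sub>v m" if x: "x \<in> carrier_vec m" "Sm (Suc 0) fs *\<^sub>v x = 0\<^sub>v m" for x
  proof -
    have xk: "vec_index x k = 0" if "k < m" "k \<noteq> 0" for k
      by (rule coefficients_zero[where fs = fs, OF fs md x]) (use that in auto)
    obtain r where r: "r < m" "vec_index f r \<noteq> 0" using f(2) fc by (metis carrier_vecD eq_vecI index_zero_vec)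
    have "0 = (\<Sum>j<m. vec_index x j * vec_index (bs (Suc 0) fs j) r)" using Sm_entry[where fs = fs, OF fs md x(1) r(1)] x(2) r(1) by simp
    also have "\<dots> = (\<Sum>j<m. if j = 0 then vec_index x 0 * vec_index f r else 0)"
      by (intro sum.cong refl) (use xk in \<open>auto simp: bs0\<close>)
    also have "\<dots> = vec_index x 0 * vec_index f r" using r(1) by simp
    finally have "vec_index x 0 = 0" using r(2) by simp
    then have "vec_index x k = 0" if "k < m" for k using xk[OF that] by (cases "k = 0") auto
    then show ?thesis using x(1) by (intro eq_vecI) auto
  qed
  have a0: "a \<noteq> 0" by (rule a_nonzero[where fs = fs, OF fs md indep])
  define D where "D = B f f"
  have Bfe: "B f (e l) = 0" "B (e l) f = 0" for l using B_fixU_e[OF f(1), of l] B_sym[OF fc e_carrier[of l]] by simp_all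
  have D0: "D \<noteq> 0"
  proof
    assume "D = 0"
    then have "B (bs (Suc 0) fs j) f = 0" for j using Bfe by (simp add: bs0 D_def)
    then have "f = 0\<^sub>v m" by (intro B_nondegenerate[where fs = fs, OF fs md indep fc])
    then show False using f(2) by simp
  qed
  obtain x where x: "x \<in> carrier_vec m" "wf = Sm (Suc 0) fs *\<^sub>v x" using expand[where fs = fs, OF fs md indep wc] by blast
  define k where "k = vec_index x 0"
  \<comment> \<open>A single number describes the part in the \<open>e l\<close>: \<open>f\<close>
    is fixed by the torus, so all their coefficients agree.\<close>
  define y where "y = B wf e0 / a"
  have Bf: "B wf f = k * D" using B_Sm_fix[where fs = fs, OF fs md x(1) f(1)] by (simp add: x(2) k_def fs0 D_def)
  have Be: "B wf (e l) = y * a" for l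
    using B_wm_e[where lam = "\<lambda>_. 1" and f = f and l = l and z = 1] fc f(3) a0 by (simp add: y_def wf_def)
  have xl: "vec_index x (Suc 0 + l) = y" if "l < q - 1" for l
    using B_Sm_e[where fs = fs, OF fs md x(1) that] Be[of l] a0 by (simp add: x(2))
  have ww: "B wf wf = D" unfolding wf_def D_def by (rule B_act[OF wm_SL2 fc fc])
  have Bs: "B f wf = k * D" "B (e l) wf = y * a" for l
    using Bf Be[of l] B_sym[OF fc wc] B_sym[OF e_carrier[of l] wc] by simp_all
  have expd: "D = k * (k * D) + (of_nat q - 1) * (y * (y * a))"
  proof -
    have "D = (\<Sum>j<Suc 0. vec_index x j * B (fs j) wf) + (\<Sum>l<q - 1. vec_index x (Suc 0 + l) * B (e l) wf)"
      using B_Sm_split[where fs = fs, OF fs md x(1) wc] ww x(2) by simp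
    also have "(\<Sum>l<q - 1. vec_index x (Suc 0 + l) * B (e l) wf) = (\<Sum>l<q - 1. y * (y * a))"
      by (intro sum.cong refl) (simp only: xl Bs lessThan_iff)
    also have "\<dots> = (of_nat q - 1) * (y * (y * a))" by (simp only: sum_constant card_lessThan q1)
    finally show ?thesis by (simp add: fs0 k_def Bs)
  qed
  have sm: "of_nat q * (k * (k * D)) = D + (of_nat q - 1) * (k * D)"
  proof -
    have "of_nat q * (k * (k * D)) = (\<Sum>t\<in>UNIV. B (act (Um t) wf) wf)"
      using sum_Um_Sm[where fs = fs, OF fs md x(1) wc] by (simp add: x(2)[symmetric] bs0 k_def Bs)
    also have "\<dots> = B f f + (\<Sum>t\<in>UNIV - {0 :: 'f}. 1) * B wf f"
      unfolding wf_def by (rule sum_Um_Bruhat[where lam = "\<lambda>_. 1"]) (use f in auto)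
    also have "(\<Sum>t\<in>UNIV - {0 :: 'f}. 1 :: complex) = of_nat q - 1" using card_units q1 by simp
    finally show ?thesis by (simp add: D_def Bf[unfolded D_def])
  qed
  have "D * ((k - 1) * (of_nat q * k + 1)) = 0" using sm by (simp add: algebra_simps)
  moreover have "k \<noteq> 1"
  proof
    \<comment> \<open>For \<open>k = 1\<close> the norm equation leaves nothing for the
      \<open>e l\<close>, so \<open>f\<close> would also be fixed by the Weyl element and thus by
      the whole group.\<close>
    assume k1: "k = 1"
    have "(of_nat q - 1) * (y * (y * a)) = 0" using expd k1 by simp
    moreover have "(of_nat q - 1 :: complex) \<noteq> 0" unfolding q1[symmetric] using q_ge by simp
    ultimately have y0: "y = 0" using a0 by simp
    have "wf = f"
    proof (rule eq_vecI)
      fix r assume "r < dim_vec f"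
      then have r: "r < m" using fc by simp
      have "vec_index wf r = (\<Sum>j<Suc 0 + (q - 1). vec_index x j * vec_index (bs (Suc 0) fs j) r)"
        unfolding x(2) md[symmetric] by (rule Sm_entry[where fs = fs, OF fs md x(1) r])
      also have "\<dots> = vec_index f r" unfolding sum_lessThan_add
        using k1 xl y0 by (simp add: bs0 k_def)
      finally show "vec_index wf r = vec_index f r" .
    qed (use wc fc in simp)
    then have w: "act wm f = f" by (simp only: wf_def)
    have Dx: "act (Dm x) f = f" if "x \<noteq> 0" for x using f(3)[OF that] by (simp only: one_smult_vec)
    have "act g f = f" if "g \<in> carrier SL2" for g by (rule fixed_by_generators[OF f(1) Dx w that])
    moreover have "B f e0 = 0" using Bfe(1)[of 0] by (simp only: e_0)
    moreover have "B f f \<noteq> 0" using D0 by (simp only: D_def not_False_eq_True)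
    ultimately show False by (intro no_fixed_vector[OF fc])
  qed
  ultimately have qk: "of_nat q * k = - 1" using D0 by (simp add: eq_neg_iff_add_eq_0)
  have Dq: "D * (of_nat q + 1) = (of_nat q * y) ^ 2 * a"
  proof -
    have "of_nat q * (of_nat q * D) = (of_nat q * k) * (of_nat q * k) * D + of_nat q * of_nat q * (of_nat q - 1) * (y * (y * a))"
      by (subst expd) (simp add: algebra_simps)
    then have "(of_nat q - 1) * (D * (of_nat q + 1)) = (of_nat q - 1) * ((of_nat q * y) ^ 2 * a)"
      unfolding qk by (simp add: algebra_simps power2_eq_square)
    moreover have "(of_nat q - 1 :: complex) \<noteq> 0" unfolding q1[symmetric] using q_ge by simp
    ultimately show ?thesis by simp
  qed
  let ?S = "Sm (Suc 0) fs"
  have S: "?S \<in> carrier_mat m m" by (rule Sm_carrier[where fs = fs, OF fs md])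
  have SK: "elements_mat ?S \<subseteq> K" by (rule Sm_elements[where fs = fs, OF fs md]) (use f(4) in \<open>auto simp: fs0\<close>)
  have dS: "det ?S \<noteq> 0" by (rule det_Sm[where fs = fs, OF fs md indep])
  have "?S\<^sup>T * F * ?S = mat m m (\<lambda>(i, j). if i = j then (if i < Suc 0 then D else a) else 0)"
    by (rule Gram_diag[where fs = fs, OF fs md]) (auto simp: fs0 D_def)
  then have "det (?S\<^sup>T * F * ?S) = (\<Prod>i<m. if i < Suc 0 then D else a)" by (simp only: det_diag)
  also have "{..<m} = {..<Suc (q - 1)}" using md by (simp only: add_Suc add_0)
  also have "(\<Prod>i<Suc (q - 1). if i < Suc 0 then D else a) = D * a ^ (q - 1)"
    unfolding prod.lessThan_Suc_shift by simp
  also have "det (?S\<^sup>T * F * ?S) = det ?S ^ 2 * det F"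
    using S F_carrier by (simp add: det_mult[of _ m] det_transpose[of _ m] power2_eq_square)
  finally have dF: "det ?S ^ 2 * det F = D * a ^ (q - 1)" .
  \<comment> \<open>Since \<open>q\<close> is even, the single factor \<open>a\<close> on the right
    of \<open>Dq\<close> completes \<open>a ^ (q - 1)\<close> to a square.\<close>
  define h where "h = q div 2"
  have "a * a ^ (q - 1) = a ^ q" using q_ge by (simp add: power_eq_if)
  also have "\<dots> = (a ^ h) ^ 2" using q_even(2) by (simp add: h_def power_mult[symmetric])
  finally have ah: "a * a ^ (q - 1) = (a ^ h) ^ 2" .
  have qp: "(of_nat q + 1 :: complex) \<noteq> 0" using of_nat_eq_0_iff[of "q + 1", where 'a = complex] by (simp only: of_nat_add of_nat_1)
  \<comment> \<open>Chosen so that \<open>(q + 1) * Y ^ 2\<close> solves the equation for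
    \<open>det F\<close>: after multiplication by \<open>q + 1\<close> and the square of
    \<open>det ?S\<close>, \<open>Dq\<close> exhibits \<open>det F\<close> as a square.\<close>
  define Y where "Y = of_nat q * y * a ^ h / ((of_nat q + 1) * det ?S)"
  have "y \<in> K" unfolding y_def
  proof (intro divide_mem a_K B_mem csubfield_axioms wc e0(1))
    show "vec_index wf r \<in> K" if "r < m" for r
      unfolding wf_def by (rule act_mem[OF csubfield_axioms _ _ fc f(4)]) (use that in auto)
  qed (auto intro: e0(4))
  then have YK: "Y \<in> K" unfolding Y_def using det_mem[OF S SK] a_K by auto
  have y0: "y \<noteq> 0" using Dq D0 qp by auto
  have "(of_nat q + 1) * det ?S ^ 2 * det F = (D * (of_nat q + 1)) * a ^ (q - 1)"
    using dF by (simp add: mult_ac)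
  also have "\<dots> = (of_nat q * y) ^ 2 * (a * a ^ (q - 1))" unfolding Dq by (simp only: mult_ac)
  also have "\<dots> = (of_nat q * y * a ^ h) ^ 2" unfolding ah by (simp only: power_mult_distrib)
  also have "of_nat q * y * a ^ h = Y * ((of_nat q + 1) * det ?S)" using dS qp by (simp add: Y_def)
  finally have "((of_nat q + 1) * det ?S ^ 2) * det F = ((of_nat q + 1) * det ?S ^ 2) * ((of_nat q + 1) * Y ^ 2)"
    by (simp add: power2_eq_square mult_ac)
  then have "det F = of_nat (q + 1) * Y ^ 2" using dS qp by (simp add: add.commute)
  moreover have "Y \<noteq> 0" using y0 a0 dS qp q_ge by (simp add: Y_def)
  ultimately show "\<exists>y\<in>K. y \<noteq> 0 \<and> det F = of_nat (q + 1) * y ^ 2" using YK by blast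
qed

end

section \<open>The principal series over a quadratic extension\<close>

lemma (in csubfield) quadratic_extension:
  assumes \<delta>: "\<delta> * \<delta> \<in> K"
  shows "csubfield {\<alpha> + \<gamma> * \<delta> | \<alpha> \<gamma>. \<alpha> \<in> K \<and> \<gamma> \<in> K}"
proof -
  define L where "L = {\<alpha> + \<gamma> * \<delta> | \<alpha> \<gamma>. \<alpha> \<in> K \<and> \<gamma> \<in> K}"
  have I: "x \<in> L" if "x = \<alpha> + \<gamma> * \<delta>" "\<alpha> \<in> K" "\<gamma> \<in> K" for x \<alpha> \<gamma> unfolding L_def using that by blast
  have E: "\<exists>\<alpha> \<gamma>. x = \<alpha> + \<gamma> * \<delta> \<and> \<alpha> \<in> K \<and> \<gamma> \<in> K" if "x \<in> L" for x using that unfolding L_def by blast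
  have "csubfield L"
  proof
    show "1 \<in> L" by (rule I[of _ 1 0]) auto
    fix x assume "x \<in> L"
    then obtain \<alpha> \<gamma> where x: "x = \<alpha> + \<gamma> * \<delta>" "\<alpha> \<in> K" "\<gamma> \<in> K" using E by blast
    show "- x \<in> L" by (rule I[of _ "- \<alpha>" "- \<gamma>"]) (use x in auto)
    show "inverse x \<in> L"
    proof (cases "\<alpha> - \<gamma> * \<delta> = 0")
      \<comment> \<open>Here the conjugate of \<open>x\<close> vanishes and cannot be used as a
        multiplier, but then \<open>x = 2 * \<alpha>\<close> lies in \<open>K\<close>.\<close>
      case True
      then have "inverse x = inverse (2 * \<alpha>) + 0 * \<delta>" using x(1) by simp
      then show ?thesis by (rule I) (use x in auto)
    next
      case False
      define N where "N = inverse (\<alpha> * \<alpha> - \<gamma> * \<gamma> * (\<delta> * \<delta>))"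
      have NK: "N \<in> K" unfolding N_def using x \<delta> by auto
      have "\<alpha> * \<alpha> - \<gamma> * \<gamma> * (\<delta> * \<delta>) = x * (\<alpha> - \<gamma> * \<delta>)" using x(1) by (simp add: algebra_simps)
      then have "inverse x = N * (\<alpha> - \<gamma> * \<delta>)" unfolding N_def using False by simp
      also have "\<dots> = N * \<alpha> + (- (N * \<gamma>)) * \<delta>" by (simp add: algebra_simps)
      finally show ?thesis by (rule I) (use NK x in auto)
    qed
    fix y assume "y \<in> L"
    then obtain \<alpha>' \<gamma>' where y: "y = \<alpha>' + \<gamma>' * \<delta>" "\<alpha>' \<in> K" "\<gamma>' \<in> K" using E by blast
    have "x + y = (\<alpha> + \<alpha>') + (\<gamma> + \<gamma>') * \<delta>" using x y by (simp add: algebra_simps)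
    then show "x + y \<in> L" by (rule I) (use x y in auto)
    have "x * y = (\<alpha> * \<alpha>' + \<gamma> * \<gamma>' * (\<delta> * \<delta>)) + (\<alpha> * \<gamma>' + \<gamma> * \<alpha>') * \<delta>" using x y by (simp add: algebra_simps)
    then show "x * y \<in> L" by (rule I) (use x y \<delta> in auto)
  qed
  then show ?thesis by (simp only: L_def)
qed

lemma sum_lessThan_2: "(\<Sum>j<2. g j) = g 0 + g (Suc 0)" for g :: "nat \<Rightarrow> complex"
  by (simp add: numeral_2_eq_2)

context sl2_rep
begin

lemma \<chi>_mem: "g \<in> carrier SL2 \<Longrightarrow> \<chi> g \<in> K"
proof -
  assume g: "g \<in> carrier SL2"
  have "\<chi> g = sum_list (diag_mat (\<rho> g))" using aff g by (simp add: affords_def)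
  also have "\<dots> = (\<Sum>i<m. \<rho> g $$ (i, i))" by (rule sum_list_diag_mat[OF \<rho>_carrier[OF g]])
  also have "\<dots> \<in> K" by (intro sum_mem \<rho>_K g) auto
  finally show ?thesis .
qed

lemma fixU_combination:
  assumes "fixU u" "fixU v"
  shows "fixU (x \<cdot>\<^sub>v u + y \<cdot>\<^sub>v v)"
proof -
  have c: "u \<in> carrier_vec m" "v \<in> carrier_vec m" using assms by (auto simp: fixU_def)
  have "act (Um t) (x \<cdot>\<^sub>v u + y \<cdot>\<^sub>v v) = x \<cdot>\<^sub>v act (Um t) u + y \<cdot>\<^sub>v act (Um t) v" for t
    using act_add[of "Um t" "x \<cdot>\<^sub>v u" "y \<cdot>\<^sub>v v"] act_smult[of "Um t"] c by simp
  then show ?thesis using assms c by (simp add: fixU_def)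
qed

context
  assumes real: "K \<subseteq> \<real>"
begin

lemma cnj_K: "x \<in> K \<Longrightarrow> cnj x = x"
  using real Reals_cnj_iff by blast

text \<open>The representing matrices have entries in the real field \<open>K\<close>, so entrywise
  conjugation commutes with the group.\<close>

lemma act_cnj:
  assumes "g \<in> carrier SL2" "v \<in> carrier_vec m"
  shows "act g (map_vec cnj v) = map_vec cnj (act g v)"
proof (rule eq_vecI)
  note R = \<rho>_carrier[OF assms(1)]
  have v': "map_vec cnj v \<in> carrier_vec m" using assms(2) by simp
  fix r assume "r < dim_vec (map_vec cnj (act g v))"
  then have r: "r < m" using R by (simp add: act_def)
  have "vec_index (act g (map_vec cnj v)) r = (\<Sum>j<m. \<rho> g $$ (r, j) * cnj (vec_index v j))"
    unfolding act_def mat_vec_entry[OF R v' r] using assms(2) by (intro sum.cong refl) simp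
  also have "\<dots> = cnj (\<Sum>j<m. \<rho> g $$ (r, j) * vec_index v j)"
    unfolding cnj_sum by (intro sum.cong refl) (simp add: cnj_K[OF \<rho>_K[OF assms(1) r]])
  also have "(\<Sum>j<m. \<rho> g $$ (r, j) * vec_index v j) = vec_index (act g v) r"
    unfolding act_def by (rule mat_vec_entry[OF R assms(2) r, symmetric])
  finally show "vec_index (act g (map_vec cnj v)) r = vec_index (map_vec cnj (act g v)) r"
    using r R by (simp add: act_def)
qed (use \<rho>_carrier[OF assms(1)] in \<open>simp add: act_def\<close>)

lemma B_cnj:
  assumes "u \<in> carrier_vec m" "v \<in> carrier_vec m"
  shows "B (map_vec cnj u) (map_vec cnj v) = cnj (B u v)"
proof -
  have B: "B u v = (\<Sum>i<m. vec_index u i * (\<Sum>j<m. F $$ (i, j) * vec_index v j))"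
    if "u \<in> carrier_vec m" "v \<in> carrier_vec m" for u v
    unfolding B_def using that F_carrier by (simp add: scalar_prod_def atLeast0LessThan)
  have F: "cnj (F $$ (i, j)) = F $$ (i, j)" if "i < m" "j < m" for i j
    using F_elements elements_mat_subset_iff[OF F_carrier] that by (intro cnj_K) blast
  have c: "map_vec cnj u \<in> carrier_vec m" "map_vec cnj v \<in> carrier_vec m" using assms by simp_all
  have d: "dim_vec u = m" "dim_vec v = m" using assms by simp_all
  show ?thesis unfolding B[OF c] B[OF assms] cnj_sum complex_cnj_mult
    by (intro sum.cong refl arg_cong2[where f = "(*)"]) (simp_all add: d F)
qed

lemma cnj_e: "map_vec cnj (e l) = e l"
proof (rule eq_vecI)
  fix r assume r: "r < dim_vec (e l)"
  then have "r < m" by (simp only: carrier_vecD[OF e_carrier[of l]])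
  then show "vec_index (map_vec cnj (e l)) r = vec_index (e l) r" using r cnj_K[OF e_K] by simp
qed simp

text \<open>The torus eigenvalue \<open>z\<close> lies in the extension \<open>L\<close> of
  \<open>K\<close> by \<open>\<delta>\<close>, and conjugation exchanges the eigenvector
  \<open>f\<close> with an eigenvector \<open>fb\<close> for the inverse character. Both are
  isotropic, so the plane is governed by \<open>s = B f fb\<close>, for which the averages yield
  \<open>s = of_nat q * (y * cnj y * a)\<close>. Division by \<open>y\<close> removes the norm
  \<open>y * cnj y\<close>, and symmetrising under conjugation produces vectors over
  \<open>K\<close>.\<close>

lemma principal_series_diagonalization:
  assumes z: "z ^ (q - 1) = 1" "z * z \<noteq> 1" "z * cnj z = 1"
    and v: "v1 = of_nat q + 1" "vc = 1" "\<And>l. l \<in> {1..(q - 2) div 2} \<Longrightarrow> va l = z ^ l + inverse (z ^ l)"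
    and n_odd: "odd n"
  obtains S d where "S \<in> carrier_mat m m" "elements_mat S \<subseteq> K"
    "S\<^sup>T * F * S = mat m m (\<lambda>(i, j). if i = j then (if i = 0 then a * d else a) else 0)"
    "a \<noteq> 0" "d \<in> K" "d \<noteq> 0" "m = q + 1"
proof -
  have "(of_nat m :: complex) = of_nat (q + 1)" using m_eq v(1) by simp
  then have mq: "m = q + 1" by (simp only: of_nat_eq_iff)
  have q1: "of_nat (q - 1) = (of_nat q - 1 :: complex)" "of_nat (q - 2) = (of_nat q - 2 :: complex)"
    using q_ge by (simp_all add: of_nat_diff)
  have Q: "(of_nat q :: complex) \<noteq> 0" "(of_nat q - 1 :: complex) \<noteq> 0" unfolding q1(1)[symmetric] using q_ge by simp_all
  have z0: "z \<noteq> 0" and iz: "inverse z = cnj z" using z(3) by (auto simp: inverse_unique)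
  have \<chi>z: "\<chi> (Dm (\<nu> ^ k)) = z ^ k + inverse (z ^ k)" if k: "k \<in> {1..<q - 1}" for k
  proof -
    have "z ^ k * z ^ (q - 1 - k) = z ^ (q - 1)"
      unfolding power_add[symmetric] by (rule arg_cong[where f = "(^) z"]) (use k in auto)
    then have inv: "inverse (z ^ k) = z ^ (q - 1 - k)" using z(1) by (simp add: inverse_unique)
    obtain l where l: "l \<in> {1..(q - 2) div 2}" "\<chi> (Dm (\<nu> ^ k)) = va l" "l = k \<or> l = q - 1 - k"
      using \<chi>_Dm_cases[OF k] by blast
    have \<chi>l: "\<chi> (Dm (\<nu> ^ k)) = z ^ l + inverse (z ^ l)" unfolding l(2) by (rule v(3)[OF l(1)])
    from l(3) show ?thesis
    proof
      assume "l = q - 1 - k"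
      then have "z ^ l = inverse (z ^ k)" using inv by simp
      then show ?thesis unfolding \<chi>l by (simp only: inverse_inverse_eq add.commute)
    qed (use \<chi>l in simp)
  qed
  define \<tau> where "\<tau> = z + cnj z"
  define \<delta> where "\<delta> = z - cnj z"
  have \<tau>K: "\<tau> \<in> K"
  proof -
    have "\<chi> (Dm (\<nu> ^ 1)) = \<tau>" using \<chi>z[of 1] q_ge iz by (simp add: \<tau>_def)
    then show ?thesis using \<chi>_mem[of "Dm (\<nu> ^ 1)"] by simp
  qed
  have \<delta>2: "\<delta> * \<delta> = \<tau> * \<tau> - 4" using z(3) by (simp add: \<delta>_def \<tau>_def algebra_simps)
  have \<delta>K: "\<delta> * \<delta> \<in> K" unfolding \<delta>2 using \<tau>K by auto
  have \<delta>0: "\<delta> \<noteq> 0" using z(2,3) by (auto simp: \<delta>_def)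
  have c\<delta>: "cnj \<delta> = - \<delta>" by (simp add: \<delta>_def)
  define L where "L = {\<alpha> + \<gamma> * \<delta> | \<alpha> \<gamma>. \<alpha> \<in> K \<and> \<gamma> \<in> K}"
  have csL: "csubfield L" unfolding L_def by (rule quadratic_extension[OF \<delta>K])
  interpret L: csubfield L by (rule csL)
  have LI: "\<alpha> + \<gamma> * \<delta> \<in> L" if "\<alpha> \<in> K" "\<gamma> \<in> K" for \<alpha> \<gamma> using that by (auto simp: L_def)
  have KL: "K \<subseteq> L"
  proof
    fix x assume "x \<in> K"
    then show "x \<in> L" using LI[of x 0] by simp
  qed
  have zL: "z \<in> L"
  proof -
    have "z = \<tau> / 2 + 1 / 2 * \<delta>" by (simp add: \<tau>_def \<delta>_def field_simps)
    then show ?thesis using LI[of "\<tau> / 2" "1 / 2"] \<tau>K by simp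
  qed
  obtain lam where lam: "\<And>k. lam (\<nu> ^ k) = z ^ k" using exists_multiplicative_character[OF z(1)] by blast
  have lam_mult: "lam (x * y) = lam x * lam y" if xy: "x \<noteq> 0" "y \<noteq> 0" for x y
  proof -
    obtain i j where "x = \<nu> ^ i" "y = \<nu> ^ j" using unit_power xy by meson
    then show ?thesis using lam[of "i + j"] by (simp add: power_add lam)
  qed
  have lam1: "lam 1 = 1" using lam[of 0] by simp
  have lam_inv: "lam (inverse x) * lam x = 1" if "x \<noteq> 0" for x
    using lam_mult[of "inverse x" x] that lam1 by simp
  have lam_pow: "\<exists>k. lam x = z ^ k" if "x \<noteq> 0" for x using unit_power[OF that] lam by blast
  obtain f where f: "fixU f" "f \<noteq> 0\<^sub>v m" "\<And>x. x \<noteq> 0 \<Longrightarrow> act (Dm x) f = lam x \<cdot>\<^sub>v f" "\<And>r. r < m \<Longrightarrow> vec_index f r \<in> L"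
  proof (rule Borel_eigenvector[where lam = lam and L = L, OF lam_mult lam1 _ _ csL KL])
    show "lam x \<noteq> 0" if "x \<noteq> 0" for x using lam_pow[OF that] z0 by auto
    show "lam x \<in> L" if "x \<noteq> 0" for x using lam_pow[OF that] zL by auto
    \<comment> \<open>Each torus element other than 1 contributes \<open>1 + u ^ k\<close>, and the
      powers of \<open>u\<close> form a geometric sum over a full period with the term 1 left out.
      The total is \<open>q * (q - 1)\<close>: the eigencharacter occurs once.\<close>
    define u where "u = inverse (z * z)"
    have u: "u \<noteq> 1" "u ^ (q - 1) = 1"
      using z(2) unfolding u_def power_inverse power_mult_distrib z(1) by (simp_all only: inverse_eq_1_iff mult_1_left inverse_1 not_False_eq_True)
    have "(\<Sum>x\<in>UNIV - {0, 1}. inverse (lam x) * \<chi> (Dm x)) = (\<Sum>k\<in>{1..<q - 1}. 1 + u ^ k)"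
      unfolding sum_units using z0
      by (intro sum.cong refl) (simp add: \<chi>z lam u_def power_inverse power_mult_distrib distrib_left del: One_nat_def)
    also have "\<dots> = of_nat (q - 2) + (\<Sum>k\<in>{1..<q - 1}. u ^ k)"
      by (simp add: sum.distrib)
    also have "(\<Sum>k\<in>{1..<q - 1}. u ^ k) = - 1"
    proof -
      have "(\<Sum>k<q - 1. u ^ k) = 0" using geometric_sum[OF u(1), of "q - 1"] u(2) by simp
      moreover have "{..<q - 1} = insert 0 {1..<q - 1}" using q_ge by auto
      ultimately have "1 + (\<Sum>k\<in>{1..<q - 1}. u ^ k) = 0" by simp
      then show ?thesis by (metis add_eq_0_iff)
    qed
    finally have s: "(\<Sum>x\<in>UNIV - {0, 1}. inverse (lam x) * \<chi> (Dm x)) = of_nat (q - 2) + - 1" .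
    have "v1 + of_nat (q - 1) * vc + of_nat q * (of_nat (q - 2) + - 1) = of_nat q * (of_nat q - 1)"
      unfolding v q1 by (simp add: algebra_simps)
    then show "v1 + of_nat (q - 1) * vc + of_nat q * (\<Sum>x\<in>UNIV - {0, 1}. inverse (lam x) * \<chi> (Dm x)) \<noteq> 0"
      unfolding s using Q by simp
  qed (assumption, assumption, rule that)
  define fb where "fb = map_vec cnj f"
  have fc: "f \<in> carrier_vec m" and fbc: "fb \<in> carrier_vec m" using f(1) by (simp_all add: fixU_def fb_def)
  have cc: "map_vec cnj fb = f" by (intro eq_vecI) (simp_all add: fb_def)
  have dims: "dim_vec f = m" "dim_vec fb = m" using fc fbc by simp_all
  have fbr: "vec_index fb r = cnj (vec_index f r)" if "r < m" for r using that dims by (simp add: fb_def)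
  have fixfb: "fixU fb"
    using f(1) act_cnj[OF Um_SL2 fc] fbc unfolding fixU_def fb_def by simp
  have f\<nu>: "act (Dm \<nu>) f = z \<cdot>\<^sub>v f" using f(3)[of \<nu>] lam[of 1] by simp
  have fb\<nu>: "act (Dm \<nu>) fb = cnj z \<cdot>\<^sub>v fb"
  proof -
    have "act (Dm \<nu>) fb = map_vec cnj (z \<cdot>\<^sub>v f)" unfolding fb_def act_cnj[OF Dm_SL2[OF \<nu>_nonzero] fc] f\<nu> ..
    also have "\<dots> = cnj z \<cdot>\<^sub>v fb" by (intro eq_vecI) (simp_all add: fb_def)
    finally show ?thesis .
  qed
  have Bff: "B f f = 0" by (rule B_zero_of_sign[OF Dm_SL2[OF \<nu>_nonzero] fc fc f\<nu> f\<nu> z(2)])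
  have Bfbfb: "B fb fb = 0" using B_cnj[OF fc fc] Bff by (simp add: fb_def)
  define s where "s = B f fb"
  have Bfbf: "B fb f = s" using B_sym[OF fc fbc] by (simp add: s_def)
  have cs: "cnj s = s" using B_cnj[OF fc fbc] Bfbf cc by (simp add: s_def fb_def)
  define fs where "fs = (\<lambda>j :: nat. if j = 0 then f else fb)"
  have fs: "\<And>j. j < 2 \<Longrightarrow> fixU (fs j)" using f(1) fixfb by (simp add: fs_def)
  have md: "m = 2 + (q - 1)" using mq q_ge by simp
  have fs0: "fs 0 = f" "fs (Suc 0) = fb" by (simp_all add: fs_def)
  have bs2: "bs 2 fs 0 = f" "bs 2 fs (Suc 0) = fb" "bs 2 fs (2 + l) = e l" for l
    using bs_eq[where fs = fs, OF fs md] by (simp_all add: fs0)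
  obtain r\<^sub>0 where r0: "r\<^sub>0 < m" "vec_index f r\<^sub>0 \<noteq> 0" using f(2) fc by (metis carrier_vecD eq_vecI index_zero_vec)
  have indep: "x = 0\<^sub>v m" if x: "x \<in> carrier_vec m" "Sm 2 fs *\<^sub>v x = 0\<^sub>v m" for x
  proof -
    have xk: "vec_index x k = 0" if "k < m" "\<not> k < 2" for k
      by (rule coefficients_zero[where fs = fs, OF fs md x that])
    have rel: "vec_index x 0 * vec_index f r + vec_index x (Suc 0) * vec_index fb r = 0" if r: "r < m" for r
    proof -
      have "0 = (\<Sum>j<2 + (q - 1). vec_index x j * vec_index (bs 2 fs j) r)"
        using Sm_entry[where fs = fs, OF fs md x(1) r] x(2) r unfolding md[symmetric] by simp
      also have "\<dots> = vec_index x 0 * vec_index f r + vec_index x (Suc 0) * vec_index fb r +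
          (\<Sum>l<q - 1. vec_index x (2 + l) * vec_index (e l) r)"
        unfolding sum_lessThan_add sum_lessThan_2 bs2 ..
      also have "(\<Sum>l<q - 1. vec_index x (2 + l) * vec_index (e l) r) = 0"
        using xk md by (intro sum.neutral) simp
      finally show ?thesis by simp
    qed
    \<comment> \<open>Otherwise \<open>f\<close> would be a multiple of its conjugate, although
      \<open>Dm \<nu>\<close> acts on the two with the different eigenvalues \<open>z\<close> and
      \<open>cnj z\<close>.\<close>
    have x0: "vec_index x 0 = 0"
    proof (rule ccontr)
      assume nz: "vec_index x 0 \<noteq> 0"
      define c where "c = - vec_index x (Suc 0) / vec_index x 0"
      have fr: "vec_index f r = c * vec_index fb r" if "r < m" for r
      proof -
        have "vec_index x 0 * vec_index f r = - vec_index x (Suc 0) * vec_index fb r"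
          using rel[OF that] by (simp add: add_eq_0_iff)
        then show ?thesis using nz by (simp add: c_def field_simps)
      qed
      then have "f = c \<cdot>\<^sub>v fb" using dims by (intro eq_vecI) auto
      then have "z \<cdot>\<^sub>v f = c \<cdot>\<^sub>v (cnj z \<cdot>\<^sub>v fb)" using f\<nu> act_smult[OF Dm_SL2[OF \<nu>_nonzero] fbc, of c] fb\<nu> by simp
      then have "vec_index (z \<cdot>\<^sub>v f) r\<^sub>0 = vec_index (c \<cdot>\<^sub>v (cnj z \<cdot>\<^sub>v fb)) r\<^sub>0" by simp
      then have "z * vec_index f r\<^sub>0 = cnj z * vec_index f r\<^sub>0" using r0(1) dims fr[OF r0(1)] by simp
      then show False using r0(2) \<delta>0 by (simp add: \<delta>_def)
    qed
    have "vec_index x (Suc 0) = 0" using rel[OF r0(1)] x0 r0 fbr[OF r0(1)] by simp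
    then have "vec_index x k = 0" if "k < m" for k
      using xk[OF that] x0 by (cases "k = 0"; cases "k = Suc 0") auto
    then show ?thesis using x(1) by (intro eq_vecI) auto
  qed
  have a0: "a \<noteq> 0" by (rule a_nonzero[where fs = fs, OF fs md indep])
  have ca: "cnj a = a" by (rule cnj_K[OF a_K])
  have s0: "s \<noteq> 0"
  proof
    assume s: "s = 0"
    have "B (bs 2 fs j) f = 0" for j
    proof (cases "j < 2")
      case True
      then have "j = 0 \<or> j = Suc 0" by linarith
      then show ?thesis using bs2(1,2) Bff Bfbf s by auto
    next
      case False
      then obtain l where "j = 2 + l" by (metis le_Suc_ex not_less)
      then show ?thesis using bs2(3)[of l] B_fixU_e[OF f(1), of l] B_sym[OF e_carrier[of l] fc] by simp
    qed
    then have "f = 0\<^sub>v m" by (intro B_nondegenerate[where fs = fs, OF fs md indep fc])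
    then show False using f(2) by simp
  qed
  define wf where "wf = act wm f"
  define wfb where "wfb = act wm fb"
  have wc: "wf \<in> carrier_vec m" "wfb \<in> carrier_vec m" unfolding wf_def wfb_def using fc fbc by auto
  have wcnj: "wfb = map_vec cnj wf" unfolding wf_def wfb_def fb_def by (rule act_cnj[OF wm_SL2 fc])
  obtain x where x: "x \<in> carrier_vec m" "wf = Sm 2 fs *\<^sub>v x" using expand[where fs = fs, OF fs md indep wc(1)] by blast
  \<comment> \<open>Both vectors belong to the inverse character of the torus, and the square of its
    value at \<open>\<nu>\<close> is not 1.\<close>
  have Bwfb: "B wf fb = 0"
  proof (rule B_zero_of_sign[OF Dm_SL2[OF \<nu>_nonzero] wc(1) fbc _ fb\<nu>])
    show "act (Dm \<nu>) wf = lam (inverse \<nu>) \<cdot>\<^sub>v wf" unfolding wf_def by (rule act_Dm_wm[OF fc f(3)]) auto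
    have "lam (inverse \<nu>) = cnj z" using lam_inv[of \<nu>] lam[of 1] iz inverse_unique[of z "lam (inverse \<nu>)"] by (simp add: mult.commute)
    moreover have "cnj z * cnj z = cnj (z * z)" by simp
    ultimately show "lam (inverse \<nu>) * cnj z \<noteq> 1" using z(2) by (metis complex_cnj_cancel_iff complex_cnj_one)
  qed
  have x0: "vec_index x 0 = 0"
    using B_Sm_fix[where fs = fs, OF fs md x(1) fixfb] Bwfb s0
    by (simp add: x(2)[symmetric] sum_lessThan_2 fs0 Bfbfb s_def[symmetric])
  define k where "k = vec_index x (Suc 0)"
  define y where "y = B wf e0 / a"
  have Bwf: "B wf f = k * s"
    using B_Sm_fix[where fs = fs, OF fs md x(1) f(1)] by (simp add: x(2)[symmetric] sum_lessThan_2 fs0 Bff Bfbf k_def)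
  have Be: "B wf (e l) = z ^ l * y * a" for l
  proof -
    have "lam (inverse (\<nu> ^ l)) * z ^ l = 1" using lam_inv[of "\<nu> ^ l"] lam[of l] by simp
    then have "B wf (e l) = z ^ l * B wf e0" unfolding wf_def by (intro B_wm_e[where lam = lam] fc f(3))
    then show ?thesis using a0 by (simp add: y_def)
  qed
  have xl: "vec_index x (2 + l) = z ^ l * y" if "l < q - 1" for l
    using B_Sm_e[where fs = fs, OF fs md x(1) that] Be[of l] a0 by (simp only: x(2)[symmetric]) simp
  have Bfw: "B fb wfb = cnj k * s"
    using B_cnj[OF fc wc(1)] Bwf B_sym[OF fc wc(1)] cs by (simp add: wcnj fb_def)
  have Bew: "B (e l) wfb = cnj (z ^ l) * cnj y * a" for l
    using B_cnj[OF e_carrier[of l] wc(1)] Be[of l] B_sym[OF e_carrier[of l] wc(1)] ca by (simp add: wcnj cnj_e)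
  have zz: "z ^ l * cnj (z ^ l) = 1" for l using z(3) by (simp add: power_mult_distrib[symmetric])
  have expd: "s = k * (cnj k * s) + (of_nat q - 1) * (y * cnj y * a)"
  proof -
    have "s = B wf wfb" unfolding wf_def wfb_def s_def by (rule B_act[OF wm_SL2 fc fbc, symmetric])
    also have "\<dots> = (\<Sum>j<2. vec_index x j * B (fs j) wfb) + (\<Sum>l<q - 1. vec_index x (2 + l) * B (e l) wfb)"
      unfolding x(2) by (rule B_Sm_split[where fs = fs, OF fs md x(1) wc(2)])
    also have "(\<Sum>l<q - 1. vec_index x (2 + l) * B (e l) wfb) = (\<Sum>l<q - 1. y * cnj y * a)"
    proof (rule sum.cong[OF refl])
      fix l assume "l \<in> {..<q - 1}"
      then have "vec_index x (2 + l) * B (e l) wfb = (z ^ l * y) * (cnj (z ^ l) * cnj y * a)" by (simp only: xl Bew lessThan_iff)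
      also have "\<dots> = (z ^ l * cnj (z ^ l)) * (y * cnj y * a)" by (simp only: mult_ac)
      finally show "vec_index x (2 + l) * B (e l) wfb = y * cnj y * a" by (simp only: zz mult_1_left)
    qed
    also have "\<dots> = (of_nat q - 1) * (y * cnj y * a)" by (simp only: sum_constant card_lessThan q1)
    finally show ?thesis by (simp add: sum_lessThan_2 fs0 x0 k_def Bfw)
  qed
  have "of_nat q * (k * (cnj k * s)) = (\<Sum>t\<in>UNIV. B (act (Um t) wf) wfb)"
    using sum_Um_Sm[where fs = fs, OF fs md x(1) wc(2)]
    by (simp add: x(2)[symmetric] sum_lessThan_2 bs2(1,2) x0 k_def Bfw)
  also have "\<dots> = B f fb + (\<Sum>t\<in>UNIV - {0}. lam (inverse t)) * B wf fb"
    unfolding wf_def wfb_def by (rule sum_Um_Bruhat[OF f(1) f(3) fixfb])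
  finally have qk: "of_nat q * (k * (cnj k * s)) = s" by (simp add: Bwfb s_def)
  have "(of_nat q - 1) * s = (of_nat q - 1) * (of_nat q * (y * cnj y * a))"
  proof -
    have "of_nat q * s = of_nat q * (k * (cnj k * s)) + of_nat q * ((of_nat q - 1) * (y * cnj y * a))"
      by (subst expd) (simp only: distrib_left)
    then show ?thesis unfolding qk by (simp add: algebra_simps)
  qed
  then have sy: "s = of_nat q * (y * cnj y * a)" using Q by simp
  have y0: "y \<noteq> 0" using sy s0 by auto
  have yL: "y \<in> L" unfolding y_def
  proof (intro L.divide_mem B_mem csL KL wc(1) e0(1) subsetD[OF KL a_K] subsetD[OF KL e0(4)])
    show "vec_index wf r \<in> L" if "r < m" for r
      unfolding wf_def by (rule act_mem[OF csL KL wm_SL2 fc f(4) that])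
  qed
  \<comment> \<open>With \<open>n\<close> odd, \<open>2 * q\<close> is the square of
    \<open>2 ^ h\<close>, so \<open>c\<close> is a rational number with
    \<open>2 * q * c * c = 1\<close>.\<close>
  obtain h where h: "n + 1 = 2 * h" using n_odd by (metis even_Suc evenE Suc_eq_plus1)
  define c :: complex where "c = inverse (2 ^ h)"
  have c: "2 * of_nat q * (c * c) = 1" "c \<in> K" "cnj c = c"
  proof -
    have "(2 :: complex) * of_nat q = 2 ^ (n + 1)" by (simp add: q)
    also have "\<dots> = 2 ^ h * 2 ^ h" unfolding h by (simp add: mult_2 power_add)
    finally have "2 * of_nat q * (c * c) = (2 ^ h * c) * (2 ^ h * c)" by (simp only: mult_ac)
    then show "2 * of_nat q * (c * c) = 1" by (simp add: c_def)
    show "c \<in> K" unfolding c_def by auto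
    then show "cnj c = c" by (rule cnj_K)
  qed
  \<comment> \<open>After division by \<open>y\<close> and \<open>cnj y\<close> the two eigenvectors
    pair to \<open>of_nat q * a\<close>, so their sum has norm \<open>2 * q * a\<close>, and
    \<open>c\<close> scales this to \<open>a\<close>. The factor \<open>\<delta>\<close> in
    \<open>p'\<close> is anti-invariant under conjugation and matches the minus sign. Hence
    \<open>p\<close> and \<open>p'\<close> are both of the form vector plus conjugate, which puts
    their entries in \<open>K\<close>.\<close>
  define p where "p = (c / y) \<cdot>\<^sub>v f + (c / cnj y) \<cdot>\<^sub>v fb"
  define p' where "p' = (c * \<delta> / y) \<cdot>\<^sub>v f + (- (c * \<delta>) / cnj y) \<cdot>\<^sub>v fb"
  have Bc: "B (x \<cdot>\<^sub>v f + y \<cdot>\<^sub>v fb) (x' \<cdot>\<^sub>v f + y' \<cdot>\<^sub>v fb) = (x * y' + y * x') * s" for x y x' y'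
  proof -
    have r: "B w (x' \<cdot>\<^sub>v f + y' \<cdot>\<^sub>v fb) = x' * B w f + y' * B w fb" if "w \<in> carrier_vec m" for w
      using that fc fbc by (simp add: B_add_right B_smult_right)
    have "B (x \<cdot>\<^sub>v f + y \<cdot>\<^sub>v fb) (x' \<cdot>\<^sub>v f + y' \<cdot>\<^sub>v fb) =
        x * B f (x' \<cdot>\<^sub>v f + y' \<cdot>\<^sub>v fb) + y * B fb (x' \<cdot>\<^sub>v f + y' \<cdot>\<^sub>v fb)"
      using fc fbc by (simp add: B_add_left B_smult_left)
    then show ?thesis unfolding r[OF fc] r[OF fbc] by (simp add: Bff Bfbfb Bfbf s_def[symmetric] algebra_simps)
  qed
  have yy: "1 / (y * cnj y) * s = of_nat q * a" unfolding sy using y0 by simp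
  have Bpp: "B p p = a"
  proof -
    have "B p p = 2 * (c * c) * (1 / (y * cnj y) * s)" unfolding p_def Bc using y0 by (simp add: field_simps)
    also have "\<dots> = (2 * of_nat q * (c * c)) * a" unfolding yy by (simp only: mult_ac)
    finally show ?thesis unfolding c(1) by simp
  qed
  have Bpp': "B p p' = 0" "B p' p = 0" unfolding p_def p'_def Bc using y0 by (simp_all add: field_simps)
  have Bp'p': "B p' p' = a * (4 - \<tau> * \<tau>)"
  proof -
    have "B p' p' = - (\<delta> * \<delta>) * (2 * (c * c) * (1 / (y * cnj y) * s))" unfolding p'_def Bc using y0 by (simp add: field_simps)
    also have "\<dots> = - (\<delta> * \<delta>) * ((2 * of_nat q * (c * c)) * a)" unfolding yy by (simp only: mult_ac)
    finally show ?thesis unfolding c(1) \<delta>2 by (simp add: algebra_simps)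
  qed
  have pK: "vec_index p r \<in> K \<and> vec_index p' r \<in> K" if r: "r < m" for r
  proof -
    have "vec_index f r / y \<in> L" using f(4)[OF r] yL by auto
    then obtain \<alpha> \<gamma> where w: "vec_index f r / y = \<alpha> + \<gamma> * \<delta>" "\<alpha> \<in> K" "\<gamma> \<in> K" unfolding L_def by blast
    have "vec_index fb r / cnj y = cnj (vec_index f r / y)" using fbr[OF r] by simp
    also have "\<dots> = \<alpha> - \<gamma> * \<delta>" unfolding w(1) using w c\<delta> by (simp add: cnj_K)
    finally have w': "vec_index fb r / cnj y = \<alpha> - \<gamma> * \<delta>" .
    have "vec_index p r = c * (vec_index f r / y) + c * (vec_index fb r / cnj y)" using r dims by (simp add: p_def)
    also have "\<dots> = 2 * c * \<alpha>" unfolding w(1) w' by (simp add: algebra_simps)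
    finally have 1: "vec_index p r \<in> K" using c(2) w(2) by simp
    have "vec_index p' r = c * \<delta> * (vec_index f r / y) - c * \<delta> * (vec_index fb r / cnj y)" using r dims by (simp add: p'_def)
    also have "\<dots> = 2 * c * \<gamma> * (\<delta> * \<delta>)" unfolding w(1) w' by (simp add: algebra_simps)
    finally have "vec_index p' r \<in> K" using c(2) w(3) \<delta>K by simp
    with 1 show ?thesis by simp
  qed
  \<comment> \<open>The vector \<open>p'\<close> comes first to fit the norm pattern
    \<open>a * d, a, ..., a\<close>, with \<open>d = 4 - \<tau> * \<tau>\<close>, the negative of
    the square of \<open>\<delta>\<close>.\<close>
  define gs where "gs = (\<lambda>j :: nat. if j = 0 then p' else p)"
  have gs: "\<And>j. j < 2 \<Longrightarrow> fixU (gs j)"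
    unfolding gs_def p_def p'_def using fixU_combination[OF f(1) fixfb] by simp
  show thesis
  proof (rule that)
    show "Sm 2 gs \<in> carrier_mat m m" by (rule Sm_carrier[where fs = gs, OF gs md])
    show "elements_mat (Sm 2 gs) \<subseteq> K" by (rule Sm_elements[where fs = gs, OF gs md]) (use pK in \<open>auto simp: gs_def\<close>)
    have "(Sm 2 gs)\<^sup>T * F * Sm 2 gs =
        mat m m (\<lambda>(i, j). if i = j then (if i < 2 then (if i = 0 then a * (4 - \<tau> * \<tau>) else a) else a) else 0)"
      by (rule Gram_diag[where fs = gs, OF gs md]) (auto simp: gs_def Bpp Bpp' Bp'p')
    also have "(\<lambda>(i :: nat, j). if i = j then (if i < 2 then (if i = 0 then a * (4 - \<tau> * \<tau>) else a) else a) else 0) =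
        (\<lambda>(i, j). if i = j then (if i = 0 then a * (4 - \<tau> * \<tau>) else a) else 0)" by (intro ext) auto
    finally show "(Sm 2 gs)\<^sup>T * F * Sm 2 gs = mat m m (\<lambda>(i, j). if i = j then (if i = 0 then a * (4 - \<tau> * \<tau>) else a) else 0)" .
    show "4 - \<tau> * \<tau> \<in> K" using \<tau>K by auto
    show "4 - \<tau> * \<tau> \<noteq> 0" using \<delta>2 \<delta>0 by auto
  qed (fact a0 mq)+
qed

end

end

section \<open>The invariants of the irreducible characters\<close>

lemma zeta_cis: "zeta r = cis (2 * pi / real r)"
  by (simp add: zeta_def cis_conv_exp mult_ac)

lemma zeta_power: "zeta r ^ k = cis (real k * (2 * pi / real r))"
  unfolding zeta_cis by (rule DeMoivre)

lemma zeta_power_order: "r > 0 \<Longrightarrow> zeta r ^ r = 1"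
  unfolding zeta_power by simp

lemma zeta_power_ne_1:
  assumes "0 < k" "k < r"
  shows "zeta r ^ k \<noteq> 1"
proof
  assume "zeta r ^ k = 1"
  then have "cos (real k * (2 * pi / real r)) = 1" unfolding zeta_power by (metis cis.sel(1) one_complex.sel(1))
  then obtain j :: int where j: "real k * (2 * pi / real r) = of_int j * 2 * pi" unfolding cos_one_2pi_int by blast
  then have "real k = of_int j * real r" using assms by (simp add: field_simps)
  then have "int k = j * int r" by (metis of_int_eq_iff of_int_mult of_int_of_nat_eq)
  then have "r dvd k" by (metis dvd_triv_right int_dvd_int_iff)
  then show False using assms by (auto dest: dvd_imp_le)
qed

lemma zeta_cnj: "zeta r ^ k * cnj (zeta r ^ k) = 1"
  unfolding zeta_power cis_cnj cis_mult by simp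

lemma zeta_powi: "zeta r powi int (i * l) = (zeta r ^ i) ^ l" "zeta r powi (- int (i * l)) = inverse ((zeta r ^ i) ^ l)"
  unfolding power_int_minus power_int_of_nat power_mult by (rule refl)+

lemma (in csubfield) square_class_mult_square:
  assumes "y \<in> K" "y \<noteq> 0"
  shows "square_class K (c * y\<^sup>2) = square_class K c"
proof -
  have "\<exists>w. c * y\<^sup>2 * u\<^sup>2 = c * w\<^sup>2 \<and> w \<in> K \<and> w \<noteq> 0" if "u \<in> K" "u \<noteq> 0" for u
    using that assms by (intro exI[of _ "y * u"]) (auto simp: power_mult_distrib)
  moreover have "\<exists>w. c * u\<^sup>2 = c * y\<^sup>2 * w\<^sup>2 \<and> w \<in> K \<and> w \<noteq> 0" if "u \<in> K" "u \<noteq> 0" for u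
    using that assms by (intro exI[of _ "u / y"]) (auto simp: power_divide)
  ultimately show ?thesis unfolding square_class_def by blast
qed

context sl2_even
begin

lemma sl2_repI:
  assumes "class_function_with_values \<nu> b \<chi> v1 vc va vb" "orthogonal_module_of \<chi> m \<rho> F" "v1 - vc = of_nat q"
  shows "sl2_rep n q \<nu> b (char_field \<chi>) \<chi> m \<rho> F v1 vc va vb"
proof -
  have "csubfield (char_field \<chi>)" unfolding char_field_def by (rule csubfield_rat_adjoin)
  then show ?thesis
    using assms unfolding orthogonal_module_of_def
    by (intro sl2_rep.intro sl2_rep_axioms.intro sl2_even_axioms) auto
qed

lemma char_field_subset:
  assumes "class_function_with_values \<nu> b \<chi> v1 vc va vb" "csubfield L" "v1 \<in> L" "vc \<in> L"
    "\<And>l. l \<in> {1..(q - 2) div 2} \<Longrightarrow> va l \<in> L" "\<And>k. k \<in> {1..q div 2} \<Longrightarrow> vb k \<in> L"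
  shows "char_field \<chi> \<subseteq> L"
  unfolding char_field_def
proof (rule rat_adjoin_minimal[OF assms(2)], rule image_subsetI)
  fix g :: "'f mat" assume "g \<in> carrier SL2"
  then have "\<chi> g \<in> {v1, vc} \<union> va ` {1..(q - 2) div 2} \<union> vb ` {1..q div 2}" by (rule class_function_range[OF assms(1)])
  moreover have "{v1, vc} \<union> va ` {1..(q - 2) div 2} \<union> vb ` {1..q div 2} \<subseteq> L"
    by (intro Un_least insert_subsetI empty_subsetI image_subsetI assms(3-6))
  ultimately show "\<chi> g \<in> L" by (rule subsetD[rotated])
qed

lemma value_in_char_field: "g \<in> carrier SL2 \<Longrightarrow> \<chi> g \<in> char_field \<chi>"
  unfolding char_field_def by (rule subsetD[OF rat_adjoin_superset]) (rule imageI)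

lemma disc_psi:
  assumes "is_psi \<nu> b \<psi>" "orthogonal_module_of \<psi> m \<rho> F"
  shows "disc_pm (char_field \<psi>) m F = square_class \<rat> (of_nat (q + 1))"
proof -
  have cf: "class_function_with_values \<nu> b \<psi> (of_nat q) 0 (\<lambda>l. 1) (\<lambda>m. - 1)"
    using assms(1) unfolding is_psi_def card .
  interpret sl2_rep n q \<nu> b "char_field \<psi>" \<psi> m \<rho> F "of_nat q" 0 "\<lambda>l. 1" "\<lambda>m. - 1"
    by (rule sl2_repI[OF cf assms(2)]) simp
  have "char_field \<psi> \<subseteq> \<rat>" by (rule char_field_subset[OF cf csubfield_Rats]) auto
  then have K: "char_field \<psi> = \<rat>" using Rats_subset by blast
  have St: "m = q" "\<exists>y\<in>char_field \<psi>. y \<noteq> 0 \<and> det F = of_nat (q + 1) * y ^ 2"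
    by (rule Steinberg_det; simp)+
  then obtain y where y: "y \<in> char_field \<psi>" "y \<noteq> 0" "det F = of_nat (q + 1) * y ^ 2" by blast
  \<comment> \<open>Since 4 divides \<open>q\<close>, the exponent \<open>q * (q - 1) div 2\<close>
    is even and the sign in the discriminant is 1.\<close>
  obtain k where "n = 2 + k" using n le_Suc_ex by blast
  then have "q = 4 * 2 ^ k" by (simp add: q power_add)
  then have "m * (m - 1) div 2 = 2 * (2 ^ k * (q - 1))" using St(1) by (simp add: mult.assoc)
  then have "(- 1 :: complex) ^ (m * (m - 1) div 2) = 1" by (simp only: power_mult power2_minus power_one)
  then show ?thesis
    unfolding disc_pm_def y(3) K[symmetric] using square_class_mult_square[OF y(1,2), of "of_nat (q + 1)"] by simp
qed

lemma clifford_chi: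
  assumes i: "1 \<le> i" "i \<le> (q - 2) div 2" and "is_chi \<nu> b i \<chi>" "orthogonal_module_of \<chi> m \<rho> F" and n_odd: "odd n"
  shows "same_brauer_class (subfield_ring (char_field \<chi>))
    (even_clifford_algebra (char_field \<chi>) m F) (base_algebra (char_field \<chi>))"
proof -
  define z where "z = zeta (q - 1) ^ i"
  have cf: "class_function_with_values \<nu> b \<chi> (of_nat q + 1) 1 (\<lambda>l. z ^ l + inverse (z ^ l)) (\<lambda>m. 0)"
    using assms(3) unfolding is_chi_def card zeta_powi z_def .
  interpret sl2_rep n q \<nu> b "char_field \<chi>" \<chi> m \<rho> F "of_nat q + 1" 1 "\<lambda>l. z ^ l + inverse (z ^ l)" "\<lambda>m. 0"
    by (rule sl2_repI[OF cf assms(4)]) simp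
  have zz: "z * cnj z = 1" unfolding z_def by (rule zeta_cnj)
  have real: "char_field \<chi> \<subseteq> \<real>"
  proof (rule char_field_subset[OF cf csubfield_Reals])
    fix l
    have "z ^ l * cnj (z ^ l) = 1" using zz by (simp add: power_mult_distrib[symmetric])
    then have "inverse (z ^ l) = cnj (z ^ l)" by (rule inverse_unique)
    then show "z ^ l + inverse (z ^ l) \<in> \<real>" by (simp add: Reals_cnj_iff add.commute)
  qed auto
  have "z ^ (q - 1) = (zeta (q - 1) ^ (q - 1)) ^ i" unfolding z_def power_mult[symmetric] by (simp only: mult.commute)
  then have z1: "z ^ (q - 1) = 1" using zeta_power_order[of "q - 1"] q_ge by simp
  \<comment> \<open>The bounds on \<open>i\<close> give \<open>0 < 2 * i < q - 1\<close>, so the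
    square is a nontrivial power of a primitive root; this keeps the two Borel eigencharacters
    distinct.\<close>
  have "z * z = zeta (q - 1) ^ (i + i)" unfolding z_def power_add ..
  also have "\<dots> \<noteq> 1" by (rule zeta_power_ne_1) (use i q_even q_ge in linarith)+
  finally have z2: "z * z \<noteq> 1" .
  obtain S d where S: "S \<in> carrier_mat m m" "elements_mat S \<subseteq> char_field \<chi>"
    "S\<^sup>T * F * S = mat m m (\<lambda>(i, j). if i = j then (if i = 0 then a * d else a) else 0)"
    "a \<noteq> 0" "d \<in> char_field \<chi>" "d \<noteq> 0" "m = q + 1"
    by (rule principal_series_diagonalization[OF real z1 z2 zz refl refl refl n_odd])
  \<comment> \<open>An odd \<open>n\<close> that is at least 2 is at least 3, so 8 divides
    \<open>q\<close> and the dimension is 1 modulo 8.\<close>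
  have "n = 3 + (n - 3)" using n n_odd by (cases "n = 2") auto
  then have "q = 8 * 2 ^ (n - 3)" using q power_add[of "2 :: nat" 3 "n - 3"] by simp
  then have "m = 8 * 2 ^ (n - 3) + 1" using S(7) by simp
  then show ?thesis by (rule even_clifford_split_8k1[OF _ F_carrier F_elements S(1-3) a_K S(4-6)])
qed

lemma clifford_theta:
  assumes "is_theta \<nu> b j \<theta>" "orthogonal_module_of \<theta> m \<rho> F"
  shows "q = 4 \<Longrightarrow> same_brauer_class (subfield_ring (char_field \<theta>))
      (even_clifford_algebra (char_field \<theta>) m F) (quaternion_algebra (char_field \<theta>) (- 1) (- 1))"
    and "q \<ge> 8 \<Longrightarrow> same_brauer_class (subfield_ring (char_field \<theta>))
      (even_clifford_algebra (char_field \<theta>) m F) (base_algebra (char_field \<theta>))"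
proof -
  let ?vb = "\<lambda>m. - (zeta (q + 1) powi (int (j * m))) - zeta (q + 1) powi (- int (j * m))"
  have cf: "class_function_with_values \<nu> b \<theta> (of_nat q - 1) (- 1) (\<lambda>l. 0) ?vb"
    using assms(1) unfolding is_theta_def card .
  interpret sl2_rep n q \<nu> b "char_field \<theta>" \<theta> m \<rho> F "of_nat q - 1" "- 1" "\<lambda>l. 0" ?vb
    by (rule sl2_repI[OF cf assms(2)]) simp
  have "(of_nat m :: complex) = of_nat (q - 1)" using m_eq q_ge by (simp add: of_nat_diff)
  then have mq: "m = q - 1" by (simp only: of_nat_eq_iff)
  obtain S where S: "S \<in> carrier_mat m m" "elements_mat S \<subseteq> char_field \<theta>"
    "S\<^sup>T * F * S = mat m m (\<lambda>(i, j). if i = j then a else 0)" "a \<noteq> 0"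
    by (rule cuspidal_diagonalization[OF mq])
  show "same_brauer_class (subfield_ring (char_field \<theta>))
      (even_clifford_algebra (char_field \<theta>) m F) (quaternion_algebra (char_field \<theta>) (- 1) (- 1))" if "q = 4"
  proof -
    have m3: "m = 3" using mq that by simp
    show ?thesis unfolding m3
      by (rule even_clifford_quaternion[OF F_carrier[unfolded m3] F_elements S(1)[unfolded m3] S(2) S(3)[unfolded m3] _ S(4)[unfolded m3]])
         (rule a_K[unfolded m3])
  qed
  show "same_brauer_class (subfield_ring (char_field \<theta>))
      (even_clifford_algebra (char_field \<theta>) m F) (base_algebra (char_field \<theta>))" if q8: "q \<ge> 8"
  proof -
    have "n \<noteq> 2" using q8 q by auto
    then have "q = 8 * 2 ^ (n - 3)" using q n power_add[of "2 :: nat" 3 "n - 3"] by simp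
    \<comment> \<open>Dimension \<open>8 * 2 ^ (n - 3) - 1\<close> is rewritten as
      \<open>8 * k + 7\<close> by taking one block of eight out.\<close>
    moreover obtain k :: nat where "2 ^ (n - 3) = Suc k" by (metis not0_implies_Suc power_not_zero zero_neq_numeral)
    ultimately have "m = 8 * k + 7" using mq by simp
    then show ?thesis by (rule even_clifford_split_8k7[OF _ F_carrier F_elements S(1-3) a_K S(4)])
  qed
qed

text \<open>Up to sign, the values on the powers of \<open>b\<close> are the two Gaussian periods of
  order five, \<open>u\<close> and \<open>- 1 - u\<close>. Each is obtained rationally from the
  other, so \<open>j = 1\<close> and \<open>j = 2\<close> give the same field, and
  \<open>(2 * u + 1) ^ 2 = 5\<close> identifies it.\<close>

lemma char_field_theta_4:
  assumes th: "is_theta \<nu> b j \<theta>" and q4: "q = 4" and j: "1 \<le> j" "j \<le> q div 2"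
  shows "char_field \<theta> = rat_adjoin {complex_of_real (sqrt 5)}"
proof -
  define \<zeta> where "\<zeta> = zeta 5"
  define T where "T k = \<zeta> ^ k + inverse (\<zeta> ^ k)" for k
  have cf: "class_function_with_values \<nu> b \<theta> (of_nat q - 1) (- 1) (\<lambda>l. 0) (\<lambda>m. - T (j * m))"
  proof -
    have "- (zeta (q + 1) powi (int (j * m))) - zeta (q + 1) powi (- int (j * m)) = - T (j * m)" for m
      unfolding zeta_powi by (simp add: T_def \<zeta>_def q4 power_mult)
    then show ?thesis using th unfolding is_theta_def card by (simp only:)
  qed
  define u where "u = \<zeta> + \<zeta> ^ 4"
  have \<zeta>5: "\<zeta> ^ 5 = 1" unfolding \<zeta>_def by (rule zeta_power_order) simp
  have \<zeta>1: "\<zeta> \<noteq> 1" using zeta_power_ne_1[of 1 5] by (simp add: \<zeta>_def)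
  have "(\<zeta> - 1) * (1 + \<zeta> + \<zeta> ^ 2 + \<zeta> ^ 3 + \<zeta> ^ 4) = \<zeta> ^ 5 - 1"
    by (simp add: algebra_simps power_numeral_reduce)
  then have sum0: "1 + \<zeta> + \<zeta> ^ 2 + \<zeta> ^ 3 + \<zeta> ^ 4 = 0" using \<zeta>5 \<zeta>1 by simp
  have i1: "inverse \<zeta> = \<zeta> ^ 4" by (rule inverse_unique) (use \<zeta>5 in \<open>simp add: power_numeral_reduce\<close>)
  have i2: "inverse (\<zeta> ^ 2) = \<zeta> ^ 3" by (rule inverse_unique) (use \<zeta>5 in \<open>simp add: power_add[symmetric]\<close>)
  have i4: "inverse (\<zeta> ^ 4) = \<zeta>" using i1 by (metis inverse_inverse_eq)
  have T1: "T 1 = u" by (simp add: T_def u_def i1)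
  have T4: "T 4 = u" unfolding T_def i4 u_def by (rule add.commute)
  have T2: "T 2 = - 1 - u" unfolding T_def i2 u_def using sum0 by (simp add: algebra_simps eq_neg_iff_add_eq_0)
  have "\<zeta> ^ 8 = \<zeta> ^ 3" using \<zeta>5 power_add[of \<zeta> 5 3] by simp
  then have "(2 * u + 1) ^ 2 = 4 * (\<zeta> ^ 2 + \<zeta> ^ 3 + 2 * \<zeta> ^ 5) + 4 * u + 1"
    unfolding u_def by (simp add: power2_eq_square algebra_simps power_numeral_reduce)
  also have "\<dots> = 4 * (1 + \<zeta> + \<zeta> ^ 2 + \<zeta> ^ 3 + \<zeta> ^ 4) + 5" unfolding u_def \<zeta>5 by (simp add: algebra_simps)
  also have "\<dots> = complex_of_real (sqrt 5) ^ 2" unfolding sum0 by (simp flip: of_real_power)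
  \<comment> \<open>Only the square is computed, so the sign of \<open>2 * u + 1\<close> stays open;
    either sign generates the same field.\<close>
  finally have us0: "2 * u + 1 = complex_of_real (sqrt 5) \<or> 2 * u + 1 = - complex_of_real (sqrt 5)"
    by (simp only: power2_eq_iff)
  then have us: "u = (complex_of_real (sqrt 5) - 1) / 2 \<or> u = (- complex_of_real (sqrt 5) - 1) / 2"
    by (auto simp: field_simps)
  interpret R: csubfield "rat_adjoin {complex_of_real (sqrt 5)}" by (rule csubfield_rat_adjoin)
  interpret C: csubfield "char_field \<theta>" unfolding char_field_def by (rule csubfield_rat_adjoin)
  have s5: "complex_of_real (sqrt 5) \<in> rat_adjoin {complex_of_real (sqrt 5)}" using rat_adjoin_superset by blast
  have "(complex_of_real (sqrt 5) - 1) / 2 \<in> rat_adjoin {complex_of_real (sqrt 5)}"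
    "(- complex_of_real (sqrt 5) - 1) / 2 \<in> rat_adjoin {complex_of_real (sqrt 5)}"
    by (intro R.divide_mem R.diff_mem R.uminus_mem s5 R.one_mem R.numeral_mem)+
  then have uR: "u \<in> rat_adjoin {complex_of_real (sqrt 5)}" using us by (elim disjE) (simp_all only:)
  have j12: "j = 1 \<or> j = 2" using j q4 by auto
  have TR: "T (j * k) \<in> rat_adjoin {complex_of_real (sqrt 5)}" if "k \<in> {1..q div 2}" for k
  proof -
    have "k = 1 \<or> k = 2" using that q4 by auto
    then have "j * k = 1 \<or> j * k = 2 \<or> j * k = 4" using j12 by auto
    then show ?thesis using T1 T2 T4 uR by auto
  qed
  show ?thesis
  proof
    show "char_field \<theta> \<subseteq> rat_adjoin {complex_of_real (sqrt 5)}"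
      by (rule char_field_subset[OF cf R.csubfield_axioms]) (use TR in auto)
    have "\<theta> (b [^]\<^bsub>SL2\<^esub> (1 :: nat)) = - T (j * 1)" by (rule class_function_values(4)[OF cf]) (use q4 in auto)
    moreover have "b [^]\<^bsub>SL2\<^esub> (1 :: nat) \<in> carrier SL2" by (rule SL2.nat_pow_closed[OF b])
    ultimately have "- T j \<in> char_field \<theta>" using value_in_char_field[of "b [^]\<^bsub>SL2\<^esub> (1 :: nat)" \<theta>] by simp
    then have "T j \<in> char_field \<theta>" using C.uminus_mem[of "- T j"] by simp
    then have "u \<in> char_field \<theta>" using j12
    proof (elim disjE)
      assume "T j \<in> char_field \<theta>" "j = 2"
      then have "- 1 - u \<in> char_field \<theta>" using T2 by simp
      then have "- 1 - (- 1 - u) \<in> char_field \<theta>" by (rule C.diff_mem[OF C.uminus_mem[OF C.one_mem]])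
      then show ?thesis by simp
    qed (simp add: T1[symmetric])
    then have "2 * u + 1 \<in> char_field \<theta>" "- (2 * u + 1) \<in> char_field \<theta>" by auto
    moreover have "complex_of_real (sqrt 5) = 2 * u + 1 \<or> complex_of_real (sqrt 5) = - (2 * u + 1)"
      using us0 by (elim disjE) (simp_all only: minus_minus simp_thms)
    ultimately have "complex_of_real (sqrt 5) \<in> char_field \<theta>" by metis
    then show "rat_adjoin {complex_of_real (sqrt 5)} \<subseteq> char_field \<theta>"
      by (intro rat_adjoin_minimal C.csubfield_axioms) simp
  qed
qed

end

theorem theorem6p2:
  fixes n q :: nat and \<nu> :: "'f::{field,finite}" and b :: "'f mat"
  assumes "n \<ge> 2" and "q = 2 ^ n" and "CARD('f) = q"
    and "generates_units \<nu>"
    and "b \<in> carrier SL2" and "group.ord SL2 b = q + 1"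
  shows
    "(\<forall>\<psi> m \<rho> F. is_psi \<nu> b \<psi> \<and> orthogonal_module_of \<psi> m \<rho> F \<longrightarrow>
        disc_pm (char_field \<psi>) m F = square_class \<rat> (of_nat (q + 1))) \<and>
     (odd n \<longrightarrow>
       (\<forall>i \<chi> m \<rho> F. 1 \<le> i \<and> i \<le> (q - 2) div 2 \<and>
          is_chi \<nu> b i \<chi> \<and> orthogonal_module_of \<chi> m \<rho> F \<longrightarrow>
          same_brauer_class (subfield_ring (char_field \<chi>))
            (even_clifford_algebra (char_field \<chi>) m F) (base_algebra (char_field \<chi>)))) \<and>
     (\<forall>j \<theta> m \<rho> F. 1 \<le> j \<and> j \<le> q div 2 \<and>
        is_theta \<nu> b j \<theta> \<and> orthogonal_module_of \<theta> m \<rho> F \<longrightarrow>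
        (q = 4 \<longrightarrow>
          char_field \<theta> = rat_adjoin {complex_of_real (sqrt 5)} \<and>
          same_brauer_class (subfield_ring (rat_adjoin {complex_of_real (sqrt 5)}))
            (even_clifford_algebra (rat_adjoin {complex_of_real (sqrt 5)}) m F)
            (quaternion_algebra (rat_adjoin {complex_of_real (sqrt 5)}) (- 1) (- 1))) \<and>
        (q \<ge> 8 \<longrightarrow>
          same_brauer_class (subfield_ring (char_field \<theta>))
            (even_clifford_algebra (char_field \<theta>) m F) (base_algebra (char_field \<theta>))))"
proof -
  interpret sl2_even n q \<nu> b by (rule sl2_even.intro[OF assms])
  show ?thesis
  proof (intro conjI allI impI; (elim conjE)?)
    fix \<psi> m \<rho> F assume "is_psi \<nu> b \<psi>" "orthogonal_module_of \<psi> m \<rho> F"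
    then show "disc_pm (char_field \<psi>) m F = square_class \<rat> (of_nat (q + 1))" by (rule disc_psi)
  next
    fix i \<chi> m \<rho> F
    assume "odd n" "1 \<le> i" "i \<le> (q - 2) div 2" "is_chi \<nu> b i \<chi>" "orthogonal_module_of \<chi> m \<rho> F"
    then show "same_brauer_class (subfield_ring (char_field \<chi>))
        (even_clifford_algebra (char_field \<chi>) m F) (base_algebra (char_field \<chi>))" by (intro clifford_chi)
  next
    fix j \<theta> m \<rho> F
    assume j: "1 \<le> j" "j \<le> q div 2" and th: "is_theta \<nu> b j \<theta>" "orthogonal_module_of \<theta> m \<rho> F" and q4: "q = 4"
    show K: "char_field \<theta> = rat_adjoin {complex_of_real (sqrt 5)}" by (rule char_field_theta_4[OF th(1) q4 j])
    show "same_brauer_class (subfield_ring (rat_adjoin {complex_of_real (sqrt 5)}))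
        (even_clifford_algebra (rat_adjoin {complex_of_real (sqrt 5)}) m F)
        (quaternion_algebra (rat_adjoin {complex_of_real (sqrt 5)}) (- 1) (- 1))"
      unfolding K[symmetric] by (rule clifford_theta(1)[OF th q4])
  next
    fix j \<theta> m \<rho> F
    assume "is_theta \<nu> b j \<theta>" "orthogonal_module_of \<theta> m \<rho> F" "q \<ge> 8"
    then show "same_brauer_class (subfield_ring (char_field \<theta>))
        (even_clifford_algebra (char_field \<theta>) m F) (base_algebra (char_field \<theta>))" by (rule clifford_theta(2))
  qed
qed

end
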